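(* Let $\mathcal V$ be a (semi-strict) braided monoidal bicategory and let $\mathcal B,\mathcal C$ be $\mathcal V$-bicategories. Let $\mathcal B\otimes\mathcal C$ be the following data: objects $\mathcal B_0\times\mathcal C_0$; hom-objects $(\mathcal B\otimes\mathcal C)((b,c),(b',c')):=\mathcal B(b,b')\otimes\mathcal C(c,c')$; multiplication $$\underline m\colon\mathcal B(b',b'')\mathcal C(c',c'')\mathcal B(b,b')\mathcal C(c,c')\xrightarrow{1\beta1}\mathcal B(b',b'')\mathcal B(b,b')\mathcal C(c',c'')\mathcal C(c,c')\xrightarrow{mm}\mathcal B(b,b'')\mathcal C(c,c'');$$ units $\underline u\colon\mathbb 1=\mathbb 1\otimes\mathbb 1\xrightarrow{u\otimes u}\mathcal B(b,b)\otimes\mathcal C(c,c)$; and the associator $\underline\alpha\colon\underline m(\underline m\otimes1)\Rightarrow\underline m(1\otimes\underline m)$ and unitors $\underline\lambda\colon\underline m(\underline u\otimes1)\Rightarrow1$, $\underline\rho\colon\underline m(1\otimes\underline u)\Rightarrow1$ described in the context. Then $\mathcal B\otimes\mathcal C$ is a $\mathcal V$-bicategory.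
   Context: **Gray monoids.** A Gray monoid is a monoid in the category of 2-categories and 2-functors with the Gray tensor product. So its tensor product is strictly associative and unital (unit $\mathbb 1$), and for 1-cells $f\colon A\to A'$, $g\colon B\to B'$ there is an invertible interchanger $\Sigma_{f,g}\colon (f\otimes B')(A\otimes g)\Rightarrow (A'\otimes g)(f\otimes B)$ satisfying the usual axioms. Juxtaposition denotes tensor product of objects and cells (interchangers being inserted where needed); $1$ denotes an identity. **Semi-strict braided monoidal bicategory.** A Gray monoid $\mathcal V$ with a pseudonatural equivalence $\beta_{A,B}\colon A\otimes B\to B\otimes A$ (from $\otimes$ to $\otimes$ precomposed with the symmetry of the Gray tensor product) and invertible modifications $$R_{A,B,C}\colon\beta_{A,BC}\Rightarrow(1_B\,\beta_{A,C})(\beta_{A,B}\,1_C),\qquad S_{A,B,C}\colon\beta_{AB,C}\Rightarrow(\beta_{A,C}\,1_B)(1_A\,\beta_{B,C}),$$ satisfying four braiding axioms: - the two composites from $\beta_{A,BCD}$ to $(1\,1\,\beta_{A,D})(1\,\beta_{A,C}\,1)(\beta_{A,B}\,1\,1)$ built from two instances of $R$ agree; - the two composites from $\beta_{ABC,D}$ to $(\beta_{A,D}\,1\,1)(1\,\beta_{B,D}\,1)(1\,1\,\beta_{C,D})$ built from two instances of $S$ agree; - the two ways of decomposing $\beta_{AB,CD}$ into four elementary braidings (first $R_{AB,C,D}$ and then two instances of $S$, or first $S_{A,B,CD}$ and then two instances of $R$) agree up to the interchanger of $\beta_{A,C}$ and $\beta_{B,D}$; - (Yang–Baxter) the two 2-isomorphisms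 $(\beta_{B,C}1)(1\beta_{A,C})(\beta_{A,B}1)\Rightarrow(1\beta_{A,B})(\beta_{A,C}1)(1\beta_{B,C})$, one obtained from $R^{-1}_{A,B,C}$, pseudonaturality of $\beta_{A,-}$ at $\beta_{B,C}$ and $R_{A,C,B}$, the other from $S^{-1}_{B,A,C}$, pseudonaturality of $\beta_{-,C}$ at $\beta_{A,B}$ and $S_{A,B,C}$, agree. Semi-strictness means moreover that $\beta_{A,\mathbb 1}$ and $\beta_{\mathbb 1,A}$ are identities, and that $R_{A,B,C}$ and $S_{A,B,C}$ are identities whenever at least one of $A,B,C$ is $\mathbb 1$. **$\mathcal V$-bicategories.** A $\mathcal V$-bicategory $\mathcal C$ over a Gray monoid $\mathcal V$ consists of a class of objects $\mathcal C_0$; hom-objects $\mathcal C(c,d)\in\mathcal V$; 1-cells $m\colon\mathcal C(d,e)\otimes\mathcal C(c,d)\to\mathcal C(c,e)$ and $u_c\colon\mathbb 1\to\mathcal C(c,c)$; and invertible 2-cells $\alpha\colon m(m1)\Rightarrow m(1m)$, $\lambda\colon m(u1)\Rightarrow 1$, $\rho\colon m(1u)\Rightarrow1$, such that - (IC) the composite $m(m1)(1u1)\xRightarrow{\alpha}m(1m)(1u1)\xRightarrow{1\lambda}m$ equals $\rho1\colon m(m1)(1u1)\Rightarrow m$; - (AC) the composite $m(m1)(m11)\xRightarrow{\alpha1}m(m1)(1m1)\xRightarrow{\alpha}m(1m)(1m1)\xRightarrow{1\alpha}m(1m)(11m)$ equals $m(m1)(m11)\xRightarrow{\alpha}m(1m)(m11)\cong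 m(m1)(11m)\xRightarrow{\alpha}m(1m)(11m)$, the middle isomorphism being the interchanger $\Sigma_{m,m}^{-1}$. **Structural 2-cells of $\mathcal B\otimes\mathcal C$.** For composable objects $(a,x),(b,y),(c,z),(d,w)$ write $B_1=\mathcal B(c,d)$, $C_1=\mathcal C(z,w)$, $B_2=\mathcal B(b,c)$, $C_2=\mathcal C(y,z)$, $B_3=\mathcal B(a,b)$, $C_3=\mathcal C(x,y)$. The associator $\underline\alpha$, from $(mm)(1\beta1)(mm11)(1\beta111)$ to $(mm)(1\beta1)(11mm)(111\beta1)$ (1-cells out of $B_1C_1B_2C_2B_3C_3$), is the composite of the following invertible 2-cells, whiskered appropriately: 1. the inverse pseudonaturality cell of $\beta$ at $m\colon C_1C_2\to\mathcal C(y,w)$, giving $(1\beta1)(mm11)\cong(m1m1)(B_1B_2\,\beta_{C_1C_2,B_3}\,C_3)$; 2. $S_{C_1,C_2,B_3}$, replacing $\beta_{C_1C_2,B_3}$ by $(\beta_{C_1,B_3}C_2)(C_1\beta_{C_2,B_3})$; 3. the interchanger of $\beta_{C_1,B_2}$ and $\beta_{C_2,B_3}$, giving $(B_1B_2C_1\beta_{C_2,B_3}C_3)(B_1\beta_{C_1,B_2}C_2B_3C_3)\cong(B_1\beta_{C_1,B_2}B_3C_2C_3)(B_1C_1B_2\beta_{C_2,B_3}C_3)$; 4. $R^{-1}_{C_1,B_2,B_3}$, replacing $(B_2\beta_{C_1,B_3})(\beta_{C_1,B_2}B_3)$ by $\beta_{C_1,B_2B_3}$; 5. $\alpha\alpha\colon(mm)(m1m1)\Rightarrow(mm)(1m1m)$;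 6. the pseudonaturality cell of $\beta$ at $m\colon B_2B_3\to\mathcal B(a,c)$, giving $(1m1m)(B_1\,\beta_{C_1,B_2B_3}\,C_2C_3)\cong(1\beta1)(11mm)$. The unitor $\underline\lambda$ is $(mm)(1\beta1)(uu11)\cong(mm)(u1u1)\xRightarrow{\lambda\lambda}1$ and $\underline\rho$ is $(mm)(1\beta1)(11uu)\cong(mm)(1u1u)\xRightarrow{\rho\rho}1$, where the isomorphisms are pseudonaturality cells of $\beta$ at $u$, using that $\beta_{\mathbb 1,-}$ and $\beta_{-,\mathbb 1}$ are identities. *)

theory Defs
  imports Main
begin

section \<open>Strict 2-categories\<close>

text \<open>Composition of 1-cells and both compositions of 2-cells are written in applicative order;
  they are constrained only on composable arguments.\<close>

record ('o, 'f, 't) two_cat =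
  Obj :: "'o set"
  Arr :: "'f set"
  Cell :: "'t set"
  dom1 :: "'f \<Rightarrow> 'o"
  cod1 :: "'f \<Rightarrow> 'o"
  dom2 :: "'t \<Rightarrow> 'f"
  cod2 :: "'t \<Rightarrow> 'f"
  id1 :: "'o \<Rightarrow> 'f"
  id2 :: "'f \<Rightarrow> 't"
  comp1 :: "'f \<Rightarrow> 'f \<Rightarrow> 'f" (infixr \<open>\<cdot>\<index>\<close> 70)
  hcomp :: "'t \<Rightarrow> 't \<Rightarrow> 't" (infixr \<open>\<star>\<index>\<close> 70)
  vcomp :: "'t \<Rightarrow> 't \<Rightarrow> 't" (infixr \<open>\<bullet>\<index>\<close> 60)

definition hom :: "('o, 'f, 't, 'm) two_cat_scheme \<Rightarrow> 'o \<Rightarrow> 'o \<Rightarrow> 'f set" where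
  "hom V A B = {f \<in> Arr V. dom1 V f = A \<and> cod1 V f = B}"

definition cells :: "('o, 'f, 't, 'm) two_cat_scheme \<Rightarrow> 'f \<Rightarrow> 'f \<Rightarrow> 't set" where
  "cells V f g = {\<phi> \<in> Cell V. dom2 V \<phi> = f \<and> cod2 V \<phi> = g}"

definition whiskL :: "('o, 'f, 't, 'm) two_cat_scheme \<Rightarrow> 'f \<Rightarrow> 't \<Rightarrow> 't" (infixr \<open>\<rhd>\<index>\<close> 66) where
  "f \<rhd>\<^bsub>V\<^esub> \<phi> = id2 V f \<star>\<^bsub>V\<^esub> \<phi>"

definition whiskR :: "('o, 'f, 't, 'm) two_cat_scheme \<Rightarrow> 't \<Rightarrow> 'f \<Rightarrow> 't" (infixl \<open>\<lhd>\<index>\<close> 65) where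
  "\<phi> \<lhd>\<^bsub>V\<^esub> f = \<phi> \<star>\<^bsub>V\<^esub> id2 V f"

locale two_category =
  fixes V :: "('o, 'f, 't, 'm) two_cat_scheme" (structure)
  assumes dom1_in: "f \<in> Arr V \<Longrightarrow> dom1 V f \<in> Obj V"
    and cod1_in: "f \<in> Arr V \<Longrightarrow> cod1 V f \<in> Obj V"
    and dom2_in: "\<phi> \<in> Cell V \<Longrightarrow> dom2 V \<phi> \<in> Arr V"
    and cod2_in: "\<phi> \<in> Cell V \<Longrightarrow> cod2 V \<phi> \<in> Arr V"
    and dom1_cod2: "\<phi> \<in> Cell V \<Longrightarrow> dom1 V (cod2 V \<phi>) = dom1 V (dom2 V \<phi>)"
    and cod1_cod2: "\<phi> \<in> Cell V \<Longrightarrow> cod1 V (cod2 V \<phi>) = cod1 V (dom2 V \<phi>)"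
    and id1_in: "A \<in> Obj V \<Longrightarrow> id1 V A \<in> hom V A A"
    and comp1_in: "\<lbrakk>f \<in> hom V A B; g \<in> hom V B C\<rbrakk> \<Longrightarrow> g \<cdot> f \<in> hom V A C"
    and comp1_idL: "f \<in> hom V A B \<Longrightarrow> id1 V B \<cdot> f = f"
    and comp1_idR: "f \<in> hom V A B \<Longrightarrow> f \<cdot> id1 V A = f"
    and comp1_assoc: "\<lbrakk>f \<in> hom V A B; g \<in> hom V B C; h \<in> hom V C D\<rbrakk>
        \<Longrightarrow> (h \<cdot> g) \<cdot> f = h \<cdot> (g \<cdot> f)"
    and id2_in: "f \<in> Arr V \<Longrightarrow> id2 V f \<in> cells V f f"
    and vcomp_in: "\<lbrakk>\<phi> \<in> cells V f g; \<psi> \<in> cells V g h\<rbrakk> \<Longrightarrow> \<psi> \<bullet> \<phi> \<in> cells V f h"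
    and vcomp_idL: "\<phi> \<in> cells V f g \<Longrightarrow> id2 V g \<bullet> \<phi> = \<phi>"
    and vcomp_idR: "\<phi> \<in> cells V f g \<Longrightarrow> \<phi> \<bullet> id2 V f = \<phi>"
    and vcomp_assoc: "\<lbrakk>\<phi> \<in> cells V f g; \<psi> \<in> cells V g h; \<chi> \<in> cells V h k\<rbrakk>
        \<Longrightarrow> (\<chi> \<bullet> \<psi>) \<bullet> \<phi> = \<chi> \<bullet> (\<psi> \<bullet> \<phi>)"
    and hcomp_in: "\<lbrakk>f \<in> hom V A B; g \<in> hom V B C; \<phi> \<in> cells V f f'; \<psi> \<in> cells V g g'\<rbrakk>
        \<Longrightarrow> \<psi> \<star> \<phi> \<in> cells V (g \<cdot> f) (g' \<cdot> f')"
    and hcomp_id2: "\<lbrakk>f \<in> hom V A B; g \<in> hom V B C\<rbrakk> \<Longrightarrow> id2 V g \<star> id2 V f = id2 V (g \<cdot> f)"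
    and hcomp_idL: "\<lbrakk>f \<in> hom V A B; \<phi> \<in> cells V f f'\<rbrakk> \<Longrightarrow> id2 V (id1 V B) \<star> \<phi> = \<phi>"
    and hcomp_idR: "\<lbrakk>f \<in> hom V A B; \<phi> \<in> cells V f f'\<rbrakk> \<Longrightarrow> \<phi> \<star> id2 V (id1 V A) = \<phi>"
    and hcomp_assoc: "\<lbrakk>f \<in> hom V A B; g \<in> hom V B C; h \<in> hom V C D;
          \<phi> \<in> cells V f f'; \<psi> \<in> cells V g g'; \<chi> \<in> cells V h h'\<rbrakk>
        \<Longrightarrow> (\<chi> \<star> \<psi>) \<star> \<phi> = \<chi> \<star> (\<psi> \<star> \<phi>)"
    and middle_four: "\<lbrakk>f \<in> hom V A B; g \<in> hom V B C;
          \<phi> \<in> cells V f f'; \<phi>' \<in> cells V f' f''; \<psi> \<in> cells V g g'; \<psi>' \<in> cells V g' g''\<rbrakk>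
        \<Longrightarrow> (\<psi>' \<bullet> \<psi>) \<star> (\<phi>' \<bullet> \<phi>) = (\<psi>' \<star> \<phi>') \<bullet> (\<psi> \<star> \<phi>)"

definition inverse2 :: "('o, 'f, 't, 'm) two_cat_scheme \<Rightarrow> 't \<Rightarrow> 't \<Rightarrow> bool" where
  "inverse2 V \<phi> \<psi> \<longleftrightarrow> \<phi> \<in> Cell V \<and> \<psi> \<in> cells V (cod2 V \<phi>) (dom2 V \<phi>) \<and>
     \<psi> \<bullet>\<^bsub>V\<^esub> \<phi> = id2 V (dom2 V \<phi>) \<and> \<phi> \<bullet>\<^bsub>V\<^esub> \<psi> = id2 V (cod2 V \<phi>)"

definition iso_cells :: "('o, 'f, 't, 'm) two_cat_scheme \<Rightarrow> 'f \<Rightarrow> 'f \<Rightarrow> 't set" where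
  "iso_cells V f g = {\<phi> \<in> cells V f g. \<exists>\<psi>. inverse2 V \<phi> \<psi>}"

definition inv2 :: "('o, 'f, 't, 'm) two_cat_scheme \<Rightarrow> 't \<Rightarrow> 't" where
  "inv2 V \<phi> = (THE \<psi>. inverse2 V \<phi> \<psi>)"

definition equivalence1 :: "('o, 'f, 't, 'm) two_cat_scheme \<Rightarrow> 'f \<Rightarrow> bool" where
  "equivalence1 V f \<longleftrightarrow> f \<in> Arr V \<and> (\<exists>g \<in> hom V (cod1 V f) (dom1 V f).
     iso_cells V (g \<cdot>\<^bsub>V\<^esub> f) (id1 V (dom1 V f)) \<noteq> {} \<and>
     iso_cells V (f \<cdot>\<^bsub>V\<^esub> g) (id1 V (cod1 V f)) \<noteq> {})"

locale two_functor =
  src: two_category V + tgt: two_category W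
  for V :: "('o, 'f, 't, 'm) two_cat_scheme" and W :: "('p, 'g, 's, 'n) two_cat_scheme" +
  fixes F0 :: "'o \<Rightarrow> 'p" and F1 :: "'f \<Rightarrow> 'g" and F2 :: "'t \<Rightarrow> 's"
  assumes F0_in: "A \<in> Obj V \<Longrightarrow> F0 A \<in> Obj W"
    and F1_in: "f \<in> hom V A B \<Longrightarrow> F1 f \<in> hom W (F0 A) (F0 B)"
    and F2_in: "\<phi> \<in> cells V f g \<Longrightarrow> F2 \<phi> \<in> cells W (F1 f) (F1 g)"
    and F1_id: "A \<in> Obj V \<Longrightarrow> F1 (id1 V A) = id1 W (F0 A)"
    and F1_comp: "\<lbrakk>f \<in> hom V A B; g \<in> hom V B C\<rbrakk> \<Longrightarrow> F1 (g \<cdot>\<^bsub>V\<^esub> f) = F1 g \<cdot>\<^bsub>W\<^esub> F1 f"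
    and F2_id: "f \<in> Arr V \<Longrightarrow> F2 (id2 V f) = id2 W (F1 f)"
    and F2_vcomp: "\<lbrakk>\<phi> \<in> cells V f g; \<psi> \<in> cells V g h\<rbrakk> \<Longrightarrow> F2 (\<psi> \<bullet>\<^bsub>V\<^esub> \<phi>) = F2 \<psi> \<bullet>\<^bsub>W\<^esub> F2 \<phi>"
    and F2_hcomp: "\<lbrakk>f \<in> hom V A B; g \<in> hom V B C; \<phi> \<in> cells V f f'; \<psi> \<in> cells V g g'\<rbrakk>
        \<Longrightarrow> F2 (\<psi> \<star>\<^bsub>V\<^esub> \<phi>) = F2 \<psi> \<star>\<^bsub>W\<^esub> F2 \<phi>"

text \<open>The cell of a pseudonatural transformation \<open>s : F \<Rightarrow> G\<close> at \<open>f : A \<rightarrow> B\<close> is directed as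
  \<open>s1 f : G f \<cdot> s0 A \<Rightarrow> s0 B \<cdot> F f\<close>.\<close>

locale pseudonatural =
  F: two_functor V W F0 F1 F2 + G: two_functor V W G0 G1 G2
  for V :: "('o, 'f, 't, 'm) two_cat_scheme" and W :: "('p, 'g, 's, 'n) two_cat_scheme"
    and F0 F1 F2 G0 G1 G2 +
  fixes s0 :: "'o \<Rightarrow> 'g" and s1 :: "'f \<Rightarrow> 's"
  assumes s0_in: "A \<in> Obj V \<Longrightarrow> s0 A \<in> hom W (F0 A) (G0 A)"
    and s1_in: "f \<in> hom V A B \<Longrightarrow> s1 f \<in> iso_cells W (G1 f \<cdot>\<^bsub>W\<^esub> s0 A) (s0 B \<cdot>\<^bsub>W\<^esub> F1 f)"
    and s1_id: "A \<in> Obj V \<Longrightarrow> s1 (id1 V A) = id2 W (s0 A)"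
    and s1_comp: "\<lbrakk>f \<in> hom V A B; g \<in> hom V B C\<rbrakk>
        \<Longrightarrow> s1 (g \<cdot>\<^bsub>V\<^esub> f) = (s1 g \<lhd>\<^bsub>W\<^esub> F1 f) \<bullet>\<^bsub>W\<^esub> (G1 g \<rhd>\<^bsub>W\<^esub> s1 f)"
    and s1_nat: "\<lbrakk>f \<in> hom V A B; \<phi> \<in> cells V f f'\<rbrakk>
        \<Longrightarrow> s1 f' \<bullet>\<^bsub>W\<^esub> (G2 \<phi> \<lhd>\<^bsub>W\<^esub> s0 A) = (s0 B \<rhd>\<^bsub>W\<^esub> F2 \<phi>) \<bullet>\<^bsub>W\<^esub> s1 f"

text \<open>Invertible modifications from the transformation with components \<open>s0\<close> and cells \<open>s1\<close> to
  the one with components \<open>t0\<close> and cells \<open>t1\<close>, both between 2-functors acting on 1-cells by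
  \<open>F1\<close> and \<open>G1\<close>.\<close>

definition invertible_modification ::
  "('o, 'f, 't, 'm) two_cat_scheme \<Rightarrow> ('p, 'g, 's, 'n) two_cat_scheme \<Rightarrow>
   ('f \<Rightarrow> 'g) \<Rightarrow> ('f \<Rightarrow> 'g) \<Rightarrow> ('o \<Rightarrow> 'g) \<Rightarrow> ('f \<Rightarrow> 's) \<Rightarrow> ('o \<Rightarrow> 'g) \<Rightarrow> ('f \<Rightarrow> 's) \<Rightarrow> ('o \<Rightarrow> 's) \<Rightarrow> bool"
where
  "invertible_modification V W F1 G1 s0 s1 t0 t1 \<Gamma> \<longleftrightarrow>
     (\<forall>A \<in> Obj V. \<Gamma> A \<in> iso_cells W (s0 A) (t0 A)) \<and>
     (\<forall>A \<in> Obj V. \<forall>B \<in> Obj V. \<forall>f \<in> hom V A B.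
        t1 f \<bullet>\<^bsub>W\<^esub> (G1 f \<rhd>\<^bsub>W\<^esub> \<Gamma> A) = (\<Gamma> B \<lhd>\<^bsub>W\<^esub> F1 f) \<bullet>\<^bsub>W\<^esub> s1 f)"


section \<open>Gray monoids\<close>

text \<open>A 2-functor out of the Gray tensor product \<open>V \<otimes> V\<close> amounts to 2-functors \<open>A \<otimes> -\<close> and
  \<open>- \<otimes> B\<close> together with interchangers. Accordingly a monoid for the Gray tensor product is given
  by the actions of objects on cells from the left (\<open>\<ltimes>\<close>, and \<open>\<ltimes>\<^sub>2\<close> on 2-cells) and from the right
  (\<open>\<rtimes>\<close>, \<open>\<rtimes>\<^sub>2\<close>), and by the interchangers \<open>inter f g\<close>.\<close>

record ('o, 'f, 't) gray = "('o, 'f, 't) two_cat" +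
  unit :: 'o (\<open>\<one>\<index>\<close>)
  ten :: "'o \<Rightarrow> 'o \<Rightarrow> 'o" (infixr \<open>\<otimes>\<index>\<close> 80)
  tenL1 :: "'o \<Rightarrow> 'f \<Rightarrow> 'f" (infixr \<open>\<ltimes>\<index>\<close> 76)
  tenR1 :: "'f \<Rightarrow> 'o \<Rightarrow> 'f" (infixl \<open>\<rtimes>\<index>\<close> 75)
  tenL2 :: "'o \<Rightarrow> 't \<Rightarrow> 't" (infixr \<open>\<ltimes>\<^sub>2\<index>\<close> 76)
  tenR2 :: "'t \<Rightarrow> 'o \<Rightarrow> 't" (infixl \<open>\<rtimes>\<^sub>2\<index>\<close> 75)
  inter :: "'f \<Rightarrow> 'f \<Rightarrow> 't" (\<open>\<Sigma>\<index>\<close>)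

locale gray_monoid = two_category V
  for V :: "('o, 'f, 't, 'm) gray_scheme" (structure) +
  assumes unit_in: "\<one> \<in> Obj V"
    and tenL_functor: "A \<in> Obj V \<Longrightarrow> two_functor V V (\<lambda>B. A \<otimes> B) (\<lambda>g. A \<ltimes> g) (\<lambda>\<psi>. A \<ltimes>\<^sub>2 \<psi>)"
    and tenR_functor: "B \<in> Obj V \<Longrightarrow> two_functor V V (\<lambda>A. A \<otimes> B) (\<lambda>f. f \<rtimes> B) (\<lambda>\<phi>. \<phi> \<rtimes>\<^sub>2 B)"
    and unitL0: "A \<in> Obj V \<Longrightarrow> \<one> \<otimes> A = A"
    and unitR0: "A \<in> Obj V \<Longrightarrow> A \<otimes> \<one> = A"
    and unitL1: "f \<in> Arr V \<Longrightarrow> \<one> \<ltimes> f = f"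
    and unitR1: "f \<in> Arr V \<Longrightarrow> f \<rtimes> \<one> = f"
    and unitL2: "\<phi> \<in> Cell V \<Longrightarrow> \<one> \<ltimes>\<^sub>2 \<phi> = \<phi>"
    and unitR2: "\<phi> \<in> Cell V \<Longrightarrow> \<phi> \<rtimes>\<^sub>2 \<one> = \<phi>"
    and assoc0: "\<lbrakk>A \<in> Obj V; B \<in> Obj V; C \<in> Obj V\<rbrakk> \<Longrightarrow> (A \<otimes> B) \<otimes> C = A \<otimes> (B \<otimes> C)"
    and assocLL1: "\<lbrakk>A \<in> Obj V; B \<in> Obj V; f \<in> Arr V\<rbrakk> \<Longrightarrow> (A \<otimes> B) \<ltimes> f = A \<ltimes> (B \<ltimes> f)"
    and assocLR1: "\<lbrakk>A \<in> Obj V; B \<in> Obj V; f \<in> Arr V\<rbrakk> \<Longrightarrow> (A \<ltimes> f) \<rtimes> B = A \<ltimes> (f \<rtimes> B)"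
    and assocRR1: "\<lbrakk>A \<in> Obj V; B \<in> Obj V; f \<in> Arr V\<rbrakk> \<Longrightarrow> (f \<rtimes> A) \<rtimes> B = f \<rtimes> (A \<otimes> B)"
    and assocLL2: "\<lbrakk>A \<in> Obj V; B \<in> Obj V; \<phi> \<in> Cell V\<rbrakk> \<Longrightarrow> (A \<otimes> B) \<ltimes>\<^sub>2 \<phi> = A \<ltimes>\<^sub>2 (B \<ltimes>\<^sub>2 \<phi>)"
    and assocLR2: "\<lbrakk>A \<in> Obj V; B \<in> Obj V; \<phi> \<in> Cell V\<rbrakk> \<Longrightarrow> (A \<ltimes>\<^sub>2 \<phi>) \<rtimes>\<^sub>2 B = A \<ltimes>\<^sub>2 (\<phi> \<rtimes>\<^sub>2 B)"
    and assocRR2: "\<lbrakk>A \<in> Obj V; B \<in> Obj V; \<phi> \<in> Cell V\<rbrakk> \<Longrightarrow> (\<phi> \<rtimes>\<^sub>2 A) \<rtimes>\<^sub>2 B = \<phi> \<rtimes>\<^sub>2 (A \<otimes> B)"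
    and inter_in: "\<lbrakk>f \<in> hom V A A'; g \<in> hom V B B'\<rbrakk>
        \<Longrightarrow> \<Sigma> f g \<in> iso_cells V ((f \<rtimes> B') \<cdot> (A \<ltimes> g)) ((A' \<ltimes> g) \<cdot> (f \<rtimes> B))"
    and inter_nat: "\<lbrakk>f \<in> hom V A A'; g \<in> hom V B B'; \<phi> \<in> cells V f f'; \<psi> \<in> cells V g g'\<rbrakk>
        \<Longrightarrow> \<Sigma> f' g' \<bullet> ((\<phi> \<rtimes>\<^sub>2 B') \<star> (A \<ltimes>\<^sub>2 \<psi>)) = ((A' \<ltimes>\<^sub>2 \<psi>) \<star> (\<phi> \<rtimes>\<^sub>2 B)) \<bullet> \<Sigma> f g"
    and inter_idL: "\<lbrakk>A \<in> Obj V; g \<in> Arr V\<rbrakk> \<Longrightarrow> \<Sigma> (id1 V A) g = id2 V (A \<ltimes> g)"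
    and inter_idR: "\<lbrakk>B \<in> Obj V; f \<in> Arr V\<rbrakk> \<Longrightarrow> \<Sigma> f (id1 V B) = id2 V (f \<rtimes> B)"
    and inter_compL: "\<lbrakk>f \<in> hom V A A'; f' \<in> hom V A' A''; g \<in> hom V B B'\<rbrakk>
        \<Longrightarrow> \<Sigma> (f' \<cdot> f) g = (\<Sigma> f' g \<lhd> (f \<rtimes> B)) \<bullet> ((f' \<rtimes> B') \<rhd> \<Sigma> f g)"
    and inter_compR: "\<lbrakk>f \<in> hom V A A'; g \<in> hom V B B'; g' \<in> hom V B' B''\<rbrakk>
        \<Longrightarrow> \<Sigma> f (g' \<cdot> g) = ((A' \<ltimes> g') \<rhd> \<Sigma> f g) \<bullet> (\<Sigma> f g' \<lhd> (A \<ltimes> g))"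
    and inter_assocL: "\<lbrakk>C \<in> Obj V; f \<in> Arr V; g \<in> Arr V\<rbrakk> \<Longrightarrow> \<Sigma> (C \<ltimes> f) g = C \<ltimes>\<^sub>2 \<Sigma> f g"
    and inter_assocM: "\<lbrakk>C \<in> Obj V; f \<in> Arr V; g \<in> Arr V\<rbrakk> \<Longrightarrow> \<Sigma> (f \<rtimes> C) g = \<Sigma> f (C \<ltimes> g)"
    and inter_assocR: "\<lbrakk>C \<in> Obj V; f \<in> Arr V; g \<in> Arr V\<rbrakk> \<Longrightarrow> \<Sigma> f (g \<rtimes> C) = \<Sigma> f g \<rtimes>\<^sub>2 C"

text \<open>The tensor product of two 1-cells is only determined up to an interchanger; we choose the
  domain of \<open>\<Sigma> f g\<close>, and correspondingly for 2-cells.\<close>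

definition ten1 :: "('o, 'f, 't, 'm) gray_scheme \<Rightarrow> 'f \<Rightarrow> 'f \<Rightarrow> 'f" (infixl \<open>\<boxtimes>\<index>\<close> 73) where
  "f \<boxtimes>\<^bsub>V\<^esub> g = (f \<rtimes>\<^bsub>V\<^esub> cod1 V g) \<cdot>\<^bsub>V\<^esub> (dom1 V f \<ltimes>\<^bsub>V\<^esub> g)"

definition ten2 :: "('o, 'f, 't, 'm) gray_scheme \<Rightarrow> 't \<Rightarrow> 't \<Rightarrow> 't" (infixl \<open>\<boxtimes>\<^sub>2\<index>\<close> 73) where
  "\<phi> \<boxtimes>\<^sub>2\<^bsub>V\<^esub> \<psi> =
     (\<phi> \<rtimes>\<^sub>2\<^bsub>V\<^esub> cod1 V (dom2 V \<psi>)) \<star>\<^bsub>V\<^esub> (dom1 V (dom2 V \<phi>) \<ltimes>\<^sub>2\<^bsub>V\<^esub> \<psi>)"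


section \<open>Semi-strict braided monoidal bicategories\<close>

text \<open>\<open>\<beta>L f B\<close> and \<open>\<beta>R A g\<close> are the pseudonaturality cells of \<open>\<beta>\<close> in its first and second variable.\<close>

record ('o, 'f, 't) braided = "('o, 'f, 't) gray" +
  braid :: "'o \<Rightarrow> 'o \<Rightarrow> 'f" (\<open>\<beta>\<index>\<close>)
  braidL :: "'f \<Rightarrow> 'o \<Rightarrow> 't" (\<open>\<beta>L\<index>\<close>)
  braidR :: "'o \<Rightarrow> 'f \<Rightarrow> 't" (\<open>\<beta>R\<index>\<close>)
  hexR :: "'o \<Rightarrow> 'o \<Rightarrow> 'o \<Rightarrow> 't"
  hexS :: "'o \<Rightarrow> 'o \<Rightarrow> 'o \<Rightarrow> 't"

text \<open>A pseudonatural transformation between 2-functors on the Gray tensor product is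
  pseudonatural in each variable and compatible with the interchangers (\<open>braid_inter\<close>). The
  symmetry of the Gray tensor product exchanges \<open>\<Sigma> f g\<close> with the inverse of \<open>\<Sigma> g f\<close>. Likewise
  \<open>hexR\<close> and \<open>hexS\<close> are modifications in each of their three variables; the pseudonaturality cells
  of their codomains involve interchangers of braidings with the 1-cell of the remaining variable.\<close>

locale semistrict_braided = gray_monoid V
  for V :: "('o, 'f, 't, 'm) braided_scheme" (structure) +
  assumes braid_pseudonatR: "A \<in> Obj V \<Longrightarrow>
        pseudonatural V V (\<lambda>B. A \<otimes> B) (\<lambda>g. A \<ltimes> g) (\<lambda>\<psi>. A \<ltimes>\<^sub>2 \<psi>)
          (\<lambda>B. B \<otimes> A) (\<lambda>g. g \<rtimes> A) (\<lambda>\<psi>. \<psi> \<rtimes>\<^sub>2 A) (\<lambda>B. \<beta> A B) (\<lambda>g. \<beta>R A g)"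
    and braid_pseudonatL: "B \<in> Obj V \<Longrightarrow>
        pseudonatural V V (\<lambda>A. A \<otimes> B) (\<lambda>f. f \<rtimes> B) (\<lambda>\<phi>. \<phi> \<rtimes>\<^sub>2 B)
          (\<lambda>A. B \<otimes> A) (\<lambda>f. B \<ltimes> f) (\<lambda>\<phi>. B \<ltimes>\<^sub>2 \<phi>) (\<lambda>A. \<beta> A B) (\<lambda>f. \<beta>L f B)"
    and braid_inter: "\<lbrakk>f \<in> hom V A A'; g \<in> hom V B B'\<rbrakk> \<Longrightarrow>
        (\<beta> A' B' \<rhd> \<Sigma> f g) \<bullet> (\<beta>L f B' \<lhd> (A \<ltimes> g)) \<bullet> ((B' \<ltimes> f) \<rhd> \<beta>R A g)
        = (\<beta>R A' g \<lhd> (f \<rtimes> B)) \<bullet> ((g \<rtimes> A') \<rhd> \<beta>L f B) \<bullet> (inv2 V (\<Sigma> g f) \<lhd> \<beta> A B)"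
    and braid_equivalence: "\<lbrakk>A \<in> Obj V; B \<in> Obj V\<rbrakk> \<Longrightarrow> equivalence1 V (\<beta> A B)"
    and hexR_mod1: "\<lbrakk>B \<in> Obj V; C \<in> Obj V\<rbrakk> \<Longrightarrow>
        invertible_modification V V (\<lambda>f. f \<rtimes> (B \<otimes> C)) (\<lambda>f. (B \<otimes> C) \<ltimes> f)
          (\<lambda>A. \<beta> A (B \<otimes> C)) (\<lambda>f. \<beta>L f (B \<otimes> C))
          (\<lambda>A. (B \<ltimes> \<beta> A C) \<cdot> (\<beta> A B \<rtimes> C))
          (\<lambda>f. ((B \<ltimes> \<beta> (cod1 V f) C) \<rhd> (\<beta>L f B \<rtimes>\<^sub>2 C)) \<bullet> ((B \<ltimes>\<^sub>2 \<beta>L f C) \<lhd> (\<beta> (dom1 V f) B \<rtimes> C)))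
          (\<lambda>A. hexR V A B C)"
    and hexR_mod2: "\<lbrakk>A \<in> Obj V; C \<in> Obj V\<rbrakk> \<Longrightarrow>
        invertible_modification V V (\<lambda>g. A \<ltimes> g \<rtimes> C) (\<lambda>g. g \<rtimes> (C \<otimes> A))
          (\<lambda>B. \<beta> A (B \<otimes> C)) (\<lambda>g. \<beta>R A (g \<rtimes> C))
          (\<lambda>B. (B \<ltimes> \<beta> A C) \<cdot> (\<beta> A B \<rtimes> C))
          (\<lambda>g. ((cod1 V g \<ltimes> \<beta> A C) \<rhd> (\<beta>R A g \<rtimes>\<^sub>2 C)) \<bullet> (\<Sigma> g (\<beta> A C) \<lhd> (\<beta> A (dom1 V g) \<rtimes> C)))
          (\<lambda>B. hexR V A B C)"
    and hexR_mod3: "\<lbrakk>A \<in> Obj V; B \<in> Obj V\<rbrakk> \<Longrightarrow>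
        invertible_modification V V (\<lambda>h. (A \<otimes> B) \<ltimes> h) (\<lambda>h. B \<ltimes> h \<rtimes> A)
          (\<lambda>C. \<beta> A (B \<otimes> C)) (\<lambda>h. \<beta>R A (B \<ltimes> h))
          (\<lambda>C. (B \<ltimes> \<beta> A C) \<cdot> (\<beta> A B \<rtimes> C))
          (\<lambda>h. ((B \<ltimes> \<beta> A (cod1 V h)) \<rhd> inv2 V (\<Sigma> (\<beta> A B) h))
               \<bullet> ((B \<ltimes>\<^sub>2 \<beta>R A h) \<lhd> (\<beta> A B \<rtimes> dom1 V h)))
          (\<lambda>C. hexR V A B C)"
    and hexS_mod1: "\<lbrakk>B \<in> Obj V; C \<in> Obj V\<rbrakk> \<Longrightarrow>
        invertible_modification V V (\<lambda>f. f \<rtimes> (B \<otimes> C)) (\<lambda>f. C \<ltimes> f \<rtimes> B)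
          (\<lambda>A. \<beta> (A \<otimes> B) C) (\<lambda>f. \<beta>L (f \<rtimes> B) C)
          (\<lambda>A. (\<beta> A C \<rtimes> B) \<cdot> (A \<ltimes> \<beta> B C))
          (\<lambda>f. ((\<beta> (cod1 V f) C \<rtimes> B) \<rhd> \<Sigma> f (\<beta> B C)) \<bullet> ((\<beta>L f C \<rtimes>\<^sub>2 B) \<lhd> (dom1 V f \<ltimes> \<beta> B C)))
          (\<lambda>A. hexS V A B C)"
    and hexS_mod2: "\<lbrakk>A \<in> Obj V; C \<in> Obj V\<rbrakk> \<Longrightarrow>
        invertible_modification V V (\<lambda>g. A \<ltimes> g \<rtimes> C) (\<lambda>g. (C \<otimes> A) \<ltimes> g)
          (\<lambda>B. \<beta> (A \<otimes> B) C) (\<lambda>g. \<beta>L (A \<ltimes> g) C)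
          (\<lambda>B. (\<beta> A C \<rtimes> B) \<cdot> (A \<ltimes> \<beta> B C))
          (\<lambda>g. ((\<beta> A C \<rtimes> cod1 V g) \<rhd> (A \<ltimes>\<^sub>2 \<beta>L g C))
               \<bullet> (inv2 V (\<Sigma> (\<beta> A C) g) \<lhd> (A \<ltimes> \<beta> (dom1 V g) C)))
          (\<lambda>B. hexS V A B C)"
    and hexS_mod3: "\<lbrakk>A \<in> Obj V; B \<in> Obj V\<rbrakk> \<Longrightarrow>
        invertible_modification V V (\<lambda>h. (A \<otimes> B) \<ltimes> h) (\<lambda>h. h \<rtimes> (A \<otimes> B))
          (\<lambda>C. \<beta> (A \<otimes> B) C) (\<lambda>h. \<beta>R (A \<otimes> B) h)
          (\<lambda>C. (\<beta> A C \<rtimes> B) \<cdot> (A \<ltimes> \<beta> B C))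
          (\<lambda>h. ((\<beta> A (cod1 V h) \<rtimes> B) \<rhd> (A \<ltimes>\<^sub>2 \<beta>R B h)) \<bullet> ((\<beta>R A h \<rtimes>\<^sub>2 B) \<lhd> (A \<ltimes> \<beta> B (dom1 V h))))
          (\<lambda>C. hexS V A B C)"
    and braiding_RR: "\<lbrakk>A \<in> Obj V; B \<in> Obj V; C \<in> Obj V; D \<in> Obj V\<rbrakk> \<Longrightarrow>
        ((B \<otimes> C) \<ltimes> \<beta> A D \<rhd> hexR V A B C \<rtimes>\<^sub>2 D) \<bullet> hexR V A (B \<otimes> C) D
        = (B \<ltimes>\<^sub>2 hexR V A C D \<lhd> \<beta> A B \<rtimes> (C \<otimes> D)) \<bullet> hexR V A B (C \<otimes> D)"
    and braiding_SS: "\<lbrakk>A \<in> Obj V; B \<in> Obj V; C \<in> Obj V; D \<in> Obj V\<rbrakk> \<Longrightarrow>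
        (hexS V A B D \<rtimes>\<^sub>2 C \<lhd> (A \<otimes> B) \<ltimes> \<beta> C D) \<bullet> hexS V (A \<otimes> B) C D
        = (\<beta> A D \<rtimes> (B \<otimes> C) \<rhd> A \<ltimes>\<^sub>2 hexS V B C D) \<bullet> hexS V A (B \<otimes> C) D"
    and braiding_RS: "\<lbrakk>A \<in> Obj V; B \<in> Obj V; C \<in> Obj V; D \<in> Obj V\<rbrakk> \<Longrightarrow>
        ((C \<ltimes>\<^sub>2 hexS V A B D) \<star> (hexS V A B C \<rtimes>\<^sub>2 D)) \<bullet> hexR V (A \<otimes> B) C D
        = (C \<ltimes> \<beta> A D \<rtimes> B \<rhd> \<Sigma> (\<beta> A C) (\<beta> B D) \<lhd> A \<ltimes> \<beta> B C \<rtimes> D)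
          \<bullet> ((hexR V A C D \<rtimes>\<^sub>2 B) \<star> (A \<ltimes>\<^sub>2 hexR V B C D)) \<bullet> hexS V A B (C \<otimes> D)"
    and yang_baxter: "\<lbrakk>A \<in> Obj V; B \<in> Obj V; C \<in> Obj V\<rbrakk> \<Longrightarrow>
        (hexR V A C B \<lhd> A \<ltimes> \<beta> B C) \<bullet> \<beta>R A (\<beta> B C) \<bullet> (\<beta> B C \<rtimes> A \<rhd> inv2 V (hexR V A B C))
        = (C \<ltimes> \<beta> A B \<rhd> hexS V A B C) \<bullet> inv2 V (\<beta>L (\<beta> A B) C)
          \<bullet> (inv2 V (hexS V B A C) \<lhd> \<beta> A B \<rtimes> C)"
    and braid_unitR: "A \<in> Obj V \<Longrightarrow> \<beta> A \<one> = id1 V A"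
    and braid_unitL: "A \<in> Obj V \<Longrightarrow> \<beta> \<one> A = id1 V A"
    and hexR_unit: "\<lbrakk>A \<in> Obj V; B \<in> Obj V; C \<in> Obj V; A = \<one> \<or> B = \<one> \<or> C = \<one>\<rbrakk>
        \<Longrightarrow> hexR V A B C = id2 V (\<beta> A (B \<otimes> C))"
    and hexS_unit: "\<lbrakk>A \<in> Obj V; B \<in> Obj V; C \<in> Obj V; A = \<one> \<or> B = \<one> \<or> C = \<one>\<rbrakk>
        \<Longrightarrow> hexS V A B C = id2 V (\<beta> (A \<otimes> B) C)"


section \<open>Enriched bicategories\<close>

text \<open>\<open>eMul C c d e\<close> is the composition \<open>C(d,e) \<otimes> C(c,d) \<rightarrow> C(c,e)\<close>, and \<open>eAssoc C a b c d\<close> is the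
  associator with domain a 1-cell out of \<open>C(c,d) \<otimes> C(b,c) \<otimes> C(a,b)\<close>.\<close>

record ('c, 'o, 'f, 't) enr_bicat =
  eObj :: "'c set"
  eHom :: "'c \<Rightarrow> 'c \<Rightarrow> 'o"
  eMul :: "'c \<Rightarrow> 'c \<Rightarrow> 'c \<Rightarrow> 'f"
  eUnit :: "'c \<Rightarrow> 'f"
  eAssoc :: "'c \<Rightarrow> 'c \<Rightarrow> 'c \<Rightarrow> 'c \<Rightarrow> 't"
  eLeft :: "'c \<Rightarrow> 'c \<Rightarrow> 't"
  eRight :: "'c \<Rightarrow> 'c \<Rightarrow> 't"

locale enriched_bicategory = gray_monoid V
  for V :: "('o, 'f, 't, 'm) gray_scheme" (structure) +
  fixes C :: "('c, 'o, 'f, 't) enr_bicat"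
  assumes eHom_in: "\<lbrakk>c \<in> eObj C; d \<in> eObj C\<rbrakk> \<Longrightarrow> eHom C c d \<in> Obj V"
    and eMul_in: "\<lbrakk>c \<in> eObj C; d \<in> eObj C; e \<in> eObj C\<rbrakk>
        \<Longrightarrow> eMul C c d e \<in> hom V (eHom C d e \<otimes> eHom C c d) (eHom C c e)"
    and eUnit_in: "c \<in> eObj C \<Longrightarrow> eUnit C c \<in> hom V \<one> (eHom C c c)"
    and eAssoc_in: "\<lbrakk>a \<in> eObj C; b \<in> eObj C; c \<in> eObj C; d \<in> eObj C\<rbrakk> \<Longrightarrow>
        eAssoc C a b c d \<in> iso_cells V (eMul C a b d \<cdot> (eMul C b c d \<rtimes> eHom C a b))
                                        (eMul C a c d \<cdot> (eHom C c d \<ltimes> eMul C a b c))"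
    and eLeft_in: "\<lbrakk>c \<in> eObj C; d \<in> eObj C\<rbrakk> \<Longrightarrow>
        eLeft C c d \<in> iso_cells V (eMul C c d d \<cdot> (eUnit C d \<rtimes> eHom C c d)) (id1 V (eHom C c d))"
    and eRight_in: "\<lbrakk>c \<in> eObj C; d \<in> eObj C\<rbrakk> \<Longrightarrow>
        eRight C c d \<in> iso_cells V (eMul C c c d \<cdot> (eHom C c d \<ltimes> eUnit C c)) (id1 V (eHom C c d))"
    and IC: "\<lbrakk>a \<in> eObj C; b \<in> eObj C; c \<in> eObj C\<rbrakk> \<Longrightarrow>
        (eMul C a b c \<rhd> eHom C b c \<ltimes>\<^sub>2 eLeft C a b)
          \<bullet> (eAssoc C a b b c \<lhd> eHom C b c \<ltimes> eUnit C b \<rtimes> eHom C a b)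
        = eMul C a b c \<rhd> eRight C b c \<rtimes>\<^sub>2 eHom C a b"
    and AC: "\<lbrakk>a \<in> eObj C; b \<in> eObj C; c \<in> eObj C; d \<in> eObj C; e \<in> eObj C\<rbrakk> \<Longrightarrow>
        (eMul C a d e \<rhd> eHom C d e \<ltimes>\<^sub>2 eAssoc C a b c d)
          \<bullet> (eAssoc C a b d e \<lhd> eHom C d e \<ltimes> eMul C b c d \<rtimes> eHom C a b)
          \<bullet> (eMul C a b e \<rhd> eAssoc C b c d e \<rtimes>\<^sub>2 eHom C a b)
        = (eAssoc C a c d e \<lhd> (eHom C d e \<otimes> eHom C c d) \<ltimes> eMul C a b c)
          \<bullet> (eMul C a c e \<rhd> inv2 V (\<Sigma> (eMul C c d e) (eMul C a b c)))
          \<bullet> (eAssoc C a b c e \<lhd> eMul C c d e \<rtimes> (eHom C b c \<otimes> eHom C a b))"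


section \<open>The tensor product of enriched bicategories\<close>

context
  fixes V :: "('o, 'f, 't, 'm) braided_scheme" (structure)
    and B :: "('b, 'o, 'f, 't) enr_bicat" and C :: "('c, 'o, 'f, 't) enr_bicat"
begin

definition tensor_hom :: "'b \<times> 'c \<Rightarrow> 'b \<times> 'c \<Rightarrow> 'o" where
  "tensor_hom = (\<lambda>(a, x) (b, y). eHom B a b \<otimes> eHom C x y)"

definition tensor_mul :: "'b \<times> 'c \<Rightarrow> 'b \<times> 'c \<Rightarrow> 'b \<times> 'c \<Rightarrow> 'f" where
  "tensor_mul = (\<lambda>(a, x) (b, y) (c, z).
     (eMul B a b c \<boxtimes> eMul C x y z) \<cdot> (eHom B b c \<ltimes> \<beta> (eHom C y z) (eHom B a b) \<rtimes> eHom C x y))"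

definition tensor_unit :: "'b \<times> 'c \<Rightarrow> 'f" where
  "tensor_unit = (\<lambda>(b, c). eUnit B b \<boxtimes> eUnit C c)"

text \<open>In \<open>step1\<close>, \<open>step5\<close> and \<open>step6\<close> the additional interchangers bring the tensor products of
  1-cells into the form in which the pseudonaturality cells and \<open>\<alpha>\<alpha>\<close> apply.\<close>

definition tensor_assoc :: "'b \<times> 'c \<Rightarrow> 'b \<times> 'c \<Rightarrow> 'b \<times> 'c \<Rightarrow> 'b \<times> 'c \<Rightarrow> 't" where
  "tensor_assoc = (\<lambda>(a, x) (b, y) (c, z) (d, w).
     let B1 = eHom B c d; C1 = eHom C z w; B2 = eHom B b c; C2 = eHom C y z;
         B3 = eHom B a b; C3 = eHom C x y;
         Bac = eHom B a c; Bbd = eHom B b d; Cxz = eHom C x z; Cyw = eHom C y w; Cxw = eHom C x w;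
         m = eMul B; n = eMul C;
         step1 =
           (m a b d \<boxtimes> n x y w)
             \<rhd> ((m b c d \<rtimes> (B3 \<otimes> Cyw \<otimes> C3) \<rhd> (B1 \<otimes> B2) \<ltimes>\<^sub>2 inv2 V (\<beta>L (n y z w) B3) \<rtimes>\<^sub>2 C3)
                \<bullet> (inv2 V (\<Sigma> (m b c d) (\<beta> Cyw B3 \<rtimes> C3)) \<lhd> (B1 \<otimes> B2) \<ltimes> n y z w \<rtimes> (B3 \<otimes> C3)))
             \<lhd> B1 \<ltimes> \<beta> C1 B2 \<rtimes> (C2 \<otimes> B3 \<otimes> C3);
         step2 =
           (m a b d \<boxtimes> n x y w) \<cdot> ((m b c d \<rtimes> B3) \<boxtimes> (n y z w \<rtimes> C3))
             \<rhd> (B1 \<otimes> B2) \<ltimes>\<^sub>2 hexS V C1 C2 B3 \<rtimes>\<^sub>2 C3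
             \<lhd> B1 \<ltimes> \<beta> C1 B2 \<rtimes> (C2 \<otimes> B3 \<otimes> C3);
         step3 =
           (m a b d \<boxtimes> n x y w) \<cdot> ((m b c d \<rtimes> B3) \<boxtimes> (n y z w \<rtimes> C3))
               \<cdot> ((B1 \<otimes> B2) \<ltimes> \<beta> C1 B3 \<rtimes> (C2 \<otimes> C3))
             \<rhd> B1 \<ltimes>\<^sub>2 inv2 V (\<Sigma> (\<beta> C1 B2) (\<beta> C2 B3)) \<rtimes>\<^sub>2 C3;
         step4 =
           (m a b d \<boxtimes> n x y w) \<cdot> ((m b c d \<rtimes> B3) \<boxtimes> (n y z w \<rtimes> C3))
             \<rhd> B1 \<ltimes>\<^sub>2 inv2 V (hexR V C1 B2 B3) \<rtimes>\<^sub>2 (C2 \<otimes> C3)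
             \<lhd> (B1 \<otimes> C1 \<otimes> B2) \<ltimes> \<beta> C2 B3 \<rtimes> C3;
         step5 =
           ((m a c d \<rtimes> Cxw \<rhd> \<Sigma> (B1 \<ltimes> m a b c) (n x z w) \<lhd> (B1 \<otimes> B2 \<otimes> B3 \<otimes> C1) \<ltimes> n x y z)
              \<bullet> (eAssoc B a b c d \<boxtimes>\<^sub>2 eAssoc C x y z w)
              \<bullet> (m a b d \<rtimes> Cxw \<rhd> inv2 V (\<Sigma> (m b c d \<rtimes> B3) (n x y w))
                   \<lhd> (B1 \<otimes> B2 \<otimes> B3) \<ltimes> n y z w \<rtimes> C3))
             \<lhd> (B1 \<ltimes> \<beta> C1 (B2 \<otimes> B3) \<rtimes> (C2 \<otimes> C3)) \<cdot> ((B1 \<otimes> C1 \<otimes> B2) \<ltimes> \<beta> C2 B3 \<rtimes> C3);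
         step6 =
           (m a c d \<boxtimes> n x z w)
             \<rhd> ((B1 \<ltimes>\<^sub>2 \<beta>R C1 (m a b c) \<rtimes>\<^sub>2 Cxz \<lhd> (B1 \<otimes> C1 \<otimes> B2 \<otimes> B3) \<ltimes> n x y z)
                \<bullet> (B1 \<ltimes> m a b c \<rtimes> (C1 \<otimes> Cxz) \<rhd> inv2 V (\<Sigma> (B1 \<ltimes> \<beta> C1 (B2 \<otimes> B3)) (n x y z))))
             \<lhd> (B1 \<otimes> C1 \<otimes> B2) \<ltimes> \<beta> C2 B3 \<rtimes> C3
     in step6 \<bullet> step5 \<bullet> step4 \<bullet> step3 \<bullet> step2 \<bullet> step1)"

definition tensor_left :: "'b \<times> 'c \<Rightarrow> 'b \<times> 'c \<Rightarrow> 't" where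
  "tensor_left = (\<lambda>(a, x) (b, y).
     let B1 = eHom B a b; C1 = eHom C x y; Bb = eHom B b b; Cy = eHom C y y;
         m = eMul B a b b; n = eMul C x y y; u = eUnit B b; v = eUnit C y
     in (eLeft B a b \<boxtimes>\<^sub>2 eLeft C x y)
        \<bullet> (m \<rtimes> C1 \<rhd> inv2 V (\<Sigma> (u \<rtimes> B1) n) \<lhd> B1 \<ltimes> v \<rtimes> C1)
        \<bullet> ((m \<boxtimes> n) \<cdot> (u \<rtimes> (B1 \<otimes> Cy \<otimes> C1)) \<rhd> inv2 V (\<beta>L v B1) \<rtimes>\<^sub>2 C1)
        \<bullet> (m \<boxtimes> n \<rhd> inv2 V (\<Sigma> u (\<beta> Cy B1 \<rtimes> C1)) \<lhd> v \<rtimes> (B1 \<otimes> C1)))"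

definition tensor_right :: "'b \<times> 'c \<Rightarrow> 'b \<times> 'c \<Rightarrow> 't" where
  "tensor_right = (\<lambda>(a, x) (b, y).
     let B1 = eHom B a b; C1 = eHom C x y; Ba = eHom B a a; Cx = eHom C x x;
         m = eMul B a a b; n = eMul C x x y; u = eUnit B a; v = eUnit C x
     in (eRight B a b \<boxtimes>\<^sub>2 eRight C x y)
        \<bullet> (m \<rtimes> C1 \<rhd> inv2 V (\<Sigma> (B1 \<ltimes> u) n) \<lhd> (B1 \<otimes> C1) \<ltimes> v)
        \<bullet> (m \<boxtimes> n \<rhd> B1 \<ltimes>\<^sub>2 inv2 V (\<beta>R C1 u) \<rtimes>\<^sub>2 Cx \<lhd> (B1 \<otimes> C1) \<ltimes> v))"

definition tensor_bicat :: "('b \<times> 'c, 'o, 'f, 't) enr_bicat" where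
  "tensor_bicat =
     \<lparr>eObj = eObj B \<times> eObj C, eHom = tensor_hom, eMul = tensor_mul, eUnit = tensor_unit,
      eAssoc = tensor_assoc, eLeft = tensor_left, eRight = tensor_right\<rparr>"

end

end

theory Submission
  imports Defs
begin

text \<open>Up to coherence, the multiplication of \<open>B \<otimes> C\<close> is that of a composite of two monads along a distributive
  law: the braiding moves a C-strand past a B-strand, and the axioms of a braiding together with
  pseudonaturality make this crossing compatible with multiplications and units on either side. The axioms for
  \<open>B \<otimes> C\<close> then follow from those for \<open>B\<close> and \<open>C\<close> by a long diagram chase.

  The chase is carried out with string diagrams, encoded as lists of layers. Interchanging two adjacent layers is a
  terminating and, by the naturality and composition axioms of the interchanger, coherently confluent rewriting
  system, so there is at most one interchange cell between two diagrams. Hence a path of structural cells determines a 2-cell even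
  if the interchangers between its steps are left implicit, and an equation of such paths can be certified by
  a list of moves, which the simplifier evaluates.\<close>

section \<open>Whiskering in Gray monoids\<close>

text \<open>In a Gray monoid, cells on different tensor factors commute only up to \<Sigma>. Hence
  the composites in the axioms for B \<otimes> C contain an interchanger between almost any two
  consecutive steps, and comparing these by hand is the obstacle that shapes the proof. It is
  removed by making the ends of every step syntactic: a cell is carried together with the two
  diagrams that it connects, so an interchange cell between them never has to be named.

  Strands carry only indices of objects, and five objects suffice for (AC), three for (IC). Both
  axioms thereby become closed statements about lists. The lists of moves need no justification of
  their own: a move either fails or preserves the 2-cell, which is proved once and for all. What
  remains to be verified in the given bicategories is that each basic equation holds, essentially
  one per axiom used, and that the associator and unitors of B \<otimes> C are the values of the
  expected paths.\<close>

context two_category begin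

lemma hom_Arr: "f \<in> hom V A B \<Longrightarrow> f \<in> Arr V" by (simp add: hom_def)
lemma hom_self: "f \<in> Arr V \<Longrightarrow> f \<in> hom V (dom1 V f) (cod1 V f)" by (simp add: hom_def)
lemma hom_Obj: "f \<in> hom V A B \<Longrightarrow> A \<in> Obj V" "f \<in> hom V A B \<Longrightarrow> B \<in> Obj V"
  using dom1_in cod1_in by (auto simp: hom_def)
lemma cells_Cell: "\<phi> \<in> cells V f g \<Longrightarrow> \<phi> \<in> Cell V" by (simp add: cells_def)
lemma cells_dom: "\<phi> \<in> cells V f g \<Longrightarrow> dom2 V \<phi> = f" by (simp add: cells_def)
lemma cells_hom: "\<phi> \<in> cells V f g \<Longrightarrow> f \<in> hom V A B \<Longrightarrow> g \<in> hom V A B"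
  using dom1_cod2 cod1_cod2 cod2_in by (fastforce simp: hom_def cells_def)
lemma cells_hom': "\<phi> \<in> cells V f g \<Longrightarrow> g \<in> hom V A B \<Longrightarrow> f \<in> hom V A B"
  using dom1_cod2 cod1_cod2 dom2_in by (fastforce simp: hom_def cells_def)

text \<open>The usual monoid argument; it makes the definite description in \<open>inv2\<close>
  denote the inverse.\<close>

lemma inverse2_unique:
  assumes "inverse2 V \<phi> \<psi>" "inverse2 V \<phi> \<psi>'" shows "\<psi> = \<psi>'"
proof -
  have c: "\<phi> \<in> cells V (dom2 V \<phi>) (cod2 V \<phi>)" "\<psi> \<in> cells V (cod2 V \<phi>) (dom2 V \<phi>)"
    "\<psi>' \<in> cells V (cod2 V \<phi>) (dom2 V \<phi>)"
    using assms by (auto simp: inverse2_def cells_def)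
  have "\<psi> = \<psi> \<bullet> (\<phi> \<bullet> \<psi>')"
    using assms vcomp_idR[OF c(2)] by (simp add: inverse2_def)
  also have "\<dots> = \<psi>'"
    using assms vcomp_assoc[OF c(3) c(1) c(2)] vcomp_idL[OF c(3)] by (simp add: inverse2_def)
  finally show ?thesis .
qed

lemma inv2_eq: "inverse2 V \<phi> \<psi> \<Longrightarrow> inv2 V \<phi> = \<psi>"
  unfolding inv2_def using inverse2_unique by blast

lemma inverse2_inv2: "\<phi> \<in> iso_cells V f g \<Longrightarrow> inverse2 V \<phi> (inv2 V \<phi>)"
  using inv2_eq by (auto simp: iso_cells_def)

lemma inverse2_sym: "inverse2 V \<phi> \<psi> \<Longrightarrow> inverse2 V \<psi> \<phi>"
  by (auto simp: inverse2_def cells_def)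

lemma iso_cells_cells: "\<phi> \<in> iso_cells V f g \<Longrightarrow> \<phi> \<in> cells V f g" by (simp add: iso_cells_def)

lemma inv2_in:
  assumes "\<phi> \<in> iso_cells V f g" shows "inv2 V \<phi> \<in> iso_cells V g f"
proof -
  note i = inverse2_inv2[OF assms]
  then have "inv2 V \<phi> \<in> cells V g f"
    using assms by (simp add: inverse2_def iso_cells_def cells_def)
  then show ?thesis using inverse2_sym[OF i] by (auto simp: iso_cells_def)
qed

lemma inv2_inv2: "\<phi> \<in> iso_cells V f g \<Longrightarrow> inv2 V (inv2 V \<phi>) = \<phi>"
  using inverse2_inv2 inverse2_sym inv2_eq by blast

lemma inv2_left: "\<phi> \<in> iso_cells V f g \<Longrightarrow> inv2 V \<phi> \<bullet> \<phi> = id2 V f"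
  using inverse2_inv2[of \<phi> f g] by (auto simp: inverse2_def iso_cells_def cells_def)
lemma inv2_right: "\<phi> \<in> iso_cells V f g \<Longrightarrow> \<phi> \<bullet> inv2 V \<phi> = id2 V g"
  using inverse2_inv2[of \<phi> f g] by (auto simp: inverse2_def iso_cells_def cells_def)

lemma iso_cellsI:
  assumes "\<phi> \<in> cells V f g" "\<psi> \<in> cells V g f" "\<psi> \<bullet> \<phi> = id2 V f" "\<phi> \<bullet> \<psi> = id2 V g"
  shows "\<phi> \<in> iso_cells V f g" "inv2 V \<phi> = \<psi>"
proof -
  have "inverse2 V \<phi> \<psi>" using assms by (auto simp: inverse2_def cells_def)
  then show "\<phi> \<in> iso_cells V f g" "inv2 V \<phi> = \<psi>"
    using assms(1) inv2_eq by (auto simp: iso_cells_def)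
qed

lemma id2_iso: "f \<in> Arr V \<Longrightarrow> id2 V f \<in> iso_cells V f f" "f \<in> Arr V \<Longrightarrow> inv2 V (id2 V f) = id2 V f"
  using iso_cellsI[OF id2_in id2_in] vcomp_idL[OF id2_in] by blast+

lemma vcomp_iso:
  assumes "\<phi> \<in> iso_cells V f g" "\<psi> \<in> iso_cells V g h"
  shows "\<psi> \<bullet> \<phi> \<in> iso_cells V f h" "inv2 V (\<psi> \<bullet> \<phi>) = inv2 V \<phi> \<bullet> inv2 V \<psi>"
proof -
  note c = assms[THEN iso_cells_cells] assms[THEN inv2_in, THEN iso_cells_cells]
  have 1: "(inv2 V \<phi> \<bullet> inv2 V \<psi>) \<bullet> (\<psi> \<bullet> \<phi>) = id2 V f"
    using vcomp_assoc[OF vcomp_in[OF c(1,2)] c(4,3)] vcomp_assoc[OF c(1,2,4)] vcomp_idL[OF c(1)]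
    by (simp add: inv2_left[OF assms(1)] inv2_left[OF assms(2)])
  have 2: "(\<psi> \<bullet> \<phi>) \<bullet> (inv2 V \<phi> \<bullet> inv2 V \<psi>) = id2 V h"
    using vcomp_assoc[OF vcomp_in[OF c(4,3)] c(1,2)] vcomp_assoc[OF c(4,3,1)] vcomp_idL[OF c(4)]
    by (simp add: inv2_right[OF assms(1)] inv2_right[OF assms(2)])
  show "\<psi> \<bullet> \<phi> \<in> iso_cells V f h" "inv2 V (\<psi> \<bullet> \<phi>) = inv2 V \<phi> \<bullet> inv2 V \<psi>"
    using iso_cellsI[OF vcomp_in[OF c(1,2)] vcomp_in[OF c(4,3)] 1 2] by blast+
qed

lemma hcomp_iso:
  assumes "f \<in> hom V A B" "g \<in> hom V B C" "\<phi> \<in> iso_cells V f f'" "\<psi> \<in> iso_cells V g g'"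
  shows "\<psi> \<star> \<phi> \<in> iso_cells V (g \<cdot> f) (g' \<cdot> f')" "inv2 V (\<psi> \<star> \<phi>) = inv2 V \<psi> \<star> inv2 V \<phi>"
proof -
  note c = assms(3,4)[THEN iso_cells_cells] assms(3,4)[THEN inv2_in, THEN iso_cells_cells]
  note h = assms(1,2) cells_hom[OF c(1) assms(1)] cells_hom[OF c(2) assms(2)]
  have "\<psi> \<star> \<phi> \<in> cells V (g \<cdot> f) (g' \<cdot> f')" "inv2 V \<psi> \<star> inv2 V \<phi> \<in> cells V (g' \<cdot> f') (g \<cdot> f)"
    using hcomp_in h c by blast+
  moreover have "(inv2 V \<psi> \<star> inv2 V \<phi>) \<bullet> (\<psi> \<star> \<phi>) = id2 V (g \<cdot> f)"
    by (subst middle_four[OF h(1,2) c(1,3,2,4), symmetric])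
      (use assms h inv2_left hcomp_id2 in auto)
  moreover have "(\<psi> \<star> \<phi>) \<bullet> (inv2 V \<psi> \<star> inv2 V \<phi>) = id2 V (g' \<cdot> f')"
    by (subst middle_four[OF h(3,4) c(3,1,4,2), symmetric])
      (use assms h inv2_right hcomp_id2 in auto)
  ultimately show "\<psi> \<star> \<phi> \<in> iso_cells V (g \<cdot> f) (g' \<cdot> f')" "inv2 V (\<psi> \<star> \<phi>) = inv2 V \<psi> \<star> inv2 V \<phi>"
    using iso_cellsI by blast+
qed

lemma whiskL_in: "\<lbrakk>f \<in> hom V A B; g \<in> hom V B C; \<phi> \<in> cells V f f'\<rbrakk> \<Longrightarrow> g \<rhd> \<phi> \<in> cells V (g \<cdot> f) (g \<cdot> f')"
  unfolding whiskL_def by (rule hcomp_in[OF _ _ _ id2_in]) (auto intro: hom_Arr)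
lemma whiskR_in: "\<lbrakk>f \<in> hom V A B; g \<in> hom V B C; \<phi> \<in> cells V g g'\<rbrakk> \<Longrightarrow> \<phi> \<lhd> f \<in> cells V (g \<cdot> f) (g' \<cdot> f)"
  unfolding whiskR_def by (rule hcomp_in[OF _ _ id2_in]) (auto intro: hom_Arr)
lemma whiskL_iso:
  assumes "f \<in> hom V A B" "g \<in> hom V B C" "\<phi> \<in> iso_cells V f f'"
  shows "g \<rhd> \<phi> \<in> iso_cells V (g \<cdot> f) (g \<cdot> f')" "inv2 V (g \<rhd> \<phi>) = g \<rhd> inv2 V \<phi>"
  unfolding whiskL_def using hcomp_iso[OF assms id2_iso(1)] id2_iso(2) assms hom_Arr by auto
lemma whiskR_iso:
  assumes "f \<in> hom V A B" "g \<in> hom V B C" "\<phi> \<in> iso_cells V g g'"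
  shows "\<phi> \<lhd> f \<in> iso_cells V (g \<cdot> f) (g' \<cdot> f)" "inv2 V (\<phi> \<lhd> f) = inv2 V \<phi> \<lhd> f"
  unfolding whiskR_def using hcomp_iso[OF assms(1,2) id2_iso(1) assms(3)] id2_iso(2) assms hom_Arr by auto

lemma whiskL_vcomp:
  assumes "f \<in> hom V A B" "g \<in> hom V B C" "\<phi> \<in> cells V f f'" "\<psi> \<in> cells V f' f''"
  shows "g \<rhd> (\<psi> \<bullet> \<phi>) = (g \<rhd> \<psi>) \<bullet> (g \<rhd> \<phi>)"
  unfolding whiskL_def using assms middle_four[OF assms(1,2,3,4) id2_in id2_in] vcomp_idL[OF id2_in]
  by (simp add: hom_Arr)
lemma whiskR_vcomp:
  assumes "f \<in> hom V A B" "g \<in> hom V B C" "\<phi> \<in> cells V g g'" "\<psi> \<in> cells V g' g''"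
  shows "(\<psi> \<bullet> \<phi>) \<lhd> f = (\<psi> \<lhd> f) \<bullet> (\<phi> \<lhd> f)"
  unfolding whiskR_def using assms middle_four[OF assms(1,2) id2_in id2_in assms(3,4)] vcomp_idL[OF id2_in]
  by (simp add: hom_Arr)
lemma whiskL_id2: "\<lbrakk>f \<in> hom V A B; g \<in> hom V B C\<rbrakk> \<Longrightarrow> g \<rhd> id2 V f = id2 V (g \<cdot> f)"
  unfolding whiskL_def by (rule hcomp_id2)
lemma whiskR_id2: "\<lbrakk>f \<in> hom V A B; g \<in> hom V B C\<rbrakk> \<Longrightarrow> id2 V g \<lhd> f = id2 V (g \<cdot> f)"
  unfolding whiskR_def by (rule hcomp_id2)
lemma whiskL_comp1:
  assumes "f \<in> hom V A B" "g \<in> hom V B C" "h \<in> hom V C D" "\<phi> \<in> cells V f f'"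
  shows "(h \<cdot> g) \<rhd> \<phi> = h \<rhd> g \<rhd> \<phi>"
  unfolding whiskL_def hcomp_id2[OF assms(2,3), symmetric]
  by (rule hcomp_assoc[OF assms(1,2,3,4) id2_in id2_in]) (use assms hom_Arr in auto)
lemma whiskR_comp1:
  assumes "f \<in> hom V A B" "g \<in> hom V B C" "h \<in> hom V C D" "\<phi> \<in> cells V h h'"
  shows "\<phi> \<lhd> (g \<cdot> f) = \<phi> \<lhd> g \<lhd> f"
  unfolding whiskR_def hcomp_id2[OF assms(1,2), symmetric]
  by (rule hcomp_assoc[OF assms(1,2,3) id2_in id2_in assms(4), symmetric]) (use assms hom_Arr in auto)
lemma whiskL_whiskR:
  assumes "f \<in> hom V A B" "g \<in> hom V B C" "h \<in> hom V C D" "\<phi> \<in> cells V g g'"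
  shows "(h \<rhd> \<phi>) \<lhd> f = h \<rhd> (\<phi> \<lhd> f)"
  unfolding whiskR_def whiskL_def
  by (rule hcomp_assoc[OF assms(1,2,3) id2_in assms(4) id2_in]) (use assms hom_Arr in auto)
lemma whiskL_id1: "\<lbrakk>f \<in> hom V A B; \<phi> \<in> cells V f f'\<rbrakk> \<Longrightarrow> id1 V B \<rhd> \<phi> = \<phi>"
  unfolding whiskL_def by (rule hcomp_idL)
lemma whiskR_id1: "\<lbrakk>f \<in> hom V A B; \<phi> \<in> cells V f f'\<rbrakk> \<Longrightarrow> \<phi> \<lhd> id1 V A = \<phi>"
  unfolding whiskR_def by (rule hcomp_idR)

text \<open>The middle-four law against identity cells, in both orders. Their agreement is the
  strict commutation of cells acting on successive 1-cells; cells on different tensor factors need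
  \<Sigma> instead.\<close>

lemma hcomp_whisk:
  assumes "f \<in> hom V A B" "g \<in> hom V B C" "\<phi> \<in> cells V f f'" "\<psi> \<in> cells V g g'"
  shows "\<psi> \<star> \<phi> = (\<psi> \<lhd> f') \<bullet> (g \<rhd> \<phi>)" "\<psi> \<star> \<phi> = (g' \<rhd> \<phi>) \<bullet> (\<psi> \<lhd> f)"
proof -
  note h = assms(1,2) cells_hom[OF assms(3,1)] cells_hom[OF assms(4,2)]
  note i = h[THEN hom_Arr, THEN id2_in]
  show "\<psi> \<star> \<phi> = (\<psi> \<lhd> f') \<bullet> (g \<rhd> \<phi>)" unfolding whiskR_def whiskL_def
    using middle_four[OF h(1,2) assms(3) i(3) i(2) assms(4)] vcomp_idL[OF assms(3)] vcomp_idR[OF assms(4)] by simp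
  show "\<psi> \<star> \<phi> = (g' \<rhd> \<phi>) \<bullet> (\<psi> \<lhd> f)" unfolding whiskR_def whiskL_def
    using middle_four[OF h(1,2) i(1) assms(3) assms(4) i(4)] vcomp_idL[OF assms(4)] vcomp_idR[OF assms(3)] by simp
qed

end

context gray_monoid begin

lemma ten_Obj: "\<lbrakk>A \<in> Obj V; B \<in> Obj V\<rbrakk> \<Longrightarrow> A \<otimes> B \<in> Obj V"
  using two_functor.F0_in[OF tenL_functor] by blast
lemma tenL1_in: "\<lbrakk>A \<in> Obj V; f \<in> hom V B C\<rbrakk> \<Longrightarrow> A \<ltimes> f \<in> hom V (A \<otimes> B) (A \<otimes> C)"
  using two_functor.F1_in[OF tenL_functor] by blast
lemma tenR1_in: "\<lbrakk>A \<in> Obj V; f \<in> hom V B C\<rbrakk> \<Longrightarrow> f \<rtimes> A \<in> hom V (B \<otimes> A) (C \<otimes> A)"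
  using two_functor.F1_in[OF tenR_functor] by blast
lemma tenL2_in: "\<lbrakk>A \<in> Obj V; \<phi> \<in> cells V f g\<rbrakk> \<Longrightarrow> A \<ltimes>\<^sub>2 \<phi> \<in> cells V (A \<ltimes> f) (A \<ltimes> g)"
  using two_functor.F2_in[OF tenL_functor] by blast
lemma tenR2_in: "\<lbrakk>A \<in> Obj V; \<phi> \<in> cells V f g\<rbrakk> \<Longrightarrow> \<phi> \<rtimes>\<^sub>2 A \<in> cells V (f \<rtimes> A) (g \<rtimes> A)"
  using two_functor.F2_in[OF tenR_functor] by blast
lemma tenL1_id: "\<lbrakk>A \<in> Obj V; B \<in> Obj V\<rbrakk> \<Longrightarrow> A \<ltimes> id1 V B = id1 V (A \<otimes> B)"
  using two_functor.F1_id[OF tenL_functor] by blast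
lemma tenR1_id: "\<lbrakk>A \<in> Obj V; B \<in> Obj V\<rbrakk> \<Longrightarrow> id1 V B \<rtimes> A = id1 V (B \<otimes> A)"
  using two_functor.F1_id[OF tenR_functor] by blast
lemma tenL1_comp: "\<lbrakk>A \<in> Obj V; f \<in> hom V B C; g \<in> hom V C D\<rbrakk> \<Longrightarrow> A \<ltimes> (g \<cdot> f) = (A \<ltimes> g) \<cdot> (A \<ltimes> f)"
  using two_functor.F1_comp[OF tenL_functor] by blast
lemma tenR1_comp: "\<lbrakk>A \<in> Obj V; f \<in> hom V B C; g \<in> hom V C D\<rbrakk> \<Longrightarrow> (g \<cdot> f) \<rtimes> A = (g \<rtimes> A) \<cdot> (f \<rtimes> A)"
  using two_functor.F1_comp[OF tenR_functor] by blast
lemma tenL2_id: "\<lbrakk>A \<in> Obj V; f \<in> Arr V\<rbrakk> \<Longrightarrow> A \<ltimes>\<^sub>2 id2 V f = id2 V (A \<ltimes> f)"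
  using two_functor.F2_id[OF tenL_functor] by blast
lemma tenR2_id: "\<lbrakk>A \<in> Obj V; f \<in> Arr V\<rbrakk> \<Longrightarrow> id2 V f \<rtimes>\<^sub>2 A = id2 V (f \<rtimes> A)"
  using two_functor.F2_id[OF tenR_functor] by blast
lemma tenL2_vcomp: "\<lbrakk>A \<in> Obj V; \<phi> \<in> cells V f g; \<psi> \<in> cells V g h\<rbrakk> \<Longrightarrow> A \<ltimes>\<^sub>2 (\<psi> \<bullet> \<phi>) = (A \<ltimes>\<^sub>2 \<psi>) \<bullet> (A \<ltimes>\<^sub>2 \<phi>)"
  using two_functor.F2_vcomp[OF tenL_functor] by blast
lemma tenR2_vcomp: "\<lbrakk>A \<in> Obj V; \<phi> \<in> cells V f g; \<psi> \<in> cells V g h\<rbrakk> \<Longrightarrow> (\<psi> \<bullet> \<phi>) \<rtimes>\<^sub>2 A = (\<psi> \<rtimes>\<^sub>2 A) \<bullet> (\<phi> \<rtimes>\<^sub>2 A)"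
  using two_functor.F2_vcomp[OF tenR_functor] by blast
lemma tenL2_whiskL:
  assumes "A \<in> Obj V" "f \<in> hom V B C" "g \<in> hom V C D" "\<phi> \<in> cells V f f'"
  shows "A \<ltimes>\<^sub>2 (g \<rhd> \<phi>) = (A \<ltimes> g) \<rhd> (A \<ltimes>\<^sub>2 \<phi>)"
  unfolding whiskL_def
  using two_functor.F2_hcomp[OF tenL_functor[OF assms(1)] assms(2,3,4) id2_in] assms
  by (simp add: hom_Arr tenL2_id)
lemma tenL2_whiskR:
  assumes "A \<in> Obj V" "f \<in> hom V B C" "g \<in> hom V C D" "\<phi> \<in> cells V g g'"
  shows "A \<ltimes>\<^sub>2 (\<phi> \<lhd> f) = (A \<ltimes>\<^sub>2 \<phi>) \<lhd> (A \<ltimes> f)"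
  unfolding whiskR_def
  using two_functor.F2_hcomp[OF tenL_functor[OF assms(1)] assms(2,3) id2_in assms(4)] assms
  by (simp add: hom_Arr tenL2_id)
lemma tenR2_whiskL:
  assumes "A \<in> Obj V" "f \<in> hom V B C" "g \<in> hom V C D" "\<phi> \<in> cells V f f'"
  shows "(g \<rhd> \<phi>) \<rtimes>\<^sub>2 A = (g \<rtimes> A) \<rhd> (\<phi> \<rtimes>\<^sub>2 A)"
  unfolding whiskL_def
  using two_functor.F2_hcomp[OF tenR_functor[OF assms(1)] assms(2,3,4) id2_in] assms
  by (simp add: hom_Arr tenR2_id)
lemma tenR2_whiskR:
  assumes "A \<in> Obj V" "f \<in> hom V B C" "g \<in> hom V C D" "\<phi> \<in> cells V g g'"
  shows "(\<phi> \<lhd> f) \<rtimes>\<^sub>2 A = (\<phi> \<rtimes>\<^sub>2 A) \<lhd> (f \<rtimes> A)"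
  unfolding whiskR_def
  using two_functor.F2_hcomp[OF tenR_functor[OF assms(1)] assms(2,3) id2_in assms(4)] assms
  by (simp add: hom_Arr tenR2_id)
lemma tenL2_iso:
  assumes "A \<in> Obj V" "\<phi> \<in> iso_cells V f g"
  shows "A \<ltimes>\<^sub>2 \<phi> \<in> iso_cells V (A \<ltimes> f) (A \<ltimes> g)" "inv2 V (A \<ltimes>\<^sub>2 \<phi>) = A \<ltimes>\<^sub>2 inv2 V \<phi>"
proof -
  note c = iso_cells_cells[OF assms(2)] iso_cells_cells[OF inv2_in[OF assms(2)]]
  have a: "f \<in> Arr V" "g \<in> Arr V" using c(1) dom2_in cod2_in by (auto simp: cells_def)
  show "A \<ltimes>\<^sub>2 \<phi> \<in> iso_cells V (A \<ltimes> f) (A \<ltimes> g)" "inv2 V (A \<ltimes>\<^sub>2 \<phi>) = A \<ltimes>\<^sub>2 inv2 V \<phi>"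
    using iso_cellsI[OF c[THEN tenL2_in[OF assms(1)]]] tenL2_vcomp[OF assms(1) c(1,2)]
      tenL2_vcomp[OF assms(1) c(2,1)] inv2_left[OF assms(2)] inv2_right[OF assms(2)] tenL2_id a assms(1)
    by auto
qed
lemma tenR2_iso:
  assumes "A \<in> Obj V" "\<phi> \<in> iso_cells V f g"
  shows "\<phi> \<rtimes>\<^sub>2 A \<in> iso_cells V (f \<rtimes> A) (g \<rtimes> A)" "inv2 V (\<phi> \<rtimes>\<^sub>2 A) = inv2 V \<phi> \<rtimes>\<^sub>2 A"
proof -
  note c = iso_cells_cells[OF assms(2)] iso_cells_cells[OF inv2_in[OF assms(2)]]
  have a: "f \<in> Arr V" "g \<in> Arr V" using c(1) dom2_in cod2_in by (auto simp: cells_def)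
  show "\<phi> \<rtimes>\<^sub>2 A \<in> iso_cells V (f \<rtimes> A) (g \<rtimes> A)" "inv2 V (\<phi> \<rtimes>\<^sub>2 A) = inv2 V \<phi> \<rtimes>\<^sub>2 A"
    using iso_cellsI[OF c[THEN tenR2_in[OF assms(1)]]] tenR2_vcomp[OF assms(1) c(1,2)]
      tenR2_vcomp[OF assms(1) c(2,1)] inv2_left[OF assms(2)] inv2_right[OF assms(2)] tenR2_id a assms(1)
    by auto
qed

end

section \<open>String diagrams\<close>

text \<open>\<open>SB i j\<close> and \<open>SC i j\<close> stand for \<open>B(p i, p j)\<close> and \<open>C(q i, q j)\<close> for chosen families of objects \<open>p\<close>, \<open>q\<close>; the box \<open>Cr as bs\<close> is the braiding
  of two tensor products.\<close>

datatype strand = SB nat nat | SC nat nat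

datatype box = MB nat nat nat | MC nat nat nat | UB nat | UC nat | Cr "strand list" "strand list"

fun bsrc :: "box \<Rightarrow> strand list" where
  "bsrc (MB i j k) = [SB j k, SB i j]"
| "bsrc (MC i j k) = [SC j k, SC i j]"
| "bsrc (UB i) = []"
| "bsrc (UC i) = []"
| "bsrc (Cr as bs) = as @ bs"

fun btgt :: "box \<Rightarrow> strand list" where
  "btgt (MB i j k) = [SB i k]"
| "btgt (MC i j k) = [SC i k]"
| "btgt (UB i) = [SB i i]"
| "btgt (UC i) = [SC i i]"
| "btgt (Cr as bs) = bs @ as"

type_synonym layer = "strand list \<times> box \<times> strand list"
type_synonym diagram = "layer list"

text \<open>A layer is a box with strands on both sides, and the first layer of a diagram is applied first. Boxes
  without output are excluded: they could pass around each other, and interchange would not be confluent.\<close>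

fun chain :: "strand list \<Rightarrow> diagram \<Rightarrow> strand list \<Rightarrow> bool" where
  "chain xs [] ys \<longleftrightarrow> xs = ys"
| "chain xs ((l, g, r) # d) ys \<longleftrightarrow> xs = l @ bsrc g @ r \<and> btgt g \<noteq> [] \<and> chain (l @ btgt g @ r) d ys"

fun wlayer :: "strand list \<Rightarrow> strand list \<Rightarrow> layer \<Rightarrow> layer" where
  "wlayer l r (a, g, b) = (l @ a, g, b @ r)"

abbreviation wdiag :: "strand list \<Rightarrow> strand list \<Rightarrow> diagram \<Rightarrow> diagram" where
  "wdiag l r \<equiv> map (wlayer l r)"

lemma chain_append: "chain xs (d @ d') ys \<longleftrightarrow> (\<exists>zs. chain xs d zs \<and> chain zs d' ys)"
  by (induction xs d ys rule: chain.induct) auto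

lemma chain_unique: "chain xs d ys \<Longrightarrow> chain xs d zs \<Longrightarrow> ys = zs"
  by (induction xs d ys rule: chain.induct) auto

lemma chain_wdiag: "chain xs d ys \<Longrightarrow> chain (l @ xs @ r) (wdiag l r d) (l @ ys @ r)"
  by (induction xs d ys rule: chain.induct) auto

lemma wdiag_wdiag: "wdiag l r (wdiag l' r' d) = wdiag (l @ l') (r' @ r) d"
  by auto

lemma wdiag_Nil: "wdiag [] [] d = d"
  by (induction d) auto

text \<open>The orientation is that of \<open>\<Sigma> f g\<close>: in the source the right-hand box
  \<open>g\<close> is applied first, in the target the left-hand box \<open>f\<close>. The strands
  \<open>m\<close> separate the boxes, \<open>l\<close> and \<open>r\<close> are idle.\<close>

definition swap_src :: "strand list \<Rightarrow> box \<Rightarrow> strand list \<Rightarrow> box \<Rightarrow> strand list \<Rightarrow> diagram" where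
  "swap_src l f m g r = [(l @ bsrc f @ m, g, r), (l, f, m @ btgt g @ r)]"

definition swap_tgt :: "strand list \<Rightarrow> box \<Rightarrow> strand list \<Rightarrow> box \<Rightarrow> strand list \<Rightarrow> diagram" where
  "swap_tgt l f m g r = [(l, f, m @ bsrc g @ r), (l @ btgt f @ m, g, r)]"

text \<open>The list ends in the unit, so a single strand denotes
  \<open>ob s \<otimes> \<one>\<close>, which strict unitality identifies with
  \<open>ob s\<close>.\<close>

primrec tens :: "('o, 'f, 't, 'm) gray_scheme \<Rightarrow> (strand \<Rightarrow> 'o) \<Rightarrow> strand list \<Rightarrow> 'o" where
  "tens V ob [] = unit V"
| "tens V ob (s # xs) = ten V (ob s) (tens V ob xs)"

text \<open>Interchange and its coherence concern only the Gray monoid, so boxes are interpreted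
  here by arbitrary 1-cells of the right type; the braiding enters with a concrete
  \<open>bx\<close>.\<close>

locale diagram_semantics = gray_monoid V
  for V :: "('o, 'f, 't, 'm) gray_scheme" (structure) +
  fixes ob :: "strand \<Rightarrow> 'o" and bx :: "box \<Rightarrow> 'f"
  assumes ob_in: "ob s \<in> Obj V"
    and bx_in: "bx g \<in> hom V (tens V ob (bsrc g)) (tens V ob (btgt g))"
begin

abbreviation T :: "strand list \<Rightarrow> 'o" where "T \<equiv> tens V ob"

lemma T_in: "T xs \<in> Obj V"
  by (induction xs) (auto intro: ten_Obj ob_in unit_in)

lemma T_append: "T (xs @ ys) = T xs \<otimes> T ys"
  by (induction xs) (auto simp: unitL0 T_in assoc0 ob_in)

definition wh1 :: "strand list \<Rightarrow> strand list \<Rightarrow> 'f \<Rightarrow> 'f" where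
  "wh1 l r f = T l \<ltimes> f \<rtimes> T r"

definition wh2 :: "strand list \<Rightarrow> strand list \<Rightarrow> 't \<Rightarrow> 't" where
  "wh2 l r \<phi> = T l \<ltimes>\<^sub>2 \<phi> \<rtimes>\<^sub>2 T r"

lemma wh1_in: "f \<in> hom V (T xs) (T ys) \<Longrightarrow> wh1 l r f \<in> hom V (T (l @ xs @ r)) (T (l @ ys @ r))"
  unfolding wh1_def T_append using T_in tenL1_in tenR1_in by (simp add: assoc0[symmetric] ten_Obj)

lemma wh1_comp: "f \<in> hom V A B \<Longrightarrow> g \<in> hom V B C \<Longrightarrow> wh1 l r (g \<cdot> f) = wh1 l r g \<cdot> wh1 l r f"
  unfolding wh1_def by (simp add: tenL1_comp[OF T_in] tenR1_comp[OF T_in tenL1_in[OF T_in] tenL1_in[OF T_in]])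

lemma wh1_id: "wh1 l r (id1 V (T xs)) = id1 V (T (l @ xs @ r))"
  unfolding wh1_def T_append by (simp add: tenL1_id tenR1_id T_in ten_Obj assoc0)

lemma wh1_wh1: "f \<in> Arr V \<Longrightarrow> wh1 l r (wh1 l' r' f) = wh1 (l @ l') (r' @ r) f"
  unfolding wh1_def T_append
  using assocLR1[OF T_in T_in] assocLL1[OF T_in T_in] assocRR1[OF T_in T_in]
  by (metis T_in hom_Arr hom_self tenL1_in tenR1_in)

lemma wh1_Nil: "f \<in> Arr V \<Longrightarrow> wh1 [] [] f = f"
  unfolding wh1_def by (simp add: unitL1 unitR1)

lemma wh2_iso:
  assumes "\<phi> \<in> iso_cells V f g"
  shows "wh2 l r \<phi> \<in> iso_cells V (wh1 l r f) (wh1 l r g)" "inv2 V (wh2 l r \<phi>) = wh2 l r (inv2 V \<phi>)"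
  unfolding wh2_def wh1_def using tenL2_iso[OF T_in assms] tenR2_iso[OF T_in tenL2_iso(1)[OF T_in assms]] by auto

lemma wh2_vcomp: "\<phi> \<in> cells V f g \<Longrightarrow> \<psi> \<in> cells V g h \<Longrightarrow> wh2 l r (\<psi> \<bullet> \<phi>) = wh2 l r \<psi> \<bullet> wh2 l r \<phi>"
  unfolding wh2_def by (simp add: tenL2_vcomp[OF T_in] tenR2_vcomp[OF T_in tenL2_in[OF T_in] tenL2_in[OF T_in]])

lemma wh2_id:
  assumes "f \<in> Arr V" shows "wh2 l r (id2 V f) = id2 V (wh1 l r f)"
  unfolding wh2_def wh1_def
  by (simp add: tenL2_id[OF T_in assms] tenR2_id[OF T_in hom_Arr[OF tenL1_in[OF T_in hom_self[OF assms]]]])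

lemma wh2_wh2:
  assumes "\<phi> \<in> Cell V" shows "wh2 l r (wh2 l' r' \<phi>) = wh2 (l @ l') (r' @ r) \<phi>"
proof -
  have c: "\<phi> \<in> cells V (dom2 V \<phi>) (cod2 V \<phi>)" using assms by (simp add: cells_def)
  have "T l' \<ltimes>\<^sub>2 \<phi> \<in> Cell V" "\<phi> \<rtimes>\<^sub>2 T r' \<in> Cell V"
    "T l' \<ltimes>\<^sub>2 (\<phi> \<rtimes>\<^sub>2 T r') \<in> Cell V"
    by (rule cells_Cell tenL2_in[OF T_in] tenR2_in[OF T_in] c)+
  then show ?thesis
    unfolding wh2_def T_append using assms
    by (simp add: assocLR2[OF T_in T_in] assocLR2[OF T_in ten_Obj[OF T_in T_in]] assocLL2[OF T_in T_in] assocRR2[OF T_in T_in])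
qed

lemma wh2_Nil: "\<phi> \<in> Cell V \<Longrightarrow> wh2 [] [] \<phi> = \<phi>"
  unfolding wh2_def by (simp add: unitL2 unitR2)

lemma wh2_whiskL:
  assumes "f \<in> hom V B C" "g \<in> hom V C D" "\<phi> \<in> cells V f f'"
  shows "wh2 l r (g \<rhd> \<phi>) = wh1 l r g \<rhd> wh2 l r \<phi>"
  unfolding wh2_def wh1_def using tenL2_whiskL[OF T_in assms]
    tenR2_whiskL[OF T_in tenL1_in[OF T_in assms(1)] tenL1_in[OF T_in assms(2)] tenL2_in[OF T_in assms(3)]] by simp

lemma wh2_whiskR:
  assumes "f \<in> hom V B C" "g \<in> hom V C D" "\<phi> \<in> cells V g g'"
  shows "wh2 l r (\<phi> \<lhd> f) = wh2 l r \<phi> \<lhd> wh1 l r f"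
  unfolding wh2_def wh1_def using tenL2_whiskR[OF T_in assms]
    tenR2_whiskR[OF T_in tenL1_in[OF T_in assms(1)] tenL1_in[OF T_in assms(2)] tenL2_in[OF T_in assms(3)]] by simp

text \<open>The source \<open>xs\<close> is consulted only for the empty diagram, where it says
  which identity is meant.\<close>

fun ev :: "strand list \<Rightarrow> diagram \<Rightarrow> 'f" where
  "ev xs [] = id1 V (T xs)"
| "ev xs ((l, g, r) # d) = ev (l @ btgt g @ r) d \<cdot> wh1 l r (bx g)"

lemma ev_in: "chain xs d ys \<Longrightarrow> ev xs d \<in> hom V (T xs) (T ys)"
  by (induction xs d ys rule: chain.induct) (auto intro: comp1_in wh1_in bx_in id1_in T_in)

lemma ev_append: "chain xs d ys \<Longrightarrow> chain ys d' zs \<Longrightarrow> ev xs (d @ d') = ev ys d' \<cdot> ev xs d"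
proof (induction xs d ys rule: chain.induct)
  case (1 xs ys) then show ?case using comp1_idR[OF ev_in] by auto
next
  case (2 xs l g r d ys)
  then show ?case using comp1_assoc[OF wh1_in[OF bx_in] ev_in ev_in] by auto
qed

lemma ev_wdiag: "chain xs d ys \<Longrightarrow> ev (l @ xs @ r) (wdiag l r d) = wh1 l r (ev xs d)"
proof (induction xs d ys rule: chain.induct)
  case (1 xs ys) then show ?case by (simp add: wh1_id)
next
  case (2 xs a g b d ys)
  have "wh1 l r (ev (a @ btgt g @ b) d \<cdot> wh1 a b (bx g)) = wh1 l r (ev (a @ btgt g @ b) d) \<cdot> wh1 l r (wh1 a b (bx g))"
    using 2 by (intro wh1_comp[OF wh1_in[OF bx_in] ev_in]) auto
  then show ?case using 2 by (simp add: wh1_wh1[OF hom_Arr[OF bx_in]])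
qed

lemma ev_single: "ev xs [(l, g, r)] = wh1 l r (bx g)"
  using comp1_idL[OF wh1_in[OF bx_in]] by simp

text \<open>Different diagrams can have the same value under \<open>ev\<close>, so the type of a
  2-cell records its diagrams and not merely its 1-cells.\<close>

definition dcell :: "strand list \<Rightarrow> strand list \<Rightarrow> diagram \<Rightarrow> 't \<Rightarrow> diagram \<Rightarrow> bool" where
  "dcell xs ys d \<phi> d' \<longleftrightarrow> chain xs d ys \<and> chain xs d' ys \<and> \<phi> \<in> iso_cells V (ev xs d) (ev xs d')"

lemma dcell_id: "chain xs d ys \<Longrightarrow> dcell xs ys d (id2 V (ev xs d)) d"
  unfolding dcell_def using ev_in hom_Arr id2_iso by blast

lemma dcell_comp: "dcell xs ys d \<phi> d' \<Longrightarrow> dcell xs ys d' \<psi> d'' \<Longrightarrow> dcell xs ys d (\<psi> \<bullet> \<phi>) d''"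
  unfolding dcell_def using vcomp_iso(1) by blast

lemma dcell_inv: "dcell xs ys d \<phi> d' \<Longrightarrow> dcell xs ys d' (inv2 V \<phi>) d"
  unfolding dcell_def using inv2_in by blast

lemma dcell_cells: "dcell xs ys d \<phi> d' \<Longrightarrow> \<phi> \<in> cells V (ev xs d) (ev xs d')"
  unfolding dcell_def using iso_cells_cells by blast

text \<open>The layers \<open>X\<close> lie below \<open>\<phi>\<close> and \<open>Y\<close> above
  it, with strands \<open>l\<close> and \<open>r\<close> alongside. The argument \<open>vs\<close>
  is the source of \<open>Y\<close>, which \<open>ev\<close> needs when \<open>Y\<close> is
  empty.\<close>

definition ctx :: "strand list \<Rightarrow> diagram \<Rightarrow> strand list \<Rightarrow> strand list \<Rightarrow> strand list \<Rightarrow> diagram \<Rightarrow> 't \<Rightarrow> 't" where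
  "ctx xs X l r vs Y \<phi> = ev vs Y \<rhd> wh2 l r \<phi> \<lhd> ev xs X"

lemma ev_ctx:
  assumes "chain xs X (l @ zs @ r)" "chain zs P ws" "chain (l @ ws @ r) Y ys"
  shows "ev xs (X @ wdiag l r P @ Y) = (ev (l @ ws @ r) Y \<cdot> wh1 l r (ev zs P)) \<cdot> ev xs X"
    "chain xs (X @ wdiag l r P @ Y) ys"
proof -
  note w = chain_wdiag[OF assms(2), of l r]
  have w2: "chain (l @ zs @ r) (wdiag l r P @ Y) ys" using w assms(3) by (auto simp: chain_append)
  show "ev xs (X @ wdiag l r P @ Y) = (ev (l @ ws @ r) Y \<cdot> wh1 l r (ev zs P)) \<cdot> ev xs X"
    using ev_append[OF assms(1) w2] ev_append[OF w assms(3)] ev_wdiag[OF assms(2)] by simp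
  show "chain xs (X @ wdiag l r P @ Y) ys" using assms(1) w2 by (auto simp: chain_append)
qed

context
  fixes xs X l r zs ws Y ys
  assumes cX: "chain xs X (l @ zs @ r)" and cY: "chain (l @ ws @ r) Y ys"
begin

lemma ctx_dcell:
  assumes "dcell zs ws P \<phi> Q"
  shows "dcell xs ys (X @ wdiag l r P @ Y) (ctx xs X l r (l @ ws @ r) Y \<phi>) (X @ wdiag l r Q @ Y)"
    and "inv2 V (ctx xs X l r (l @ ws @ r) Y \<phi>) = ctx xs X l r (l @ ws @ r) Y (inv2 V \<phi>)"
proof -
  have c: "chain zs P ws" "chain zs Q ws" and i: "\<phi> \<in> iso_cells V (ev zs P) (ev zs Q)"
    using assms by (auto simp: dcell_def)
  note w = wh2_iso[OF i, of l r]
  note hp = wh1_in[OF ev_in[OF c(1)], of l r]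
  note a = whiskL_iso[OF hp ev_in[OF cY] w(1)]
  note b = whiskR_iso[OF ev_in[OF cX] comp1_in[OF hp ev_in[OF cY]] a(1)]
  show "dcell xs ys (X @ wdiag l r P @ Y) (ctx xs X l r (l @ ws @ r) Y \<phi>) (X @ wdiag l r Q @ Y)"
    unfolding dcell_def ctx_def using b(1) ev_ctx[OF cX _ cY] c by simp
  show "inv2 V (ctx xs X l r (l @ ws @ r) Y \<phi>) = ctx xs X l r (l @ ws @ r) Y (inv2 V \<phi>)"
    unfolding ctx_def using b(2) a(2) w(2) by simp
qed

lemma ctx_vcomp:
  assumes "dcell zs ws P \<phi> Q" "dcell zs ws Q \<psi> R"
  shows "ctx xs X l r (l @ ws @ r) Y (\<psi> \<bullet> \<phi>)
    = ctx xs X l r (l @ ws @ r) Y \<psi> \<bullet> ctx xs X l r (l @ ws @ r) Y \<phi>"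
proof -
  have c: "chain zs P ws" "chain zs Q ws" using assms by (auto simp: dcell_def)
  note i = assms[THEN dcell_cells]
  note hp = wh1_in[OF ev_in[OF c(1)], of l r] and hq = wh1_in[OF ev_in[OF c(2)], of l r]
  have w: "wh2 l r \<phi> \<in> cells V (wh1 l r (ev zs P)) (wh1 l r (ev zs Q))"
    "wh2 l r \<psi> \<in> cells V (wh1 l r (ev zs Q)) (wh1 l r (ev zs R))"
    using assms wh2_iso(1) iso_cells_cells unfolding dcell_def by blast+
  show ?thesis unfolding ctx_def wh2_vcomp[OF i]
    using whiskL_vcomp[OF hp ev_in[OF cY] w]
      whiskR_vcomp[OF ev_in[OF cX] comp1_in[OF hp ev_in[OF cY]] whiskL_in[OF hp ev_in[OF cY] w(1)] whiskL_in[OF hq ev_in[OF cY] w(2)]]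
    by simp
qed

lemma ctx_id:
  assumes "chain zs P ws"
  shows "ctx xs X l r (l @ ws @ r) Y (id2 V (ev zs P)) = id2 V (ev xs (X @ wdiag l r P @ Y))"
proof -
  note hp = wh1_in[OF ev_in[OF assms], of l r]
  show ?thesis unfolding ctx_def wh2_id[OF hom_Arr[OF ev_in[OF assms]]]
    using whiskL_id2[OF hp ev_in[OF cY]] whiskR_id2[OF ev_in[OF cX] comp1_in[OF hp ev_in[OF cY]]]
      ev_ctx(1)[OF cX assms cY] by simp
qed

text \<open>Contexts tensor only with objects, which is strictly associative and 2-functorial.
  Nested contexts therefore fuse on the nose, without interchangers.\<close>

lemma ctx_ctx:
  assumes "dcell us vs P \<phi> Q" "chain zs X' (l' @ us @ r')" "chain (l' @ vs @ r') Y' ws"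
  shows "ctx xs X l r (l @ ws @ r) Y (ctx zs X' l' r' (l' @ vs @ r') Y' \<phi>)
    = ctx xs (X @ wdiag l r X') (l @ l') (r' @ r) ((l @ l') @ vs @ (r' @ r)) (wdiag l r Y' @ Y) \<phi>"
proof -
  have c: "chain us P vs" using assms by (auto simp: dcell_def)
  note i = dcell_cells[OF assms(1)]
  note hp = ev_in[OF c]
  have w: "wh2 l' r' \<phi> \<in> cells V (wh1 l' r' (ev us P)) (wh1 l' r' (ev us Q))"
    using assms wh2_iso(1) iso_cells_cells unfolding dcell_def by blast
  have w': "wh2 (l @ l') (r' @ r) \<phi> \<in> cells V (wh1 (l @ l') (r' @ r) (ev us P)) (wh1 (l @ l') (r' @ r) (ev us Q))"
    using assms wh2_iso(1) iso_cells_cells unfolding dcell_def by blast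
  note h1 = wh1_in[OF hp, of l' r'] and h2 = ev_in[OF assms(2)] and h3 = ev_in[OF assms(3)]
  note k1 = wh1_in[OF hp, of "l @ l'" "r' @ r"] and k2 = wh1_in[OF h2, of l r] and k3 = wh1_in[OF h3, of l r]
  note e = ev_in[OF cX] and e' = ev_in[OF cY]
  have "wh2 l r (ev (l' @ vs @ r') Y' \<rhd> wh2 l' r' \<phi> \<lhd> ev zs X')
    = wh1 l r (ev (l' @ vs @ r') Y') \<rhd> wh2 (l @ l') (r' @ r) \<phi> \<lhd> wh1 l r (ev zs X')"
    using wh2_whiskR[OF h2 comp1_in[OF h1 h3] whiskL_in[OF h1 h3 w], of l r] wh2_whiskL[OF h1 h3 w, of l r]
      wh2_wh2[OF cells_Cell[OF i], of l r] by simp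
  moreover have "ev (l @ ws @ r) Y \<rhd> (wh1 l r (ev (l' @ vs @ r') Y') \<rhd> wh2 (l @ l') (r' @ r) \<phi> \<lhd> wh1 l r (ev zs X'))
     = (ev (l @ ws @ r) Y \<cdot> wh1 l r (ev (l' @ vs @ r') Y')) \<rhd> wh2 (l @ l') (r' @ r) \<phi> \<lhd> wh1 l r (ev zs X')"
  proof -
    have k1': "wh1 (l @ l') (r' @ r) (ev us P) \<in> hom V (T (l @ (l' @ us @ r') @ r)) (T (l @ (l' @ vs @ r') @ r))"
      using k1 by simp
    show ?thesis
      using whiskL_whiskR[OF k2 comp1_in[OF k1' k3] e' whiskL_in[OF k1' k3 w']] whiskL_comp1[OF k1' k3 e' w'] by simp
  qed
  moreover have "\<dots> \<lhd> ev xs X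
     = (ev (l @ ws @ r) Y \<cdot> wh1 l r (ev (l' @ vs @ r') Y')) \<rhd> wh2 (l @ l') (r' @ r) \<phi> \<lhd> (wh1 l r (ev zs X') \<cdot> ev xs X)"
  proof -
    have k1': "wh1 (l @ l') (r' @ r) (ev us P) \<in> hom V (T (l @ (l' @ us @ r') @ r)) (T (l @ (l' @ vs @ r') @ r))"
      using k1 by simp
    note t = comp1_in[OF k3 e']
    show ?thesis by (rule whiskR_comp1[OF e k2 comp1_in[OF k1' t] whiskL_in[OF k1' t w'], symmetric])
  qed
  moreover have "ev (l @ ws @ r) Y \<cdot> wh1 l r (ev (l' @ vs @ r') Y') = ev ((l @ l') @ vs @ r' @ r) (wdiag l r Y' @ Y)"
    using ev_append[OF chain_wdiag[OF assms(3)] cY] ev_wdiag[OF assms(3), of l r] by simp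
  moreover have "wh1 l r (ev zs X') \<cdot> ev xs X = ev xs (X @ wdiag l r X')"
    using ev_append[OF cX chain_wdiag[OF assms(2)]] ev_wdiag[OF assms(2), of l r] by simp
  ultimately show ?thesis unfolding ctx_def by simp
qed

end

end

section \<open>Interchange of layers\<close>

lemma wdiag_swap:
  "wdiag l r (swap_src l' f m g r') = swap_src (l @ l') f m g (r' @ r)"
  "wdiag l r (swap_tgt l' f m g r') = swap_tgt (l @ l') f m g (r' @ r)"
  by (simp_all add: swap_src_def swap_tgt_def)

context diagram_semantics begin

text \<open>The cells act at different heights, \<open>\<phi>\<close> below \<open>Y\<close> and
  \<open>\<psi>\<close> above it, so the strict interchange law of the 2-category applies even if
  they occupy overlapping strands.\<close>

lemma ctx_commute:
  assumes P: "dcell zs ws P \<phi> Q" and P': "dcell zs' ws' P' \<psi> Q'"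
    and cX: "chain xs X (l @ zs @ r)" and cY: "chain (l @ ws @ r) Y (l' @ zs' @ r')"
    and cZ: "chain (l' @ ws' @ r') Z ys"
  shows "ctx xs (X @ wdiag l r Q @ Y) l' r' (l' @ ws' @ r') Z \<psi>
      \<bullet> ctx xs X l r (l @ ws @ r) (Y @ wdiag l' r' P' @ Z) \<phi>
    = ctx xs X l r (l @ ws @ r) (Y @ wdiag l' r' Q' @ Z) \<phi>
      \<bullet> ctx xs (X @ wdiag l r P @ Y) l' r' (l' @ ws' @ r') Z \<psi>"
proof -
  have c: "chain zs P ws" "chain zs Q ws" "chain zs' P' ws'" "chain zs' Q' ws'"
    and i: "\<phi> \<in> iso_cells V (ev zs P) (ev zs Q)" "\<psi> \<in> iso_cells V (ev zs' P') (ev zs' Q')"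
    using P P' by (auto simp: dcell_def)
  let ?a = "ctx xs X l r (l @ ws @ r) Y \<phi>" and ?b = "ev (l' @ ws' @ r') Z \<rhd> wh2 l' r' \<psi>"
  have a: "?a \<in> cells V (ev xs (X @ wdiag l r P @ Y)) (ev xs (X @ wdiag l r Q @ Y))"
    by (rule dcell_cells[OF ctx_dcell(1)[OF cX cY P]])
  note f = ev_in[OF ev_ctx(2)[OF cX c(1) cY]] and f' = ev_in[OF ev_ctx(2)[OF cX c(2) cY]]
  note hp = wh1_in[OF ev_in[OF c(3)], of l' r'] and hq = wh1_in[OF ev_in[OF c(4)], of l' r']
  note w' = iso_cells_cells[OF wh2_iso(1)[OF i(2), of l' r']]
  note b = whiskL_in[OF hp ev_in[OF cZ] w']
  \<comment> \<open>Both sides of the claim are whiskered forms of the one horizontal composite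
    \<open>?b \<star> ?a\<close>.\<close>
  note hw = hcomp_whisk[OF f comp1_in[OF hp ev_in[OF cZ]] a b]
  have g: "(ev (l' @ ws' @ r') Z \<cdot> wh1 l' r' (ev zs' R)) \<rhd> ?a = ctx xs X l r (l @ ws @ r) (Y @ wdiag l' r' R @ Z) \<phi>"
    if R: "chain zs' R ws'" for R
  proof -
    have cZ': "chain (l' @ zs' @ r') (wdiag l' r' R @ Z) ys"
      using chain_wdiag[OF R] cZ by (auto simp: chain_append)
    have e: "ev (l' @ ws' @ r') Z \<cdot> wh1 l' r' (ev zs' R) = ev (l' @ zs' @ r') (wdiag l' r' R @ Z)"
      using ev_append[OF chain_wdiag[OF R] cZ] ev_wdiag[OF R] by simp
    note w = iso_cells_cells[OF wh2_iso(1)[OF i(1), of l r]]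
    note k = wh1_in[OF ev_in[OF c(1)], of l r]
    show ?thesis unfolding e ctx_def ev_append[OF cY cZ']
      using whiskL_whiskR[OF ev_in[OF cX] comp1_in[OF k ev_in[OF cY]] ev_in[OF cZ'] whiskL_in[OF k ev_in[OF cY] w]]
        whiskL_comp1[OF k ev_in[OF cY] ev_in[OF cZ'] w] by simp
  qed
  show ?thesis using hw g[OF c(3)] g[OF c(4)] unfolding ctx_def by simp
qed

text \<open>The separating strands are attached to the right-hand argument; by
  \<open>inter_assocM\<close> attaching them to the left-hand one gives the same cell.\<close>

definition swap_cell :: "box \<Rightarrow> strand list \<Rightarrow> box \<Rightarrow> 't" where
  "swap_cell f m g = \<Sigma> (bx f) (T m \<ltimes> bx g)"

lemma swap_dcell:
  assumes "btgt f \<noteq> []" "btgt g \<noteq> []"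
  shows "dcell (bsrc f @ m @ bsrc g) (btgt f @ m @ btgt g) (swap_src [] f m g []) (swap_cell f m g) (swap_tgt [] f m g [])"
proof -
  have h: "T m \<ltimes> bx g \<in> hom V (T (m @ bsrc g)) (T (m @ btgt g))"
    unfolding T_append by (rule tenL1_in[OF T_in bx_in])
  have e: "ev (bsrc f @ m @ bsrc g) (swap_src [] f m g []) = (bx f \<rtimes> T (m @ btgt g)) \<cdot> (T (bsrc f) \<ltimes> (T m \<ltimes> bx g))"
    "ev (bsrc f @ m @ bsrc g) (swap_tgt [] f m g []) = (T (btgt f) \<ltimes> (T m \<ltimes> bx g)) \<cdot> (bx f \<rtimes> T (m @ bsrc g))"
    unfolding swap_src_def swap_tgt_def using hom_Arr[OF bx_in] ev_single
    by (simp_all add: wh1_def unitL1 unitR1 assocLL1[symmetric] T_in T_append[symmetric] hom_Arr[OF tenL1_in[OF T_in bx_in]]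
         hom_Arr[OF tenR1_in[OF T_in bx_in]] del: ev.simps(2)) (simp_all add: wh1_def unitL1 unitR1 ev_single assocLL1 T_in T_append hom_Arr[OF tenL1_in[OF T_in bx_in]]
         hom_Arr[OF tenR1_in[OF T_in bx_in]] hom_Arr[OF tenL1_in[OF T_in tenL1_in[OF T_in bx_in]]] comp1_idL[OF tenL1_in[OF T_in tenL1_in[OF T_in bx_in]]]
         comp1_idL[OF tenR1_in[OF ten_Obj[OF T_in T_in] bx_in]])
  show ?thesis
    unfolding dcell_def e using inter_in[OF bx_in h] assms
    by (simp add: swap_cell_def swap_src_def swap_tgt_def)
qed

text \<open>Interchange is used only in the direction of \<Sigma>; inverses enter later, through
  common reducts. The cell is an index of the relation so that confluence can be stated for cells
  and not only for diagrams.\<close>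

inductive slide1 :: "strand list \<Rightarrow> strand list \<Rightarrow> diagram \<Rightarrow> 't \<Rightarrow> diagram \<Rightarrow> bool" for xs ys where
  slide1I: "\<lbrakk>chain xs X (l @ (bsrc f @ m @ bsrc g) @ r); chain (l @ (btgt f @ m @ btgt g) @ r) Y ys;
     btgt f \<noteq> []; btgt g \<noteq> []\<rbrakk>
   \<Longrightarrow> slide1 xs ys (X @ swap_src l f m g r @ Y)
        (ctx xs X l r (l @ (btgt f @ m @ btgt g) @ r) Y (swap_cell f m g)) (X @ swap_tgt l f m g r @ Y)"

inductive slide :: "strand list \<Rightarrow> strand list \<Rightarrow> diagram \<Rightarrow> 't \<Rightarrow> diagram \<Rightarrow> bool" for xs ys where
  slide_refl: "chain xs d ys \<Longrightarrow> slide xs ys d (id2 V (ev xs d)) d"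
| slide_step: "slide1 xs ys d \<phi> d' \<Longrightarrow> slide xs ys d' \<psi> d'' \<Longrightarrow> slide xs ys d (\<psi> \<bullet> \<phi>) d''"

lemma slide1_dcell: "slide1 xs ys d \<phi> d' \<Longrightarrow> dcell xs ys d \<phi> d'"
proof (induction rule: slide1.induct)
  case (slide1I X l f m g r Y)
  from ctx_dcell(1)[OF slide1I(1,2) swap_dcell[OF slide1I(3,4)]]
  show ?case by (simp add: wdiag_swap)
qed

lemma slide_dcell: "slide xs ys d \<phi> d' \<Longrightarrow> dcell xs ys d \<phi> d'"
  by (induction rule: slide.induct) (auto intro: dcell_id dcell_comp slide1_dcell)

lemma slide1_slide:
  assumes "slide1 xs ys d \<phi> d'" shows "slide xs ys d \<phi> d'"
proof -
  have "chain xs d' ys" using slide1_dcell[OF assms] by (simp add: dcell_def)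
  from slide_step[OF assms slide_refl[OF this]] show ?thesis
    using vcomp_idL[OF dcell_cells[OF slide1_dcell[OF assms]]] by simp
qed

lemma slide_trans:
  assumes "slide xs ys d \<phi> d'" "slide xs ys d' \<psi> d''" shows "slide xs ys d (\<psi> \<bullet> \<phi>) d''"
  using assms
proof (induction rule: slide.induct)
  case (slide_refl d) then show ?case using vcomp_idR[OF dcell_cells[OF slide_dcell]] by auto
next
  case (slide_step d \<phi> d' \<chi> e)
  then have "\<psi> \<bullet> (\<chi> \<bullet> \<phi>) = (\<psi> \<bullet> \<chi>) \<bullet> \<phi>"
    using vcomp_assoc dcell_cells slide_dcell slide1_dcell by metis
  then show ?case using slide_step slide.slide_step by auto
qed

lemma slide1_ctx:
  assumes "slide1 zs ws P \<phi> Q" "chain xs X (l @ zs @ r)" "chain (l @ ws @ r) Y ys"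
  shows "slide1 xs ys (X @ wdiag l r P @ Y) (ctx xs X l r (l @ ws @ r) Y \<phi>) (X @ wdiag l r Q @ Y)"
  using assms
proof (induction rule: slide1.induct)
  case (slide1I X' l' f m g r' Y')
  have 1: "chain xs (X @ wdiag l r X') ((l @ l') @ (bsrc f @ m @ bsrc g) @ (r' @ r))"
    using chain_wdiag[OF slide1I(1), of l r] slide1I(5) by (auto simp: chain_append)
  have 2: "chain ((l @ l') @ (btgt f @ m @ btgt g) @ (r' @ r)) (wdiag l r Y' @ Y) ys"
    using chain_wdiag[OF slide1I(2), of l r] slide1I(6) by (auto simp: chain_append)
  show ?case
    using slide1.slide1I[OF 1 2 slide1I(3,4)] ctx_ctx[OF slide1I(5,6) swap_dcell[OF slide1I(3,4)] slide1I(1,2)]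
    by (simp add: wdiag_swap)
qed

lemma slide_ctx:
  assumes "slide zs ws P \<phi> Q" "chain xs X (l @ zs @ r)" "chain (l @ ws @ r) Y ys"
  shows "slide xs ys (X @ wdiag l r P @ Y) (ctx xs X l r (l @ ws @ r) Y \<phi>) (X @ wdiag l r Q @ Y)"
  using assms
proof (induction rule: slide.induct)
  case (slide_refl d) then show ?case by (simp add: ctx_id slide.slide_refl ev_ctx(2))
next
  case (slide_step d \<phi> d' \<chi> e)
  then show ?case
    using slide.slide_step[OF slide1_ctx] ctx_vcomp[OF slide_step(4,5) slide1_dcell slide_dcell] by simp
qed

section \<open>Interchangers of a box with a whole diagram\<close>

lemma swap_cell_wh_left: "wh2 [] r (swap_cell f (m @ l) g) = \<Sigma> (bx f) (T m \<ltimes> wh1 l r (bx g))"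
proof -
  have "T (m @ l) \<ltimes> bx g \<in> hom V (T (m @ l @ bsrc g)) (T (m @ l @ btgt g))"
    using tenL1_in[OF T_in[of "m @ l"] bx_in[of g]] T_append[of "m @ l"] by simp
  note i = inter_in[OF bx_in[of f] this]
  have "T [] \<ltimes>\<^sub>2 swap_cell f (m @ l) g = swap_cell f (m @ l) g"
    unfolding swap_cell_def using cells_Cell[OF iso_cells_cells[OF i]] by (simp add: unitL2)
  moreover have "swap_cell f (m @ l) g \<rtimes>\<^sub>2 T r = \<Sigma> (bx f) ((T (m @ l) \<ltimes> bx g) \<rtimes> T r)"
    unfolding swap_cell_def by (rule inter_assocR[symmetric]) (auto intro: T_in hom_Arr[OF bx_in] hom_Arr[OF tenL1_in[OF T_in bx_in]])
  moreover have "(T (m @ l) \<ltimes> bx g) \<rtimes> T r = T m \<ltimes> wh1 l r (bx g)"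
    by (simp add: wh1_def T_append assocLL1 assocLR1 T_in hom_Arr[OF bx_in] hom_Arr[OF tenL1_in[OF T_in bx_in]])
  ultimately show ?thesis unfolding wh2_def by simp
qed

lemma swap_cell_wh_right: "wh2 l [] (swap_cell g (r @ m) h) = \<Sigma> (wh1 l r (bx g)) (T m \<ltimes> bx h)"
proof -
  note a = hom_Arr[OF bx_in, of g] hom_Arr[OF tenL1_in[OF T_in bx_in]]
    hom_Arr[OF tenL1_in[OF T_in tenL1_in[OF T_in bx_in]]]
  have "swap_cell g (r @ m) h \<in> Cell V"
    unfolding swap_cell_def using inter_in[OF bx_in tenL1_in[OF T_in bx_in]] iso_cells_cells cells_Cell by blast
  then have "wh2 l [] (swap_cell g (r @ m) h) = T l \<ltimes>\<^sub>2 swap_cell g (r @ m) h"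
    unfolding wh2_def using cells_Cell[OF tenL2_in[OF T_in]] unitR2 by (auto simp: cells_def)
  also have "\<dots> = \<Sigma> (T l \<ltimes> bx g) (T (r @ m) \<ltimes> bx h)"
    unfolding swap_cell_def using a by (intro inter_assocL[symmetric] T_in) auto
  also have "\<dots> = \<Sigma> (T l \<ltimes> bx g \<rtimes> T r) (T m \<ltimes> bx h)"
    using a hom_Arr[OF bx_in, of h] by (simp add: T_append assocLL1 T_in inter_assocM)
  finally show ?thesis by (simp add: wh1_def)
qed

text \<open>The composition axiom \<open>inter_compR\<close> read on diagrams: the box
  \<open>f\<close>, applied last, first moves below all of \<open>P\<close> and then below the layer
  of \<open>g\<close>.\<close>

lemma inter_left_Cons:
  assumes "chain (l @ btgt g @ r) P ws" "btgt f \<noteq> []" "btgt g \<noteq> []"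
  shows "\<Sigma> (bx f) (T m \<ltimes> ev (l @ bsrc g @ r) ((l, g, r) # P))
    = ctx (bsrc f @ m @ l @ bsrc g @ r) [] [] r ([] @ (btgt f @ (m @ l) @ btgt g) @ r)
        (wdiag (btgt f @ m) [] P) (swap_cell f (m @ l) g)
      \<bullet> ctx (bsrc f @ m @ l @ bsrc g @ r) [(bsrc f @ m @ l, g, r)] [] [] ([] @ (btgt f @ m @ ws) @ []) []
        (\<Sigma> (bx f) (T m \<ltimes> ev (l @ btgt g @ r) P))"
proof -
  define zs where "zs = l @ bsrc g @ r"
  note c = zs_def assms(3,1)
  let ?X = "[(bsrc f @ m @ l, g, r)]"
  let ?a = "bx f" and ?g = "T m \<ltimes> wh1 l r (bx g)" and ?g' = "T m \<ltimes> ev (l @ btgt g @ r) P"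
  have hg: "?g \<in> hom V (T (m @ zs)) (T (m @ l @ btgt g @ r))" "?g' \<in> hom V (T (m @ l @ btgt g @ r)) (T (m @ ws))"
    unfolding T_append[of m] c(1) by (rule tenL1_in[OF T_in] wh1_in bx_in ev_in c)+
  have comp: "T m \<ltimes> ev zs ((l, g, r) # P) = ?g' \<cdot> ?g"
    by (simp add: tenL1_comp[OF T_in wh1_in[OF bx_in] ev_in[OF c(3)]])
  have w: "wh1 (x @ m) [] f = T x \<ltimes> T m \<ltimes> f" if "f \<in> Arr V" for x f
    using that by (simp add: wh1_def T_append assocLL1[OF T_in T_in] unitR1 hom_Arr[OF tenL1_in[OF T_in tenL1_in[OF T_in hom_self]]])
  have x1: "\<Sigma> ?a ?g' \<in> cells V ((?a \<rtimes> T (m @ ws)) \<cdot> (T (bsrc f) \<ltimes> ?g')) ((T (btgt f) \<ltimes> ?g') \<cdot> (?a \<rtimes> T (m @ l @ btgt g @ r)))"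
    using iso_cells_cells[OF inter_in[OF bx_in hg(2)]] .
  have e1: "ctx (bsrc f @ m @ zs) ?X [] [] ([] @ (btgt f @ m @ ws) @ []) [] (\<Sigma> ?a ?g') = \<Sigma> ?a ?g' \<lhd> (T (bsrc f) \<ltimes> ?g)"
  proof -
    have "ev (bsrc f @ m @ zs) ?X = T (bsrc f) \<ltimes> ?g"
      unfolding ev_single wh1_def[of "bsrc f @ m @ l"] T_append
      using hom_Arr[OF bx_in, of g]
      by (simp add: wh1_def assocLL1 assocLR1 ten_Obj T_in hom_Arr[OF tenL1_in[OF T_in bx_in]] hom_Arr[OF tenR1_in[OF T_in bx_in]]
          hom_Arr[OF tenL1_in[OF T_in tenL1_in[OF T_in bx_in]]] hom_Arr[OF tenL1_in[OF T_in tenR1_in[OF T_in bx_in]]])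
    moreover have "(?a \<rtimes> T (m @ ws)) \<cdot> (T (bsrc f) \<ltimes> ?g') \<in> hom V (T (bsrc f) \<otimes> T (m @ l @ btgt g @ r)) (T (btgt f @ m @ ws))"
      unfolding T_append[of "btgt f"]
      by (rule comp1_in[OF tenL1_in[OF T_in hg(2)] tenR1_in[OF T_in bx_in]])
    ultimately show ?thesis
      unfolding ctx_def wh2_Nil[OF cells_Cell[OF x1]] using whiskL_id1[OF _ x1] by simp
  qed
  have e2: "ctx (bsrc f @ m @ zs) [] [] r ([] @ (btgt f @ (m @ l) @ btgt g) @ r) (wdiag (btgt f @ m) [] P) (swap_cell f (m @ l) g)
     = (T (btgt f) \<ltimes> ?g') \<rhd> \<Sigma> ?a ?g"
  proof -
    have "ev ([] @ (btgt f @ (m @ l) @ btgt g) @ r) (wdiag (btgt f @ m) [] P) = T (btgt f) \<ltimes> ?g'"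
      using ev_wdiag[OF c(3), of "btgt f @ m" "[]"] w[OF hom_Arr[OF ev_in[OF c(3)]]] by simp
    moreover have "wh2 [] r (swap_cell f (m @ l) g) = \<Sigma> ?a ?g" by (rule swap_cell_wh_left)
    moreover have "(T (btgt f) \<ltimes> ?g') \<rhd> \<Sigma> ?a ?g \<in> cells V ((T (btgt f) \<ltimes> ?g') \<cdot> (?a \<rtimes> T (m @ l @ btgt g @ r)) \<cdot> (T (bsrc f) \<ltimes> ?g))
        ((T (btgt f) \<ltimes> ?g') \<cdot> (T (btgt f) \<ltimes> ?g) \<cdot> (?a \<rtimes> T (m @ zs)))"
      by (rule whiskL_in[OF comp1_in[OF tenL1_in[OF T_in hg(1)] tenR1_in[OF T_in bx_in]] tenL1_in[OF T_in hg(2)] iso_cells_cells[OF inter_in[OF bx_in hg(1)]]])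
    moreover have "(T (btgt f) \<ltimes> ?g') \<cdot> (?a \<rtimes> T (m @ l @ btgt g @ r)) \<cdot> (T (bsrc f) \<ltimes> ?g)
        \<in> hom V (T (bsrc f) \<otimes> T (m @ zs)) (T (btgt f) \<otimes> T (m @ ws))"
      by (rule comp1_in[OF comp1_in[OF tenL1_in[OF T_in hg(1)] tenR1_in[OF T_in bx_in]] tenL1_in[OF T_in hg(2)]])
    ultimately show ?thesis
      unfolding ctx_def using whiskR_id1 by (simp add: T_append)
  qed
  have "\<Sigma> ?a (T m \<ltimes> ev zs ((l, g, r) # P)) = ((T (btgt f) \<ltimes> ?g') \<rhd> \<Sigma> ?a ?g) \<bullet> (\<Sigma> ?a ?g' \<lhd> (T (bsrc f) \<ltimes> ?g))"
    unfolding comp by (rule inter_compR[OF bx_in hg])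
  then show ?thesis using e1 e2 unfolding zs_def by simp
qed

text \<open>Induction on \<open>P\<close> with \<open>inter_left_Cons\<close>. The interchanger of
  \<open>f\<close> with a composite 1-cell is thus itself the cell of a sequence of elementary
  interchanges, so that coherence applies to it.\<close>

lemma slide_left:
  assumes "chain zs P ws" "btgt f \<noteq> []"
  shows "slide (bsrc f @ m @ zs) (btgt f @ m @ ws) (wdiag (bsrc f @ m) [] P @ [([], f, m @ ws)])
    (\<Sigma> (bx f) (T m \<ltimes> ev zs P)) (([], f, m @ zs) # wdiag (btgt f @ m) [] P)"
  using assms
proof (induction zs P ws rule: chain.induct)
  case (1 xs ys)
  have "\<Sigma> (bx f) (T m \<ltimes> id1 V (T xs)) = id2 V (bx f \<rtimes> T (m @ xs))"
    unfolding tenL1_id[OF T_in T_in] T_append[symmetric] by (rule inter_idR[OF T_in hom_Arr[OF bx_in]])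
  moreover have "ev (bsrc f @ m @ xs) [([], f, m @ xs)] = bx f \<rtimes> T (m @ xs)"
    unfolding ev_single by (simp add: wh1_def unitL1 hom_Arr[OF bx_in])
  ultimately show ?case using slide_refl[of "bsrc f @ m @ xs" "[([], f, m @ xs)]" "btgt f @ m @ xs"] 1
    by (simp del: ev.simps(2))
next
  case (2 zs l g r P ws)
  then have c: "zs = l @ bsrc g @ r" "btgt g \<noteq> []" "chain (l @ btgt g @ r) P ws" by auto
  note IH = 2(1)[OF c(3) assms(2)]
  let ?X = "[(bsrc f @ m @ l, g, r)]"
  have s1: "slide (bsrc f @ m @ zs) (btgt f @ m @ ws)
     (?X @ wdiag [] [] (wdiag (bsrc f @ m) [] P @ [([], f, m @ ws)]) @ [])
     (ctx (bsrc f @ m @ zs) ?X [] [] ([] @ (btgt f @ m @ ws) @ []) [] (\<Sigma> (bx f) (T m \<ltimes> ev (l @ btgt g @ r) P)))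
     (?X @ wdiag [] [] (([], f, m @ l @ btgt g @ r) # wdiag (btgt f @ m) [] P) @ [])"
    by (rule slide_ctx[OF IH]) (use c in auto)
  have s2: "slide1 (bsrc f @ m @ zs) (btgt f @ m @ ws) ([] @ swap_src [] f (m @ l) g r @ wdiag (btgt f @ m) [] P)
     (ctx (bsrc f @ m @ zs) [] [] r ([] @ (btgt f @ (m @ l) @ btgt g) @ r) (wdiag (btgt f @ m) [] P) (swap_cell f (m @ l) g))
     ([] @ swap_tgt [] f (m @ l) g r @ wdiag (btgt f @ m) [] P)"
    by (rule slide1I) (use c chain_wdiag[OF c(3), of "btgt f @ m" "[]"] assms in auto)
  show ?case unfolding c(1) inter_left_Cons[OF c(3) assms(2) c(2), of m]
  proof (rule slide_trans)
    show "slide (bsrc f @ m @ l @ bsrc g @ r) (btgt f @ m @ ws) (wdiag (bsrc f @ m) [] ((l, g, r) # P) @ [([], f, m @ ws)])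
      (ctx (bsrc f @ m @ l @ bsrc g @ r) ?X [] [] ([] @ (btgt f @ m @ ws) @ []) [] (\<Sigma> (bx f) (T m \<ltimes> ev (l @ btgt g @ r) P)))
      ((bsrc f @ m @ l, g, r) # ([], f, m @ l @ btgt g @ r) # wdiag (btgt f @ m) [] P)"
      using s1 unfolding wdiag_Nil c(1) by simp
    show "slide (bsrc f @ m @ l @ bsrc g @ r) (btgt f @ m @ ws)
      ((bsrc f @ m @ l, g, r) # ([], f, m @ l @ btgt g @ r) # wdiag (btgt f @ m) [] P)
      (ctx (bsrc f @ m @ l @ bsrc g @ r) [] [] r ([] @ (btgt f @ (m @ l) @ btgt g) @ r) (wdiag (btgt f @ m) [] P) (swap_cell f (m @ l) g))
      (([], f, m @ l @ bsrc g @ r) # wdiag (btgt f @ m) [] ((l, g, r) # P))"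
      using slide1_slide[OF s2] c(1) by (simp add: swap_src_def swap_tgt_def)
  qed
qed

text \<open>Mirror image of \<open>slide_left\<close>, with the diagram on the left and the
  composition axiom \<open>inter_compL\<close>.\<close>

lemma slide_right:
  assumes "chain zs P ws" "btgt h \<noteq> []"
  shows "slide (zs @ m @ bsrc h) (ws @ m @ btgt h) ((zs @ m, h, []) # wdiag [] (m @ btgt h) P)
    (\<Sigma> (ev zs P) (T m \<ltimes> bx h)) (wdiag [] (m @ bsrc h) P @ [(ws @ m, h, [])])"
  using assms
proof (induction zs P ws rule: chain.induct)
  case (1 xs ys)
  have "\<Sigma> (id1 V (T xs)) (T m \<ltimes> bx h) = id2 V (T xs \<ltimes> (T m \<ltimes> bx h))"
    by (rule inter_idL[OF T_in hom_Arr[OF tenL1_in[OF T_in bx_in]]])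
  moreover have "ev (xs @ m @ bsrc h) [(xs @ m, h, [])] = T xs \<ltimes> (T m \<ltimes> bx h)"
    using ev_single[of "xs @ m @ bsrc h" "xs @ m" h "[]"]
    by (simp add: wh1_def T_append assocLL1 T_in unitR1 hom_Arr[OF bx_in] hom_Arr[OF tenL1_in[OF T_in tenL1_in[OF T_in bx_in]]] del: ev.simps(2))
  ultimately show ?case using slide_refl[of "xs @ m @ bsrc h" "[(xs @ m, h, [])]" "xs @ m @ btgt h"] 1
    by (simp del: ev.simps(2))
next
  case (2 zs l g r P ws)
  then have c: "zs = l @ bsrc g @ r" "btgt g \<noteq> []" "chain (l @ btgt g @ r) P ws" by auto
  note IH = 2(1)[OF c(3) assms(2)]
  let ?X = "[(l, g, r @ m @ bsrc h)]"
  have s1: "slide (zs @ m @ bsrc h) (ws @ m @ btgt h)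
     (?X @ wdiag [] [] (((l @ btgt g @ r) @ m, h, []) # wdiag [] (m @ btgt h) P) @ [])
     (ctx (zs @ m @ bsrc h) ?X [] [] ([] @ (ws @ m @ btgt h) @ []) [] (\<Sigma> (ev (l @ btgt g @ r) P) (T m \<ltimes> bx h)))
     (?X @ wdiag [] [] (wdiag [] (m @ bsrc h) P @ [(ws @ m, h, [])]) @ [])"
    by (rule slide_ctx[OF IH]) (use c in auto)
  have s2: "slide1 (zs @ m @ bsrc h) (ws @ m @ btgt h) ([] @ swap_src l g (r @ m) h [] @ wdiag [] (m @ btgt h) P)
     (ctx (zs @ m @ bsrc h) [] l [] (l @ (btgt g @ (r @ m) @ btgt h) @ []) (wdiag [] (m @ btgt h) P) (swap_cell g (r @ m) h))
     ([] @ swap_tgt l g (r @ m) h [] @ wdiag [] (m @ btgt h) P)"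
    by (rule slide1I) (use c chain_wdiag[OF c(3), of "[]" "m @ btgt h"] assms in auto)
  let ?k = "T m \<ltimes> bx h" and ?f = "wh1 l r (bx g)" and ?f' = "ev (l @ btgt g @ r) P"
  have hk: "?k \<in> hom V (T (m @ bsrc h)) (T (m @ btgt h))"
    unfolding T_append[of m] by (rule tenL1_in[OF T_in bx_in])
  have hf: "?f \<in> hom V (T zs) (T (l @ btgt g @ r))" "?f' \<in> hom V (T (l @ btgt g @ r)) (T ws)"
    unfolding c(1) by (rule wh1_in bx_in ev_in c)+
  note x1 = inter_in[OF hf(2) hk, THEN iso_cells_cells] and x2 = inter_in[OF hf(1) hk, THEN iso_cells_cells]
  have w: "wh1 [] x f = f \<rtimes> T x" if "f \<in> Arr V" for x f
    using that by (simp add: wh1_def unitL1)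
  have e1: "ctx (zs @ m @ bsrc h) ?X [] [] ([] @ (ws @ m @ btgt h) @ []) [] (\<Sigma> ?f' ?k) = \<Sigma> ?f' ?k \<lhd> (?f \<rtimes> T (m @ bsrc h))"
  proof -
    have "ev (zs @ m @ bsrc h) ?X = ?f \<rtimes> T (m @ bsrc h)"
      unfolding ev_single wh1_def T_append
      by (simp add: assocRR1 ten_Obj T_in hom_Arr[OF tenL1_in[OF T_in bx_in]])
    moreover have "(?f' \<rtimes> T (m @ btgt h)) \<cdot> (T (l @ btgt g @ r) \<ltimes> ?k) \<in> hom V (T (l @ btgt g @ r) \<otimes> T (m @ bsrc h)) (T (ws @ m @ btgt h))"
      unfolding T_append[of ws]
      by (rule comp1_in[OF tenL1_in[OF T_in hk] tenR1_in[OF T_in hf(2)]])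
    ultimately show ?thesis
      unfolding ctx_def wh2_Nil[OF cells_Cell[OF x1]] using whiskL_id1[OF _ x1] by simp
  qed
  have e2: "ctx (zs @ m @ bsrc h) [] l [] (l @ (btgt g @ (r @ m) @ btgt h) @ []) (wdiag [] (m @ btgt h) P) (swap_cell g (r @ m) h)
     = (?f' \<rtimes> T (m @ btgt h)) \<rhd> \<Sigma> ?f ?k"
  proof -
    have "ev (l @ (btgt g @ (r @ m) @ btgt h) @ []) (wdiag [] (m @ btgt h) P) = ?f' \<rtimes> T (m @ btgt h)"
      using ev_wdiag[OF c(3), of "[]" "m @ btgt h"] w[OF hom_Arr[OF ev_in[OF c(3)]]] by simp
    moreover note swap_cell_wh_right[of l g r m h]
    moreover note whiskL_in[OF comp1_in[OF tenL1_in[OF T_in hk] tenR1_in[OF T_in hf(1)]] tenR1_in[OF T_in hf(2)] x2]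
    moreover note comp1_in[OF comp1_in[OF tenL1_in[OF T_in hk] tenR1_in[OF T_in hf(1)]] tenR1_in[OF T_in hf(2)]]
    ultimately show ?thesis
      unfolding ctx_def using whiskR_id1 by (simp add: T_append)
  qed
  have "\<Sigma> (ev zs ((l, g, r) # P)) ?k = (\<Sigma> ?f' ?k \<lhd> (?f \<rtimes> T (m @ bsrc h))) \<bullet> ((?f' \<rtimes> T (m @ btgt h)) \<rhd> \<Sigma> ?f ?k)"
    using inter_compL[OF hf hk] by simp
  moreover have "slide (zs @ m @ bsrc h) (ws @ m @ btgt h) ((zs @ m, h, []) # wdiag [] (m @ btgt h) ((l, g, r) # P))
     ((\<Sigma> ?f' ?k \<lhd> (?f \<rtimes> T (m @ bsrc h))) \<bullet> ((?f' \<rtimes> T (m @ btgt h)) \<rhd> \<Sigma> ?f ?k))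
     (wdiag [] (m @ bsrc h) ((l, g, r) # P) @ [(ws @ m, h, [])])"
  proof (rule slide_trans)
    show "slide (zs @ m @ bsrc h) (ws @ m @ btgt h) ((zs @ m, h, []) # wdiag [] (m @ btgt h) ((l, g, r) # P))
      ((?f' \<rtimes> T (m @ btgt h)) \<rhd> \<Sigma> ?f ?k)
      ((l, g, r @ m @ bsrc h) # ((l @ btgt g @ r) @ m, h, []) # wdiag [] (m @ btgt h) P)"
      using slide1_slide[OF s2[unfolded e2]] c(1) by (simp add: swap_src_def swap_tgt_def)
    show "slide (zs @ m @ bsrc h) (ws @ m @ btgt h)
      ((l, g, r @ m @ bsrc h) # ((l @ btgt g @ r) @ m, h, []) # wdiag [] (m @ btgt h) P)
      (\<Sigma> ?f' ?k \<lhd> (?f \<rtimes> T (m @ bsrc h))) (wdiag [] (m @ bsrc h) ((l, g, r) # P) @ [(ws @ m, h, [])])"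
      using s1[unfolded e1 wdiag_Nil] by simp
  qed
  ultimately show ?case by simp
qed

text \<open>Naturality of \<open>\<Sigma> f g\<close> in \<open>g\<close>, in the language of
  contexts. It is used with \<open>\<phi>\<close> an interchange cell, to close the critical pair,
  and with \<open>\<phi>\<close> a structural cell, to move a step past a layer.\<close>

lemma inter_nat_left:
  assumes "dcell zs ws P \<phi> Q"
  shows "\<Sigma> (bx f) (T m \<ltimes> ev zs Q)
      \<bullet> ctx (bsrc f @ m @ zs) [] (bsrc f @ m) [] ((bsrc f @ m) @ ws @ []) [([], f, m @ ws)] \<phi>
    = ctx (bsrc f @ m @ zs) [([], f, m @ zs)] (btgt f @ m) [] ((btgt f @ m) @ ws @ []) [] \<phi>
      \<bullet> \<Sigma> (bx f) (T m \<ltimes> ev zs P)"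
proof -
  have c: "chain zs P ws" "chain zs Q ws" and i: "\<phi> \<in> cells V (ev zs P) (ev zs Q)"
    using assms dcell_cells by (auto simp: dcell_def)
  have hP: "T m \<ltimes> ev zs P \<in> hom V (T (m @ zs)) (T (m @ ws))"
    unfolding T_append by (rule tenL1_in[OF T_in ev_in[OF c(1)]])
  note p = tenL2_in[OF T_in[of m] i]
  note n = inter_nat[OF bx_in hP id2_in[OF hom_Arr[OF bx_in]] p, of f]
  have w: "wh2 (x @ m) [] \<phi> = T x \<ltimes>\<^sub>2 T m \<ltimes>\<^sub>2 \<phi>" for x
    unfolding wh2_def T_append
    using cells_Cell[OF i] cells_Cell[OF tenL2_in[OF T_in[of x] tenL2_in[OF T_in[of m] i]]]
    by (simp add: assocLL2[OF T_in T_in] unitR2)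
  have e: "ev (bsrc f @ m @ us) [([], f, m @ us)] = bx f \<rtimes> T (m @ us)" for us
    unfolding ev_single by (simp add: wh1_def unitL1 hom_Arr[OF bx_in])
  have t: "T x \<ltimes>\<^sub>2 T m \<ltimes>\<^sub>2 \<phi> \<in> cells V (T x \<ltimes> (T m \<ltimes> ev zs P)) (T x \<ltimes> (T m \<ltimes> ev zs Q))"
    "T x \<ltimes> (T m \<ltimes> ev zs P) \<in> hom V (T (x @ m @ zs)) (T (x @ m @ ws))" for x
    using tenL2_in[OF T_in p] tenL1_in[OF T_in hP] by (auto simp: T_append[of x])
  have r: "bx f \<rtimes> T (m @ us) \<in> hom V (T (bsrc f @ m @ us)) (T (btgt f @ m @ us))" for us
    unfolding T_append[of "bsrc f"] T_append[of "btgt f"] by (rule tenR1_in[OF T_in bx_in])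
  have i2: "id2 V (bx f) \<rtimes>\<^sub>2 T x = id2 V (bx f \<rtimes> T x)" for x
    by (rule tenR2_id[OF T_in hom_Arr[OF bx_in]])
  have 1: "ctx (bsrc f @ m @ zs) [] (bsrc f @ m) [] ((bsrc f @ m) @ ws @ []) [([], f, m @ ws)] \<phi>
    = (id2 V (bx f) \<rtimes>\<^sub>2 T (m @ ws)) \<star> (T (bsrc f) \<ltimes>\<^sub>2 T m \<ltimes>\<^sub>2 \<phi>)"
  proof -
    have "(bx f \<rtimes> T (m @ ws)) \<rhd> (T (bsrc f) \<ltimes>\<^sub>2 T m \<ltimes>\<^sub>2 \<phi>) \<lhd> id1 V (T (bsrc f @ m @ zs)) = (bx f \<rtimes> T (m @ ws)) \<rhd> (T (bsrc f) \<ltimes>\<^sub>2 T m \<ltimes>\<^sub>2 \<phi>)"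
      by (rule whiskR_id1[OF comp1_in[OF t(2) r] whiskL_in[OF t(2) r t(1)]])
    then show ?thesis using e[of ws] by (simp add: ctx_def w i2 whiskL_def del: ev.simps(2))
  qed
  have 2: "ctx (bsrc f @ m @ zs) [([], f, m @ zs)] (btgt f @ m) [] ((btgt f @ m) @ ws @ []) [] \<phi>
    = (T (btgt f) \<ltimes>\<^sub>2 T m \<ltimes>\<^sub>2 \<phi>) \<star> (id2 V (bx f) \<rtimes>\<^sub>2 T (m @ zs))"
  proof -
    have "id1 V (T (btgt f @ m @ ws)) \<rhd> (T (btgt f) \<ltimes>\<^sub>2 T m \<ltimes>\<^sub>2 \<phi>) = T (btgt f) \<ltimes>\<^sub>2 T m \<ltimes>\<^sub>2 \<phi>"
      by (rule whiskL_id1[OF t(2,1)])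
    then show ?thesis using e[of zs] by (simp add: ctx_def w i2 whiskR_def del: ev.simps(2))
  qed
  show ?thesis using n unfolding 1 2 by simp
qed

lemma inter_nat_right:
  assumes "dcell zs ws P \<phi> Q"
  shows "\<Sigma> (ev zs Q) (T m \<ltimes> bx h)
      \<bullet> ctx (zs @ m @ bsrc h) [(zs @ m, h, [])] [] (m @ btgt h) ([] @ ws @ m @ btgt h) [] \<phi>
    = ctx (zs @ m @ bsrc h) [] [] (m @ bsrc h) ([] @ ws @ m @ bsrc h) [(ws @ m, h, [])] \<phi>
      \<bullet> \<Sigma> (ev zs P) (T m \<ltimes> bx h)"
proof -
  have c: "chain zs P ws" "chain zs Q ws" and i: "\<phi> \<in> cells V (ev zs P) (ev zs Q)"
    using assms dcell_cells by (auto simp: dcell_def)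
  let ?k = "T m \<ltimes> bx h"
  have hk: "?k \<in> hom V (T (m @ bsrc h)) (T (m @ btgt h))"
    unfolding T_append[of m] by (rule tenL1_in[OF T_in bx_in])
  note n = inter_nat[OF ev_in[OF c(1)] hk i id2_in[OF hom_Arr[OF hk]]]
  have w: "wh2 [] x \<phi> = \<phi> \<rtimes>\<^sub>2 T x" for x
    using cells_Cell[OF i] by (simp add: wh2_def unitL2)
  have e: "ev (us @ m @ bsrc h) [(us @ m, h, [])] = T us \<ltimes> ?k" for us
    unfolding ev_single
    by (simp add: wh1_def T_append assocLL1 T_in unitR1 hom_Arr[OF bx_in] hom_Arr[OF tenL1_in[OF T_in tenL1_in[OF T_in bx_in]]])
  have t: "\<phi> \<rtimes>\<^sub>2 T x \<in> cells V (ev zs P \<rtimes> T x) (ev zs Q \<rtimes> T x)"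
    "ev zs P \<rtimes> T x \<in> hom V (T (zs @ x)) (T (ws @ x))" for x
    unfolding T_append by (rule tenR2_in[OF T_in i] tenR1_in[OF T_in ev_in[OF c(1)]])+
  have r: "T us \<ltimes> ?k \<in> hom V (T (us @ m @ bsrc h)) (T (us @ m @ btgt h))" for us
    unfolding T_append[of us] by (rule tenL1_in[OF T_in hk])
  have i2: "T x \<ltimes>\<^sub>2 id2 V ?k = id2 V (T x \<ltimes> ?k)" for x
    by (rule tenL2_id[OF T_in hom_Arr[OF hk]])
  have 1: "ctx (zs @ m @ bsrc h) [] [] (m @ bsrc h) ([] @ ws @ m @ bsrc h) [(ws @ m, h, [])] \<phi>
    = (T ws \<ltimes>\<^sub>2 id2 V ?k) \<star> (\<phi> \<rtimes>\<^sub>2 T (m @ bsrc h))"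
  proof -
    have "(T ws \<ltimes> ?k) \<rhd> (\<phi> \<rtimes>\<^sub>2 T (m @ bsrc h)) \<lhd> id1 V (T (zs @ m @ bsrc h)) = (T ws \<ltimes> ?k) \<rhd> (\<phi> \<rtimes>\<^sub>2 T (m @ bsrc h))"
      by (rule whiskR_id1[OF comp1_in[OF t(2) r] whiskL_in[OF t(2) r t(1)]])
    then show ?thesis using e[of ws] by (simp add: ctx_def w i2 whiskL_def del: ev.simps(2))
  qed
  have 2: "ctx (zs @ m @ bsrc h) [(zs @ m, h, [])] [] (m @ btgt h) ([] @ ws @ m @ btgt h) [] \<phi>
    = (\<phi> \<rtimes>\<^sub>2 T (m @ btgt h)) \<star> (T zs \<ltimes>\<^sub>2 id2 V ?k)"
  proof -
    have "id1 V (T (ws @ m @ btgt h)) \<rhd> (\<phi> \<rtimes>\<^sub>2 T (m @ btgt h)) = \<phi> \<rtimes>\<^sub>2 T (m @ btgt h)"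
      by (rule whiskL_id1[OF t(2,1)])
    then show ?thesis using e[of zs] by (simp add: ctx_def w i2 whiskR_def del: ev.simps(2))
  qed
  show ?thesis using n unfolding 1 2 by simp
qed

text \<open>The only genuine critical pair: three boxes side by side, applied from right to left,
  where the middle one can be exchanged with either neighbour. Both reductions end with the boxes
  applied from left to right; the two composites of three interchanges agree by naturality of the
  interchanger of \<open>f'\<close> at the cell exchanging \<open>f\<close> and
  \<open>g\<close>.\<close>

lemma slide_joinable_overlap:
  assumes nt: "btgt f \<noteq> []" "btgt g \<noteq> []" "btgt f' \<noteq> []"
    and cX: "chain xs X (l @ (bsrc f' @ m' @ bsrc f @ m @ bsrc g) @ r)"
    and cY: "chain (l @ (btgt f' @ m' @ btgt f @ m @ btgt g) @ r) Y ys"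
  defines "vs \<equiv> l @ (btgt f' @ m' @ btgt f @ m @ btgt g) @ r"
  shows "\<exists>e \<omega>1 \<omega>2.
      slide xs ys (X @ swap_tgt (l @ bsrc f' @ m') f m g r @ (l, f', m' @ btgt f @ m @ btgt g @ r) # Y) \<omega>1 e
    \<and> slide xs ys (X @ (l @ bsrc f' @ m' @ bsrc f @ m, g, r) # swap_tgt l f' m' f (m @ btgt g @ r) @ Y) \<omega>2 e
    \<and> \<omega>1 \<bullet> ctx xs X (l @ bsrc f' @ m') r ((l @ bsrc f' @ m') @ (btgt f @ m @ btgt g) @ r)
             ((l, f', m' @ btgt f @ m @ btgt g @ r) # Y) (swap_cell f m g)
      = \<omega>2 \<bullet> ctx xs (X @ [(l @ bsrc f' @ m' @ bsrc f @ m, g, r)]) l (m @ btgt g @ r)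
             (l @ (btgt f' @ m' @ btgt f) @ (m @ btgt g @ r)) Y (swap_cell f' m' f)"
proof -
  let ?z = "bsrc f @ m @ bsrc g" and ?w = "btgt f @ m @ btgt g"
  let ?P = "swap_src [] f m g []" and ?Q = "swap_tgt [] f m g []"
  let ?R = "bsrc f' @ m' @ ?z" and ?R' = "btgt f' @ m' @ ?w"
  let ?c = "ctx xs X l r (l @ ?R' @ r) Y"
  note cX' = cX[folded append_assoc[of "bsrc f'"]] and sd = swap_dcell[OF nt(1,2), of m]
  have cP: "chain ?z ?P ?w" "chain ?z ?Q ?w" using sd by (auto simp: dcell_def)
  have cX: "chain xs X (l @ ?R @ r)" and cY: "chain (l @ ?R' @ r) Y ys" using cX cY by simp_all
  note sP = slide_left[OF cP(1) nt(3), of m'] and sQ = slide_left[OF cP(2) nt(3), of m']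
  let ?a = "ctx ?R [] (bsrc f' @ m') [] ((bsrc f' @ m') @ ?w @ []) [([], f', m' @ ?w)] (swap_cell f m g)"
  let ?b = "ctx ?R [([], f', m' @ ?z)] (btgt f' @ m') [] ((btgt f' @ m') @ ?w @ []) [] (swap_cell f m g)"
  have sa: "slide1 ?R ?R' ([] @ wdiag (bsrc f' @ m') [] ?P @ [([], f', m' @ ?w)]) ?a ([] @ wdiag (bsrc f' @ m') [] ?Q @ [([], f', m' @ ?w)])"
    using slide1I[of ?R "[]" "bsrc f' @ m'" f m g "[]" "[([], f', m' @ ?w)]" ?R'] nt by (simp add: wdiag_swap)
  have sb: "slide1 ?R ?R' ([([], f', m' @ ?z)] @ wdiag (btgt f' @ m') [] ?P @ []) ?b ([([], f', m' @ ?z)] @ wdiag (btgt f' @ m') [] ?Q @ [])"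
    using slide1I[of ?R "[([], f', m' @ ?z)]" "btgt f' @ m'" f m g "[]" "[]" ?R'] nt by (simp add: wdiag_swap)
  let ?SP = "\<Sigma> (bx f') (T m' \<ltimes> ev ?z ?P)" and ?SQ = "\<Sigma> (bx f') (T m' \<ltimes> ev ?z ?Q)"
  have nat: "?SQ \<bullet> ?a = ?b \<bullet> ?SP"
    by (rule inter_nat_left[OF sd])
  let ?p = "ctx ?R [(bsrc f' @ m' @ bsrc f @ m, g, [])] [] (m @ btgt g) ([] @ (btgt f' @ m' @ btgt f) @ m @ btgt g) [] (swap_cell f' m' f)"
  let ?q = "ctx ?R [] [] [] ([] @ (btgt f' @ (m' @ bsrc f @ m) @ btgt g) @ []) (wdiag (btgt f' @ m') [] [([], f, m @ btgt g)]) (swap_cell f' (m' @ bsrc f @ m) g)"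
  let ?L = "(bsrc f' @ m' @ bsrc f @ m, g, [])"
  have sp: "slide1 ?R ?R' ([?L] @ swap_src [] f' m' f (m @ btgt g) @ []) ?p ([?L] @ swap_tgt [] f' m' f (m @ btgt g) @ [])"
    by (rule slide1I) (use nt in auto)
  have sq: "slide1 ?R ?R' ([] @ swap_src [] f' (m' @ bsrc f @ m) g [] @ wdiag (btgt f' @ m') [] [([], f, m @ btgt g)]) ?q
     ([] @ swap_tgt [] f' (m' @ bsrc f @ m) g [] @ wdiag (btgt f' @ m') [] [([], f, m @ btgt g)])"
    by (rule slide1I) (use nt in auto)
  \<comment> \<open>The interchanger of \<open>f'\<close> with the two-layer diagram splits into two
    elementary ones, and the first of them, \<open>?p\<close>, is the other leg of the critical
    pair.\<close>
  have SP: "?SP = ?q \<bullet> ?p"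
  proof -
    have "\<Sigma> (bx f') (T m' \<ltimes> ev (bsrc f @ m @ btgt g) [([], f, m @ btgt g)]) = wh2 [] (m @ btgt g) (swap_cell f' m' f)"
      using swap_cell_wh_left[of "m @ btgt g" f' m' "[]" f] ev_single[of "bsrc f @ m @ btgt g" "[]" f "m @ btgt g"] by simp
    moreover have "ctx ?R [?L] [] [] ([] @ (btgt f' @ m' @ ?w) @ []) [] (wh2 [] (m @ btgt g) (swap_cell f' m' f)) = ?p"
      using swap_dcell[OF nt(3,1), of m', THEN dcell_cells, THEN cells_Cell] wh2_wh2[of "swap_cell f' m' f" "[]" "[]" "[]" "m @ btgt g"]
      unfolding ctx_def by simp
    ultimately show ?thesis
      using inter_left_Cons[of "bsrc f @ m" g "[]" "[([], f, m @ btgt g)]" "btgt f @ m @ btgt g" f' m'] nt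
      by (simp add: swap_src_def del: ev.simps)
  qed
  have d: "dcell ?R ?R' (swap_src [] f' (m' @ bsrc f @ m) g [] @ wdiag (btgt f' @ m') [] [([], f, m @ btgt g)]) ?q (([], f', m' @ ?z) # wdiag (btgt f' @ m') [] ?P)"
    using slide1_dcell[OF sq] by (simp add: swap_src_def swap_tgt_def)
  have dp: "dcell ?R ?R' (wdiag (bsrc f' @ m') [] ?P @ [([], f', m' @ ?w)]) ?p (swap_src [] f' (m' @ bsrc f @ m) g [] @ wdiag (btgt f' @ m') [] [([], f, m @ btgt g)])"
    using slide1_dcell[OF sp] by (simp add: swap_src_def swap_tgt_def)
  have da: "dcell ?R ?R' (wdiag (bsrc f' @ m') [] ?P @ [([], f', m' @ ?w)]) ?a (wdiag (bsrc f' @ m') [] ?Q @ [([], f', m' @ ?w)])"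
    using slide1_dcell[OF sa] by simp
  have db: "dcell ?R ?R' (([], f', m' @ ?z) # wdiag (btgt f' @ m') [] ?P) ?b (([], f', m' @ ?z) # wdiag (btgt f' @ m') [] ?Q)"
    using slide1_dcell[OF sb] by simp
  have "?c ?SQ \<bullet> ?c ?a = ?c (?b \<bullet> ?q) \<bullet> ?c ?p"
  proof -
    have "?c ?SQ \<bullet> ?c ?a = ?c (?b \<bullet> ?SP)"
      using ctx_vcomp[OF cX cY da slide_dcell[OF sQ]] nat by simp
    also have "\<dots> = ?c (?b \<bullet> ?q \<bullet> ?p)" by (simp add: SP)
    also have "?b \<bullet> ?q \<bullet> ?p = (?b \<bullet> ?q) \<bullet> ?p"
      by (rule vcomp_assoc[OF dcell_cells[OF dp] dcell_cells[OF d] dcell_cells[OF db], symmetric])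
    also have "?c \<dots> = ?c (?b \<bullet> ?q) \<bullet> ?c ?p"
      by (rule ctx_vcomp[OF cX cY dp dcell_comp[OF d db]])
    finally show ?thesis .
  qed
  moreover have "?c ?a = ctx xs X (l @ bsrc f' @ m') r ((l @ bsrc f' @ m') @ ?w @ r) ((l, f', m' @ ?w @ r) # Y) (swap_cell f m g)"
    using ctx_ctx[OF cX cY sd, of "[]" "bsrc f' @ m'" "[]" "[([], f', m' @ ?w)]"] nt by simp
  moreover have "?c ?p = ctx xs (X @ [(l @ bsrc f' @ m' @ bsrc f @ m, g, r)]) l (m @ btgt g @ r) (l @ (btgt f' @ m' @ btgt f) @ (m @ btgt g @ r)) Y (swap_cell f' m' f)"
    using ctx_ctx[OF cX cY swap_dcell[OF nt(3,1), of m'], of "[?L]" "[]" "m @ btgt g" "[]"] nt by simp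
  moreover have "slide xs ys (X @ swap_tgt (l @ bsrc f' @ m') f m g r @ (l, f', m' @ ?w @ r) # Y) (?c ?SQ) (X @ wdiag l r (([], f', m' @ ?z) # wdiag (btgt f' @ m') [] ?Q) @ Y)"
    using slide_ctx[OF sQ cX cY] by (simp add: wdiag_swap)
  moreover have "slide xs ys (X @ (l @ bsrc f' @ m' @ bsrc f @ m, g, r) # swap_tgt l f' m' f (m @ btgt g @ r) @ Y) (?c (?b \<bullet> ?q)) (X @ wdiag l r (([], f', m' @ ?z) # wdiag (btgt f' @ m') [] ?Q) @ Y)"
  proof -
    have "slide ?R ?R' (swap_src [] f' (m' @ bsrc f @ m) g [] @ wdiag (btgt f' @ m') [] [([], f, m @ btgt g)]) (?b \<bullet> ?q) (([], f', m' @ ?z) # wdiag (btgt f' @ m') [] ?Q)"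
    proof (rule slide_trans)
      show "slide ?R ?R' (swap_src [] f' (m' @ bsrc f @ m) g [] @ wdiag (btgt f' @ m') [] [([], f, m @ btgt g)]) ?q (([], f', m' @ ?z) # wdiag (btgt f' @ m') [] ?P)"
        using slide1_slide[OF sq] by (simp add: swap_src_def swap_tgt_def)
      show "slide ?R ?R' (([], f', m' @ ?z) # wdiag (btgt f' @ m') [] ?P) ?b (([], f', m' @ ?z) # wdiag (btgt f' @ m') [] ?Q)"
        using slide1_slide[OF sb] by simp
    qed
    from slide_ctx[OF this cX cY] show ?thesis by (simp add: swap_src_def swap_tgt_def)
  qed
  ultimately show ?thesis by (metis append.assoc)
qed

end

section \<open>Coherence of interchange\<close>

context diagram_semantics begin

text \<open>Local confluence together with its cells. Two redexes occupy two consecutive layers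
  each, so they coincide, share one layer, or are disjoint. The second case is the critical pair,
  the third is \<open>ctx_commute\<close>.\<close>

lemma slide1_joinable:
  assumes "slide1 xs ys d \<phi> d1" "slide1 xs ys d \<psi> d2"
  shows "\<exists>e \<omega>1 \<omega>2. slide xs ys d1 \<omega>1 e \<and> slide xs ys d2 \<omega>2 e \<and> \<omega>1 \<bullet> \<phi> = \<omega>2 \<bullet> \<psi>"
proof -
  \<comment> \<open>By symmetry the first redex may be assumed to start no higher than the second;
    \<open>Z\<close> will be the piece of diagram between their starting points.\<close>
  have main: "\<exists>e \<omega>1 \<omega>2. slide xs ys (X @ swap_tgt l f m g r @ Y) \<omega>1 e
      \<and> slide xs ys (X' @ swap_tgt l' f' m' g' r' @ Y') \<omega>2 e
      \<and> \<omega>1 \<bullet> ctx xs X l r (l @ (btgt f @ m @ btgt g) @ r) Y (swap_cell f m g)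
        = \<omega>2 \<bullet> ctx xs X' l' r' (l' @ (btgt f' @ m' @ btgt g') @ r') Y' (swap_cell f' m' g')"
    if eq: "X @ swap_src l f m g r @ Y = X' @ swap_src l' f' m' g' r' @ Y'"
    and X: "chain xs X (l @ (bsrc f @ m @ bsrc g) @ r)" "chain (l @ (btgt f @ m @ btgt g) @ r) Y ys" "btgt f \<noteq> []" "btgt g \<noteq> []"
    and X': "chain xs X' (l' @ (bsrc f' @ m' @ bsrc g') @ r')" "chain (l' @ (btgt f' @ m' @ btgt g') @ r') Y' ys" "btgt f' \<noteq> []" "btgt g' \<noteq> []"
    and len: "length X \<le> length X'" for X l f m g r Y X' l' f' m' g' r' Y'
  proof -
    obtain Z where Z: "X' = X @ Z" "swap_src l f m g r @ Y = Z @ swap_src l' f' m' g' r' @ Y'"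
    proof -
      from eq consider us where "X = X' @ us" "us @ swap_src l f m g r @ Y = swap_src l' f' m' g' r' @ Y'"
        | us where "X @ us = X'" "swap_src l f m g r @ Y = us @ swap_src l' f' m' g' r' @ Y'"
        by (auto simp: append_eq_append_conv2[of X])
      then show thesis by cases (use len that in force)+
    qed
    note sd = swap_dcell[OF X(3,4), of m] and sd' = swap_dcell[OF X'(3,4), of m']
    consider "Z = []" | a where "Z = [a]" | a b Z' where "Z = a # b # Z'" by (metis list.exhaust)
    then show ?thesis
    proof cases
      case 1
      then have "X' = X" "l' = l" "f' = f" "m' = m" "g' = g" "r' = r" "Y' = Y" using Z by (auto simp: swap_src_def)
      moreover have "\<exists>\<omega>. slide xs ys (X @ swap_tgt l f m g r @ Y) \<omega> (X @ swap_tgt l f m g r @ Y)"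
        using slide_refl slide1_dcell[OF slide1I[OF X]] by (auto simp: dcell_def)
      ultimately show ?thesis by blast
    next
      case (2 a)
      then have a: "a = (l @ bsrc f @ m, g, r)" and f: "l = l' @ bsrc f' @ m'" "f = g'" "r' = m @ btgt g @ r"
        and Y: "Y = (l', f', m' @ btgt f @ m @ btgt g @ r) # Y'"
        using Z(2) by (auto simp: swap_src_def)
      have "chain xs X (l' @ (bsrc f' @ m' @ bsrc f @ m @ bsrc g) @ r)" using X(1) f by simp
      moreover have "chain (l' @ (btgt f' @ m' @ btgt f @ m @ btgt g) @ r) Y' ys" using X'(2) f by simp
      ultimately show ?thesis
        using slide_joinable_overlap[OF X(3,4) X'(3), of xs X l' m' m r Y' ys] Z(1) 2 a f Y by simp
    next
      case (3 a b Z')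
      then have Z': "Z = swap_src l f m g r @ Z'" "Y = Z' @ swap_src l' f' m' g' r' @ Y'"
        using Z(2) by (auto simp: swap_src_def)
      let ?z = "bsrc f @ m @ bsrc g" and ?w = "btgt f @ m @ btgt g"
      let ?z' = "bsrc f' @ m' @ bsrc g'" and ?w' = "btgt f' @ m' @ btgt g'"
      have cZ: "chain (l @ ?w @ r) Z' (l' @ ?z' @ r')"
        using X(2) Z'(2) by (auto simp: chain_append swap_src_def)
      note cc = ctx_commute[OF sd sd' X(1) cZ X'(2), unfolded wdiag_swap append_Nil append_Nil2]
      have c1: "chain xs (X @ swap_tgt l f m g r @ Z') (l' @ ?z' @ r')"
        using ev_ctx(2)[OF X(1) _ cZ, of "swap_tgt [] f m g []"] sd by (simp add: wdiag_swap dcell_def)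
      have c2: "chain (l @ ?w @ r) (Z' @ swap_tgt l' f' m' g' r' @ Y') ys"
        using ev_ctx(2)[OF cZ _ X'(2), of "swap_tgt [] f' m' g' []"] sd' by (simp add: wdiag_swap dcell_def)
      have s1: "slide xs ys (X @ swap_tgt l f m g r @ Y)
          (ctx xs (X @ swap_tgt l f m g r @ Z') l' r' (l' @ ?w' @ r') Y' (swap_cell f' m' g'))
          (X @ swap_tgt l f m g r @ Z' @ swap_tgt l' f' m' g' r' @ Y')"
        using slide1_slide[OF slide1I[OF c1 X'(2-4)]] Z' by simp
      have s2: "slide xs ys (X' @ swap_tgt l' f' m' g' r' @ Y')
          (ctx xs X l r (l @ ?w @ r) (Z' @ swap_tgt l' f' m' g' r' @ Y') (swap_cell f m g))
          (X @ swap_tgt l f m g r @ Z' @ swap_tgt l' f' m' g' r' @ Y')"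
        using slide1_slide[OF slide1I[OF X(1) c2 X(3,4)]] Z Z' by simp
      show ?thesis using s1 s2 cc unfolding Z(1) Z' by auto
    qed
  qed
  from assms(1) obtain X l f m g r Y where 1:
    "d = X @ swap_src l f m g r @ Y" "d1 = X @ swap_tgt l f m g r @ Y"
    "\<phi> = ctx xs X l r (l @ (btgt f @ m @ btgt g) @ r) Y (swap_cell f m g)"
    "chain xs X (l @ (bsrc f @ m @ bsrc g) @ r)" "chain (l @ (btgt f @ m @ btgt g) @ r) Y ys" "btgt f \<noteq> []" "btgt g \<noteq> []"
    by (auto elim: slide1.cases)
  from assms(2) obtain X' l' f' m' g' r' Y' where 2:
    "d = X' @ swap_src l' f' m' g' r' @ Y'" "d2 = X' @ swap_tgt l' f' m' g' r' @ Y'"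
    "\<psi> = ctx xs X' l' r' (l' @ (btgt f' @ m' @ btgt g') @ r') Y' (swap_cell f' m' g')"
    "chain xs X' (l' @ (bsrc f' @ m' @ bsrc g') @ r')" "chain (l' @ (btgt f' @ m' @ btgt g') @ r') Y' ys" "btgt f' \<noteq> []" "btgt g' \<noteq> []"
    by (auto elim: slide1.cases)
  show ?thesis
  proof (cases "length X \<le> length X'")
    case True
    show ?thesis using main[OF _ 1(4-7) 2(4-7) True] 1(1-3) 2(1-3) by auto
  next
    case False
    then have len: "length X' \<le> length X" by simp
    have e: "X' @ swap_src l' f' m' g' r' @ Y' = X @ swap_src l f m g r @ Y" using 1(1) 2(1) by simp
    from main[OF e 2(4-7) 1(4-7) len] obtain e \<omega>1 \<omega>2 where
      "slide xs ys d2 \<omega>1 e" "slide xs ys d1 \<omega>2 e" "\<omega>1 \<bullet> \<psi> = \<omega>2 \<bullet> \<phi>"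
      using 1(2,3) 2(2,3) by auto
    then show ?thesis by (metis (no_types))
  qed
qed

text \<open>Right widths, read from the last layer, decrease lexicographically under a swap: the layer
  that becomes last is further to the right.\<close>

definition slide_measure :: "diagram \<Rightarrow> nat list" where
  "slide_measure d = map (\<lambda>(l, g, r). length r) (rev d)"

lemma slide1_decreases:
  assumes "slide1 xs ys d \<phi> d'" shows "(slide_measure d', slide_measure d) \<in> lenlex less_than"
  using assms
proof (induction rule: slide1.induct)
  case (slide1I X l f m g r Y)
  let ?A = "map (\<lambda>(l, g, r). length r) (rev Y)" and ?B = "map (\<lambda>(l, g, r). length r) (rev X)"
  \<comment> \<open>Of the two exchanged layers the later one now has only \<open>r\<close> to the
    right of its box, where it had \<open>m\<close>, the output of \<open>g\<close> and
    \<open>r\<close> before. Since \<open>g\<close> has an output, this entry drops strictly,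
    whatever happens to the earlier one.\<close>
  have "(length r # length (m @ bsrc g @ r) # ?B, length (m @ btgt g @ r) # length r # ?B) \<in> lex less_than"
    using slide1I(4) by simp
  then have "(?A @ length r # length (m @ bsrc g @ r) # ?B, ?A @ length (m @ btgt g @ r) # length r # ?B) \<in> lex less_than"
    by (rule lex_append_leftI)
  then show ?case by (simp add: slide_measure_def swap_src_def swap_tgt_def lenlex_conv)
qed

definition slide_normal :: "strand list \<Rightarrow> strand list \<Rightarrow> diagram \<Rightarrow> bool" where
  "slide_normal xs ys d \<longleftrightarrow> chain xs d ys \<and> (\<forall>\<phi> d'. \<not> slide1 xs ys d \<phi> d')"

lemma wf_slide: "wf {(d', d). (slide_measure d', slide_measure d) \<in> lenlex less_than}"
  using wf_inv_image[OF wf_lenlex[OF wf_less_than], of slide_measure] by (simp add: inv_image_def)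

lemma slide_normal_exists:
  assumes "chain xs d ys" shows "\<exists>\<phi> e. slide xs ys d \<phi> e \<and> slide_normal xs ys e"
  using assms
proof (induction d rule: wf_induct_rule[OF wf_slide])
  case (1 d)
  show ?case
  proof (cases "slide_normal xs ys d")
    case True then show ?thesis using slide_refl 1(2) by blast
  next
    case False
    then obtain \<phi> d' where s: "slide1 xs ys d \<phi> d'" using 1(2) by (auto simp: slide_normal_def)
    then have "chain xs d' ys" using slide1_dcell by (auto simp: dcell_def)
    then show ?thesis using 1(1)[of d'] slide1_decreases[OF s] slide_step[OF s] by blast
  qed
qed

text \<open>Newman's lemma for cells: \<open>slide1_joinable\<close> supplies commuting squares and
  not merely common reducts, so the induction that gives unique normal forms also shows that all
  reductions to them carry the same 2-cell.\<close>

lemma slide_normal_unique: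
  assumes "slide xs ys d \<phi> e" "slide_normal xs ys e" "slide xs ys d \<psi> e'" "slide_normal xs ys e'"
  shows "e = e' \<and> \<phi> = \<psi>"
  using assms
proof (induction d arbitrary: \<phi> e \<psi> e' rule: wf_induct_rule[OF wf_slide])
  case (1 d)
  show ?case
  proof (cases "slide_normal xs ys d")
    case True
    then have "e = d \<and> \<phi> = id2 V (ev xs d)" "e' = d \<and> \<psi> = id2 V (ev xs d)"
      using 1(2,4) by (auto elim: slide.cases simp: slide_normal_def)
    then show ?thesis by simp
  next
    case False
    obtain d1 \<phi>1 \<phi>' where a: "slide1 xs ys d \<phi>1 d1" "slide xs ys d1 \<phi>' e" "\<phi> = \<phi>' \<bullet> \<phi>1"
      using 1(2,3) False by (auto elim: slide.cases)
    obtain d2 \<psi>1 \<psi>' where b: "slide1 xs ys d \<psi>1 d2" "slide xs ys d2 \<psi>' e'" "\<psi> = \<psi>' \<bullet> \<psi>1"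
      using 1(4,5) False by (auto elim: slide.cases)
    obtain p \<omega>1 \<omega>2 where p: "slide xs ys d1 \<omega>1 p" "slide xs ys d2 \<omega>2 p" "\<omega>1 \<bullet> \<phi>1 = \<omega>2 \<bullet> \<psi>1"
      using slide1_joinable[OF a(1) b(1)] by blast
    have "chain xs p ys" using slide_dcell[OF p(1)] by (simp add: dcell_def)
    then obtain n \<chi> where n: "slide xs ys p \<chi> n" "slide_normal xs ys n" using slide_normal_exists by blast
    have "e = n \<and> \<phi>' = \<chi> \<bullet> \<omega>1"
      using 1(1)[OF _ a(2) 1(3) slide_trans[OF p(1) n(1)] n(2)] slide1_decreases[OF a(1)] by simp
    moreover have "e' = n \<and> \<psi>' = \<chi> \<bullet> \<omega>2"
      using 1(1)[OF _ b(2) 1(5) slide_trans[OF p(2) n(1)] n(2)] slide1_decreases[OF b(1)] by simp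
    moreover have "(\<chi> \<bullet> \<omega>1) \<bullet> \<phi>1 = \<chi> \<bullet> (\<omega>1 \<bullet> \<phi>1)" "(\<chi> \<bullet> \<omega>2) \<bullet> \<psi>1 = \<chi> \<bullet> (\<omega>2 \<bullet> \<psi>1)"
      using vcomp_assoc slide1_dcell[OF a(1), THEN dcell_cells] slide1_dcell[OF b(1), THEN dcell_cells]
        slide_dcell[OF p(1), THEN dcell_cells] slide_dcell[OF p(2), THEN dcell_cells] slide_dcell[OF n(1), THEN dcell_cells]
      by blast+
    ultimately show ?thesis using a(3) b(3) p(3) by simp
  qed
qed

text \<open>By confluence there is at most one such \<open>\<phi>\<close>, the coherence cell between diagrams that differ by interchange.\<close>

definition ich :: "strand list \<Rightarrow> strand list \<Rightarrow> diagram \<Rightarrow> 't \<Rightarrow> diagram \<Rightarrow> bool" where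
  "ich xs ys d \<phi> d' \<longleftrightarrow> (\<exists>e a b. slide xs ys d a e \<and> slide xs ys d' b e \<and> \<phi> = inv2 V b \<bullet> a)"

lemma ich_dcell: "ich xs ys d \<phi> d' \<Longrightarrow> dcell xs ys d \<phi> d'"
  unfolding ich_def by (auto intro: dcell_comp[OF slide_dcell dcell_inv[OF slide_dcell]])

text \<open>Prolonging both legs by a reduction \<open>c\<close> of the common reduct changes
  nothing, since \<open>c\<close> cancels against its inverse. With a normal reduct the legs are
  unique, on which \<open>ich_unique\<close> and \<open>ich_trans\<close> rest.\<close>

lemma ich_normal:
  "ich xs ys d \<phi> d' \<longleftrightarrow>
    (\<exists>e a b. slide xs ys d a e \<and> slide xs ys d' b e \<and> slide_normal xs ys e \<and> \<phi> = inv2 V b \<bullet> a)"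
proof
  assume "ich xs ys d \<phi> d'"
  then obtain e a b where e: "slide xs ys d a e" "slide xs ys d' b e" "\<phi> = inv2 V b \<bullet> a"
    unfolding ich_def by blast
  then have "chain xs e ys" using slide_dcell by (auto simp: dcell_def)
  then obtain n c where n: "slide xs ys e c n" "slide_normal xs ys n" using slide_normal_exists by blast
  note s = e(1,2)[THEN slide_dcell] slide_dcell[OF n(1)]
  then have i: "a \<in> iso_cells V (ev xs d) (ev xs e)" "b \<in> iso_cells V (ev xs d') (ev xs e)" "c \<in> iso_cells V (ev xs e) (ev xs n)"
    by (auto simp: dcell_def)
  note i' = i[THEN iso_cells_cells] i[THEN inv2_in, THEN iso_cells_cells]
  have "inv2 V (c \<bullet> b) \<bullet> (c \<bullet> a) = (inv2 V b \<bullet> inv2 V c) \<bullet> (c \<bullet> a)"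
    by (simp add: vcomp_iso(2)[OF i(2,3)])
  also have "\<dots> = inv2 V b \<bullet> (inv2 V c \<bullet> (c \<bullet> a))"
    by (rule vcomp_assoc[OF vcomp_in[OF i'(1,3)] i'(6,5)])
  also have "inv2 V c \<bullet> (c \<bullet> a) = a"
    using vcomp_assoc[OF i'(1,3,6)] inv2_left[OF i(3)] vcomp_idL[OF i'(1)] by simp
  finally show "\<exists>e a b. slide xs ys d a e \<and> slide xs ys d' b e \<and> slide_normal xs ys e \<and> \<phi> = inv2 V b \<bullet> a"
    using slide_trans[OF e(1) n(1)] slide_trans[OF e(2) n(1)] n(2) e(3) by metis
qed (auto simp: ich_def)

text \<open>The coherence theorem for interchange: both cells are built from the unique reductions
  of \<open>d\<close> and \<open>d'\<close> to their common normal form.\<close>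

theorem ich_unique:
  assumes "ich xs ys d \<phi> d'" "ich xs ys d \<psi> d'" shows "\<phi> = \<psi>"
  using assms slide_normal_unique unfolding ich_normal by metis

lemma slide_ich:
  assumes "slide xs ys d \<phi> d'" shows "ich xs ys d \<phi> d'"
proof -
  have c: "chain xs d' ys" using slide_dcell[OF assms] by (simp add: dcell_def)
  have "inv2 V (id2 V (ev xs d')) \<bullet> \<phi> = \<phi>"
    using id2_iso(2)[OF hom_Arr[OF ev_in[OF c]]] vcomp_idL[OF dcell_cells[OF slide_dcell[OF assms]]] by simp
  then show ?thesis unfolding ich_def using assms slide_refl[OF c] by metis
qed

lemma ich_refl: "chain xs d ys \<Longrightarrow> ich xs ys d (id2 V (ev xs d)) d"
  using slide_ich slide_refl by blast

lemma ich_sym: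
  assumes "ich xs ys d \<phi> d'" shows "ich xs ys d' (inv2 V \<phi>) d"
proof -
  from assms obtain e a b where e: "slide xs ys d a e" "slide xs ys d' b e" "\<phi> = inv2 V b \<bullet> a"
    unfolding ich_def by blast
  then have i: "a \<in> iso_cells V (ev xs d) (ev xs e)" "b \<in> iso_cells V (ev xs d') (ev xs e)"
    using slide_dcell by (auto simp: dcell_def)
  have "inv2 V \<phi> = inv2 V a \<bullet> b"
    unfolding e(3) using vcomp_iso(2)[OF i(1) inv2_in[OF i(2)]] inv2_inv2[OF i(2)] by simp
  then show ?thesis unfolding ich_def using e by blast
qed

text \<open>The two zigzags meet in \<open>d'\<close>, whose reductions to normal form agree and
  cancel.\<close>

lemma ich_trans:
  assumes "ich xs ys d \<phi> d'" "ich xs ys d' \<psi> d''" shows "ich xs ys d (\<psi> \<bullet> \<phi>) d''"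
proof -
  from assms obtain e a b e' a' b' where e: "slide xs ys d a e" "slide xs ys d' b e" "\<phi> = inv2 V b \<bullet> a" "slide_normal xs ys e"
    and e': "slide xs ys d' a' e'" "slide xs ys d'' b' e'" "\<psi> = inv2 V b' \<bullet> a'" "slide_normal xs ys e'"
    unfolding ich_normal by blast
  have s: "e' = e" "a' = b" using slide_normal_unique[OF e(2,4) e'(1,4)] by auto
  have i: "a \<in> iso_cells V (ev xs d) (ev xs e)" "b \<in> iso_cells V (ev xs d') (ev xs e)" "b' \<in> iso_cells V (ev xs d'') (ev xs e)"
    using e(1,2) e'(2) slide_dcell s by (auto simp: dcell_def)
  note i' = i[THEN iso_cells_cells] i[THEN inv2_in, THEN iso_cells_cells]
  have "\<psi> \<bullet> \<phi> = inv2 V b' \<bullet> (b \<bullet> (inv2 V b \<bullet> a))"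
    unfolding e'(3) e(3) s(2) by (rule vcomp_assoc[OF vcomp_in[OF i'(1,5)] i'(2,6)])
  also have "b \<bullet> (inv2 V b \<bullet> a) = a"
    using vcomp_assoc[OF i'(1,5,2)] inv2_right[OF i(2)] vcomp_idL[OF i'(1)] by simp
  finally show ?thesis unfolding ich_def using e(1) e'(2) s(1) by blast
qed

lemma ich_ctx:
  assumes "ich zs ws P \<phi> Q" "chain xs X (l @ zs @ r)" "chain (l @ ws @ r) Y ys"
  shows "ich xs ys (X @ wdiag l r P @ Y) (ctx xs X l r (l @ ws @ r) Y \<phi>) (X @ wdiag l r Q @ Y)"
proof -
  from assms obtain e a b where e: "slide zs ws P a e" "slide zs ws Q b e" "\<phi> = inv2 V b \<bullet> a"
    unfolding ich_def by blast
  have "ctx xs X l r (l @ ws @ r) Y \<phi> = inv2 V (ctx xs X l r (l @ ws @ r) Y b) \<bullet> ctx xs X l r (l @ ws @ r) Y a"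
    unfolding e(3) using ctx_vcomp[OF assms(2,3) slide_dcell[OF e(1)] dcell_inv[OF slide_dcell[OF e(2)]]]
      ctx_dcell(2)[OF assms(2,3) slide_dcell[OF e(2)]] by simp
  then show ?thesis unfolding ich_def using slide_ctx[OF e(1) assms(2,3)] slide_ctx[OF e(2) assms(2,3)] by blast
qed

end

section \<open>Paths of structural cells\<close>

text \<open>One name for each kind of structural 2-cell of B, C and the braiding.
  \<open>NatL\<close> and \<open>NatR\<close> are pseudonaturality cells at a single whiskered box.
  \<open>TrivR\<close> and \<open>TrivL\<close> erase a braiding with the unit object, which is an
  identity as a 1-cell but still a box in a diagram.\<close>

datatype rule =
    AssB nat nat nat nat | AssC nat nat nat nat
  | LeftB nat nat | LeftC nat nat | RightB nat nat | RightC nat nat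
  | NatL "strand list" box "strand list" "strand list"
  | NatR "strand list" "strand list" box "strand list"
  | HexS "strand list" "strand list" "strand list"
  | HexR "strand list" "strand list" "strand list"
  | TrivR "strand list" | TrivL "strand list"

fun rdom :: "rule \<Rightarrow> strand list" where
  "rdom (AssB i j k l) = [SB k l, SB j k, SB i j]"
| "rdom (AssC i j k l) = [SC k l, SC j k, SC i j]"
| "rdom (LeftB i j) = [SB i j]"
| "rdom (LeftC i j) = [SC i j]"
| "rdom (RightB i j) = [SB i j]"
| "rdom (RightC i j) = [SC i j]"
| "rdom (NatL l g r bs) = l @ bsrc g @ r @ bs"
| "rdom (NatR as l g r) = as @ l @ bsrc g @ r"
| "rdom (HexS as bs cs) = as @ bs @ cs"
| "rdom (HexR as bs cs) = as @ bs @ cs"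
| "rdom (TrivR as) = as"
| "rdom (TrivL as) = as"

fun rcod :: "rule \<Rightarrow> strand list" where
  "rcod (AssB i j k l) = [SB i l]"
| "rcod (AssC i j k l) = [SC i l]"
| "rcod (LeftB i j) = [SB i j]"
| "rcod (LeftC i j) = [SC i j]"
| "rcod (RightB i j) = [SB i j]"
| "rcod (RightC i j) = [SC i j]"
| "rcod (NatL l g r bs) = bs @ l @ btgt g @ r"
| "rcod (NatR as l g r) = l @ btgt g @ r @ as"
| "rcod (HexS as bs cs) = cs @ as @ bs"
| "rcod (HexR as bs cs) = bs @ cs @ as"
| "rcod (TrivR as) = as"
| "rcod (TrivL as) = as"

fun rsrc :: "rule \<Rightarrow> diagram" where
  "rsrc (AssB i j k l) = [([], MB j k l, [SB i j]), ([], MB i j l, [])]"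
| "rsrc (AssC i j k l) = [([], MC j k l, [SC i j]), ([], MC i j l, [])]"
| "rsrc (LeftB i j) = [([], UB j, [SB i j]), ([], MB i j j, [])]"
| "rsrc (LeftC i j) = [([], UC j, [SC i j]), ([], MC i j j, [])]"
| "rsrc (RightB i j) = [([SB i j], UB i, []), ([], MB i i j, [])]"
| "rsrc (RightC i j) = [([SC i j], UC i, []), ([], MC i i j, [])]"
| "rsrc (NatL l g r bs) = [([], Cr (l @ bsrc g @ r) bs, []), (bs @ l, g, r)]"
| "rsrc (NatR as l g r) = [([], Cr as (l @ bsrc g @ r), []), (l, g, r @ as)]"
| "rsrc (HexS as bs cs) = [([], Cr (as @ bs) cs, [])]"
| "rsrc (HexR as bs cs) = [([], Cr as (bs @ cs), [])]"
| "rsrc (TrivR as) = [([], Cr as [], [])]"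
| "rsrc (TrivL as) = [([], Cr [] as, [])]"

fun rtgt :: "rule \<Rightarrow> diagram" where
  "rtgt (AssB i j k l) = [([SB k l], MB i j k, []), ([], MB i k l, [])]"
| "rtgt (AssC i j k l) = [([SC k l], MC i j k, []), ([], MC i k l, [])]"
| "rtgt (LeftB i j) = []"
| "rtgt (LeftC i j) = []"
| "rtgt (RightB i j) = []"
| "rtgt (RightC i j) = []"
| "rtgt (NatL l g r bs) = [(l, g, r @ bs), ([], Cr (l @ btgt g @ r) bs, [])]"
| "rtgt (NatR as l g r) = [(as @ l, g, r), ([], Cr as (l @ btgt g @ r), [])]"
| "rtgt (HexS as bs cs) = [(as, Cr bs cs, []), ([], Cr as cs, bs)]"
| "rtgt (HexR as bs cs) = [([], Cr as bs, cs), (bs, Cr as cs, [])]"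
| "rtgt (TrivR as) = []"
| "rtgt (TrivL as) = []"

text \<open>Besides matching the boundaries of the two sides, this excludes instances containing a
  box without output, such as the braiding of two empty lists.\<close>

definition rok :: "rule \<Rightarrow> bool" where
  "rok \<rho> \<longleftrightarrow> chain (rdom \<rho>) (rsrc \<rho>) (rcod \<rho>) \<and> chain (rdom \<rho>) (rtgt \<rho>) (rcod \<rho>)"

text \<open>\<open>Step X l \<rho> b r Y\<close> applies the rule \<open>\<rho>\<close>, backwards if \<open>\<not> b\<close>, after the layers \<open>X\<close> and before \<open>Y\<close>, with
  strands \<open>l\<close> to its left and \<open>r\<close> to its right.\<close>

datatype step = Step diagram "strand list" rule bool "strand list" diagram

definition psrc :: "rule \<Rightarrow> bool \<Rightarrow> diagram" where "psrc \<rho> b = (if b then rsrc \<rho> else rtgt \<rho>)"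
definition ptgt :: "rule \<Rightarrow> bool \<Rightarrow> diagram" where "ptgt \<rho> b = (if b then rtgt \<rho> else rsrc \<rho>)"

fun ssrc :: "step \<Rightarrow> diagram" where "ssrc (Step X l \<rho> b r Y) = X @ wdiag l r (psrc \<rho> b) @ Y"
fun stgt :: "step \<Rightarrow> diagram" where "stgt (Step X l \<rho> b r Y) = X @ wdiag l r (ptgt \<rho> b) @ Y"

fun sinv :: "step \<Rightarrow> step" where "sinv (Step X l \<rho> b r Y) = Step X l \<rho> (\<not> b) r Y"

fun sok :: "strand list \<Rightarrow> strand list \<Rightarrow> step \<Rightarrow> bool" where
  "sok xs ys (Step X l \<rho> b r Y) \<longleftrightarrow>
     chain xs X (l @ rdom \<rho> @ r) \<and> chain (l @ rcod \<rho> @ r) Y ys \<and> rok \<rho>"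

fun wstep :: "diagram \<Rightarrow> strand list \<Rightarrow> strand list \<Rightarrow> diagram \<Rightarrow> step \<Rightarrow> step" where
  "wstep X l r Y (Step X' l' \<rho> b r' Y') = Step (X @ wdiag l r X') (l @ l') \<rho> b (r' @ r) (wdiag l r Y' @ Y)"

abbreviation wpath :: "diagram \<Rightarrow> strand list \<Rightarrow> strand list \<Rightarrow> diagram \<Rightarrow> step list \<Rightarrow> step list" where
  "wpath X l r Y \<equiv> map (wstep X l r Y)"

text \<open>Only the types of the structural cells are assumed; equations between them are supplied
  later, as tiles.\<close>

locale diagram_rules = diagram_semantics V ob bx
  for V :: "('o, 'f, 't, 'm) gray_scheme" (structure) and ob :: "strand \<Rightarrow> 'o" and bx :: "box \<Rightarrow> 'f" +
  fixes rc :: "rule \<Rightarrow> 't"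
  assumes rc_in: "rok \<rho> \<Longrightarrow> rc \<rho> \<in> iso_cells V (ev (rdom \<rho>) (rsrc \<rho>)) (ev (rdom \<rho>) (rtgt \<rho>))"
begin

definition rcell :: "rule \<Rightarrow> bool \<Rightarrow> 't" where
  "rcell \<rho> b = (if b then rc \<rho> else inv2 V (rc \<rho>))"

lemma rcell_dcell: "rok \<rho> \<Longrightarrow> dcell (rdom \<rho>) (rcod \<rho>) (psrc \<rho> b) (rcell \<rho> b) (ptgt \<rho> b)"
  using rc_in inv2_in by (auto simp: dcell_def rok_def psrc_def ptgt_def rcell_def)

fun scell :: "strand list \<Rightarrow> step \<Rightarrow> 't" where
  "scell xs (Step X l \<rho> b r Y) = ctx xs X l r (l @ rcod \<rho> @ r) Y (rcell \<rho> b)"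

lemma scell_dcell: "sok xs ys \<sigma> \<Longrightarrow> dcell xs ys (ssrc \<sigma>) (scell xs \<sigma>) (stgt \<sigma>)"
  by (cases \<sigma>) (use ctx_dcell(1) rcell_dcell in auto)

lemma sinv_simps: "sok xs ys (sinv \<sigma>) = sok xs ys \<sigma>" "ssrc (sinv \<sigma>) = stgt \<sigma>" "stgt (sinv \<sigma>) = ssrc \<sigma>"
  by (cases \<sigma>; simp add: psrc_def ptgt_def)+

lemma scell_sinv:
  assumes "sok xs ys \<sigma>" shows "scell xs (sinv \<sigma>) = inv2 V (scell xs \<sigma>)"
proof (cases \<sigma>)
  case (Step X l \<rho> b r Y)
  with assms have c: "chain xs X (l @ rdom \<rho> @ r)" "chain (l @ rcod \<rho> @ r) Y ys" "rok \<rho>" by auto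
  have "inv2 V (rcell \<rho> b) = rcell \<rho> (\<not> b)"
    using inv2_inv2[OF rc_in[OF c(3)]] by (simp add: rcell_def)
  then show ?thesis using Step ctx_dcell(2)[OF c(1,2) rcell_dcell[OF c(3)]] by simp
qed

text \<open>\<open>\<phi>\<close> is the composite of the steps of the path, with coherence cells of interchange inserted between
  consecutive steps.\<close>

primrec pc :: "strand list \<Rightarrow> strand list \<Rightarrow> diagram \<Rightarrow> step list \<Rightarrow> diagram \<Rightarrow> 't \<Rightarrow> bool" where
  "pc xs ys d [] e \<phi> \<longleftrightarrow> ich xs ys d \<phi> e"
| "pc xs ys d (\<sigma> # p) e \<phi> \<longleftrightarrow> sok xs ys \<sigma> \<and> (\<exists>\<psi> \<chi>. ich xs ys d \<psi> (ssrc \<sigma>) \<and>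
     pc xs ys (stgt \<sigma>) p e \<chi> \<and> \<phi> = \<chi> \<bullet> scell xs \<sigma> \<bullet> \<psi>)"

lemma pc_dcell: "pc xs ys d p e \<phi> \<Longrightarrow> dcell xs ys d \<phi> e"
  by (induction p arbitrary: d \<phi>) (auto intro: ich_dcell dcell_comp scell_dcell)

text \<open>By \<open>ich_unique\<close> each gap admits only one cell. Hence two composites are
  equal as soon as they are values of the same list of steps between the same ends.\<close>

lemma pc_unique: "pc xs ys d p e \<phi> \<Longrightarrow> pc xs ys d p e \<psi> \<Longrightarrow> \<phi> = \<psi>"
  by (induction p arbitrary: d \<phi> \<psi>) (use ich_unique in \<open>auto, metis\<close>)

lemma vassoc:
  "dcell xs ys a \<phi> b \<Longrightarrow> dcell xs ys b \<psi> c \<Longrightarrow> dcell xs ys c \<chi> d \<Longrightarrow> (\<chi> \<bullet> \<psi>) \<bullet> \<phi> = \<chi> \<bullet> \<psi> \<bullet> \<phi>"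
  using vcomp_assoc dcell_cells by blast

lemma vid:
  "dcell xs ys a \<phi> b \<Longrightarrow> \<phi> \<bullet> id2 V (ev xs a) = \<phi>" "dcell xs ys a \<phi> b \<Longrightarrow> id2 V (ev xs b) \<bullet> \<phi> = \<phi>"
  using vcomp_idL vcomp_idR dcell_cells by blast+

lemma vinv:
  "dcell xs ys a \<phi> b \<Longrightarrow> inv2 V \<phi> \<bullet> \<phi> = id2 V (ev xs a)" "dcell xs ys a \<phi> b \<Longrightarrow> \<phi> \<bullet> inv2 V \<phi> = id2 V (ev xs b)"
  using inv2_left inv2_right by (auto simp: dcell_def)

lemma pc_pre:
  assumes "ich xs ys c \<psi> d" "pc xs ys d p e \<phi>" shows "pc xs ys c p e (\<phi> \<bullet> \<psi>)"
proof (cases p)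
  case Nil then show ?thesis using ich_trans assms by simp
next
  case (Cons \<sigma> q)
  with assms(2) obtain \<omega> \<chi> where s: "sok xs ys \<sigma>" "ich xs ys d \<omega> (ssrc \<sigma>)" "pc xs ys (stgt \<sigma>) q e \<chi>"
    "\<phi> = \<chi> \<bullet> scell xs \<sigma> \<bullet> \<omega>" by auto
  note t = ich_dcell[OF assms(1)] ich_dcell[OF s(2)] scell_dcell[OF s(1)] pc_dcell[OF s(3)]
  have "\<phi> \<bullet> \<psi> = \<chi> \<bullet> (scell xs \<sigma> \<bullet> \<omega>) \<bullet> \<psi>"
    unfolding s(4) by (rule vassoc[OF t(1) dcell_comp[OF t(2,3)] t(4)])
  also have "(scell xs \<sigma> \<bullet> \<omega>) \<bullet> \<psi> = scell xs \<sigma> \<bullet> \<omega> \<bullet> \<psi>" by (rule vassoc[OF t(1-3)])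
  finally show ?thesis using Cons s ich_trans[OF assms(1) s(2)] by auto
qed

lemma pc_append:
  "pc xs ys d (p @ q) e \<phi> \<longleftrightarrow> (\<exists>c \<chi> \<psi>. pc xs ys d p c \<psi> \<and> pc xs ys c q e \<chi> \<and> \<phi> = \<chi> \<bullet> \<psi>)"
proof (induction p arbitrary: d \<phi>)
  case Nil
  show ?case
  proof
    assume a: "pc xs ys d ([] @ q) e \<phi>"
    then have "chain xs d ys" using pc_dcell by (auto simp: dcell_def)
    moreover have "\<phi> = \<phi> \<bullet> id2 V (ev xs d)" using vid(1)[OF pc_dcell[OF a]] by simp
    ultimately show "\<exists>c \<chi> \<psi>. pc xs ys d [] c \<psi> \<and> pc xs ys c q e \<chi> \<and> \<phi> = \<chi> \<bullet> \<psi>"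
      using a ich_refl unfolding append_Nil pc.simps(1) by blast
  qed (use pc_pre in auto)
next
  case (Cons \<sigma> p)
  have "pc xs ys d ((\<sigma> # p) @ q) e \<phi> \<longleftrightarrow> sok xs ys \<sigma> \<and> (\<exists>\<omega> c \<chi> \<psi>. ich xs ys d \<omega> (ssrc \<sigma>) \<and>
      pc xs ys (stgt \<sigma>) p c \<psi> \<and> pc xs ys c q e \<chi> \<and> \<phi> = (\<chi> \<bullet> \<psi>) \<bullet> scell xs \<sigma> \<bullet> \<omega>)"
    unfolding append_Cons pc.simps Cons.IH by metis
  also have "\<dots> \<longleftrightarrow> sok xs ys \<sigma> \<and> (\<exists>\<omega> c \<chi> \<psi>. ich xs ys d \<omega> (ssrc \<sigma>) \<and>
      pc xs ys (stgt \<sigma>) p c \<psi> \<and> pc xs ys c q e \<chi> \<and> \<phi> = \<chi> \<bullet> \<psi> \<bullet> scell xs \<sigma> \<bullet> \<omega>)"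
    using vassoc[OF dcell_comp[OF ich_dcell scell_dcell] pc_dcell pc_dcell] by metis
  also have "\<dots> \<longleftrightarrow> (\<exists>c \<chi> \<psi>. pc xs ys d (\<sigma> # p) c \<psi> \<and> pc xs ys c q e \<chi> \<and> \<phi> = \<chi> \<bullet> \<psi>)"
    unfolding pc.simps by metis
  finally show ?case .
qed

lemma pc_post:
  assumes "pc xs ys d p c \<phi>" "ich xs ys c \<psi> e" shows "pc xs ys d p e (\<psi> \<bullet> \<phi>)"
proof -
  have "pc xs ys d (p @ []) e (\<psi> \<bullet> \<phi>)" unfolding pc_append using assms by auto
  then show ?thesis by simp
qed

lemma pc_step:
  assumes "sok xs ys \<sigma>" shows "pc xs ys (ssrc \<sigma>) [\<sigma>] (stgt \<sigma>) (scell xs \<sigma>)"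
proof -
  note d = scell_dcell[OF assms]
  have "ich xs ys (ssrc \<sigma>) (id2 V (ev xs (ssrc \<sigma>))) (ssrc \<sigma>)" "ich xs ys (stgt \<sigma>) (id2 V (ev xs (stgt \<sigma>))) (stgt \<sigma>)"
    using d ich_refl by (auto simp: dcell_def)
  moreover have "scell xs \<sigma> = id2 V (ev xs (stgt \<sigma>)) \<bullet> scell xs \<sigma> \<bullet> id2 V (ev xs (ssrc \<sigma>))"
    using vid[OF d] by simp
  ultimately show ?thesis using assms unfolding pc.simps by blast
qed

lemma wstep_simps:
  "ssrc (wstep X l r Y \<sigma>) = X @ wdiag l r (ssrc \<sigma>) @ Y" "stgt (wstep X l r Y \<sigma>) = X @ wdiag l r (stgt \<sigma>) @ Y"
  by (cases \<sigma>; simp add: wdiag_wdiag[symmetric])+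

lemma wstep_cell:
  assumes "sok zs ws \<sigma>" "chain xs X (l @ zs @ r)" "chain (l @ ws @ r) Y ys"
  shows "sok xs ys (wstep X l r Y \<sigma>)" "scell xs (wstep X l r Y \<sigma>) = ctx xs X l r (l @ ws @ r) Y (scell zs \<sigma>)"
proof -
  obtain X' l' \<rho> b r' Y' where s: "\<sigma> = Step X' l' \<rho> b r' Y'" by (cases \<sigma>)
  with assms have c: "chain zs X' (l' @ rdom \<rho> @ r')" "chain (l' @ rcod \<rho> @ r') Y' ws" "rok \<rho>" by auto
  show "sok xs ys (wstep X l r Y \<sigma>)"
    using s c(3) chain_wdiag[OF c(1), of l r] chain_wdiag[OF c(2), of l r] assms(2,3) by (auto simp: chain_append)
  show "scell xs (wstep X l r Y \<sigma>) = ctx xs X l r (l @ ws @ r) Y (scell zs \<sigma>)"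
    using s ctx_ctx[OF assms(2,3) rcell_dcell[OF c(3)] c(1,2)] by simp
qed

lemma pc_ctx:
  assumes "pc zs ws d p e \<phi>" "chain xs X (l @ zs @ r)" "chain (l @ ws @ r) Y ys"
  shows "pc xs ys (X @ wdiag l r d @ Y) (wpath X l r Y p) (X @ wdiag l r e @ Y) (ctx xs X l r (l @ ws @ r) Y \<phi>)"
  using assms(1)
proof (induction p arbitrary: d \<phi>)
  case Nil then show ?case using ich_ctx[OF _ assms(2,3)] by simp
next
  case (Cons \<sigma> p)
  then obtain \<psi> \<chi> where s: "sok zs ws \<sigma>" "ich zs ws d \<psi> (ssrc \<sigma>)" "pc zs ws (stgt \<sigma>) p e \<chi>" "\<phi> = \<chi> \<bullet> scell zs \<sigma> \<bullet> \<psi>"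
    by auto
  note t = ich_dcell[OF s(2)] scell_dcell[OF s(1)] pc_dcell[OF s(3)]
  show ?case
    using Cons.IH[OF s(3)] ich_ctx[OF s(2) assms(2,3)] wstep_cell[OF s(1) assms(2,3)]
      ctx_vcomp[OF assms(2,3) dcell_comp[OF t(1,2)] t(3)] ctx_vcomp[OF assms(2,3) t(1,2)] s(4)
    by (auto simp: wstep_simps)
qed

text \<open>A nonempty path fixes its ends up to interchange: both sources are joined to the source
  of its first step, both targets to the target of its last. For the empty path the two pairs of
  ends could be unrelated.\<close>

lemma pc_transfer:
  assumes "pc xs ys d p e \<phi>" "pc xs ys d' p e' \<phi>'" "p \<noteq> []"
  shows "\<exists>\<psi> \<chi>. ich xs ys d \<psi> d' \<and> ich xs ys e' \<chi> e \<and> \<phi> = \<chi> \<bullet> \<phi>' \<bullet> \<psi>"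
proof -
  have post: "\<exists>\<omega>. ich xs ys e' \<omega> e \<and> \<chi> = \<omega> \<bullet> \<chi>'"
    if "pc xs ys d p e \<chi>" "pc xs ys d p e' \<chi>'" for d p \<chi> \<chi>'
    using that
  proof (induction p arbitrary: d \<chi> \<chi>')
    case Nil
    then have i: "ich xs ys d \<chi> e" "ich xs ys d \<chi>' e'" by auto
    note j = ich_trans[OF ich_sym[OF i(2)] i(1)]
    show ?case using j ich_unique[OF i(1) ich_trans[OF i(2) j]] by blast
  next
    case (Cons \<sigma> p)
    then obtain \<psi> \<zeta> \<psi>' \<zeta>' where a: "sok xs ys \<sigma>" "ich xs ys d \<psi> (ssrc \<sigma>)" "pc xs ys (stgt \<sigma>) p e \<zeta>" "\<chi> = \<zeta> \<bullet> scell xs \<sigma> \<bullet> \<psi>"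
      "ich xs ys d \<psi>' (ssrc \<sigma>)" "pc xs ys (stgt \<sigma>) p e' \<zeta>'" "\<chi>' = \<zeta>' \<bullet> scell xs \<sigma> \<bullet> \<psi>'" by auto
    from Cons.IH[OF a(3,6)] obtain \<omega> where w: "ich xs ys e' \<omega> e" "\<zeta> = \<omega> \<bullet> \<zeta>'" by blast
    show ?case
      using w a ich_unique[OF a(2,5)] vassoc[OF dcell_comp[OF ich_dcell[OF a(2)] scell_dcell[OF a(1)]] pc_dcell[OF a(6)] ich_dcell[OF w(1)]]
      by auto
  qed
  from assms(3) obtain \<sigma> q where p: "p = \<sigma> # q" by (cases p) auto
  with assms(1,2) obtain \<psi> \<psi>' where i: "ich xs ys d \<psi> (ssrc \<sigma>)" "ich xs ys d' \<psi>' (ssrc \<sigma>)" by auto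
  note j = ich_trans[OF i(1) ich_sym[OF i(2)]]
  from post[OF assms(1) pc_pre[OF j assms(2)]] j show ?thesis by blast
qed

definition peq :: "strand list \<Rightarrow> strand list \<Rightarrow> step list \<Rightarrow> step list \<Rightarrow> bool" where
  "peq xs ys p q \<longleftrightarrow> (\<forall>d e \<phi>. pc xs ys d p e \<phi> \<longrightarrow> pc xs ys d q e \<phi>)"

lemma peq_append: "peq xs ys p q \<Longrightarrow> peq xs ys (u @ p @ v) (u @ q @ v)"
  unfolding peq_def pc_append by metis

text \<open>The equation is witnessed at a single source diagram; by \<open>tile_peq\<close> it then
  permits replacement between arbitrary ends, provided that the replaced path is nonempty.\<close>

definition tile :: "strand list \<Rightarrow> strand list \<Rightarrow> diagram \<Rightarrow> step list \<Rightarrow> step list \<Rightarrow> bool" where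
  "tile xs ys d p q \<longleftrightarrow> (\<exists>e \<phi>. pc xs ys d p e \<phi> \<and> pc xs ys d q e \<phi>)"

lemma tile_sym: "tile xs ys d p q \<Longrightarrow> tile xs ys d q p"
  unfolding tile_def by blast

lemma tile_peq:
  assumes "tile xs ys d p q" "p \<noteq> []" shows "peq xs ys p q"
  unfolding peq_def
proof (intro allI impI)
  fix d' e' \<phi>' assume a: "pc xs ys d' p e' \<phi>'"
  from assms(1) obtain e \<phi> where t: "pc xs ys d p e \<phi>" "pc xs ys d q e \<phi>" unfolding tile_def by blast
  from pc_transfer[OF a t(1) assms(2)] obtain \<psi> \<chi> where i: "ich xs ys d' \<psi> d" "ich xs ys e \<chi> e'" "\<phi>' = \<chi> \<bullet> \<phi> \<bullet> \<psi>"
    by blast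
  show "pc xs ys d' q e' \<phi>'" using pc_post[OF pc_pre[OF i(1) t(2)] i(2)] i(3) by simp
qed

lemma tile_ctx:
  assumes "tile zs ws d p q" "chain xs X (l @ zs @ r)" "chain (l @ ws @ r) Y ys"
  shows "tile xs ys (X @ wdiag l r d @ Y) (wpath X l r Y p) (wpath X l r Y q)"
  using assms(1) pc_ctx[OF _ assms(2,3)] unfolding tile_def by blast

lemma pc_inverse:
  assumes "pc xs ys d p e \<phi>" shows "pc xs ys e (rev (map sinv p)) d (inv2 V \<phi>)"
  using assms
proof (induction p arbitrary: d \<phi>)
  case Nil then show ?case using ich_sym by simp
next
  case (Cons \<sigma> p)
  then obtain \<psi> \<chi> where s: "sok xs ys \<sigma>" "ich xs ys d \<psi> (ssrc \<sigma>)" "pc xs ys (stgt \<sigma>) p e \<chi>" "\<phi> = \<chi> \<bullet> scell xs \<sigma> \<bullet> \<psi>"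
    by auto
  have i: "\<psi> \<in> iso_cells V (ev xs d) (ev xs (ssrc \<sigma>))" "scell xs \<sigma> \<in> iso_cells V (ev xs (ssrc \<sigma>)) (ev xs (stgt \<sigma>))"
    "\<chi> \<in> iso_cells V (ev xs (stgt \<sigma>)) (ev xs e)"
    using ich_dcell[OF s(2)] scell_dcell[OF s(1)] pc_dcell[OF s(3)] by (auto simp: dcell_def)
  have "inv2 V \<phi> = (inv2 V \<psi> \<bullet> inv2 V (scell xs \<sigma>)) \<bullet> inv2 V \<chi>"
    unfolding s(4) using vcomp_iso(2)[OF vcomp_iso(1)[OF i(1,2)] i(3)] vcomp_iso(2)[OF i(1,2)] by simp
  moreover have "pc xs ys (stgt \<sigma>) [sinv \<sigma>] d (inv2 V \<psi> \<bullet> inv2 V (scell xs \<sigma>))"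
    using pc_post[OF pc_step[of xs ys "sinv \<sigma>", unfolded sinv_simps] ich_sym[OF s(2)]] scell_sinv[OF s(1)] s(1) by simp
  ultimately show ?case using Cons.IH[OF s(3)] by (simp add: pc_append del: pc.simps) blast
qed

text \<open>All cells are invertible, so \<nu>\<mu> = \<zeta>\<omega> gives \<mu>\<omega>^-1 =
  \<nu>^-1\<zeta>. In this way one axiom yields the various forms in which the certificates apply
  it.\<close>

lemma tile_rotate:
  assumes "tile xs ys d (u @ v) (w @ z)"
  shows "\<exists>c. tile xs ys c (rev (map sinv w) @ u) (z @ rev (map sinv v))"
proof -
  from assms obtain e \<phi> b \<mu> \<nu> c \<omega> \<zeta> where u: "pc xs ys d u b \<mu>" and v: "pc xs ys b v e \<nu>"
    and w: "pc xs ys d w c \<omega>" and z: "pc xs ys c z e \<zeta>" and eq: "\<nu> \<bullet> \<mu> = \<zeta> \<bullet> \<omega>"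
    unfolding tile_def pc_append by metis
  note t = pc_dcell[OF u] pc_dcell[OF v] pc_dcell[OF w] pc_dcell[OF z]
  note iw = dcell_inv[OF t(3)] and iv = dcell_inv[OF t(2)]
  have "pc xs ys c (rev (map sinv w) @ u) b (\<mu> \<bullet> inv2 V \<omega>)"
    unfolding pc_append using u pc_inverse[OF w] by blast
  moreover have "pc xs ys c (z @ rev (map sinv v)) b (inv2 V \<nu> \<bullet> \<zeta>)"
    unfolding pc_append using z pc_inverse[OF v] by blast
  moreover have "\<mu> \<bullet> inv2 V \<omega> = inv2 V \<nu> \<bullet> \<zeta>"
  proof -
    have "\<mu> \<bullet> inv2 V \<omega> = (inv2 V \<nu> \<bullet> \<nu>) \<bullet> \<mu> \<bullet> inv2 V \<omega>"
      using vinv(1)[OF t(2)] vid(2)[OF dcell_comp[OF iw t(1)]] by simp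
    also have "\<dots> = inv2 V \<nu> \<bullet> (\<nu> \<bullet> \<mu>) \<bullet> inv2 V \<omega>"
      using vassoc[OF dcell_comp[OF iw t(1)] t(2) iv] vassoc[OF iw t(1,2)] by simp
    also have "(\<nu> \<bullet> \<mu>) \<bullet> inv2 V \<omega> = \<zeta> \<bullet> \<omega> \<bullet> inv2 V \<omega>"
      unfolding eq by (rule vassoc[OF iw t(3,4)])
    also have "\<dots> = \<zeta>" using vinv(2)[OF t(3)] vid(1)[OF t(4)] by simp
    finally show ?thesis .
  qed
  ultimately show ?thesis unfolding tile_def by metis
qed

end

section \<open>A certificate checker for equations between paths\<close>

fun strip :: "strand list \<Rightarrow> strand list \<Rightarrow> strand list option" where
  "strip [] ys = Some ys"
| "strip (x # xs) [] = None"
| "strip (x # xs) (y # ys) = (if x = y then strip xs ys else None)"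

lemma strip_Some: "strip xs ys = Some zs \<Longrightarrow> ys = xs @ zs"
  by (induction xs ys rule: strip.induct) (auto split: if_splits)

text \<open>The direction of \<Sigma>, from \<open>swap_src\<close> to \<open>swap_tgt\<close>;
  stripping recovers the strands \<open>m\<close> between the boxes.\<close>

fun swap_down :: "layer \<Rightarrow> layer \<Rightarrow> (layer \<times> layer) option" where
  "swap_down (l1, g1, r1) (l2, g2, r2) = (case strip (l2 @ bsrc g2) l1 of
     None \<Rightarrow> None
   | Some m \<Rightarrow> if r2 = m @ btgt g1 @ r1 then Some ((l2, g2, m @ bsrc g1 @ r1), (l2 @ btgt g2 @ m, g1, r1)) else None)"

fun swap_up :: "layer \<Rightarrow> layer \<Rightarrow> (layer \<times> layer) option" where
  "swap_up (l1, g1, r1) (l2, g2, r2) = (case strip (l1 @ btgt g1) l2 of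
     None \<Rightarrow> None
   | Some m \<Rightarrow> if r1 = m @ bsrc g2 @ r2 then Some ((l1 @ bsrc g1 @ m, g2, r2), (l1, g1, m @ btgt g2 @ r2)) else None)"

definition swap_layers :: "layer \<Rightarrow> layer \<Rightarrow> (layer \<times> layer) option" where
  "swap_layers L1 L2 = (case swap_down L1 L2 of None \<Rightarrow> swap_up L1 L2 | z \<Rightarrow> z)"

fun swap_at :: "nat \<Rightarrow> diagram \<Rightarrow> diagram option" where
  "swap_at 0 (L1 # L2 # d) = map_option (\<lambda>(a, b). a # b # d) (swap_layers L1 L2)"
| "swap_at (Suc j) (L # d) = map_option ((#) L) (swap_at j d)"
| "swap_at _ _ = None"

text \<open>Insertion sort by interchanges. Only its soundness is used: equal results prove that two
  diagrams differ by interchange, unequal results prove nothing.\<close>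

fun ins_layer :: "layer \<Rightarrow> diagram \<Rightarrow> diagram" where
  "ins_layer L [] = [L]"
| "ins_layer L (L' # d) = (case swap_down L L' of None \<Rightarrow> L # L' # d | Some (a, b) \<Rightarrow> a # ins_layer b d)"

fun normalize :: "diagram \<Rightarrow> diagram" where
  "normalize [] = []"
| "normalize (L # d) = ins_layer L (normalize d)"

text \<open>Transfers the layer just below a rule to the place just above it, if its box lies
  entirely to the left or entirely to the right of the strands of the rule. The semantic reason is
  naturality of the interchanger.\<close>

fun lower :: "step \<Rightarrow> step option" where
  "lower (Step X l \<rho> b r Y) = (case rev X of [] \<Rightarrow> None | (a, g, c) # Z \<Rightarrow>
     (case strip (a @ btgt g) l of
        Some m \<Rightarrow> if c = m @ rdom \<rho> @ r then Some (Step (rev Z) (a @ bsrc g @ m) \<rho> b r ((a, g, m @ rcod \<rho> @ r) # Y)) else None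
      | None \<Rightarrow> (case strip (l @ rdom \<rho>) a of
          Some m \<Rightarrow> if r = m @ btgt g @ c then Some (Step (rev Z) l \<rho> b (m @ bsrc g @ c) ((l @ rcod \<rho> @ m, g, c) # Y)) else None
        | None \<Rightarrow> None)))"

fun lift :: "step \<Rightarrow> step option" where
  "lift (Step X l \<rho> b r Y) = (case Y of [] \<Rightarrow> None | (a, g, c) # Z \<Rightarrow>
     (case strip (a @ bsrc g) l of
        Some m \<Rightarrow> if c = m @ rcod \<rho> @ r then Some (Step (X @ [(a, g, m @ rdom \<rho> @ r)]) (a @ btgt g @ m) \<rho> b r Z) else None
      | None \<Rightarrow> (case strip (l @ rcod \<rho>) a of
          Some m \<Rightarrow> if r = m @ bsrc g @ c then Some (Step (X @ [(l @ rdom \<rho> @ m, g, c)]) l \<rho> b (m @ btgt g @ c) Z) else None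
        | None \<Rightarrow> None)))"

text \<open>Different presentations of the same step: \<open>SX j\<close> and \<open>SY j\<close>
  exchange two neighbouring layers below or above the rule, \<open>Dn\<close> and \<open>Up\<close>
  stand for \<open>lower\<close> and \<open>lift\<close>.\<close>

datatype code = SX nat | SY nat | Dn | Up

fun recode :: "code \<Rightarrow> step \<Rightarrow> step option" where
  "recode (SX j) (Step X l \<rho> b r Y) = map_option (\<lambda>X'. Step X' l \<rho> b r Y) (swap_at j X)"
| "recode (SY j) (Step X l \<rho> b r Y) = map_option (Step X l \<rho> b r) (swap_at j Y)"
| "recode Dn \<sigma> = lower \<sigma>"
| "recode Up \<sigma> = lift \<sigma>"

fun recodes :: "code list \<Rightarrow> step \<Rightarrow> step option" where
  "recodes [] \<sigma> = Some \<sigma>"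
| "recodes (c # cs) \<sigma> = Option.bind (recode c \<sigma>) (recodes cs)"

text \<open>The second rule may act above the layers produced by the first (first branch) or below
  them (second branch). The two steps must fit together literally, which is why certificates prepare
  \<open>Comm\<close> moves by \<open>Rep\<close> moves.\<close>

fun commute :: "step \<Rightarrow> step \<Rightarrow> (step \<times> step) option" where
  "commute (Step X l \<rho> b r Y) (Step X' l' \<rho>' b' r' Y') =
    (let Z = drop (length X + length (ptgt \<rho> b)) X' in
     if X' = X @ wdiag l r (ptgt \<rho> b) @ Z \<and> Y = Z @ wdiag l' r' (psrc \<rho>' b') @ Y'
     then Some (Step (X @ wdiag l r (psrc \<rho> b) @ Z) l' \<rho>' b' r' Y',
                Step X l \<rho> b r (Z @ wdiag l' r' (ptgt \<rho>' b') @ Y'))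
     else let Z = drop (length X' + length (psrc \<rho>' b')) X in
     if X = X' @ wdiag l' r' (psrc \<rho>' b') @ Z \<and> Y' = Z @ wdiag l r (ptgt \<rho> b) @ Y
     then Some (Step X' l' \<rho>' b' r' (Z @ wdiag l r (psrc \<rho> b) @ Y),
                Step (X' @ wdiag l' r' (ptgt \<rho>' b') @ Z) l \<rho> b r Y)
     else None)"

text \<open>The first number is the position in the path. In \<open>Tile k t n rv\<close>,
  \<open>t\<close> selects the equation, \<open>n\<close> is the number of layers of the context
  below it, and \<open>rv\<close> asks for use from right to left.\<close>

datatype move = Rep nat "code list" | Comm nat | Tile nat nat nat bool

type_synonym tiles = "(step list \<times> step list) list"

text \<open>The surrounding strands and layers are read off from the first step alone; the
  comparison of the whole side afterwards makes a wrong context fail.\<close>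

fun apply_tile :: "nat \<Rightarrow> step list \<Rightarrow> step list \<Rightarrow> step list \<Rightarrow> step list option" where
  "apply_tile n (Step X' l' \<rho>' b' r' Y' # u) v (Step X l \<rho> b r Y # q) =
    (let W = wpath (take n X) (take (length l - length l') l) (drop (length r') r) (drop (length Y') Y);
         w = W (Step X' l' \<rho>' b' r' Y' # u)
     in if take (length w) (Step X l \<rho> b r Y # q) = w
        then Some (W v @ drop (length w) (Step X l \<rho> b r Y # q)) else None)"
| "apply_tile n _ v _ = None"

fun apply_move :: "tiles \<Rightarrow> move \<Rightarrow> step list \<Rightarrow> step list option" where
  "apply_move ts (Rep k cs) p = (case drop k p of \<sigma> # q \<Rightarrow> map_option (\<lambda>\<sigma>'. take k p @ \<sigma>' # q) (recodes cs \<sigma>) | [] \<Rightarrow> None)"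
| "apply_move ts (Comm k) p = (case drop k p of
     \<sigma> # \<tau> # q \<Rightarrow> map_option (\<lambda>(\<sigma>', \<tau>'). take k p @ \<sigma>' # \<tau>' # q) (commute \<sigma> \<tau>) | _ \<Rightarrow> None)"
| "apply_move ts (Tile k t n rv) p = (if t < length ts then case ts ! t of (u, v) \<Rightarrow>
     map_option ((@) (take k p)) (if rv then apply_tile n v u (drop k p) else apply_tile n u v (drop k p)) else None)"

fun run :: "tiles \<Rightarrow> move list \<Rightarrow> step list \<Rightarrow> step list option" where
  "run ts [] p = Some p"
| "run ts (m # ms) p = (case apply_move ts m p of None \<Rightarrow> None | Some q \<Rightarrow> run ts ms q)"

text \<open>An executable sufficient condition for \<open>pc\<close>: consecutive steps fit up to
  \<open>normalize\<close>. It serves the derived equations, where a 2-cell for the initial path has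
  to be provided before moves can transport it.\<close>

fun pvalid :: "strand list \<Rightarrow> strand list \<Rightarrow> diagram \<Rightarrow> step list \<Rightarrow> diagram \<Rightarrow> bool" where
  "pvalid xs ys d [] e \<longleftrightarrow> chain xs d ys \<and> chain xs e ys \<and> normalize d = normalize e"
| "pvalid xs ys d (\<sigma> # p) e \<longleftrightarrow> chain xs d ys \<and> sok xs ys \<sigma> \<and> normalize d = normalize (ssrc \<sigma>) \<and> pvalid xs ys (stgt \<sigma>) p e"

section \<open>Soundness of the certificate checker\<close>

context diagram_rules begin

definition ieq :: "strand list \<Rightarrow> strand list \<Rightarrow> diagram \<Rightarrow> diagram \<Rightarrow> bool" where
  "ieq xs ys d d' \<longleftrightarrow> (\<exists>\<phi>. ich xs ys d \<phi> d')"

lemma ieq_refl: "chain xs d ys \<Longrightarrow> ieq xs ys d d"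
  unfolding ieq_def using ich_refl by blast
lemma ieq_sym: "ieq xs ys d d' \<Longrightarrow> ieq xs ys d' d"
  unfolding ieq_def using ich_sym by blast
lemma ieq_trans: "ieq xs ys d d' \<Longrightarrow> ieq xs ys d' d'' \<Longrightarrow> ieq xs ys d d''"
  unfolding ieq_def using ich_trans by blast
lemma ieq_chain: "ieq xs ys d d' \<Longrightarrow> chain xs d ys" "ieq xs ys d d' \<Longrightarrow> chain xs d' ys"
  unfolding ieq_def using ich_dcell by (auto simp: dcell_def)
lemma ieq_Cons: "ieq (l @ btgt g @ r) ys d d' \<Longrightarrow> btgt g \<noteq> [] \<Longrightarrow> ieq (l @ bsrc g @ r) ys ((l, g, r) # d) ((l, g, r) # d')"
  unfolding ieq_def
  using ich_ctx[of "l @ btgt g @ r" ys d _ d' "l @ bsrc g @ r" "[(l, g, r)]" "[]" "[]" "[]" ys] by (fastforce simp: wdiag_Nil)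

lemma ieq_swap:
  assumes "chain xs (X @ swap_src l f m g r @ Y) ys" shows "ieq xs ys (X @ swap_src l f m g r @ Y) (X @ swap_tgt l f m g r @ Y)"
proof -
  have "chain xs X (l @ (bsrc f @ m @ bsrc g) @ r)" "chain (l @ (btgt f @ m @ btgt g) @ r) Y ys" "btgt f \<noteq> []" "btgt g \<noteq> []"
    using assms by (auto simp: chain_append swap_src_def)
  from slide_ich[OF slide1_slide[OF slide1I[OF this]]] show ?thesis unfolding ieq_def by blast
qed

lemma swap_down_ieq:
  assumes "swap_down L L' = Some (a, b)" "chain xs (L # L' # d) ys" shows "ieq xs ys (L # L' # d) (a # b # d)"
proof -
  obtain l1 g1 r1 l2 g2 r2 where "L = (l1, g1, r1)" "L' = (l2, g2, r2)" by (metis prod.exhaust)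
  then show ?thesis using assms ieq_swap[of xs "[]" l2 g2 _ g1 r1 d ys]
    by (auto simp: swap_src_def swap_tgt_def dest!: strip_Some split: option.splits if_splits)
qed

lemma swap_up_ieq:
  assumes "swap_up L L' = Some (a, b)" "chain xs (L # L' # d) ys" shows "ieq xs ys (L # L' # d) (a # b # d)"
proof -
  obtain l1 g1 r1 l2 g2 r2 where L: "L = (l1, g1, r1)" "L' = (l2, g2, r2)" by (metis prod.exhaust)
  with assms(1) obtain m where m: "l2 = l1 @ btgt g1 @ m" "r1 = m @ bsrc g2 @ r2"
     "a = (l1 @ bsrc g1 @ m, g2, r2)" "b = (l1, g1, m @ btgt g2 @ r2)"
    by (auto dest!: strip_Some split: option.splits if_splits)
  show ?thesis using ieq_sym[OF ieq_swap[of xs "[]" l1 g1 m g2 r2 d ys]] assms(2) L m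
    by (auto simp: swap_src_def swap_tgt_def)
qed

lemma swap_layers_ieq:
  "swap_layers L L' = Some (a, b) \<Longrightarrow> chain xs (L # L' # d) ys \<Longrightarrow> ieq xs ys (L # L' # d) (a # b # d)"
  using swap_down_ieq swap_up_ieq unfolding swap_layers_def by (auto split: option.splits)

lemma swap_at_ieq: "swap_at j d = Some d' \<Longrightarrow> chain xs d ys \<Longrightarrow> ieq xs ys d d'"
proof (induction j d arbitrary: xs d' rule: swap_at.induct)
  case (1 L1 L2 d)
  then obtain a b where "swap_layers L1 L2 = Some (a, b)" "d' = a # b # d" by auto
  then show ?case using swap_layers_ieq 1(2) by blast
next
  case (2 j L d)
  obtain l g r where "L = (l, g, r)" by (cases L)
  then show ?case using 2 ieq_Cons by auto
qed auto

lemma ins_layer_ieq: "chain xs (L # d) ys \<Longrightarrow> ieq xs ys (L # d) (ins_layer L d)"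
proof (induction d arbitrary: L xs)
  case Nil then show ?case using ieq_refl[OF Nil] by simp
next
  case (Cons L' d)
  show ?case
  proof (cases "swap_down L L'")
    case None then show ?thesis using ieq_refl[OF Cons.prems] by simp
  next
    case (Some z)
    obtain a b where z: "z = (a, b)" by (cases z)
    note s = swap_down_ieq[OF Some[unfolded z] Cons.prems]
    obtain l g r where a: "a = (l, g, r)" by (cases a)
    then have c: "xs = l @ bsrc g @ r" "btgt g \<noteq> []" "chain (l @ btgt g @ r) (b # d) ys"
      using ieq_chain(2)[OF s] by auto
    then show ?thesis using ieq_trans[OF s] ieq_Cons[OF Cons.IH[OF c(3)] c(2)] Some z a by simp
  qed
qed

lemma normalize_ieq: "chain xs d ys \<Longrightarrow> ieq xs ys d (normalize d)"
proof (induction d arbitrary: xs)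
  case Nil then show ?case using ieq_refl by auto
next
  case (Cons L d)
  obtain l g r where L: "L = (l, g, r)" by (cases L)
  then have c: "xs = l @ bsrc g @ r" "btgt g \<noteq> []" "chain (l @ btgt g @ r) d ys" using Cons.prems by auto
  have s: "ieq xs ys (L # d) (L # normalize d)" using ieq_Cons[OF Cons.IH[OF c(3)] c(2)] L c(1) by simp
  show ?case using ieq_trans[OF s ins_layer_ieq[OF ieq_chain(2)[OF s]]] by simp
qed

lemma normalize_eq_ieq: "chain xs d ys \<Longrightarrow> chain xs d' ys \<Longrightarrow> normalize d = normalize d' \<Longrightarrow> ieq xs ys d d'"
  using normalize_ieq ieq_trans ieq_sym by metis

lemma pvalid_pc: "pvalid xs ys d p e \<Longrightarrow> \<exists>\<phi>. pc xs ys d p e \<phi>"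
proof (induction p arbitrary: d)
  case Nil then show ?case using normalize_eq_ieq by (auto simp: ieq_def)
next
  case (Cons \<sigma> p)
  then have "chain xs (ssrc \<sigma>) ys" using scell_dcell by (auto simp: dcell_def)
  then obtain \<psi> where "ich xs ys d \<psi> (ssrc \<sigma>)" using Cons.prems normalize_eq_ieq by (fastforce simp: ieq_def)
  then show ?case using Cons by fastforce
qed

lemma pc_Cons_refl:
  assumes "sok xs ys \<sigma>" "pc xs ys (stgt \<sigma>) p e \<chi>" shows "pc xs ys (ssrc \<sigma>) (\<sigma> # p) e (\<chi> \<bullet> scell xs \<sigma>)"
proof -
  have "pc xs ys (ssrc \<sigma>) ([\<sigma>] @ p) e (\<chi> \<bullet> scell xs \<sigma>)"
    unfolding pc_append using pc_step[OF assms(1)] assms(2) by blast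
  then show ?thesis by simp
qed

definition teq :: "strand list \<Rightarrow> strand list \<Rightarrow> step list \<Rightarrow> step list \<Rightarrow> bool" where
  "teq xs ys p q \<longleftrightarrow> (\<exists>d. tile xs ys d p q)"

lemma teq_sym: "teq xs ys p q \<Longrightarrow> teq xs ys q p"
  unfolding teq_def using tile_sym by blast

lemma teq_peq: "teq xs ys p q \<Longrightarrow> p \<noteq> [] \<Longrightarrow> peq xs ys p q"
  unfolding teq_def using tile_peq by blast

lemma teq_ctx:
  assumes "teq zs ws p q" "chain xs X (l @ zs @ r)" "chain (l @ ws @ r) Y ys"
  shows "teq xs ys (wpath X l r Y p) (wpath X l r Y q)"
  using assms(1) tile_ctx[OF _ assms(2,3)] unfolding teq_def by blast

text \<open>Both presentations are compared from the source of \<open>\<tau>\<close> to the target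
  of \<open>\<sigma>\<close>; the last hypothesis says that the interchange cells at the ends
  complete a commuting square.\<close>

lemma teq_single:
  assumes "sok xs ys \<sigma>" "sok xs ys \<tau>" "ich xs ys (ssrc \<tau>) \<psi> (ssrc \<sigma>)" "ich xs ys (stgt \<tau>) \<chi> (stgt \<sigma>)"
    "\<chi> \<bullet> scell xs \<tau> = scell xs \<sigma> \<bullet> \<psi>"
  shows "teq xs ys [\<sigma>] [\<tau>]"
  unfolding teq_def tile_def using pc_pre[OF assms(3) pc_step[OF assms(1)]] pc_post[OF pc_step[OF assms(2)] assms(4)] assms(5)
  by metis

text \<open>Interchanges below the rule happen at another height than the rule itself, so the
  required square is an instance of \<open>ctx_commute\<close>.\<close>

lemma teq_below:
  assumes "sok xs ys (Step X l \<rho> b r Y)" "ieq xs (l @ rdom \<rho> @ r) X X'"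
  shows "teq xs ys [Step X' l \<rho> b r Y] [Step X l \<rho> b r Y]"
proof -
  obtain \<psi> where i: "ich xs (l @ rdom \<rho> @ r) X \<psi> X'" using assms(2) by (auto simp: ieq_def)
  have c: "chain xs X (l @ rdom \<rho> @ r)" "chain (l @ rcod \<rho> @ r) Y ys" "rok \<rho>" "chain xs X' (l @ rdom \<rho> @ r)"
    using assms(1) ieq_chain[OF assms(2)] by auto
  note d = rcell_dcell[OF c(3), of b]
  have cP: "chain (rdom \<rho>) (psrc \<rho> b) (rcod \<rho>)" "chain (rdom \<rho>) (ptgt \<rho> b) (rcod \<rho>)" using d by (auto simp: dcell_def)
  have k: "chain (l @ rdom \<rho> @ r) (wdiag l r Z @ Y) ys" if "chain (rdom \<rho>) Z (rcod \<rho>)" for Z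
    using chain_wdiag[OF that] c(2) by (auto simp: chain_append)
  have j: "ich xs ys (X @ wdiag l r Z @ Y) (ctx xs [] [] [] ([] @ (l @ rdom \<rho> @ r) @ []) (wdiag l r Z @ Y) \<psi>) (X' @ wdiag l r Z @ Y)"
    if "chain (rdom \<rho>) Z (rcod \<rho>)" for Z
    using ich_ctx[OF i, of xs "[]" "[]" "[]" "wdiag l r Z @ Y" ys] k[OF that] by (simp add: wdiag_Nil)
  note cc = ctx_commute[OF ich_dcell[OF i] d, of xs "[]" "[]" "[]" "[]" l r Y ys]
  show ?thesis
    by (rule teq_single[where \<psi> = "ctx xs [] [] [] ([] @ (l @ rdom \<rho> @ r) @ []) (wdiag l r (psrc \<rho> b) @ Y) \<psi>"
          and \<chi> = "ctx xs [] [] [] ([] @ (l @ rdom \<rho> @ r) @ []) (wdiag l r (ptgt \<rho> b) @ Y) \<psi>"])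
      (use c j[OF cP(1)] j[OF cP(2)] cc in \<open>auto simp: wdiag_Nil\<close>)
qed

lemma teq_above:
  assumes "sok xs ys (Step X l \<rho> b r Y)" "ieq (l @ rcod \<rho> @ r) ys Y Y'"
  shows "teq xs ys [Step X l \<rho> b r Y'] [Step X l \<rho> b r Y]"
proof -
  obtain \<psi> where i: "ich (l @ rcod \<rho> @ r) ys Y \<psi> Y'" using assms(2) by (auto simp: ieq_def)
  have c: "chain xs X (l @ rdom \<rho> @ r)" "chain (l @ rcod \<rho> @ r) Y ys" "rok \<rho>" "chain (l @ rcod \<rho> @ r) Y' ys"
    using assms(1) ieq_chain[OF assms(2)] by auto
  note d = rcell_dcell[OF c(3), of b]
  have cP: "chain (rdom \<rho>) (psrc \<rho> b) (rcod \<rho>)" "chain (rdom \<rho>) (ptgt \<rho> b) (rcod \<rho>)" using d by (auto simp: dcell_def)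
  have k: "chain xs (X @ wdiag l r Z) (l @ rcod \<rho> @ r)" if "chain (rdom \<rho>) Z (rcod \<rho>)" for Z
    using chain_wdiag[OF that] c(1) by (auto simp: chain_append)
  have j: "ich xs ys (X @ wdiag l r Z @ Y) (ctx xs (X @ wdiag l r Z) [] [] ([] @ ys @ []) [] \<psi>) (X @ wdiag l r Z @ Y')"
    if "chain (rdom \<rho>) Z (rcod \<rho>)" for Z
    using ich_ctx[OF i, of xs "X @ wdiag l r Z" "[]" "[]" "[]" ys] k[OF that] by (simp add: wdiag_Nil)
  note cc = ctx_commute[OF d ich_dcell[OF i], of xs X l r "[]" "[]" "[]" "[]" ys]
  show ?thesis
    by (rule teq_single[where \<psi> = "ctx xs (X @ wdiag l r (psrc \<rho> b)) [] [] ([] @ ys @ []) [] \<psi>"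
          and \<chi> = "ctx xs (X @ wdiag l r (ptgt \<rho> b)) [] [] ([] @ ys @ []) [] \<psi>"])
      (use c j[OF cP(1)] j[OF cP(2)] cc in \<open>auto simp: wdiag_Nil\<close>)
qed

text \<open>The required square is naturality of \<Sigma> at the cell of the rule, and
  \<open>slide_left\<close> shows that the two interchangers in it are coherence cells.\<close>

lemma teq_past_left:
  assumes "rok \<rho>" "btgt h \<noteq> []"
  shows "teq (bsrc h @ m @ rdom \<rho>) (btgt h @ m @ rcod \<rho>)
    [Step [([], h, m @ rdom \<rho>)] (btgt h @ m) \<rho> b [] []] [Step [] (bsrc h @ m) \<rho> b [] [([], h, m @ rcod \<rho>)]]"
proof -
  note d = rcell_dcell[OF assms(1), of b]
  have cP: "chain (rdom \<rho>) (psrc \<rho> b) (rcod \<rho>)" "chain (rdom \<rho>) (ptgt \<rho> b) (rcod \<rho>)" using d by (auto simp: dcell_def)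
  show ?thesis
    by (rule teq_single[where \<psi> = "\<Sigma> (bx h) (T m \<ltimes> ev (rdom \<rho>) (psrc \<rho> b))" and \<chi> = "\<Sigma> (bx h) (T m \<ltimes> ev (rdom \<rho>) (ptgt \<rho> b))"])
      (use assms slide_ich[OF slide_left[OF cP(1) assms(2), of m]] slide_ich[OF slide_left[OF cP(2) assms(2), of m]] inter_nat_left[OF d, of h m] in auto)
qed

lemma teq_past_right:
  assumes "rok \<rho>" "btgt h \<noteq> []"
  shows "teq (rdom \<rho> @ m @ bsrc h) (rcod \<rho> @ m @ btgt h)
    [Step [] [] \<rho> b (m @ bsrc h) [(rcod \<rho> @ m, h, [])]] [Step [(rdom \<rho> @ m, h, [])] [] \<rho> b (m @ btgt h) []]"
proof -
  note d = rcell_dcell[OF assms(1), of b]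
  have cP: "chain (rdom \<rho>) (psrc \<rho> b) (rcod \<rho>)" "chain (rdom \<rho>) (ptgt \<rho> b) (rcod \<rho>)" using d by (auto simp: dcell_def)
  show ?thesis
    by (rule teq_single[where \<psi> = "\<Sigma> (ev (rdom \<rho>) (psrc \<rho> b)) (T m \<ltimes> bx h)" and \<chi> = "\<Sigma> (ev (rdom \<rho>) (ptgt \<rho> b)) (T m \<ltimes> bx h)"])
      (use assms slide_ich[OF slide_right[OF cP(1) assms(2), of m]] slide_ich[OF slide_right[OF cP(2) assms(2), of m]] inter_nat_right[OF d, of m h] in auto)
qed

lemma lower_teq:
  assumes "lower \<sigma> = Some \<tau>" "sok xs ys \<sigma>" shows "teq xs ys [\<sigma>] [\<tau>]"
proof -
  obtain X l \<rho> b r Y where s: "\<sigma> = Step X l \<rho> b r Y" by (cases \<sigma>)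
  from assms(1) s obtain a g c Z where "rev X = (a, g, c) # Z" by (auto split: list.splits)
  then have X: "X = rev Z @ [(a, g, c)]" "rev X = (a, g, c) # Z" by (metis rev.simps(2) rev_rev_ident, simp)
  have k: "chain xs (rev Z) (a @ bsrc g @ c)" "l @ rdom \<rho> @ r = a @ btgt g @ c" "btgt g \<noteq> []"
    "chain (l @ rcod \<rho> @ r) Y ys" "rok \<rho>"
    using assms(2) s X(1) by (auto simp: chain_append)
  show ?thesis
  proof (cases "strip (a @ btgt g) l")
    case (Some m)
    then have l: "l = a @ btgt g @ m" by (auto dest: strip_Some)
    have t: "c = m @ rdom \<rho> @ r" "\<tau> = Step (rev Z) (a @ bsrc g @ m) \<rho> b r ((a, g, m @ rcod \<rho> @ r) # Y)"
      using assms(1) s X(2) Some by (auto split: if_splits)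
    show ?thesis
      using teq_ctx[OF teq_past_left[OF k(5,3), of m b], of xs "rev Z" a r Y ys] k s t l X(1) by simp
  next
    case None
    then obtain m where m: "strip (l @ rdom \<rho>) a = Some m" using assms(1) s X(2) by (auto split: option.splits)
    then have a: "a = l @ rdom \<rho> @ m" by (auto dest: strip_Some)
    have t: "r = m @ btgt g @ c" "\<tau> = Step (rev Z) l \<rho> b (m @ bsrc g @ c) ((l @ rcod \<rho> @ m, g, c) # Y)"
      using assms(1) s X(2) None m by (auto split: if_splits)
    show ?thesis
      using teq_ctx[OF teq_sym[OF teq_past_right[OF k(5,3), of m b]], of xs "rev Z" l c Y ys] k s t a X(1) by simp
  qed
qed

lemma lift_teq:
  assumes "lift \<sigma> = Some \<tau>" "sok xs ys \<sigma>" shows "teq xs ys [\<sigma>] [\<tau>]"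
proof -
  obtain X l \<rho> b r Y where s: "\<sigma> = Step X l \<rho> b r Y" by (cases \<sigma>)
  from assms(1) s obtain a g c Z where Y: "Y = (a, g, c) # Z" by (auto split: list.splits)
  have k: "chain xs X (l @ rdom \<rho> @ r)" "l @ rcod \<rho> @ r = a @ bsrc g @ c" "btgt g \<noteq> []"
    "chain (a @ btgt g @ c) Z ys" "rok \<rho>"
    using assms(2) s Y by auto
  show ?thesis
  proof (cases "strip (a @ bsrc g) l")
    case (Some m)
    then have l: "l = a @ bsrc g @ m" by (auto dest: strip_Some)
    have t: "c = m @ rcod \<rho> @ r" "\<tau> = Step (X @ [(a, g, m @ rdom \<rho> @ r)]) (a @ btgt g @ m) \<rho> b r Z"
      using assms(1) s Y Some by (auto split: if_splits)
    show ?thesis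
      using teq_ctx[OF teq_sym[OF teq_past_left[OF k(5,3), of m b]], of xs X a r Z ys] k s t l Y by simp
  next
    case None
    then obtain m where m: "strip (l @ rcod \<rho>) a = Some m" using assms(1) s Y by (auto split: option.splits)
    then have a: "a = l @ rcod \<rho> @ m" by (auto dest: strip_Some)
    have t: "r = m @ bsrc g @ c" "\<tau> = Step (X @ [(l @ rdom \<rho> @ m, g, c)]) l \<rho> b (m @ btgt g @ c) Z"
      using assms(1) s Y None m by (auto split: if_splits)
    show ?thesis
      using teq_ctx[OF teq_past_right[OF k(5,3), of m b], of xs X l c Z ys] k s t a Y by simp
  qed
qed

lemma recode_teq:
  assumes "recode c \<sigma> = Some \<tau>" "sok xs ys \<sigma>" shows "teq xs ys [\<sigma>] [\<tau>]"
proof (cases "(c, \<sigma>)" rule: recode.cases)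
  case (1 j X l \<rho> b r Y)
  then obtain X' where X': "swap_at j X = Some X'" "\<tau> = Step X' l \<rho> b r Y" using assms(1) by auto
  show ?thesis using teq_sym[OF teq_below[of xs ys X l \<rho> b r Y X']] swap_at_ieq[OF X'(1)] assms(2) X'(2) 1 by auto
next
  case (2 j X l \<rho> b r Y)
  then obtain Y' where Y': "swap_at j Y = Some Y'" "\<tau> = Step X l \<rho> b r Y'" using assms(1) by auto
  show ?thesis using teq_sym[OF teq_above[of xs ys X l \<rho> b r Y Y']] swap_at_ieq[OF Y'(1)] assms(2) Y'(2) 2 by auto
qed (use assms lower_teq lift_teq in auto)

lemma peq_sok: "peq xs ys [\<sigma>] [\<tau>] \<Longrightarrow> sok xs ys \<sigma> \<Longrightarrow> sok xs ys \<tau>"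
  unfolding peq_def using pc_step by fastforce

lemma recodes_peq: "recodes cs \<sigma> = Some \<tau> \<Longrightarrow> sok xs ys \<sigma> \<Longrightarrow> peq xs ys [\<sigma>] [\<tau>]"
proof (induction cs arbitrary: \<sigma>)
  case Nil then show ?case by (simp add: peq_def)
next
  case (Cons c cs)
  then obtain \<sigma>' where s: "recode c \<sigma> = Some \<sigma>'" "recodes cs \<sigma>' = Some \<tau>"
    by (auto simp: bind_eq_Some_conv)
  have p: "peq xs ys [\<sigma>] [\<sigma>']" by (rule teq_peq[OF recode_teq[OF s(1) Cons.prems(2)]]) simp
  show ?case using Cons.IH[OF s(2) peq_sok[OF p Cons.prems(2)]] p unfolding peq_def by blast
qed

lemma pc_pair:
  assumes "sok xs ys \<sigma>" "sok xs ys \<tau>" "stgt \<sigma> = ssrc \<tau>"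
  shows "pc xs ys (ssrc \<sigma>) [\<sigma>, \<tau>] (stgt \<tau>) (scell xs \<tau> \<bullet> scell xs \<sigma>)"
  using pc_Cons_refl[OF assms(1), of "[\<tau>]"] pc_step[OF assms(2)] unfolding assms(3) by blast

text \<open>In either order the two steps fit literally, so no coherence cells intervene and
  \<open>ctx_commute\<close> compares the composites directly.\<close>

lemma commute_teq_aux:
  assumes "sok xs ys (Step X l \<rho> b r (Z @ wdiag l' r' (psrc \<rho>' b') @ Y))"
    "sok xs ys (Step (X @ wdiag l r (ptgt \<rho> b) @ Z) l' \<rho>' b' r' Y)"
  shows "teq xs ys
     [Step X l \<rho> b r (Z @ wdiag l' r' (psrc \<rho>' b') @ Y), Step (X @ wdiag l r (ptgt \<rho> b) @ Z) l' \<rho>' b' r' Y]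
     [Step (X @ wdiag l r (psrc \<rho> b) @ Z) l' \<rho>' b' r' Y, Step X l \<rho> b r (Z @ wdiag l' r' (ptgt \<rho>' b') @ Y)]"
proof -
  have c: "chain xs X (l @ rdom \<rho> @ r)" "chain (l' @ rcod \<rho>' @ r') Y ys" "rok \<rho>" "rok \<rho>'"
    using assms by auto
  note d = rcell_dcell[OF c(3), of b] and d' = rcell_dcell[OF c(4), of b']
  have P: "chain (rdom \<rho>) (psrc \<rho> b) (rcod \<rho>)" "chain (rdom \<rho>) (ptgt \<rho> b) (rcod \<rho>)"
    "chain (rdom \<rho>') (psrc \<rho>' b') (rcod \<rho>')" "chain (rdom \<rho>') (ptgt \<rho>' b') (rcod \<rho>')"
    using d d' by (auto simp: dcell_def)
  have "chain xs (X @ wdiag l r (ptgt \<rho> b)) (l @ rcod \<rho> @ r)"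
    using c(1) chain_wdiag[OF P(2), of l r] by (auto simp: chain_append)
  moreover have "chain xs ((X @ wdiag l r (ptgt \<rho> b)) @ Z) (l' @ rdom \<rho>' @ r')" using assms(2) by simp
  \<comment> \<open>The layers before \<open>Z\<close> determine its source, since the target of a
    chain is unique.\<close>
  ultimately have cZ: "chain (l @ rcod \<rho> @ r) Z (l' @ rdom \<rho>' @ r')"
    unfolding chain_append[of xs "X @ wdiag l r (ptgt \<rho> b)"] using chain_unique by metis
  have k: "sok xs ys (Step (X @ wdiag l r (psrc \<rho> b) @ Z) l' \<rho>' b' r' Y)"
    "sok xs ys (Step X l \<rho> b r (Z @ wdiag l' r' (ptgt \<rho>' b') @ Y))"
    using ev_ctx(2)[OF c(1) P(1) cZ] ev_ctx(2)[OF cZ P(4) c(2)] c by auto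
  have t: "stgt (Step X l \<rho> b r (Z @ wdiag l' r' (psrc \<rho>' b') @ Y)) = ssrc (Step (X @ wdiag l r (ptgt \<rho> b) @ Z) l' \<rho>' b' r' Y)"
    "stgt (Step (X @ wdiag l r (psrc \<rho> b) @ Z) l' \<rho>' b' r' Y) = ssrc (Step X l \<rho> b r (Z @ wdiag l' r' (ptgt \<rho>' b') @ Y))"
    by simp_all
  note q = pc_pair[OF assms t(1)] pc_pair[OF k t(2)]
  have "teq xs ys p q" if "pc xs ys e p f \<phi>" "pc xs ys e q f \<phi>" for e f p q \<phi>
    using that unfolding teq_def tile_def by blast
  from this[OF q(1)] q(2) show ?thesis
    using ctx_commute[OF d d' c(1) cZ c(2)] by simp
qed

lemma commute_teq:
  assumes "commute \<sigma> \<tau> = Some (\<sigma>', \<tau>')" "sok xs ys \<sigma>" "sok xs ys \<tau>" shows "teq xs ys [\<sigma>, \<tau>] [\<sigma>', \<tau>']"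
proof -
  obtain X l \<rho> b r Y where s: "\<sigma> = Step X l \<rho> b r Y" by (cases \<sigma>)
  obtain X' l' \<rho>' b' r' Y' where t: "\<tau> = Step X' l' \<rho>' b' r' Y'" by (cases \<tau>)
  from assms(1) consider Z where "X' = X @ wdiag l r (ptgt \<rho> b) @ Z" "Y = Z @ wdiag l' r' (psrc \<rho>' b') @ Y'"
     "\<sigma>' = Step (X @ wdiag l r (psrc \<rho> b) @ Z) l' \<rho>' b' r' Y'" "\<tau>' = Step X l \<rho> b r (Z @ wdiag l' r' (ptgt \<rho>' b') @ Y')"
    | Z where "X = X' @ wdiag l' r' (psrc \<rho>' b') @ Z" "Y' = Z @ wdiag l r (ptgt \<rho> b) @ Y"
     "\<sigma>' = Step X' l' \<rho>' b' r' (Z @ wdiag l r (psrc \<rho> b) @ Y)" "\<tau>' = Step (X' @ wdiag l' r' (ptgt \<rho>' b') @ Z) l \<rho> b r Y"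
    unfolding s t commute.simps Let_def by (auto split: if_splits)
  then show ?thesis
  proof cases
    case 1
    then show ?thesis using commute_teq_aux assms(2,3) unfolding s t by simp
  next
    case 2
    have c: "chain xs X' (l' @ rdom \<rho>' @ r')" "chain (l @ rcod \<rho> @ r) Y ys" "rok \<rho>" "rok \<rho>'"
      using assms(2,3) unfolding s t by auto
    note d = rcell_dcell[OF c(3), of b] and d' = rcell_dcell[OF c(4), of b']
    have P: "chain (rdom \<rho>) (psrc \<rho> b) (rcod \<rho>)" "chain (rdom \<rho>) (ptgt \<rho> b) (rcod \<rho>)"
      "chain (rdom \<rho>') (psrc \<rho>' b') (rcod \<rho>')" "chain (rdom \<rho>') (ptgt \<rho>' b') (rcod \<rho>')"
      using d d' by (auto simp: dcell_def)
    have "chain xs (X' @ wdiag l' r' (psrc \<rho>' b')) (l' @ rcod \<rho>' @ r')"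
      using c(1) chain_wdiag[OF P(3), of l' r'] by (auto simp: chain_append)
    moreover have "chain xs ((X' @ wdiag l' r' (psrc \<rho>' b')) @ Z) (l @ rdom \<rho> @ r)"
      using assms(2) 2(1) unfolding s by simp
    ultimately have cZ: "chain (l' @ rcod \<rho>' @ r') Z (l @ rdom \<rho> @ r)"
      unfolding chain_append[of xs "X' @ wdiag l' r' (psrc \<rho>' b')"] using chain_unique by metis
    have "sok xs ys \<sigma>'" "sok xs ys \<tau>'"
      using ev_ctx(2)[OF c(1) P(4) cZ] ev_ctx(2)[OF cZ P(1) c(2)] c 2(3,4) by auto
    then show ?thesis
      using teq_sym[OF commute_teq_aux[of xs ys X' l' \<rho>' b' r' Z l r \<rho> b Y]] 2 unfolding s t by simp
  qed
qed

lemma chain_wdiag_dom: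
  assumes "chain zs d y" "chain us (wdiag l r d) (l @ y @ r)" shows "us = l @ zs @ r"
proof (cases d)
  case Nil then show ?thesis using assms by simp
next
  case (Cons L e) then show ?thesis using assms by (cases L) auto
qed

lemma apply_tile_peq:
  assumes "apply_tile n u v p = Some q" "teq zs ws u v" "list_all (sok xs ys) p" shows "peq xs ys p q"
proof -
  obtain X' l' \<rho>' b' r' Y' u' X l \<rho> b r Y p' where u: "u = Step X' l' \<rho>' b' r' Y' # u'" and p: "p = Step X l \<rho> b r Y # p'"
    using assms(1) by (cases "(n, u, v, p)" rule: apply_tile.cases) auto
  define X0 l0 r0 Y0 where d: "X0 = take n X" "l0 = take (length l - length l') l" "r0 = drop (length r') r" "Y0 = drop (length Y') Y"
  define w where "w = wpath X0 l0 r0 Y0 u"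
  have q: "take (length w) p = w" "q = wpath X0 l0 r0 Y0 v @ drop (length w) p"
    using assms(1) unfolding u p w_def d apply_tile.simps Let_def by (auto split: if_splits)
  have pw: "p = w @ drop (length w) p" using q(1) by (metis append_take_drop_id)
  \<comment> \<open>The first step of the match already exhibits the whole context, and with it the
    boundary at which the equation is applied.\<close>
  have h: "X = X0 @ wdiag l0 r0 X'" "l = l0 @ l'" "\<rho> = \<rho>'" "r = r' @ r0" "Y = wdiag l0 r0 Y' @ Y0"
    using pw unfolding w_def u p by auto
  obtain c \<phi> e where "pc zs ws c u e \<phi>" using assms(2) unfolding teq_def tile_def by blast
  then have z: "chain zs X' (l' @ rdom \<rho> @ r')" "chain (l' @ rcod \<rho> @ r') Y' ws"
    unfolding u h(3) by auto
  have k: "chain xs (X0 @ wdiag l0 r0 X') (l0 @ (l' @ rdom \<rho> @ r') @ r0)" "chain (l0 @ (l' @ rcod \<rho> @ r') @ r0) (wdiag l0 r0 Y' @ Y0) ys"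
    using assms(3) unfolding p h by auto
  have a: "chain xs X0 (l0 @ zs @ r0)" using k(1) chain_wdiag_dom[OF z(1)] unfolding chain_append by blast
  have b: "chain (l0 @ ws @ r0) Y0 ys"
    using k(2) chain_wdiag[OF z(2), of l0 r0] chain_unique unfolding chain_append by metis
  have "peq xs ys w (wpath X0 l0 r0 Y0 v)"
    unfolding w_def by (rule teq_peq[OF teq_ctx[OF assms(2) a b]]) (simp add: u)
  from peq_append[OF this, of "[]" "drop (length w) p"] show ?thesis using pw q(2) by simp
qed

lemma pc_sok: "pc xs ys d p e \<phi> \<Longrightarrow> list_all (sok xs ys) p"
  by (induction p arbitrary: d \<phi>) auto

lemma apply_move_pc:
  assumes "apply_move ts m p = Some q" "pc xs ys d p e \<phi>"
    and "\<And>u v. (u, v) \<in> set ts \<Longrightarrow> \<exists>zs ws. teq zs ws u v"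
  shows "pc xs ys d q e \<phi>"
proof (cases m)
  case (Rep k cs)
  then obtain \<sigma> p' where dr: "drop k p = \<sigma> # p'" using assms(1) by (auto split: list.splits)
  then obtain \<tau> where t: "recodes cs \<sigma> = Some \<tau>" "q = take k p @ \<tau> # p'" using assms(1) Rep by auto
  have p: "p = take k p @ [\<sigma>] @ p'" using dr by (metis append_Cons append_Nil append_take_drop_id)
  have "list_all (sok xs ys) (take k p @ [\<sigma>] @ p')" using pc_sok[OF assms(2)] p by simp
  then have "peq xs ys [\<sigma>] [\<tau>]" using recodes_peq[OF t(1)] by simp
  from peq_append[OF this, of "take k p" p'] show ?thesis using assms(2) p t(2) unfolding peq_def by simp
next
  case (Comm k)
  then obtain \<sigma> \<tau> p' where dr: "drop k p = \<sigma> # \<tau> # p'" using assms(1) by (auto split: list.splits)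
  then obtain \<sigma>' \<tau>' where t: "commute \<sigma> \<tau> = Some (\<sigma>', \<tau>')" "q = take k p @ \<sigma>' # \<tau>' # p'" using assms(1) Comm by auto
  have p: "p = take k p @ [\<sigma>, \<tau>] @ p'" using dr by (metis append_Cons append_Nil append_take_drop_id)
  have "list_all (sok xs ys) (take k p @ [\<sigma>, \<tau>] @ p')" using pc_sok[OF assms(2)] p by simp
  then have "peq xs ys [\<sigma>, \<tau>] [\<sigma>', \<tau>']" using teq_peq[OF commute_teq[OF t(1)]] by simp
  from peq_append[OF this, of "take k p" p'] show ?thesis using assms(2) p t(2) unfolding peq_def by simp
next
  case (Tile k t n rv)
  obtain u v where uv: "ts ! t = (u, v)" by (cases "ts ! t")
  then have "(u, v) \<in> set ts" using assms(1) Tile nth_mem by (fastforce split: if_splits)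
  then obtain zs ws where e: "teq zs ws u v" using assms(3) by blast
  have "\<exists>u' v' q'. teq zs ws u' v' \<and> apply_tile n u' v' (drop k p) = Some q' \<and> q = take k p @ q'"
    using assms(1) Tile uv e teq_sym[OF e] by (cases rv) (auto split: if_splits)
  then obtain u' v' q' where t: "teq zs ws u' v'" "apply_tile n u' v' (drop k p) = Some q'" "q = take k p @ q'" by blast
  have "list_all (sok xs ys) (take k p @ drop k p)" using pc_sok[OF assms(2)] by simp
  then have "peq xs ys (drop k p) q'" using apply_tile_peq[OF t(2,1)] by (simp del: append_take_drop_id)
  from peq_append[OF this, of "take k p" "[]"] show ?thesis using assms(2) t(3) unfolding peq_def by simp
qed

lemma run_pc:
  assumes "run ts ms p = Some q" "pc xs ys d p e \<phi>"
    and "\<And>u v. (u, v) \<in> set ts \<Longrightarrow> \<exists>zs ws. teq zs ws u v"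
  shows "pc xs ys d q e \<phi>"
  using assms(1,2)
proof (induction ms arbitrary: p)
  case Nil then show ?case by simp
next
  case (Cons m ms)
  then obtain p' where "apply_move ts m p = Some p'" "run ts ms p' = Some q" by (auto split: option.splits)
  then show ?case using apply_move_pc[OF _ Cons.prems(2) assms(3)] Cons.IH by blast
qed

end

section \<open>Tiles and certificates\<close>

text \<open>Moves the first \<open>m\<close> steps of the right-hand side and the last steps of the left-hand side across the equation.\<close>

definition rotate_tile :: "nat \<Rightarrow> nat \<Rightarrow> step list \<times> step list \<Rightarrow> step list \<times> step list" where
  "rotate_tile n m = (\<lambda>(p, q). (rev (map sinv (take m q)) @ take n p, drop m q @ rev (map sinv (drop n p))))"

text \<open>This and the next two are the braiding axioms for iterated hexagon cells. The
  interchanger in the third is omitted, as \<open>pc\<close> inserts it.\<close>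

definition tile_SS :: "strand list \<Rightarrow> strand list \<Rightarrow> strand list \<Rightarrow> strand list \<Rightarrow> step list \<times> step list" where
  "tile_SS a b c d =
    ([Step [] [] (HexS (a @ b) c d) True [] [], Step [(a @ b, Cr c d, [])] [] (HexS a b d) True c []],
     [Step [] [] (HexS a (b @ c) d) True [] [], Step [] a (HexS b c d) True [] [([], Cr a d, b @ c)]])"

definition tile_RR :: "strand list \<Rightarrow> strand list \<Rightarrow> strand list \<Rightarrow> strand list \<Rightarrow> step list \<times> step list" where
  "tile_RR a b c d =
    ([Step [] [] (HexR a (b @ c) d) True [] [], Step [] [] (HexR a b c) True d [(b @ c, Cr a d, [])]],
     [Step [] [] (HexR a b (c @ d)) True [] [], Step [([], Cr a b, c @ d)] b (HexR a c d) True [] []])"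

definition tile_RS :: "strand list \<Rightarrow> strand list \<Rightarrow> strand list \<Rightarrow> strand list \<Rightarrow> step list \<times> step list" where
  "tile_RS a b c d =
    ([Step [] [] (HexR (a @ b) c d) True [] [], Step [] [] (HexS a b c) True d [(c, Cr (a @ b) d, [])],
      Step [(a, Cr b c, d), ([], Cr a c, b @ d)] c (HexS a b d) True [] []],
     [Step [] [] (HexS a b (c @ d)) True [] [], Step [] a (HexR b c d) True [] [([], Cr a (c @ d), b)],
      Step [(a, Cr b c, d), (a @ c, Cr b d, [])] [] (HexR a c d) True b []])"

text \<open>The six equations from here on say that \<open>hexS\<close> and \<open>hexR\<close> are
  modifications in each of their three variables, at a 1-cell consisting of one whiskered
  box.\<close>

definition tile_S1 :: "strand list \<Rightarrow> box \<Rightarrow> strand list \<Rightarrow> strand list \<Rightarrow> strand list \<Rightarrow> step list \<times> step list" where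
  "tile_S1 l g r b c = (let a = l @ bsrc g @ r; a' = l @ btgt g @ r in
    ([Step [] [] (HexS a b c) True [] [(c @ l, g, r @ b)], Step [(a, Cr b c, [])] [] (NatL l g r c) True b []],
     [Step [] [] (NatL l g (r @ b) c) True [] [], Step [(l, g, r @ b @ c)] [] (HexS a' b c) True [] []]))"

definition tile_S2 :: "strand list \<Rightarrow> strand list \<Rightarrow> box \<Rightarrow> strand list \<Rightarrow> strand list \<Rightarrow> step list \<times> step list" where
  "tile_S2 a l g r c = (let b = l @ bsrc g @ r; b' = l @ btgt g @ r in
    ([Step [] [] (HexS a b c) True [] [(c @ a @ l, g, r)], Step [] a (NatL l g r c) True [] [([], Cr a c, b')]],
     [Step [] [] (NatL (a @ l) g r c) True [] [], Step [(a @ l, g, r @ c)] [] (HexS a b' c) True [] []]))"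

definition tile_S3 :: "strand list \<Rightarrow> strand list \<Rightarrow> strand list \<Rightarrow> box \<Rightarrow> strand list \<Rightarrow> step list \<times> step list" where
  "tile_S3 a b l g r = (let c = l @ bsrc g @ r; c' = l @ btgt g @ r in
    ([Step [] [] (HexS a b c) True [] [(l, g, r @ a @ b)], Step [(a, Cr b c, [])] [] (NatR a l g r) True b [],
      Step [] a (NatR b l g r) True [] [([], Cr a c', b)]],
     [Step [] [] (NatR (a @ b) l g r) True [] [], Step [(a @ b @ l, g, r)] [] (HexS a b c') True [] []]))"

definition tile_R1 :: "strand list \<Rightarrow> box \<Rightarrow> strand list \<Rightarrow> strand list \<Rightarrow> strand list \<Rightarrow> step list \<times> step list" where
  "tile_R1 l g r b c = (let a = l @ bsrc g @ r; a' = l @ btgt g @ r in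
    ([Step [] [] (HexR a b c) True [] [(b @ c @ l, g, r)], Step [([], Cr a b, c)] b (NatL l g r c) True [] [],
      Step [] [] (NatL l g r b) True c [(b, Cr a' c, [])]],
     [Step [] [] (NatL l g r (b @ c)) True [] [], Step [(l, g, r @ b @ c)] [] (HexR a' b c) True [] []]))"

definition tile_R2 :: "strand list \<Rightarrow> strand list \<Rightarrow> box \<Rightarrow> strand list \<Rightarrow> strand list \<Rightarrow> step list \<times> step list" where
  "tile_R2 a l g r c = (let b = l @ bsrc g @ r; b' = l @ btgt g @ r in
    ([Step [] [] (HexR a b c) True [] [(l, g, r @ c @ a)], Step [] [] (NatR a l g r) True c [(b', Cr a c, [])]],
     [Step [] [] (NatR a l g (r @ c)) True [] [], Step [(a @ l, g, r @ c)] [] (HexR a b' c) True [] []]))"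

definition tile_R3 :: "strand list \<Rightarrow> strand list \<Rightarrow> strand list \<Rightarrow> box \<Rightarrow> strand list \<Rightarrow> step list \<times> step list" where
  "tile_R3 a b l g r = (let c = l @ bsrc g @ r; c' = l @ btgt g @ r in
    ([Step [] [] (HexR a b c) True [] [(b @ l, g, r @ a)], Step [([], Cr a b, c)] b (NatR a l g r) True [] []],
     [Step [] [] (NatR a (b @ l) g r) True [] [], Step [(a @ b @ l, g, r)] [] (HexR a b c') True [] []]))"

text \<open>The compatibility \<open>braid_inter\<close> of the braiding with interchangers, for one
  box in each of the two factors.\<close>

definition tile_inter :: "strand list \<Rightarrow> box \<Rightarrow> strand list \<Rightarrow> strand list \<Rightarrow> box \<Rightarrow> strand list \<Rightarrow> step list \<times> step list" where
  "tile_inter l g r l' h r' = (let a = l @ bsrc g @ r; a' = l @ btgt g @ r; b = l' @ bsrc h @ r'; b' = l' @ btgt h @ r' in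
    ([Step [] [] (NatR a l' h r') True [] [(b' @ l, g, r)], Step [(a @ l', h, r')] [] (NatL l g r b') True [] []],
     [Step [] [] (NatL l g r b) True [] [(l', h, r' @ a')], Step [(l, g, r @ b)] [] (NatR a' l' h r') True [] []]))"

text \<open>Naturality of the braiding at the associator of C. The pseudonaturality cells at its
  source and target, which are composites of two layers, are written as two steps each.\<close>

definition tile_NL_assoc :: "nat \<Rightarrow> nat \<Rightarrow> nat \<Rightarrow> nat \<Rightarrow> strand list \<Rightarrow> step list \<times> step list" where
  "tile_NL_assoc i j k l b =
    ([Step [] [] (NatL [] (MC j k l) [SC i j] b) True [] [(b, MC i j l, [])],
      Step [([], MC j k l, SC i j # b)] [] (NatL [] (MC i j l) [] b) True [] [],
      Step [] [] (AssC i j k l) True b [([], Cr [SC i l] b, [])]],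
     [Step [([], Cr [SC k l, SC j k, SC i j] b, [])] b (AssC i j k l) True [] [],
      Step [] [] (NatL [SC k l] (MC i j k) [] b) True [] [(b, MC i k l, [])],
      Step [([SC k l], MC i j k, b)] [] (NatL [] (MC i k l) [] b) True [] []])"

definition tile_NR_assoc :: "nat \<Rightarrow> nat \<Rightarrow> nat \<Rightarrow> nat \<Rightarrow> strand list \<Rightarrow> step list \<times> step list" where
  "tile_NR_assoc i j k l a =
    ([Step [] [] (NatR a [] (MB j k l) [SB i j]) True [] [([], MB i j l, a)],
      Step [(a, MB j k l, [SB i j])] [] (NatR a [] (MB i j l) []) True [] [],
      Step [] a (AssB i j k l) True [] [([], Cr a [SB i l], [])]],
     [Step [([], Cr a [SB k l, SB j k, SB i j], [])] [] (AssB i j k l) True a [],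
      Step [] [] (NatR a [SB k l] (MB i j k) []) True [] [([], MB i k l, a)],
      Step [(a @ [SB k l], MB i j k, [])] [] (NatR a [] (MB i k l) []) True [] []])"

text \<open>The same naturality at a unitor. Its target is an identity, so no pseudonaturality cell
  remains on the right-hand side.\<close>

definition tile_NL_right :: "nat \<Rightarrow> nat \<Rightarrow> strand list \<Rightarrow> step list \<times> step list" where
  "tile_NL_right i j b =
    ([Step [] [] (NatL [SC i j] (UC i) [] b) True [] [(b, MC i i j, [])],
      Step [([SC i j], UC i, b)] [] (NatL [] (MC i i j) [] b) True [] [],
      Step [] [] (RightC i j) True b [([], Cr [SC i j] b, [])]],
     [Step [([], Cr [SC i j] b, [])] b (RightC i j) True [] []])"

definition tile_NR_left :: "nat \<Rightarrow> nat \<Rightarrow> strand list \<Rightarrow> step list \<times> step list" where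
  "tile_NR_left i j a =
    ([Step [] [] (NatR a [] (UB j) [SB i j]) True [] [([], MB i j j, a)],
      Step [(a, UB j, [SB i j])] [] (NatR a [] (MB i j j) []) True [] [],
      Step [] a (LeftB i j) True [] [([], Cr a [SB i j], [])]],
     [Step [([], Cr a [SB i j], [])] [] (LeftB i j) True a []])"

text \<open>With the unit in the middle \<open>hexS\<close> is an identity, but its target diagram
  has the spurious box \<open>Cr [] c\<close>. Erasing this box leads back to the original diagram,
  hence the empty path.\<close>

definition tile_S_unit :: "strand list \<Rightarrow> strand list \<Rightarrow> step list \<times> step list" where
  "tile_S_unit a c = ([Step [] [] (HexS a [] c) True [] [], Step [] a (TrivL c) True [] [([], Cr a c, [])]], [])"

definition tile_R_unit :: "strand list \<Rightarrow> strand list \<Rightarrow> step list \<times> step list" where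
  "tile_R_unit a c = ([Step [] [] (HexR a [] c) True [] [], Step [] [] (TrivR a) True c [([], Cr a c, [])]], [])"

text \<open>Axiom (AC) of B; its \<Sigma>^-1 is the gap between the two steps of the right-hand
  side.\<close>

definition tile_ACB :: "nat \<Rightarrow> nat \<Rightarrow> nat \<Rightarrow> nat \<Rightarrow> nat \<Rightarrow> step list \<times> step list" where
  "tile_ACB i j k l m =
    ([Step [] [] (AssB j k l m) True [SB i j] [([], MB i j m, [])],
      Step [([SB l m], MB j k l, [SB i j])] [] (AssB i j l m) True [] [],
      Step [] [SB l m] (AssB i j k l) True [] [([], MB i l m, [])]],
     [Step [([], MB k l m, [SB j k, SB i j])] [] (AssB i j k m) True [] [],
      Step [([SB l m, SB k l], MB i j k, [])] [] (AssB i k l m) True [] []])"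

definition tile_ICB :: "nat \<Rightarrow> nat \<Rightarrow> nat \<Rightarrow> step list \<times> step list" where
  "tile_ICB i j k =
    ([Step [([SB j k], UB j, [SB i j])] [] (AssB i j j k) True [] [],
      Step [] [SB j k] (LeftB i j) True [] [([], MB i j k, [])]],
     [Step [] [] (RightB j k) True [SB i j] [([], MB i j k, [])]])"

definition tile_ACC :: "nat \<Rightarrow> nat \<Rightarrow> nat \<Rightarrow> nat \<Rightarrow> nat \<Rightarrow> step list \<times> step list" where
  "tile_ACC i j k l m =
    ([Step [] [] (AssC j k l m) True [SC i j] [([], MC i j m, [])],
      Step [([SC l m], MC j k l, [SC i j])] [] (AssC i j l m) True [] [],
      Step [] [SC l m] (AssC i j k l) True [] [([], MC i l m, [])]],
     [Step [([], MC k l m, [SC j k, SC i j])] [] (AssC i j k m) True [] [],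
      Step [([SC l m, SC k l], MC i j k, [])] [] (AssC i k l m) True [] []])"

definition tile_ICC :: "nat \<Rightarrow> nat \<Rightarrow> nat \<Rightarrow> step list \<times> step list" where
  "tile_ICC i j k =
    ([Step [([SC j k], UC j, [SC i j])] [] (AssC i j j k) True [] [],
      Step [] [SC j k] (LeftC i j) True [] [([], MC i j k, [])]],
     [Step [] [] (RightC j k) True [SC i j] [([], MC i j k, [])]])"

text \<open>The multiplication of C precedes that of B because \<open>f \<boxtimes> g\<close> is the
  domain of \<open>\<Sigma> f g\<close>, in which \<open>g\<close> is applied first. The same holds
  for the units below.\<close>

definition mul_diag :: "nat \<Rightarrow> nat \<Rightarrow> nat \<Rightarrow> diagram" where
  "mul_diag i j k = [([SB j k], Cr [SC j k] [SB i j], [SC i j]), ([SB j k, SB i j], MC i j k, []), ([], MB i j k, [SC i k])]"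

definition unit_diag :: "nat \<Rightarrow> diagram" where
  "unit_diag i = [([], UC i, []), ([], UB i, [SC i i])]"

abbreviation SBC :: "nat \<Rightarrow> nat \<Rightarrow> strand list" where
  "SBC i j \<equiv> [SB i j, SC i j]"

text \<open>Five of the six constituents of the associator appear as rules, the simultaneous
  \<alpha>\<alpha> as two consecutive ones. The sixth, the interchanger of two braidings, is the gap
  between \<open>HexS\<close> and \<open>HexR\<close>.\<close>

definition assoc_path :: "nat \<Rightarrow> nat \<Rightarrow> nat \<Rightarrow> nat \<Rightarrow> step list" where
  "assoc_path i j k l = (
     let x12 = ([SB k l], Cr [SC k l] [SB j k], [SC j k, SB i j, SC i j]);
         x23 = ([SB k l, SC k l, SB j k], Cr [SC j k] [SB i j], [SC i j]);
         x123 = ([SB k l], Cr [SC k l] [SB j k, SB i j], [SC j k, SC i j]);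
         Y = [([], MB j k l, [SB i j, SC j l, SC i j]), ([SB j l, SB i j], MC i j l, []), ([], MB i j l, [SC i l])];
         n = ([SB k l, SB j k, SB i j], MC j k l, [SC i j])
     in [Step [x12] [SB k l, SB j k] (NatL [] (MC j k l) [] [SB i j]) False [SC i j] Y,
         Step [x12] [SB k l, SB j k] (HexS [SC k l] [SC j k] [SB i j]) True [SC i j] (n # Y),
         Step [x23] [SB k l] (HexR [SC k l] [SB j k] [SB i j]) False [SC j k, SC i j] (n # Y),
         Step [x23, x123, n, ([SB k l, SB j k, SB i j], MC i j l, [])] [] (AssB i j k l) True [SC i l] [],
         Step [x23, x123] [SB k l, SB j k, SB i j] (AssC i j k l) True []
           [([SB k l], MB i j k, [SC i l]), ([], MB i k l, [SC i l])],
         Step [x23, ([SB k l, SC k l, SB j k, SB i j], MC i j k, [])] [SB k l] (NatR [SC k l] [] (MB i j k) []) True [SC i k]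
           [([SB k l, SB i k], MC i k l, []), ([], MB i k l, [SC i l])]])"

text \<open>\<open>TrivL\<close> has an identity as its cell; it bridges the difference between a
  braiding with the unit and no box at all.\<close>

definition left_path :: "nat \<Rightarrow> nat \<Rightarrow> step list" where
  "left_path i j = (
     let Y = [([], UB j, [SB i j, SC j j, SC i j]), ([SB j j, SB i j], MC i j j, []), ([], MB i j j, [SC i j])]
     in [Step [] [] (NatL [] (UC j) [] [SB i j]) False [SC i j] Y,
         Step [] [] (TrivL [SB i j]) True [SC i j] (([SB i j], UC j, [SC i j]) # Y),
         Step [] [SB i j] (LeftC i j) True [] [([], UB j, [SB i j, SC i j]), ([], MB i j j, [SC i j])],
         Step [] [] (LeftB i j) True [SC i j] []])"

definition right_path :: "nat \<Rightarrow> nat \<Rightarrow> step list" where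
  "right_path i j = (
     let v = ([SB i j, SC i j], UC i, []); Y = [([SB i j, SB i i], MC i i j, []), ([], MB i i j, [SC i j])]
     in [Step [v] [SB i j] (NatR [SC i j] [] (UB i) []) False [SC i i] Y,
         Step [v] [SB i j] (TrivR [SC i j]) True [SC i i] (([SB i j], UB i, [SC i j, SC i i]) # Y),
         Step [] [SB i j] (RightC i j) True [] [([SB i j], UB i, [SC i j]), ([], MB i i j, [SC i j])],
         Step [] [] (RightB i j) True [SC i j] []])"

text \<open>The crossing of a C-strand over a B-strand behaves like a distributive law; the following five equations
  are its compatibilities with the multiplications and units.\<close>

definition distC_assoc :: "step list \<times> step list" where
  "distC_assoc = ([Step [([], MC 2 3 4, [SC 1 2, SB 0 1])] [] (NatL [] (MC 1 2 4) [] [SB 0 1]) False [] [],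
   Step [([], MC 2 3 4, [SC 1 2, SB 0 1])] [] (HexS [SC 2 4] [SC 1 2] [SB 0 1]) True [] [([SB 0 1], MC 1 2 4, [])],
   Step [([SC 3 4, SC 2 3], Cr [SC 1 2] [SB 0 1], [])] [] (NatL [] (MC 2 3 4) [] [SB 0 1]) False [SC 1 2] [([SB 0 1], MC 1 2 4, [])],
   Step [([SC 3 4, SC 2 3], Cr [SC 1 2] [SB 0 1], [])] [] (HexS [SC 3 4] [SC 2 3] [SB 0 1]) True [SC 1 2] [([SB 0 1], MC 2 3 4, [SC 1 2]), ([SB 0 1], MC 1 2 4, [])],
   Step [([SC 3 4, SC 2 3], Cr [SC 1 2] [SB 0 1], []), ([SC 3 4], Cr [SC 2 3] [SB 0 1], [SC 1 2]), ([], Cr [SC 3 4] [SB 0 1], [SC 2 3, SC 1 2])] [SB 0 1] (AssC 1 2 3 4) True [] []],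
    [Step [] [] (AssC 1 2 3 4) True [SB 0 1] [([], Cr [SC 1 4] [SB 0 1], [])],
   Step [([SC 3 4], MC 1 2 3, [SB 0 1])] [] (NatL [] (MC 1 3 4) [] [SB 0 1]) False [] [],
   Step [([SC 3 4], MC 1 2 3, [SB 0 1])] [] (HexS [SC 3 4] [SC 1 3] [SB 0 1]) True [] [([SB 0 1], MC 1 3 4, [])],
   Step [] [SC 3 4] (NatL [] (MC 1 2 3) [] [SB 0 1]) False [] [([], Cr [SC 3 4] [SB 0 1], [SC 1 3]), ([SB 0 1], MC 1 3 4, [])],
   Step [] [SC 3 4] (HexS [SC 2 3] [SC 1 2] [SB 0 1]) True [] [([SC 3 4, SB 0 1], MC 1 2 3, []), ([], Cr [SC 3 4] [SB 0 1], [SC 1 3]), ([SB 0 1], MC 1 3 4, [])]])"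

definition distB_assoc :: "step list \<times> step list" where
  "distB_assoc = ([Step [] [] (HexR [SC 3 4] [SB 2 3] [SB 1 2]) False [SB 0 1] [([SB 2 3, SB 1 2], Cr [SC 3 4] [SB 0 1], []), ([], MB 1 2 3, [SB 0 1, SC 3 4]), ([], MB 0 1 3, [SC 3 4])],
   Step [] [] (NatR [SC 3 4] [] (MB 1 2 3) []) True [SB 0 1] [([SB 1 3], Cr [SC 3 4] [SB 0 1], []), ([], MB 0 1 3, [SC 3 4])],
   Step [([SC 3 4], MB 1 2 3, [SB 0 1])] [] (HexR [SC 3 4] [SB 1 3] [SB 0 1]) False [] [([], MB 0 1 3, [SC 3 4])],
   Step [([SC 3 4], MB 1 2 3, [SB 0 1])] [] (NatR [SC 3 4] [] (MB 0 1 3) []) True [] [],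
   Step [] [SC 3 4] (AssB 0 1 2 3) True [] [([], Cr [SC 3 4] [SB 0 3], [])]],
    [Step [([], Cr [SC 3 4] [SB 2 3], [SB 1 2, SB 0 1]), ([SB 2 3], Cr [SC 3 4] [SB 1 2], [SB 0 1]), ([SB 2 3, SB 1 2], Cr [SC 3 4] [SB 0 1], [])] [] (AssB 0 1 2 3) True [SC 3 4] [],
   Step [([], Cr [SC 3 4] [SB 2 3], [SB 1 2, SB 0 1])] [SB 2 3] (HexR [SC 3 4] [SB 1 2] [SB 0 1]) False [] [([SB 2 3], MB 0 1 2, [SC 3 4]), ([], MB 0 2 3, [SC 3 4])],
   Step [([], Cr [SC 3 4] [SB 2 3], [SB 1 2, SB 0 1])] [SB 2 3] (NatR [SC 3 4] [] (MB 0 1 2) []) True [] [([], MB 0 2 3, [SC 3 4])],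
   Step [([SC 3 4, SB 2 3], MB 0 1 2, [])] [] (HexR [SC 3 4] [SB 2 3] [SB 0 2]) False [] [([], MB 0 2 3, [SC 3 4])],
   Step [([SC 3 4, SB 2 3], MB 0 1 2, [])] [] (NatR [SC 3 4] [] (MB 0 2 3) []) True [] []])"

definition distCB :: "step list \<times> step list" where
  "distCB = ([Step [([], MC 2 3 4, [SB 1 2, SB 0 1])] [] (HexR [SC 2 4] [SB 1 2] [SB 0 1]) False [] [([], MB 0 1 2, [SC 2 4])],
   Step [([], MC 2 3 4, [SB 1 2, SB 0 1])] [] (NatR [SC 2 4] [] (MB 0 1 2) []) True [] [],
   Step [([SC 3 4, SC 2 3], MB 0 1 2, [])] [] (NatL [] (MC 2 3 4) [] [SB 0 2]) False [] [],
   Step [([SC 3 4, SC 2 3], MB 0 1 2, [])] [] (HexS [SC 3 4] [SC 2 3] [SB 0 2]) True [] [([SB 0 2], MC 2 3 4, [])]],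
    [Step [] [] (NatL [] (MC 2 3 4) [] [SB 1 2]) False [SB 0 1] [([SB 1 2], Cr [SC 2 4] [SB 0 1], []), ([], MB 0 1 2, [SC 2 4])],
   Step [] [] (HexS [SC 3 4] [SC 2 3] [SB 1 2]) True [SB 0 1] [([SB 1 2], MC 2 3 4, [SB 0 1]), ([SB 1 2], Cr [SC 2 4] [SB 0 1], []), ([], MB 0 1 2, [SC 2 4])],
   Step [([SC 3 4], Cr [SC 2 3] [SB 1 2], [SB 0 1]), ([], Cr [SC 3 4] [SB 1 2], [SC 2 3, SB 0 1])] [SB 1 2] (NatL [] (MC 2 3 4) [] [SB 0 1]) False [] [([], MB 0 1 2, [SC 2 4])],
   Step [([SC 3 4], Cr [SC 2 3] [SB 1 2], [SB 0 1]), ([], Cr [SC 3 4] [SB 1 2], [SC 2 3, SB 0 1])] [SB 1 2] (HexS [SC 3 4] [SC 2 3] [SB 0 1]) True [] [([SB 1 2, SB 0 1], MC 2 3 4, []), ([], MB 0 1 2, [SC 2 4])],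
   Step [([SC 3 4], Cr [SC 2 3] [SB 1 2], [SB 0 1]), ([SC 3 4, SB 1 2], Cr [SC 2 3] [SB 0 1], [])] [] (HexR [SC 3 4] [SB 1 2] [SB 0 1]) False [SC 2 3] [([SB 1 2, SB 0 1], MC 2 3 4, []), ([], MB 0 1 2, [SC 2 4])],
   Step [([SC 3 4], Cr [SC 2 3] [SB 1 2], [SB 0 1]), ([SC 3 4, SB 1 2], Cr [SC 2 3] [SB 0 1], [])] [] (NatR [SC 3 4] [] (MB 0 1 2) []) True [SC 2 3] [([SB 0 2], MC 2 3 4, [])],
   Step [] [SC 3 4] (HexR [SC 2 3] [SB 1 2] [SB 0 1]) False [] [([SC 3 4], MB 0 1 2, [SC 2 3]), ([], Cr [SC 3 4] [SB 0 2], [SC 2 3]), ([SB 0 2], MC 2 3 4, [])],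
   Step [] [SC 3 4] (NatR [SC 2 3] [] (MB 0 1 2) []) True [] [([], Cr [SC 3 4] [SB 0 2], [SC 2 3]), ([SB 0 2], MC 2 3 4, [])]])"

text \<open>In (IC) the units stand between two hom-objects of B \<otimes> C. The C-strand on the
  left crosses a unit of B that is then absorbed by the B-strand on the right; in
  \<open>distC_unit\<close>, the B-strand on the right is crossed by a unit of C absorbed by the
  C-strand on the left.\<close>

definition distB_unit :: "step list \<times> step list" where
  "distB_unit = ([Step [([SC 1 2], UB 1, [SB 0 1])] [] (HexR [SC 1 2] [SB 1 1] [SB 0 1]) False [] [([], MB 0 1 1, [SC 1 2])],
   Step [([SC 1 2], UB 1, [SB 0 1])] [] (NatR [SC 1 2] [] (MB 0 1 1) []) True [] [],
   Step [] [SC 1 2] (LeftB 0 1) True [] [([], Cr [SC 1 2] [SB 0 1], [])]],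
    [Step [] [] (NatR [SC 1 2] [] (UB 1) []) False [SB 0 1] [([SB 1 1], Cr [SC 1 2] [SB 0 1], []), ([], MB 0 1 1, [SC 1 2])],
   Step [] [] (TrivR [SC 1 2]) True [SB 0 1] [([], UB 1, [SC 1 2, SB 0 1]), ([SB 1 1], Cr [SC 1 2] [SB 0 1], []), ([], MB 0 1 1, [SC 1 2])],
   Step [([], Cr [SC 1 2] [SB 0 1], [])] [] (LeftB 0 1) True [SC 1 2] []])"

definition distC_unit :: "step list \<times> step list" where
  "distC_unit = ([Step [([SC 1 2], UC 1, [SB 0 1])] [] (NatL [] (MC 1 1 2) [] [SB 0 1]) False [] [],
   Step [([SC 1 2], UC 1, [SB 0 1])] [] (HexS [SC 1 2] [SC 1 1] [SB 0 1]) True [] [([SB 0 1], MC 1 1 2, [])],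
   Step [] [SC 1 2] (NatL [] (UC 1) [] [SB 0 1]) False [] [([], Cr [SC 1 2] [SB 0 1], [SC 1 1]), ([SB 0 1], MC 1 1 2, [])],
   Step [] [SC 1 2] (TrivL [SB 0 1]) True [] [([SC 1 2, SB 0 1], UC 1, []), ([], Cr [SC 1 2] [SB 0 1], [SC 1 1]), ([SB 0 1], MC 1 1 2, [])],
   Step [([], Cr [SC 1 2] [SB 0 1], [])] [SB 0 1] (RightC 1 2) True [] []],
    [Step [] [] (RightC 1 2) True [SB 0 1] [([], Cr [SC 1 2] [SB 0 1], [])]])"

section \<open>Certificates for the distributive laws and for both axioms\<close>

lemma distC_assoc_valid:
  "pvalid [SC 3 4, SC 2 3, SC 1 2, SB 0 1] [SB 0 1, SC 1 4]
    [([], MC 2 3 4, [SC 1 2, SB 0 1]), ([], MC 1 2 4, [SB 0 1]), ([], Cr [SC 1 4] [SB 0 1], [])]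
    (fst distC_assoc)
    [([SC 3 4, SC 2 3], Cr [SC 1 2] [SB 0 1], []), ([SC 3 4], Cr [SC 2 3] [SB 0 1], [SC 1 2]), ([], Cr [SC 3 4] [SB 0 1], [SC 2 3, SC 1 2]), ([SB 0 1, SC 3 4], MC 1 2 3, []), ([SB 0 1], MC 1 3 4, [])]"
  by code_simp

text \<open>The validity check supplies a 2-cell for the left-hand path; replaying the moves
  transports it to the right-hand path. The equations used are basic tiles, some of them rotated or
  reversed to expose the steps at hand.\<close>

lemma distC_assoc_run:
  "run [rotate_tile 1 1 (tile_S1 [] (MC 2 3 4) [] [SC 1 2] [SB 0 1]),
      tile_SS [SC 3 4] [SC 2 3] [SC 1 2] [SB 0 1],
      rotate_tile 1 2 (prod.swap (tile_NL_assoc 1 2 3 4 [SB 0 1])),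
      rotate_tile 1 1 (tile_S2 [SC 3 4] [] (MC 1 2 3) [] [SB 0 1])]
    [Tile 1 0 0 True, Tile 2 1 0 False, Comm 3, Comm 2, Tile 0 2 0 False, Tile 2 3 0 False, Rep 4
     [SY 0]]
    (fst distC_assoc) = Some (snd distC_assoc)"
  by code_simp

lemma distB_assoc_valid:
  "pvalid [SC 3 4, SB 2 3, SB 1 2, SB 0 1] [SB 0 3, SC 3 4]
    [([], Cr [SC 3 4] [SB 2 3], [SB 1 2, SB 0 1]), ([SB 2 3], Cr [SC 3 4] [SB 1 2], [SB 0 1]), ([SB 2 3, SB 1 2], Cr [SC 3 4] [SB 0 1], []), ([], MB 1 2 3, [SB 0 1, SC 3 4]), ([], MB 0 1 3, [SC 3 4])]
    (fst distB_assoc)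
    [([SC 3 4, SB 2 3], MB 0 1 2, []), ([SC 3 4], MB 0 2 3, []), ([], Cr [SC 3 4] [SB 0 3], [])]"
  by code_simp

lemma distB_assoc_run:
  "run [rotate_tile 1 1 (prod.swap (tile_R2 [SC 3 4] [] (MB 1 2 3) [] [SB 0 1])),
      rotate_tile 0 2 (tile_RR [SC 3 4] [SB 2 3] [SB 1 2] [SB 0 1]),
      tile_NR_assoc 0 1 2 3 [SC 3 4],
      rotate_tile 1 1 (prod.swap (tile_R3 [SC 3 4] [SB 2 3] [] (MB 0 1 2) []))]
    [Tile 1 0 0 True, Tile 0 1 0 True, Tile 2 2 0 False, Comm 1, Tile 2 3 0 False, Comm 0]
    (fst distB_assoc) = Some (snd distB_assoc)"
  by code_simp

lemma distCB_valid:
  "pvalid [SC 3 4, SC 2 3, SB 1 2, SB 0 1] [SB 0 2, SC 2 4]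
    [([], MC 2 3 4, [SB 1 2, SB 0 1]), ([], Cr [SC 2 4] [SB 1 2], [SB 0 1]), ([SB 1 2], Cr [SC 2 4] [SB 0 1], []), ([], MB 0 1 2, [SC 2 4])]
    (fst distCB)
    [([SC 3 4, SC 2 3], MB 0 1 2, []), ([SC 3 4], Cr [SC 2 3] [SB 0 2], []), ([], Cr [SC 3 4] [SB 0 2], [SC 2 3]), ([SB 0 2], MC 2 3 4, [])]"
  by code_simp

lemma distCB_run:
  "run [rotate_tile 1 1 (tile_inter [] (MC 2 3 4) [] [] (MB 0 1 2) []),
      prod.swap (tile_S3 [SC 3 4] [SC 2 3] [] (MB 0 1 2) []),
      rotate_tile 0 2 (tile_R1 [] (MC 2 3 4) [] [SB 1 2] [SB 0 1]),
      rotate_tile 1 1 (prod.swap (tile_RS [SC 3 4] [SC 2 3] [SB 1 2] [SB 0 1]))]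
    [Tile 1 0 0 True, Tile 2 1 0 False, Tile 0 2 0 False, Rep 3 [SY 0], Tile 2 3 0 False, Comm 1,
     Rep 5 [SY 1], Comm 5]
    (fst distCB) = Some (snd distCB)"
  by code_simp

lemma distB_unit_valid:
  "pvalid [SC 1 2, SB 0 1] [SB 0 1, SC 1 2]
    [([SC 1 2], UB 1, [SB 0 1]), ([], Cr [SC 1 2] [SB 1 1], [SB 0 1]), ([SB 1 1], Cr [SC 1 2] [SB 0 1], []), ([], MB 0 1 1, [SC 1 2])]
    (fst distB_unit)
    [([], Cr [SC 1 2] [SB 0 1], [])]"
  by code_simp

lemma distB_unit_run:
  "run [rotate_tile 1 1 (prod.swap (tile_NR_left 0 1 [SC 1 2])),
      rotate_tile 0 2 (tile_R2 [SC 1 2] [] (UB 1) [] [SB 0 1]),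
      rotate_tile 0 1 (prod.swap (tile_R_unit [SC 1 2] [SB 0 1]))]
    [Tile 1 0 0 True, Tile 0 1 0 False, Tile 1 2 0 False, Rep 1 [SY 0]]
    (fst distB_unit) = Some (snd distB_unit)"
  by code_simp

lemma distC_unit_valid:
  "pvalid [SC 1 2, SB 0 1] [SB 0 1, SC 1 2]
    [([SC 1 2], UC 1, [SB 0 1]), ([], MC 1 1 2, [SB 0 1]), ([], Cr [SC 1 2] [SB 0 1], [])]
    (fst distC_unit)
    [([], Cr [SC 1 2] [SB 0 1], [])]"
  by code_simp

lemma distC_unit_run:
  "run [rotate_tile 1 1 (tile_S2 [SC 1 2] [] (UC 1) [] [SB 0 1]),
      tile_S_unit [SC 1 2] [SB 0 1],
      rotate_tile 1 2 (prod.swap (tile_NL_right 1 2 [SB 0 1]))]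
    [Tile 1 0 0 True, Rep 3 [SY 0], Tile 2 1 0 False, Tile 0 2 0 False]
    (fst distC_unit) = Some (snd distC_unit)"
  by code_simp

text \<open>Turns the existence of a common path into an equation between two evaluations, so that
  this path never has to be written down.\<close>

lemma common_value: "x = y \<Longrightarrow> x \<noteq> None \<Longrightarrow> \<exists>p. x = Some p \<and> y = Some p"
  by auto
text \<open>The whiskered associators of the two sides of (AC), in order of application. The
  interchanger of the two multiplications, on the side of \<open>ac_rhs\<close>, contributes no
  step.\<close>

definition ac_lhs :: "step list" where
  "ac_lhs = wpath [] [] (SBC 0 1) (mul_diag 0 1 4) (assoc_path 1 2 3 4)
    @ wpath (wdiag (SBC 3 4) (SBC 0 1) (mul_diag 1 2 3)) [] [] [] (assoc_path 0 1 3 4)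
    @ wpath [] (SBC 3 4) [] (mul_diag 0 3 4) (assoc_path 0 1 2 3)"

definition ac_rhs :: "step list" where
  "ac_rhs = wpath (wdiag [] (SBC 1 2 @ SBC 0 1) (mul_diag 2 3 4)) [] [] [] (assoc_path 0 1 2 4)
    @ wpath (wdiag (SBC 3 4 @ SBC 2 3) [] (mul_diag 0 1 2)) [] [] [] (assoc_path 0 2 3 4)"

definition ic_lhs :: "step list" where
  "ic_lhs = wpath (wdiag (SBC 1 2) (SBC 0 1) (unit_diag 1)) [] [] [] (assoc_path 0 1 1 2)
    @ wpath [] (SBC 1 2) [] (mul_diag 0 1 2) (left_path 0 1)"

definition ic_rhs :: "step list" where
  "ic_rhs = wpath [] [] (SBC 0 1) (mul_diag 0 1 2) (right_path 1 2)"

text \<open>Neither side is rewritten into the other; both are brought to one path. The side with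
  three associators uses the associativities of crossings and (AC) of B and C. The side with two
  uses \<open>distCB\<close>, since there a product in C crosses a product in B.\<close>

lemma ac_run:
  "\<exists>p. run [distC_assoc, distB_assoc, tile_ACB 0 1 2 3 4, tile_ACC 0 1 2 3 4]
    [Rep 5 [Dn, SY 2], Rep 6 [SX 1, SX 2], Comm 5, Rep 7 [SX 1, SX 2], Comm 6, Rep 11 [SX 2, Dn],
     Rep 12 [SY 1, SY 2], Comm 11, Rep 10 [SX 2], Rep 11 [SY 2, SY 3], Comm 10, Rep 9 [SX 2, Dn,
     Dn], Rep 10 [SY 3, SY 2, SY 4, SY 3], Comm 9, Rep 8 [SX 2], Rep 9 [SY 3, SY 2, SY 4], Comm 8,
     Rep 8 [Up, Up], Comm 7, Rep 12 [SX 2, Dn], Rep 13 [SY 0, SY 2, SY 1, SY 3, SY 2], Comm 12, Rep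
     12 [SY 2, SY 1, SY 0, SY 3, SY 4], Comm 11, Rep 10 [SX 2, SX 3, Dn], Rep 11 [SY 0, SY 1, SY 4,
     SY 3, SY 2, SY 5, SY 4, SY 3], Comm 10, Rep 9 [SX 2, Dn], Rep 10 [SY 3, SY 2, SY 4, SY 3, SY
     5], Comm 9, Rep 9 [Up, Up, SY 0], Comm 8, Rep 4 [SY 1, SY 0], Rep 5 [SX 2, Dn], Rep 6 [SX 2,
     Dn, SY 0], Rep 7 [Dn, SY 0, SY 1], Rep 8 [Dn, SY 0, SY 1, SY 2], Tile 4 0 2 True, Rep 8 [Up, SX
     4, SX 3, SX 2], Rep 9 [SY 2], Comm 8, Rep 7 [SY 1, SY 0, Up, SX 2], Comm 7, Rep 6 [SY 0, Up, SX
     2], Comm 6, Rep 5 [SY 0, Up, SX 2], Rep 6 [SY 0], Comm 5, Rep 4 [Up, SX 2], Comm 4, Rep 2 [SY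
     0, SY 2, SY 1], Rep 3 [Dn, Dn], Comm 2, Rep 9 [SX 2, SX 3], Rep 10 [SX 2, SX 1], Comm 9, Comm
     4, Rep 3 [SY 1, SY 0, SY 2, SY 1, SY 3, SY 2], Rep 4 [SX 2, Dn], Comm 3, Comm 5, Rep 5 [SX 2,
     Dn, SY 0], Comm 4, Rep 6 [SY 0], Comm 6, Rep 5 [SY 0], Rep 6 [SX 2, Dn, SY 0], Comm 5, Comm 7,
     Rep 7 [SX 2, Dn, SY 0, SY 1], Comm 6, Rep 12 [SX 3, SX 4, Up, SX 5], Comm 12, Comm 9, Rep 9 [SX
     3, SX 2], Comm 8, Rep 8 [SX 2, SX 3, SX 4, Dn], Comm 7, Rep 10 [SY 1, SY 0, SY 3, SY 2, SY 1],
     Rep 11 [SX 2, SX 1], Comm 10, Rep 9 [SY 4, SY 3, SY 6, SY 5, SY 4], Rep 10 [SX 3, SX 2], Comm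
     9, Rep 8 [SY 4, SY 3, SY 5, SY 4, SY 7, SY 6, SY 5], Rep 9 [SX 2, SX 3, SX 4], Comm 8, Rep 14
     [SY 0, SY 2, SY 1], Rep 15 [Dn, Dn], Comm 14, Rep 14 [SX 0, SY 1, SY 0], Comm 13, Rep 9 [Up,
     Up], Rep 10 [Up, Up], Rep 11 [SX 1, SX 2], Rep 12 [SY 2, SY 1, SY 0], Rep 13 [SY 3, SY 2, SY
     1], Tile 9 1 3 False, Rep 7 [SY 2], Rep 8 [Up, SX 6, Up, SX 7], Comm 7, Rep 6 [SY 1, SY 0, SY
     2, SY 1, SY 4, SY 3, SY 2], Rep 7 [SX 7, SX 6, Dn, Dn], Comm 6, Rep 5 [SY 0, SY 1, SY 3, SY 2],
     Rep 6 [Up, SX 5], Comm 5, Rep 4 [SY 0, SY 1, SY 3, SY 2], Rep 5 [SX 3], Comm 4, Rep 3 [SY 2],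
     Rep 4 [Up, SX 5], Comm 3, Rep 9 [SX 2, SX 1, SX 3, SX 2, SY 0, Up, SY 0, Up], Comm 8, Rep 8
     [Dn, Dn, SY 1, SY 0], Comm 7, Rep 7 [SY 0, Up], Comm 6, Rep 6 [SX 3], Comm 5, Rep 5 [SY 0, Up],
     Comm 4, Rep 2 [Up, Up, Up, SY 0], Tile 2 2 6 False, Rep 12 [SY 0, SY 1, SY 2], Comm 12, Rep 11
     [SY 1, SY 0, SY 2, SY 1, SY 3, SY 2], Rep 12 [SX 5, Dn], Comm 11, Rep 10 [SY 1, SY 0, SY 2, SY
     1, SY 3, SY 2], Rep 11 [SX 3], Comm 10, Rep 9 [SY 2, SY 1, SY 0, SY 3, SY 2, SY 1, SY 4, SY 3,
     SY 2], Rep 10 [SX 5, Dn], Comm 9, Rep 14 [SY 1, SY 0, SY 2, SY 1], Comm 14, Rep 14 [SX 0, Up,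
     Up, Up], Comm 13, Rep 13 [Dn, SY 0], Comm 12, Rep 12 [SX 3], Comm 11, Rep 11 [Dn, SY 0], Comm
     10, Rep 8 [SY 2, SY 1, SY 0], Rep 9 [SX 2, SX 1, SX 3, SX 2], Rep 10 [SX 2, SX 1, SX 3, SX 2],
     Tile 8 3 6 False]
    ac_lhs = Some p
  \<and> run [distCB]
    [Rep 4 [SX 2, SX 3, Dn, SY 0, Up], Rep 5 [SX 2, SX 3, Dn, Dn, SY 1], Comm 4, Rep 2 [SX 2, Dn, SY
     1, SY 3, SY 2], Rep 3 [SX 2, SX 3, Dn, Dn], Comm 2, Rep 5 [SX 1, SX 2], Rep 6 [SX 1, SX 2, SX
     1, SX 0, Dn, SY 1], Comm 5, Rep 7 [SX 1, SX 2, SX 1, SX 0, Dn, SY 0, SY 2], Comm 6, Rep 3 [SX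
     1, SY 0], Rep 4 [SX 1, SY 1, SY 0, SY 2, SY 1], Rep 5 [SY 1, SY 0, SY 2, SY 1], Rep 6 [SY 2, SY
     1, SY 3, SY 2], Tile 3 0 2 False, Rep 2 [SX 2], Rep 3 [Dn, SY 2], Comm 2, Rep 1 [SX 2, Dn], Rep
     2 [SY 4, SY 3, SY 5], Comm 1, Rep 0 [SX 2, Dn], Rep 1 [SY 1], Comm 0, Rep 4 [Dn, SY 0, SY 3],
     Comm 3, Rep 3 [SY 5, SY 4, SY 6], Comm 2, Rep 2 [SY 2], Comm 1, Rep 3 [SY 1, SY 3, SY 2], Comm
     3, Rep 2 [SY 2], Rep 3 [Up, SX 5], Comm 2, Rep 12 [SX 1, SX 2, Dn, SY 1, SY 0, SY 3, SY 2, SY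
     1], Rep 13 [SX 1, SX 2, SX 3, Dn, Dn, Dn], Comm 12, Rep 12 [SX 2, SX 1, SX 0, Up, Up, SX 5,
     Up], Comm 11, Rep 10 [SX 0, Dn, SY 2, SY 3], Rep 11 [SX 0, SX 1, SX 2, Dn, Dn, Dn], Comm 10,
     Rep 9 [SX 0, Dn, SY 3, SY 4], Rep 10 [SX 2], Comm 9, Rep 8 [SY 0, SY 1], Rep 9 [SX 2, SX 1, SX
     0], Comm 8, Rep 7 [SY 0, SY 1, SY 2], Comm 7, Rep 6 [SY 0, SY 1, SY 2], Rep 7 [SX 3], Comm 6,
     Rep 6 [Up, SX 5], Comm 5, Rep 4 [SY 0], Rep 5 [SX 1, SX 2, SX 3], Comm 4, Rep 3 [SY 0], Rep 4
     [Up, SX 5], Comm 3, Rep 11 [SY 3, SY 2, SY 4, SY 3, SY 5, SY 4], Rep 12 [SX 0, SX 1, SX 2],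
     Comm 11, Rep 10 [SY 4, SY 3, SY 5, SY 4, SY 6, SY 5], Rep 11 [SX 2], Comm 10, Rep 9 [SY 1, SY
     0, SY 2, SY 1, SY 3, SY 2], Rep 10 [SX 2, SX 1, SX 0], Comm 9, Rep 8 [SY 2, SY 1, SY 0, SY 3,
     SY 2, SY 1, SY 4, SY 3, SY 2], Rep 9 [SX 5, Dn], Comm 8, Rep 13 [SY 1, SY 0, SY 2, SY 1, SY 3,
     SY 2], Rep 14 [SX 1, SX 2, SX 3], Comm 13, Rep 12 [SY 2], Comm 12, Rep 11 [SY 3], Rep 12 [SX
     2], Comm 11, Rep 10 [SY 0], Rep 11 [SX 2, SX 1, SX 0], Comm 10, Rep 9 [SY 0], Rep 10 [SX 5,
     Dn], Comm 9, Comm 13, Rep 12 [SY 0], Comm 12, Rep 14 [SY 3, SY 2, SY 1], Rep 15 [SX 1, SX 2,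
     Dn, Dn], Comm 14, Rep 13 [SY 4, SY 3, SY 2], Comm 13, Rep 0 [SY 1, SY 0, SY 2], Rep 1 [SY 2, SY
     1, SY 3], Rep 2 [SX 0], Rep 3 [SX 0], Rep 4 [SX 0], Rep 5 [SX 0], Rep 6 [SX 1, SX 0, SX 2], Rep
     7 [SX 1, SX 0, SX 2], Rep 8 [SX 1, SX 0, SX 3, SX 2], Rep 9 [SX 1, SX 0, SX 3, SX 2], Rep 10
     [SX 0, SX 1, SX 0, SX 2], Rep 11 [SX 0, SX 1, SX 0, SX 2], Rep 12 [SX 0], Rep 13 [SX 0], Rep 14
     [SY 2, SY 1, SY 0, SY 3, SY 2, SY 1], Rep 15 [SY 1, SY 0, Up, SY 1, SY 0]]
    ac_rhs = Some p"
  by (rule common_value; code_simp)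

text \<open>The right-hand side consists of unitors only and is just rearranged by commuting
  independent steps; all equations are applied on the side with the associator.\<close>

lemma ic_run:
  "\<exists>p. run [tile_ICC 0 1 2, distC_unit, distB_unit, tile_ICB 0 1 2]
    [Rep 7 [SY 1], Comm 7, Rep 4 [Up], Rep 5 [Dn], Comm 4, Rep 5 [SX 1], Rep 6 [SY 1, SY 2], Comm 5,
     Rep 6 [SX 1, SX 2, SX 3], Rep 7 [Up, Up, Up], Tile 6 0 4 False, Comm 6, Rep 4 [SX 1], Comm 4,
     Rep 3 [SX 1, Dn, Dn], Rep 4 [SY 4, SY 3], Comm 3, Rep 2 [SX 1], Rep 3 [SY 3, SY 2, SY 4], Comm
     2, Rep 5 [SX 1, Dn], Comm 5, Rep 4 [SX 1, SX 2, Dn], Rep 5 [SY 5, SY 4, SY 3], Comm 4, Rep 3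
     [SX 1, Dn], Rep 4 [SY 3, SY 2, SY 4, SY 3, SY 5], Comm 3, Comm 6, Rep 6 [SY 0, Up], Comm 5, Rep
     5 [Dn, Dn, SY 1], Comm 4, Rep 0 [SX 0, SX 1], Rep 1 [SX 0, SX 1], Rep 2 [Up, Up], Rep 3 [Up,
     Up, SY 0], Tile 0 1 2 False, Rep 1 [SY 1], Comm 1, Rep 3 [SY 0], Rep 4 [SY 1], Tile 2 2 0
     False, Rep 3 [SY 0], Comm 3, Comm 1, Rep 2 [SX 1], Tile 2 3 2 False]
    ic_lhs = Some p
  \<and> run []
    [Rep 1 [Dn, SY 1], Comm 1, Rep 0 [Dn], Rep 1 [Up], Comm 0, Comm 2, Rep 0 [SY 0], Rep 1 [SY 0, SY
     2], Rep 2 [Up, SY 0], Rep 3 [SY 1]]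
    ic_rhs = Some p"
  by (rule common_value; code_simp)

section \<open>Tiles in a braided monoidal bicategory\<close>

context diagram_semantics begin

lemma wh1_bx_right: "wh1 [] r (bx g) = bx g \<rtimes> T r"
  unfolding wh1_def by (simp add: unitL1 hom_Arr[OF bx_in])
lemma wh1_bx_left: "wh1 l [] (bx g) = T l \<ltimes> bx g"
  unfolding wh1_def by (simp add: unitR1 hom_Arr[OF tenL1_in[OF T_in bx_in]])
lemma wh1_bx_Nil: "wh1 [] [] (bx g) = bx g"
  by (rule wh1_Nil[OF hom_Arr[OF bx_in]])
lemma wh1_bx_append_left: "wh1 (k @ l) r (bx g) = T k \<ltimes> wh1 l r (bx g)"
  unfolding wh1_def T_append
  by (simp add: assocLL1[OF T_in T_in] hom_Arr[OF bx_in] assocLR1[OF T_in T_in hom_Arr[OF tenL1_in[OF T_in bx_in]]])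
lemma wh1_bx_append_right: "wh1 l (r @ k) (bx g) = wh1 l r (bx g) \<rtimes> T k"
  unfolding wh1_def T_append by (simp add: assocRR1[OF T_in T_in hom_Arr[OF tenL1_in[OF T_in bx_in]]])
lemma ev_Cons: "ev xs ((l, g, r) # L # d) = ev (l @ btgt g @ r) (L # d) \<cdot> wh1 l r (bx g)"
  by simp
lemma bx_Arr: "bx g \<in> Arr V" by (rule hom_Arr[OF bx_in])
lemma lay_in: "wh1 l r (bx g) \<in> hom V (T (l @ bsrc g @ r)) (T (l @ btgt g @ r))"
  by (rule wh1_in[OF bx_in])

end

text \<open>The families \<open>p\<close> and \<open>q\<close> give meaning to the indices of the
  syntax. They are total so that every strand is interpreted; an axiom at particular objects results
  from a suitable choice.\<close>

locale tensor_data = semistrict_braided V + B: enriched_bicategory V B + C: enriched_bicategory V C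
  for V :: "('o, 'f, 't, 'm) braided_scheme" (structure)
    and B :: "('b, 'o, 'f, 't) enr_bicat" and C :: "('c, 'o, 'f, 't) enr_bicat" +
  fixes p :: "nat \<Rightarrow> 'b" and q :: "nat \<Rightarrow> 'c"
  assumes p_in: "p i \<in> eObj B" and q_in: "q i \<in> eObj C"
begin

fun ob :: "strand \<Rightarrow> 'o" where
  "ob (SB i j) = eHom B (p i) (p j)"
| "ob (SC i j) = eHom C (q i) (q j)"

fun bx :: "box \<Rightarrow> 'f" where
  "bx (MB i j k) = eMul B (p i) (p j) (p k)"
| "bx (MC i j k) = eMul C (q i) (q j) (q k)"
| "bx (UB i) = eUnit B (p i)"
| "bx (UC i) = eUnit C (q i)"
| "bx (Cr as bs) = \<beta> (tens V ob as) (tens V ob bs)"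

lemma ob_Obj: "ob s \<in> Obj V"
  by (cases s) (auto intro: B.eHom_in C.eHom_in p_in q_in)

lemma tens_Obj: "tens V ob xs \<in> Obj V"
  by (induction xs) (auto intro: unit_in ten_Obj ob_Obj)

lemma tens_append: "tens V ob (xs @ ys) = tens V ob xs \<otimes> tens V ob ys"
  by (induction xs) (auto simp: unitL0 tens_Obj assoc0 ob_Obj)

lemma braid_in: "A \<in> Obj V \<Longrightarrow> A' \<in> Obj V \<Longrightarrow> \<beta> A A' \<in> hom V (A \<otimes> A') (A' \<otimes> A)"
  using pseudonatural.s0_in[OF braid_pseudonatR] by blast

lemma bx_hom: "bx g \<in> hom V (tens V ob (bsrc g)) (tens V ob (btgt g))"
proof (cases g)
  case (MB i j k) then show ?thesis using B.eMul_in[OF p_in p_in p_in, of i j k] unitR0[OF ob_Obj] by (simp del: ob.simps) (simp add: B.eHom_in p_in unitR0)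
next
  case (MC i j k) then show ?thesis using C.eMul_in[OF q_in q_in q_in, of i j k] by (simp add: C.eHom_in q_in unitR0)
next
  case (UB i) then show ?thesis using B.eUnit_in[OF p_in] by (simp add: B.eHom_in p_in unitR0)
next
  case (UC i) then show ?thesis using C.eUnit_in[OF q_in] by (simp add: C.eHom_in q_in unitR0)
next
  case (Cr as bs) then show ?thesis using braid_in[OF tens_Obj tens_Obj] by (simp add: tens_append)
qed

sublocale diagram_semantics V ob bx
  by unfold_locales (rule ob_Obj bx_hom)+

text \<open>Identities are legitimate for \<open>TrivR\<close> and \<open>TrivL\<close> because a
  braiding with the unit is an identity 1-cell.\<close>

fun rc :: "rule \<Rightarrow> 't" where
  "rc (AssB i j k l) = eAssoc B (p i) (p j) (p k) (p l)"
| "rc (AssC i j k l) = eAssoc C (q i) (q j) (q k) (q l)"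
| "rc (LeftB i j) = eLeft B (p i) (p j)"
| "rc (LeftC i j) = eLeft C (q i) (q j)"
| "rc (RightB i j) = eRight B (p i) (p j)"
| "rc (RightC i j) = eRight C (q i) (q j)"
| "rc (NatL l g r bs) = \<beta>L (wh1 l r (bx g)) (T bs)"
| "rc (NatR as l g r) = \<beta>R (T as) (wh1 l r (bx g))"
| "rc (HexS as bs cs) = hexS V (T as) (T bs) (T cs)"
| "rc (HexR as bs cs) = hexR V (T as) (T bs) (T cs)"
| "rc (TrivR as) = id2 V (id1 V (T as))"
| "rc (TrivL as) = id2 V (id1 V (T as))"

lemma hexS_in: "A \<in> Obj V \<Longrightarrow> A' \<in> Obj V \<Longrightarrow> A'' \<in> Obj V \<Longrightarrow>
  hexS V A A' A'' \<in> iso_cells V (\<beta> (A \<otimes> A') A'') ((\<beta> A A'' \<rtimes> A') \<cdot> (A \<ltimes> \<beta> A' A''))"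
  using hexS_mod1 unfolding invertible_modification_def by blast
lemma hexR_in: "A \<in> Obj V \<Longrightarrow> A' \<in> Obj V \<Longrightarrow> A'' \<in> Obj V \<Longrightarrow>
  hexR V A A' A'' \<in> iso_cells V (\<beta> A (A' \<otimes> A'')) ((A' \<ltimes> \<beta> A A'') \<cdot> (\<beta> A A' \<rtimes> A''))"
  using hexR_mod1 unfolding invertible_modification_def by blast
lemma braidL_in: "f \<in> hom V A A' \<Longrightarrow> D \<in> Obj V \<Longrightarrow> \<beta>L f D \<in> iso_cells V ((D \<ltimes> f) \<cdot> \<beta> A D) (\<beta> A' D \<cdot> (f \<rtimes> D))"
  using pseudonatural.s1_in[OF braid_pseudonatL] by blast
lemma braidR_in: "f \<in> hom V A A' \<Longrightarrow> D \<in> Obj V \<Longrightarrow> \<beta>R D f \<in> iso_cells V ((f \<rtimes> D) \<cdot> \<beta> D A) (\<beta> D A' \<cdot> (D \<ltimes> f))"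
  using pseudonatural.s1_in[OF braid_pseudonatR] by blast

lemmas wh1_bx = wh1_bx_right wh1_bx_left wh1_bx_Nil
lemmas ev_eval = ev_single ev_Cons wh1_bx unitL1[OF bx_Arr] unitR1[OF bx_Arr]
lemmas homs = B.eHom_in[OF p_in p_in] C.eHom_in[OF q_in q_in]

lemma unitR0_homs: "eHom B (p i) (p j) \<otimes> \<one> = eHom B (p i) (p j)" "eHom C (q i) (q j) \<otimes> \<one> = eHom C (q i) (q j)"
  by (simp_all add: unitR0 homs)

lemma rc_iso: "rok \<rho> \<Longrightarrow> rc \<rho> \<in> iso_cells V (ev (rdom \<rho>) (rsrc \<rho>)) (ev (rdom \<rho>) (rtgt \<rho>))"
proof (cases \<rho>)
  case (AssB i j k l)
  then show ?thesis using B.eAssoc_in[OF p_in p_in p_in p_in] 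
    by (simp add: ev_eval del: ev.simps(2) bx.simps) (simp add: unitR0_homs)
next
  case (AssC i j k l)
  then show ?thesis using C.eAssoc_in[OF q_in q_in q_in q_in] 
    by (simp add: ev_eval del: ev.simps(2) bx.simps) (simp add: unitR0_homs)
next
  case (LeftB i j)
  then show ?thesis using B.eLeft_in[OF p_in p_in] 
    by (simp add: ev_eval del: ev.simps(2) bx.simps) (simp add: unitR0_homs)
next
  case (LeftC i j)
  then show ?thesis using C.eLeft_in[OF q_in q_in] 
    by (simp add: ev_eval del: ev.simps(2) bx.simps) (simp add: unitR0_homs)
next
  case (RightB i j)
  then show ?thesis using B.eRight_in[OF p_in p_in] 
    by (simp add: ev_eval del: ev.simps(2) bx.simps) (simp add: unitR0_homs)
next
  case (RightC i j)
  then show ?thesis using C.eRight_in[OF q_in q_in] 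
    by (simp add: ev_eval del: ev.simps(2) bx.simps) (simp add: unitR0_homs)
next
  case (NatL l g r bs)
  then show ?thesis using braidL_in[OF lay_in[of l r g] T_in[of bs]]
    by (simp add: ev_eval wh1_bx_append_left[of bs l r g] wh1_bx_append_right[of l r bs g] del: ev.simps(2) bx.simps) simp
next
  case (NatR as l g r)
  then show ?thesis using braidR_in[OF lay_in[of l r g] T_in[of as]]
    by (simp add: ev_eval wh1_bx_append_left[of as l r g] wh1_bx_append_right[of l r as g] del: ev.simps(2) bx.simps) simp
next
  case (HexS as bs cs)
  then show ?thesis using hexS_in[OF T_in T_in T_in] by (simp add: ev_eval del: ev.simps(2) bx.simps) (simp add: T_append)
next
  case (HexR as bs cs)
  then show ?thesis using hexR_in[OF T_in T_in T_in] by (simp add: ev_eval del: ev.simps(2) bx.simps) (simp add: T_append)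
next
  case (TrivR as)
  then show ?thesis using id2_iso(1)[OF hom_Arr[OF id1_in[OF T_in]]] by (simp add: ev_eval del: ev.simps(2) bx.simps) (simp add: braid_unitR T_in)
next
  case (TrivL as)
  then show ?thesis using id2_iso(1)[OF hom_Arr[OF id1_in[OF T_in]]] by (simp add: ev_eval del: ev.simps(2) bx.simps) (simp add: braid_unitL T_in)
qed

sublocale diagram_rules V ob bx rc
  by unfold_locales (rule rc_iso)

end

section \<open>Paths whose steps fit without interchange\<close>

context diagram_rules begin

lemma scell_Nil:
  assumes "sok xs ys (Step [] l \<rho> b r Y)"
  shows "scell xs (Step [] l \<rho> b r Y) = ev (l @ rcod \<rho> @ r) Y \<rhd> wh2 l r (rcell \<rho> b)"
proof -
  have c: "xs = l @ rdom \<rho> @ r" "chain (l @ rcod \<rho> @ r) Y ys" "rok \<rho>" using assms by auto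
  have d: "dcell (rdom \<rho>) (rcod \<rho>) (psrc \<rho> b) (rcell \<rho> b) (ptgt \<rho> b)" by (rule rcell_dcell[OF c(3)])
  then have h: "chain (rdom \<rho>) (psrc \<rho> b) (rcod \<rho>)" and i: "rcell \<rho> b \<in> iso_cells V (ev (rdom \<rho>) (psrc \<rho> b)) (ev (rdom \<rho>) (ptgt \<rho> b))"
    by (auto simp: dcell_def)
  note w = wh1_in[OF ev_in[OF h], of l r]
  show ?thesis using whiskR_id1[OF comp1_in[OF w ev_in[OF c(2)]] whiskL_in[OF w ev_in[OF c(2)] iso_cells_cells[OF wh2_iso(1)[OF i]]]]
    by (simp add: ctx_def c(1))
qed

lemma scell_Nil2:
  assumes "sok xs ys (Step X l \<rho> b r [])"
  shows "scell xs (Step X l \<rho> b r []) = wh2 l r (rcell \<rho> b) \<lhd> ev xs X"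
proof -
  have c: "ys = l @ rcod \<rho> @ r" "rok \<rho>" using assms by auto
  have d: "dcell (rdom \<rho>) (rcod \<rho>) (psrc \<rho> b) (rcell \<rho> b) (ptgt \<rho> b)" by (rule rcell_dcell[OF c(2)])
  then have h: "chain (rdom \<rho>) (psrc \<rho> b) (rcod \<rho>)" and i: "rcell \<rho> b \<in> iso_cells V (ev (rdom \<rho>) (psrc \<rho> b)) (ev (rdom \<rho>) (ptgt \<rho> b))"
    by (auto simp: dcell_def)
  show ?thesis using whiskL_id1[OF wh1_in[OF ev_in[OF h], of l r] iso_cells_cells[OF wh2_iso(1)[OF i]]]
    by (simp add: ctx_def)
qed

lemma scell_Nil3:
  assumes "sok xs ys (Step [] l \<rho> b r [])" shows "scell xs (Step [] l \<rho> b r []) = wh2 l r (rcell \<rho> b)"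
proof -
  have c: "xs = l @ rdom \<rho> @ r" "rok \<rho>" using assms by auto
  have d: "dcell (rdom \<rho>) (rcod \<rho>) (psrc \<rho> b) (rcell \<rho> b) (ptgt \<rho> b)" by (rule rcell_dcell[OF c(2)])
  then have h: "chain (rdom \<rho>) (psrc \<rho> b) (rcod \<rho>)" and i: "rcell \<rho> b \<in> iso_cells V (ev (rdom \<rho>) (psrc \<rho> b)) (ev (rdom \<rho>) (ptgt \<rho> b))"
    by (auto simp: dcell_def)
  show ?thesis unfolding scell_Nil2[OF assms]
    using whiskR_id1[OF wh1_in[OF ev_in[OF h], of l r] iso_cells_cells[OF wh2_iso(1)[OF i]]] by (simp add: c(1))
qed

lemma rcell_Cell: "rok \<rho> \<Longrightarrow> rcell \<rho> b \<in> Cell V"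
  using rcell_dcell dcell_cells cells_Cell by blast

lemma wh2_rcell:
  assumes "rok \<rho>"
  shows "wh2 [] r (rcell \<rho> b) = rcell \<rho> b \<rtimes>\<^sub>2 T r" "wh2 l [] (rcell \<rho> b) = T l \<ltimes>\<^sub>2 rcell \<rho> b" "wh2 [] [] (rcell \<rho> b) = rcell \<rho> b"
  using rcell_Cell[OF assms] cells_Cell[OF tenL2_in[OF T_in dcell_cells[OF rcell_dcell[OF assms]]]]
  by (simp_all add: wh2_def unitL2 unitR2)

lemma rcell_True: "rcell \<rho> True = rc \<rho>" and rcell_False: "rcell \<rho> False = inv2 V (rc \<rho>)"
  by (simp_all add: rcell_def)

text \<open>Steps fit literally, so the composite of their cells contains no coherence cells and can
  be compared with an axiom as it is stated.\<close>

fun linked :: "strand list \<Rightarrow> strand list \<Rightarrow> diagram \<Rightarrow> step list \<Rightarrow> diagram \<Rightarrow> bool" where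
  "linked xs ys d [] e \<longleftrightarrow> d = e \<and> chain xs d ys"
| "linked xs ys d (\<sigma> # p) e \<longleftrightarrow> sok xs ys \<sigma> \<and> d = ssrc \<sigma> \<and> linked xs ys (stgt \<sigma>) p e"

fun pval :: "strand list \<Rightarrow> diagram \<Rightarrow> step list \<Rightarrow> 't" where
  "pval xs d [] = id2 V (ev xs d)"
| "pval xs d [\<sigma>] = scell xs \<sigma>"
| "pval xs d (\<sigma> # \<tau> # p) = pval xs d (\<tau> # p) \<bullet> scell xs \<sigma>"

text \<open>The cell of a step without whiskering by identities, as in the statements of the axioms.
  The source \<open>[]\<close> given to \<open>ev\<close> is harmless on nonempty diagrams, where it
  is not consulted.\<close>

fun seval :: "step \<Rightarrow> 't" where
  "seval (Step [] l \<rho> b r []) = wh2 l r (rcell \<rho> b)"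
| "seval (Step [] l \<rho> b r (L # Y)) = ev [] (L # Y) \<rhd> wh2 l r (rcell \<rho> b)"
| "seval (Step (L # X) l \<rho> b r []) = wh2 l r (rcell \<rho> b) \<lhd> ev [] (L # X)"
| "seval (Step (L # X) l \<rho> b r (L' # Y)) = ev [] (L' # Y) \<rhd> wh2 l r (rcell \<rho> b) \<lhd> ev [] (L # X)"

lemma ev_irrelevant: "ev xs (L # d) = ev ys (L # d)"
  by (cases L) simp

lemma seval_scell: "sok xs ys \<sigma> \<Longrightarrow> scell xs \<sigma> = seval \<sigma>"
  using scell_Nil3[of xs ys] scell_Nil2[of xs ys] scell_Nil[of xs ys] ev_irrelevant
  by (cases \<sigma> rule: seval.cases) (simp_all add: ctx_def del: ev.simps sok.simps, metis+)

fun peval :: "step list \<Rightarrow> 't" where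
  "peval [\<sigma>] = seval \<sigma>"
| "peval (\<sigma> # \<tau> # p) = peval (\<tau> # p) \<bullet> seval \<sigma>"
| "peval [] = undefined"

lemma linked_pc: "linked xs ys d p e \<Longrightarrow> pc xs ys d p e (pval xs d p)"
proof (induction p arbitrary: d)
  case Nil then show ?case using ich_refl[of xs d ys] by auto
next
  case (Cons \<sigma> p)
  then have IH: "pc xs ys (stgt \<sigma>) p e (pval xs (stgt \<sigma>) p)" and s: "sok xs ys \<sigma>" "d = ssrc \<sigma>" by auto
  show ?case
  proof (cases p)
    case Nil then show ?thesis using pc_step[OF s(1)] s(2) Cons.prems by (simp del: pc.simps)
  next
    case (Cons \<tau> p')
    have "pval xs (stgt \<sigma>) (\<tau> # p') = pval xs d (\<tau> # p')" by (induction p' arbitrary: \<tau>) auto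
    then show ?thesis using pc_Cons_refl[OF s(1) IH] s(2) Cons by (simp del: pc.simps)
  qed
qed

lemma linked_pval: "linked xs ys d (\<sigma> # p) e \<Longrightarrow> pval xs d' (\<sigma> # p) = peval (\<sigma> # p)"
  by (induction p arbitrary: \<sigma> d) (auto simp: seval_scell simp del: scell.simps)

lemma linked_pc': "linked xs ys d (\<sigma> # p) e \<Longrightarrow> pc xs ys d (\<sigma> # p) e (peval (\<sigma> # p))"
  using linked_pc linked_pval by metis

lemma rok_simps:
  "rok (AssB i j k m)" "rok (AssC i j k m)" "rok (LeftB i j)" "rok (LeftC i j)" "rok (RightB i j)" "rok (RightC i j)"
  "btgt g \<noteq> [] \<Longrightarrow> bs \<noteq> [] \<Longrightarrow> rok (NatL l g r bs)" "btgt g \<noteq> [] \<Longrightarrow> as \<noteq> [] \<Longrightarrow> rok (NatR as l g r)"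
  "cs \<noteq> [] \<Longrightarrow> rok (HexS as bs cs)" "as \<noteq> [] \<Longrightarrow> rok (HexR as bs cs)" "as \<noteq> [] \<Longrightarrow> rok (TrivR as)" "as \<noteq> [] \<Longrightarrow> rok (TrivL as)"
  by (simp_all add: rok_def)

lemma teqI: "pc xs ys d p e \<phi> \<Longrightarrow> pc xs ys d q e \<phi> \<Longrightarrow> teq xs ys p q"
  unfolding teq_def tile_def by blast

lemma teq_linked:
  "linked xs ys d (\<sigma> # p) e \<Longrightarrow> linked xs ys d (\<tau> # q) e \<Longrightarrow> peval (\<sigma> # p) = peval (\<tau> # q) \<Longrightarrow> teq xs ys (\<sigma> # p) (\<tau> # q)"
  using teqI linked_pc' by metis

lemma teq_rotate:
  assumes "teq xs ys (fst t) (snd t)"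
  shows "teq xs ys (fst (rotate_tile n m t)) (snd (rotate_tile n m t))"
proof -
  obtain d where "tile xs ys d (take n (fst t) @ drop n (fst t)) (take m (snd t) @ drop m (snd t))"
    using assms unfolding teq_def by auto
  from tile_rotate[OF this] show ?thesis unfolding teq_def rotate_tile_def by (auto simp: case_prod_beta)
qed

lemma teq_swap: "teq xs ys (fst t) (snd t) \<Longrightarrow> teq xs ys (fst (prod.swap t)) (snd (prod.swap t))"
  using teq_sym by simp

lemma ich_swap:
  assumes "chain xs (X @ swap_src l f m g r @ Y) ys"
  shows "ich xs ys (X @ swap_src l f m g r @ Y) (ctx xs X l r (l @ (btgt f @ m @ btgt g) @ r) Y (swap_cell f m g)) (X @ swap_tgt l f m g r @ Y)"
proof -
  have "chain xs X (l @ (bsrc f @ m @ bsrc g) @ r)" "chain (l @ (btgt f @ m @ btgt g) @ r) Y ys" "btgt f \<noteq> []" "btgt g \<noteq> []"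
    using assms by (auto simp: chain_append swap_src_def)
  from slide_ich[OF slide1_slide[OF slide1I[OF this]]] show ?thesis .
qed

lemma ctx_Nil:
  assumes "dcell zs ws P \<phi> Q" "xs = l @ zs @ r" "vs = l @ ws @ r" "chain vs Y ys"
  shows "ctx xs [] l r vs Y \<phi> = ev vs Y \<rhd> wh2 l r \<phi>"
proof -
  have h: "chain zs P ws" and i: "\<phi> \<in> iso_cells V (ev zs P) (ev zs Q)" using assms(1) by (auto simp: dcell_def)
  note w = wh1_in[OF ev_in[OF h], of l r] and e = ev_in[OF assms(4)[unfolded assms(3)]]
  show ?thesis unfolding ctx_def using whiskR_id1[OF comp1_in[OF w e] whiskL_in[OF w e iso_cells_cells[OF wh2_iso(1)[OF i]]]] assms(2,3) by simp
qed

lemma ctx_Nil2: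
  assumes "dcell zs ws P \<phi> Q" "vs = l @ ws @ r"
  shows "ctx xs X l r vs [] \<phi> = wh2 l r \<phi> \<lhd> ev xs X"
proof -
  have h: "chain zs P ws" and i: "\<phi> \<in> iso_cells V (ev zs P) (ev zs Q)" using assms(1) by (auto simp: dcell_def)
  show ?thesis unfolding ctx_def using whiskL_id1[OF wh1_in[OF ev_in[OF h], of l r] iso_cells_cells[OF wh2_iso(1)[OF i]]] assms(2) by simp
qed

lemmas ctx_swap = ctx_Nil[OF swap_dcell] ctx_Nil2[OF swap_dcell] ctx_Nil[OF dcell_inv[OF swap_dcell]] ctx_Nil2[OF dcell_inv[OF swap_dcell]]

lemma peval_3:
  assumes "linked xs ys d [\<sigma>, \<tau>, \<upsilon>] e"
  shows "peval [\<sigma>, \<tau>, \<upsilon>] = seval \<upsilon> \<bullet> seval \<tau> \<bullet> seval \<sigma>"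
proof -
  have s: "sok xs ys \<sigma>" "sok xs ys \<tau>" "sok xs ys \<upsilon>" "stgt \<sigma> = ssrc \<tau>" "stgt \<tau> = ssrc \<upsilon>" using assms by auto
  show ?thesis
    using vassoc[OF scell_dcell[OF s(1)] scell_dcell[OF s(2), folded s(4)] scell_dcell[OF s(3), folded s(5)]] s(1-3)
    by (simp add: seval_scell del: scell.simps)
qed

text \<open>Meant for axioms in which an interchanger comes last on one side; \<open>teq_mid\<close>
  serves those in which it stands between two structural cells.\<close>

lemma teq_post:
  assumes "linked xs ys d (\<sigma> # p) e'" "ich xs ys e' \<omega> e" "linked xs ys d (\<tau> # q) e" "\<omega> \<bullet> peval (\<sigma> # p) = peval (\<tau> # q)"
  shows "teq xs ys (\<sigma> # p) (\<tau> # q)"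
  using teqI[OF pc_post[OF linked_pc'[OF assms(1)] assms(2)]] linked_pc'[OF assms(3)] assms(4) by simp

lemma teq_post2:
  assumes "linked xs ys d [\<sigma>, \<tau>] e'" "ich xs ys e' \<omega> e" "linked xs ys d (\<upsilon> # q) e" "(\<omega> \<bullet> seval \<tau>) \<bullet> seval \<sigma> = peval (\<upsilon> # q)"
  shows "teq xs ys [\<sigma>, \<tau>] (\<upsilon> # q)"
proof -
  have s: "sok xs ys \<sigma>" "sok xs ys \<tau>" "stgt \<sigma> = ssrc \<tau>" "stgt \<tau> = e'" using assms(1) by auto
  show ?thesis
    using teq_post[OF assms(1-3)] assms(4) s(1,2)
      vassoc[OF scell_dcell[OF s(1)] scell_dcell[OF s(2), folded s(3)] ich_dcell[OF assms(2), folded s(4)]]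
    by (simp add: seval_scell del: scell.simps)
qed

lemma pc_mid:
  assumes "sok xs ys \<sigma>" "sok xs ys \<tau>" "ich xs ys (stgt \<sigma>) \<omega> (ssrc \<tau>)"
  shows "pc xs ys (ssrc \<sigma>) [\<sigma>, \<tau>] (stgt \<tau>) ((seval \<tau> \<bullet> \<omega>) \<bullet> seval \<sigma>)"
  using pc_Cons_refl[OF assms(1) pc_pre[OF assms(3) pc_step[OF assms(2)]]] seval_scell[OF assms(1)] seval_scell[OF assms(2)]
  by (simp del: pc.simps scell.simps)

lemma pc_mid':
  assumes "sok xs ys \<sigma>" "sok xs ys \<tau>" "ich xs ys (stgt \<sigma>) \<omega> (ssrc \<tau>)"
  shows "pc xs ys (ssrc \<sigma>) [\<sigma>, \<tau>] (stgt \<tau>) (seval \<tau> \<bullet> \<omega> \<bullet> seval \<sigma>)"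
  using pc_mid[OF assms] vassoc[OF scell_dcell[OF assms(1)] ich_dcell[OF assms(3)] scell_dcell[OF assms(2)]]
    seval_scell[OF assms(1)] seval_scell[OF assms(2)] by (simp del: pc.simps scell.simps)

lemma teq_mid:
  assumes "sok xs ys \<sigma>" "sok xs ys \<tau>" "ich xs ys (stgt \<sigma>) \<omega> (ssrc \<tau>)" "linked xs ys (ssrc \<sigma>) (\<upsilon> # q) (stgt \<tau>)"
    "(seval \<tau> \<bullet> \<omega>) \<bullet> seval \<sigma> = peval (\<upsilon> # q)"
  shows "teq xs ys [\<sigma>, \<tau>] (\<upsilon> # q)"
  using teqI[OF pc_mid[OF assms(1-3)]] linked_pc'[OF assms(4)] assms(5) by simp

lemma ich_swap_inv:
  assumes "chain xs (X @ swap_src l f m g r @ Y) ys"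
  shows "ich xs ys (X @ swap_tgt l f m g r @ Y) (ctx xs X l r (l @ (btgt f @ m @ btgt g) @ r) Y (inv2 V (swap_cell f m g))) (X @ swap_src l f m g r @ Y)"
proof -
  have c: "chain xs X (l @ (bsrc f @ m @ bsrc g) @ r)" "chain (l @ (btgt f @ m @ btgt g) @ r) Y ys" "btgt f \<noteq> []" "btgt g \<noteq> []"
    using assms by (auto simp: chain_append swap_src_def)
  show ?thesis using ich_sym[OF ich_swap[OF assms]] ctx_dcell(2)[OF c(1,2) swap_dcell[OF c(3,4)]] by simp
qed

lemma wh2_swap_cell_inv: "wh2 l r (inv2 V (swap_cell f m g)) = inv2 V (wh2 l r (swap_cell f m g))"
  unfolding swap_cell_def using wh2_iso(2)[OF inter_in[OF bx_in tenL1_in[OF T_in bx_in]]] by simp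

end

context tensor_data begin

lemmas linkeds = rok_simps psrc_def ptgt_def
lemmas seval_eval = ev_eval wh2_rcell unitL2[OF rcell_Cell] unitR2[OF rcell_Cell] rok_simps

lemmas lay_Arr = hom_Arr[OF lay_in]
lemmas lay_append = wh1_bx_append_right wh1_bx_append_left

lemma swap_cell_left: "wh2 [] r (swap_cell f l g) = \<Sigma> (bx f) (wh1 l r (bx g))"
  using swap_cell_wh_left[of r f "[]" l g] hom_Arr[OF lay_in] by (simp add: unitL1)
lemma swap_cell_right: "wh2 l [] (swap_cell g r h) = \<Sigma> (wh1 l r (bx g)) (bx h)"
  using swap_cell_wh_right[of l g r "[]" h] by (simp add: unitL1 bx_Arr)

section \<open>Tiles from the axioms of the braiding\<close>

context
  fixes f A A' D E
  assumes f: "f \<in> hom V A A'" and DE: "D \<in> Obj V" "E \<in> Obj V"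
begin

lemma hexS_nat1: "((\<beta> A' E \<rtimes> D \<rhd> \<Sigma> f (\<beta> D E)) \<bullet> (\<beta>L f E \<rtimes>\<^sub>2 D \<lhd> A \<ltimes> \<beta> D E)) \<bullet> (E \<ltimes> f \<rtimes> D \<rhd> hexS V A D E)
    = (hexS V A' D E \<lhd> f \<rtimes> (D \<otimes> E)) \<bullet> \<beta>L (f \<rtimes> D) E"
  using hexS_mod1[OF DE] f hom_Obj[OF f] unfolding invertible_modification_def by (auto simp: hom_def)

lemma hexS_nat2: "((\<beta> D E \<rtimes> A' \<rhd> D \<ltimes>\<^sub>2 \<beta>L f E) \<bullet> (inv2 V (\<Sigma> (\<beta> D E) f) \<lhd> D \<ltimes> \<beta> A E)) \<bullet> ((E \<otimes> D) \<ltimes> f \<rhd> hexS V D A E)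
    = (hexS V D A' E \<lhd> D \<ltimes> f \<rtimes> E) \<bullet> \<beta>L (D \<ltimes> f) E"
  using hexS_mod2[OF DE] f hom_Obj[OF f] unfolding invertible_modification_def by (auto simp: hom_def)

lemma hexS_nat3: "((\<beta> D A' \<rtimes> E \<rhd> D \<ltimes>\<^sub>2 \<beta>R E f) \<bullet> (\<beta>R D f \<rtimes>\<^sub>2 E \<lhd> D \<ltimes> \<beta> E A)) \<bullet> (f \<rtimes> (D \<otimes> E) \<rhd> hexS V D E A)
    = (hexS V D E A' \<lhd> (D \<otimes> E) \<ltimes> f) \<bullet> \<beta>R (D \<otimes> E) f"
  using hexS_mod3[OF DE] f hom_Obj[OF f] unfolding invertible_modification_def by (auto simp: hom_def)

lemma hexR_nat1: "((D \<ltimes> \<beta> A' E \<rhd> \<beta>L f D \<rtimes>\<^sub>2 E) \<bullet> (D \<ltimes>\<^sub>2 \<beta>L f E \<lhd> \<beta> A D \<rtimes> E)) \<bullet> ((D \<otimes> E) \<ltimes> f \<rhd> hexR V A D E)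
    = (hexR V A' D E \<lhd> f \<rtimes> (D \<otimes> E)) \<bullet> \<beta>L f (D \<otimes> E)"
  using hexR_mod1[OF DE] f hom_Obj[OF f] unfolding invertible_modification_def by (auto simp: hom_def)

lemma hexR_nat2: "((A' \<ltimes> \<beta> D E \<rhd> \<beta>R D f \<rtimes>\<^sub>2 E) \<bullet> (\<Sigma> f (\<beta> D E) \<lhd> \<beta> D A \<rtimes> E)) \<bullet> (f \<rtimes> (E \<otimes> D) \<rhd> hexR V D A E)
    = (hexR V D A' E \<lhd> D \<ltimes> f \<rtimes> E) \<bullet> \<beta>R D (f \<rtimes> E)"
  using hexR_mod2[OF DE] f hom_Obj[OF f] unfolding invertible_modification_def by (auto simp: hom_def)

lemma hexR_nat3: "((E \<ltimes> \<beta> D A' \<rhd> inv2 V (\<Sigma> (\<beta> D E) f)) \<bullet> (E \<ltimes>\<^sub>2 \<beta>R D f \<lhd> \<beta> D E \<rtimes> A)) \<bullet> (E \<ltimes> f \<rtimes> D \<rhd> hexR V D E A)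
    = (hexR V D E A' \<lhd> (D \<otimes> E) \<ltimes> f) \<bullet> \<beta>R D (E \<ltimes> f)"
  using hexR_mod3[OF DE] f hom_Obj[OF f] unfolding invertible_modification_def by (auto simp: hom_def)

end

lemma tile_SS:
  assumes "d \<noteq> []"
  shows "teq (a @ b @ c @ d) (d @ a @ b @ c) (fst (tile_SS a b c d)) (snd (tile_SS a b c d))"
  unfolding tile_SS_def fst_conv snd_conv
proof (rule teq_linked[where d = "[([], Cr (a @ b @ c) d, [])]" and e = "[(a @ b, Cr c d, []), (a, Cr b d, c), ([], Cr a d, b @ c)]"], goal_cases)
  case 3
  show ?case using assms
    by (simp add: seval_eval del: ev.simps(2) bx.simps) (simp add: T_append braiding_SS T_in rcell_True)
qed (use assms in \<open>simp_all add: linkeds\<close>)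

lemma tile_RR:
  assumes "a \<noteq> []"
  shows "teq (a @ b @ c @ d) (b @ c @ d @ a) (fst (tile_RR a b c d)) (snd (tile_RR a b c d))"
  unfolding tile_RR_def fst_conv snd_conv
proof (rule teq_linked[where d = "[([], Cr a (b @ c @ d), [])]" and e = "[([], Cr a b, c @ d), (b, Cr a c, d), (b @ c, Cr a d, [])]"], goal_cases)
  case 3
  show ?case using assms
    by (simp add: seval_eval del: ev.simps(2) bx.simps) (simp add: T_append braiding_RR T_in rcell_True)
qed (use assms in \<open>simp_all add: linkeds\<close>)

text \<open>The \<Sigma> in \<open>hexS_nat1\<close> is the coherence cell \<open>\<omega>\<close>:
  it follows the two structural cells and exchanges \<open>g\<close> with the braiding of the
  untouched factors \<open>b\<close> and \<open>c\<close>.\<close>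

lemma tile_S1:
  assumes "c \<noteq> []" "btgt g \<noteq> []"
  shows "teq (l @ bsrc g @ r @ b @ c) (c @ l @ btgt g @ r @ b) (fst (tile_S1 l g r b c)) (snd (tile_S1 l g r b c))"
  unfolding tile_S1_def fst_conv snd_conv Let_def
proof (rule teq_post2[where d = "[([], Cr (l @ bsrc g @ r @ b) c, []), (c @ l, g, r @ b)]" and e = "[(l, g, r @ b @ c), (l @ btgt g @ r, Cr b c, []), ([], Cr (l @ btgt g @ r) c, b)]"
      and e' = "swap_src l g r (Cr b c) [] @ [([], Cr (l @ btgt g @ r) c, b)]"
      and \<omega> = "ctx (l @ bsrc g @ r @ b @ c) [] l [] (l @ (btgt g @ r @ btgt (Cr b c)) @ []) [([], Cr (l @ btgt g @ r) c, b)] (swap_cell g r (Cr b c))"], goal_cases)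
  case 2
  show ?case using ich_swap[of "l @ bsrc g @ r @ b @ c" "[]" l g r "Cr b c" "[]" "[([], Cr (l @ btgt g @ r) c, b)]"] assms
    by (simp add: swap_src_def swap_tgt_def)
next
  case 4
  show ?case using assms hexS_nat1[OF lay_in[of l r g] T_in[of b] T_in[of c]]
    by (simp add: ctx_swap seval_eval swap_cell_right del: ev.simps(2) bx.simps)
      (simp add: T_append T_in rcell_True lay_append assocLR1[OF T_in T_in lay_Arr])
qed (use assms in \<open>simp_all add: linkeds swap_src_def\<close>)

text \<open>In \<open>hexS_nat2\<close> an inverse interchanger stands between \<open>hexS\<close>
  and the pseudonaturality cell, so it fills the gap between the two steps.\<close>

lemma tile_S2:
  assumes "c \<noteq> []" "btgt g \<noteq> []"
  shows "teq (a @ l @ bsrc g @ r @ c) (c @ a @ l @ btgt g @ r) (fst (tile_S2 a l g r c)) (snd (tile_S2 a l g r c))"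
  unfolding tile_S2_def fst_conv snd_conv Let_def
proof (rule teq_mid[where \<omega> = "ctx (a @ l @ bsrc g @ r @ c) [(a, Cr (l @ bsrc g @ r) c, [])] [] r ([] @ (btgt (Cr a c) @ l @ btgt g) @ r) [] (inv2 V (swap_cell (Cr a c) l g))"], goal_cases)
  case 3
  show ?case using ich_swap_inv[of "a @ l @ bsrc g @ r @ c" "[(a, Cr (l @ bsrc g @ r) c, [])]" "[]" "Cr a c" l g r "[]" "c @ a @ l @ btgt g @ r"] assms
    by (simp add: swap_src_def swap_tgt_def linkeds)
next
  case 5
  show ?case using assms hexS_nat2[OF lay_in[of l r g] T_in[of a] T_in[of c]]
    by (simp add: ctx_swap seval_eval wh2_swap_cell_inv swap_cell_left del: ev.simps(2) bx.simps)
      (simp add: T_append T_in rcell_True lay_append assocLR1[OF T_in T_in lay_Arr] assocLL1[OF T_in T_in lay_Arr])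
qed (use assms in \<open>simp_all add: linkeds\<close>)

lemma tile_S3:
  assumes "a \<noteq> []" "b \<noteq> []" "btgt g \<noteq> []" "bsrc g \<noteq> []"
  shows "teq (a @ b @ l @ bsrc g @ r) (l @ btgt g @ r @ a @ b) (fst (tile_S3 a b l g r)) (snd (tile_S3 a b l g r))"
  unfolding tile_S3_def fst_conv snd_conv Let_def
proof (rule teq_linked[where d = "[([], Cr (a @ b) (l @ bsrc g @ r), []), (l, g, r @ a @ b)]"
      and e = "[(a @ b @ l, g, r), (a, Cr b (l @ btgt g @ r), []), ([], Cr a (l @ btgt g @ r), b)]"], goal_cases)
  case 3
  show ?case using assms hexS_nat3[OF lay_in[of l r g] T_in[of a] T_in[of b]]
    by (simp add: seval_eval del: ev.simps(2) bx.simps)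
      (simp add: T_append T_in rcell_True lay_append assocLR1[OF T_in T_in lay_Arr] assocLL1[OF T_in T_in lay_Arr] assocRR1[OF T_in T_in lay_Arr])
qed (use assms in \<open>simp_all add: linkeds\<close>)

lemma tile_R1:
  assumes "b \<noteq> []" "c \<noteq> []" "btgt g \<noteq> []" "bsrc g \<noteq> []"
  shows "teq (l @ bsrc g @ r @ b @ c) (b @ c @ l @ btgt g @ r) (fst (tile_R1 l g r b c)) (snd (tile_R1 l g r b c))"
  unfolding tile_R1_def fst_conv snd_conv Let_def
proof (rule teq_linked[where d = "[([], Cr (l @ bsrc g @ r) (b @ c), []), (b @ c @ l, g, r)]"
      and e = "[(l, g, r @ b @ c), ([], Cr (l @ btgt g @ r) b, c), (b, Cr (l @ btgt g @ r) c, [])]"], goal_cases)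
  case 3
  show ?case using assms hexR_nat1[OF lay_in[of l r g] T_in[of b] T_in[of c]]
    by (simp add: seval_eval del: ev.simps(2) bx.simps)
      (simp add: T_append T_in rcell_True lay_append assocLR1[OF T_in T_in lay_Arr] assocLL1[OF T_in T_in lay_Arr] assocRR1[OF T_in T_in lay_Arr])
qed (use assms in \<open>simp_all add: linkeds\<close>)

lemma tile_R2:
  assumes "a \<noteq> []" "btgt g \<noteq> []" "c \<noteq> []"
  shows "teq (a @ l @ bsrc g @ r @ c) (l @ btgt g @ r @ c @ a) (fst (tile_R2 a l g r c)) (snd (tile_R2 a l g r c))"
  unfolding tile_R2_def fst_conv snd_conv Let_def
proof (rule teq_mid[where \<omega> = "ctx (a @ l @ bsrc g @ r @ c) [([], Cr a (l @ bsrc g @ r), c)] l [] (l @ (btgt g @ r @ btgt (Cr a c)) @ []) [] (swap_cell g r (Cr a c))"], goal_cases)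
  case 3
  show ?case using ich_swap[of "a @ l @ bsrc g @ r @ c" "[([], Cr a (l @ bsrc g @ r), c)]" l g r "Cr a c" "[]" "[]" "l @ btgt g @ r @ c @ a"] assms
    by (simp add: swap_src_def swap_tgt_def linkeds)
next
  case 5
  show ?case using assms hexR_nat2[OF lay_in[of l r g] T_in[of a] T_in[of c]]
    by (simp add: ctx_swap seval_eval swap_cell_right del: ev.simps(2) bx.simps)
      (simp add: T_append T_in rcell_True lay_append assocLR1[OF T_in T_in lay_Arr] assocLL1[OF T_in T_in lay_Arr])
qed (use assms in \<open>simp_all add: linkeds\<close>)

lemma tile_R3:
  assumes "a \<noteq> []" "btgt g \<noteq> []" "b \<noteq> []"
  shows "teq (a @ b @ l @ bsrc g @ r) (b @ l @ btgt g @ r @ a) (fst (tile_R3 a b l g r)) (snd (tile_R3 a b l g r))"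
  unfolding tile_R3_def fst_conv snd_conv Let_def
proof (rule teq_post2[where d = "[([], Cr a (b @ l @ bsrc g @ r), []), (b @ l, g, r @ a)]"
      and e = "[(a @ b @ l, g, r), ([], Cr a b, l @ btgt g @ r), (b, Cr a (l @ btgt g @ r), [])]"
      and e' = "swap_tgt [] (Cr a b) l g r @ [(b, Cr a (l @ btgt g @ r), [])]"
      and \<omega> = "ctx (a @ b @ l @ bsrc g @ r) [] [] r ([] @ (btgt (Cr a b) @ l @ btgt g) @ r) [(b, Cr a (l @ btgt g @ r), [])] (inv2 V (swap_cell (Cr a b) l g))"], goal_cases)
  case 2
  show ?case using ich_swap_inv[of "a @ b @ l @ bsrc g @ r" "[]" "[]" "Cr a b" l g r "[(b, Cr a (l @ btgt g @ r), [])]"] assms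
    by (simp add: swap_src_def swap_tgt_def)
next
  case 4
  show ?case using assms hexR_nat3[OF lay_in[of l r g] T_in[of a] T_in[of b]]
    by (simp add: ctx_swap seval_eval wh2_swap_cell_inv swap_cell_left del: ev.simps(2) bx.simps)
      (simp add: T_append T_in rcell_True lay_append assocLR1[OF T_in T_in lay_Arr] assocLL1[OF T_in T_in lay_Arr])
qed (use assms in \<open>simp_all add: linkeds swap_tgt_def\<close>)

text \<open>All cells involved are identities, by \<open>hexS_unit\<close> and the choice of the
  cell of \<open>TrivL\<close>; the work lies in seeing that they are identities of the same
  1-cell.\<close>

lemma tile_S_unit:
  assumes "c \<noteq> []" shows "teq (a @ c) (c @ a) (fst (tile_S_unit a c)) (snd (tile_S_unit a c))"
proof -
  have l: "linked (a @ c) (c @ a) [([], Cr a c, [])] (fst (tile_S_unit a c)) [([], Cr a c, [])]"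
    using assms by (simp add: tile_S_unit_def linkeds)
  have b: "\<beta> (T a) (T c) \<in> hom V (T (a @ c)) (T (c @ a))" unfolding T_append by (rule braid_in[OF T_in T_in])
  have "peval (fst (tile_S_unit a c)) = (\<beta> (T a) (T c) \<rhd> T a \<ltimes>\<^sub>2 id2 V (id1 V (T c))) \<bullet> id2 V (\<beta> (T a) (T c))"
    using assms by (simp add: tile_S_unit_def seval_eval del: ev.simps(2) bx.simps) (simp add: rcell_True hexS_unit T_in unit_in unitR0)
  also have "T a \<ltimes>\<^sub>2 id2 V (id1 V (T c)) = id2 V (id1 V (T (a @ c)))"
    using tenL2_id[OF T_in hom_Arr[OF id1_in[OF T_in]], of a c] by (simp add: tenL1_id T_in T_append)
  also have "\<beta> (T a) (T c) \<rhd> id2 V (id1 V (T (a @ c))) = id2 V (\<beta> (T a) (T c))"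
    using whiskL_id2[OF id1_in[OF T_in] b] comp1_idR[OF b] by simp
  also have "id2 V (\<beta> (T a) (T c)) \<bullet> id2 V (\<beta> (T a) (T c)) = id2 V (ev (a @ c) [([], Cr a c, [])])"
    using vcomp_idL[OF id2_in[OF hom_Arr[OF b]]] by (simp add: ev_single wh1_bx_Nil del: ev.simps(2) bx.simps) simp
  finally have v: "peval (fst (tile_S_unit a c)) = id2 V (ev (a @ c) [([], Cr a c, [])])" .
  obtain s1 s2 where st: "tile_S_unit a c = ([s1, s2], [])" by (simp add: tile_S_unit_def)
  have "pc (a @ c) (c @ a) [([], Cr a c, [])] [s1, s2] [([], Cr a c, [])] (id2 V (ev (a @ c) [([], Cr a c, [])]))"
    using linked_pc' l v unfolding st fst_conv by metis
  moreover have "pc (a @ c) (c @ a) [([], Cr a c, [])] [] [([], Cr a c, [])] (id2 V (ev (a @ c) [([], Cr a c, [])]))"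
    unfolding pc.simps by (rule ich_refl) (use assms in simp)
  ultimately show ?thesis unfolding st fst_conv snd_conv by (rule teqI)
qed

lemma tile_R_unit:
  assumes "a \<noteq> []" shows "teq (a @ c) (c @ a) (fst (tile_R_unit a c)) (snd (tile_R_unit a c))"
proof -
  have l: "linked (a @ c) (c @ a) [([], Cr a c, [])] (fst (tile_R_unit a c)) [([], Cr a c, [])]"
    using assms by (simp add: tile_R_unit_def linkeds)
  have b: "\<beta> (T a) (T c) \<in> hom V (T (a @ c)) (T (c @ a))" unfolding T_append by (rule braid_in[OF T_in T_in])
  have "peval (fst (tile_R_unit a c)) = (\<beta> (T a) (T c) \<rhd> id2 V (id1 V (T a)) \<rtimes>\<^sub>2 T c) \<bullet> id2 V (\<beta> (T a) (T c))"
    using assms by (simp add: tile_R_unit_def seval_eval del: ev.simps(2) bx.simps) (simp add: rcell_True hexR_unit T_in unit_in unitL0)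
  also have "id2 V (id1 V (T a)) \<rtimes>\<^sub>2 T c = id2 V (id1 V (T (a @ c)))"
    using tenR2_id[OF T_in hom_Arr[OF id1_in[OF T_in]], of a c] by (simp add: tenR1_id T_in T_append)
  also have "\<beta> (T a) (T c) \<rhd> id2 V (id1 V (T (a @ c))) = id2 V (\<beta> (T a) (T c))"
    using whiskL_id2[OF id1_in[OF T_in] b] comp1_idR[OF b] by simp
  also have "id2 V (\<beta> (T a) (T c)) \<bullet> id2 V (\<beta> (T a) (T c)) = id2 V (ev (a @ c) [([], Cr a c, [])])"
    using vcomp_idL[OF id2_in[OF hom_Arr[OF b]]] by (simp add: ev_single wh1_bx_Nil del: ev.simps(2) bx.simps) simp
  finally have v: "peval (fst (tile_R_unit a c)) = id2 V (ev (a @ c) [([], Cr a c, [])])" .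
  obtain s1 s2 where st: "tile_R_unit a c = ([s1, s2], [])" by (simp add: tile_R_unit_def)
  have "pc (a @ c) (c @ a) [([], Cr a c, [])] [s1, s2] [([], Cr a c, [])] (id2 V (ev (a @ c) [([], Cr a c, [])]))"
    using linked_pc' l v unfolding st fst_conv by metis
  moreover have "pc (a @ c) (c @ a) [([], Cr a c, [])] [] [([], Cr a c, [])] (id2 V (ev (a @ c) [([], Cr a c, [])]))"
    unfolding pc.simps by (rule ich_refl) (use assms in simp)
  ultimately show ?thesis unfolding st fst_conv snd_conv by (rule teqI)
qed

text \<open>\<open>braiding_RS\<close> is stated with horizontal composites, each of which
  \<open>hcomp_whisk\<close> turns into two successive steps. The sides are exchanged for the proof
  because the interchanger of the two braidings ends the side that starts with
  \<open>hexS\<close>.\<close>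

lemma tile_RS:
  assumes "a \<noteq> []" "b \<noteq> []" "c \<noteq> []" "d \<noteq> []"
  shows "teq (a @ b @ c @ d) (c @ d @ a @ b) (fst (tile_RS a b c d)) (snd (tile_RS a b c d))"
proof -
  have "teq (a @ b @ c @ d) (c @ d @ a @ b) (snd (tile_RS a b c d)) (fst (tile_RS a b c d))"
  unfolding tile_RS_def fst_conv snd_conv
  proof (rule teq_post[where d = "[([], Cr (a @ b) (c @ d), [])]"
      and e' = "[(a, Cr b c, d)] @ swap_src [] (Cr a c) [] (Cr b d) [] @ [(c, Cr a d, b)]"
      and e = "[(a, Cr b c, d)] @ swap_tgt [] (Cr a c) [] (Cr b d) [] @ [(c, Cr a d, b)]"
      and \<omega> = "ctx (a @ b @ c @ d) [(a, Cr b c, d)] [] [] ([] @ (btgt (Cr a c) @ [] @ btgt (Cr b d)) @ []) [(c, Cr a d, b)] (swap_cell (Cr a c) [] (Cr b d))"], goal_cases)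
    case 2
    show ?case by (rule ich_swap) (use assms in \<open>simp add: swap_src_def\<close>)
  next
    case 4
    note T4 = T_in[of a] T_in[of b] T_in[of c] T_in[of d]
    note br = braid_in[OF T4(1,3)] braid_in[OF T4(1,4)] braid_in[OF T4(2,3)] braid_in[OF T4(2,4)]
    have Sbd: "T a \<ltimes>\<^sub>2 hexR V (T b) (T c) (T d) \<in> cells V (T a \<ltimes> \<beta> (T b) (T c \<otimes> T d)) (T a \<ltimes> ((T c \<ltimes> \<beta> (T b) (T d)) \<cdot> (\<beta> (T b) (T c) \<rtimes> T d)))"
      by (rule iso_cells_cells[OF tenL2_iso(1)[OF T4(1) hexR_in[OF T4(2,3,4)]]])
    have Rab: "hexR V (T a) (T c) (T d) \<rtimes>\<^sub>2 T b \<in> cells V (\<beta> (T a) (T c \<otimes> T d) \<rtimes> T b) (((T c \<ltimes> \<beta> (T a) (T d)) \<cdot> (\<beta> (T a) (T c) \<rtimes> T d)) \<rtimes> T b)"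
      by (rule iso_cells_cells[OF tenR2_iso(1)[OF T4(2) hexR_in[OF T4(1,3,4)]]])
    have h1: "T a \<ltimes> \<beta> (T b) (T c \<otimes> T d) \<in> hom V (T a \<otimes> T b \<otimes> T c \<otimes> T d) (T a \<otimes> (T c \<otimes> T d) \<otimes> T b)"
      using tenL1_in[OF T4(1) braid_in[OF T4(2) ten_Obj[OF T4(3,4)]]] by simp
    have h2: "\<beta> (T a) (T c \<otimes> T d) \<rtimes> T b \<in> hom V (T a \<otimes> (T c \<otimes> T d) \<otimes> T b) ((T c \<otimes> T d) \<otimes> T a \<otimes> T b)"
      using tenR1_in[OF T4(2) braid_in[OF T4(1) ten_Obj[OF T4(3,4)]]] by (simp add: assoc0 ten_Obj T4)
    note e1 = hcomp_whisk(1)[OF h1 h2 Sbd Rab]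
    have Sd: "T c \<ltimes>\<^sub>2 hexS V (T a) (T b) (T d) \<in> cells V (T c \<ltimes> \<beta> (T a \<otimes> T b) (T d)) (T c \<ltimes> ((\<beta> (T a) (T d) \<rtimes> T b) \<cdot> (T a \<ltimes> \<beta> (T b) (T d))))"
      by (rule iso_cells_cells[OF tenL2_iso(1)[OF T4(3) hexS_in[OF T4(1,2,4)]]])
    have Sc: "hexS V (T a) (T b) (T c) \<rtimes>\<^sub>2 T d \<in> cells V (\<beta> (T a \<otimes> T b) (T c) \<rtimes> T d) (((\<beta> (T a) (T c) \<rtimes> T b) \<cdot> (T a \<ltimes> \<beta> (T b) (T c))) \<rtimes> T d)"
      by (rule iso_cells_cells[OF tenR2_iso(1)[OF T4(4) hexS_in[OF T4(1,2,3)]]])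
    have h3: "\<beta> (T a \<otimes> T b) (T c) \<rtimes> T d \<in> hom V ((T a \<otimes> T b) \<otimes> T c \<otimes> T d) (T c \<otimes> (T a \<otimes> T b) \<otimes> T d)"
      using tenR1_in[OF T4(4) braid_in[OF ten_Obj[OF T4(1,2)] T4(3)]] by (simp add: assoc0 ten_Obj T4)
    have h4: "T c \<ltimes> \<beta> (T a \<otimes> T b) (T d) \<in> hom V (T c \<otimes> (T a \<otimes> T b) \<otimes> T d) (T c \<otimes> T d \<otimes> T a \<otimes> T b)"
      using tenL1_in[OF T4(3) braid_in[OF ten_Obj[OF T4(1,2)] T4(4)]] by simp
    note e2 = hcomp_whisk(1)[OF h3 h4 Sc Sd]
    have c1: "T a \<ltimes> ((T c \<ltimes> \<beta> (T b) (T d)) \<cdot> (\<beta> (T b) (T c) \<rtimes> T d)) = (T (a @ c) \<ltimes> \<beta> (T b) (T d)) \<cdot> (T a \<ltimes> \<beta> (T b) (T c) \<rtimes> T d)"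
    proof -
      have "\<beta> (T b) (T c) \<rtimes> T d \<in> hom V (T b \<otimes> T c \<otimes> T d) (T c \<otimes> T b \<otimes> T d)"
        using tenR1_in[OF T4(4) br(3)] by (simp add: assoc0 T4)
      from tenL1_comp[OF T4(1) this tenL1_in[OF T4(3) br(4)]] show ?thesis
        by (simp add: T_append assocLL1 assocLR1 T4 hom_Arr[OF br(3)] hom_Arr[OF br(4)])
    qed
    have c2: "((\<beta> (T a) (T c) \<rtimes> T b) \<cdot> (T a \<ltimes> \<beta> (T b) (T c))) \<rtimes> T d = (\<beta> (T a) (T c) \<rtimes> T (b @ d)) \<cdot> (T a \<ltimes> \<beta> (T b) (T c) \<rtimes> T d)"
    proof -
      have "\<beta> (T a) (T c) \<rtimes> T b \<in> hom V (T a \<otimes> T c \<otimes> T b) ((T c \<otimes> T a) \<otimes> T b)"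
        using tenR1_in[OF T4(2) br(1)] by (simp add: assoc0 T4)
      from tenR1_comp[OF T4(4) tenL1_in[OF T4(1) br(3)] this] show ?thesis
        by (simp add: T_append assocRR1 T4 hom_Arr[OF br(1)])
    qed
    show ?case using braiding_RS[OF T4] assms
      by (simp add: seval_eval ctx_def swap_cell_left wh2_Nil del: ev.simps(2) bx.simps)
        (simp add: T_append T_in rcell_True e1 e2 c1 c2 wh1_def assocLR1 hom_Arr[OF br(1)] hom_Arr[OF br(2)] hom_Arr[OF br(3)] hom_Arr[OF br(4)])
  qed (use assms in \<open>simp_all add: linkeds swap_src_def swap_tgt_def\<close>)
  then show ?thesis by (rule teq_sym)
qed

text \<open>Whiskering on both outer sides turns the interchanger of two boxes into that of two
  layers, and \<open>inter_assocM\<close> assigns part of the strands in between to the left-hand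
  layer.\<close>

lemma swap_cell_both: "wh2 l r' (swap_cell g (r @ l') h) = \<Sigma> (wh1 l r (bx g)) (wh1 l' r' (bx h))"
proof -
  have k: "swap_cell g (r @ l') h \<in> Cell V"
    unfolding swap_cell_def using inter_in[OF bx_in tenL1_in[OF T_in bx_in]] iso_cells_cells cells_Cell by blast
  have "wh2 l r' (swap_cell g (r @ l') h) = wh2 l [] (wh2 [] r' (swap_cell g (r @ l') h))"
    by (simp add: wh2_wh2[OF k])
  also have "\<dots> = wh2 l [] (\<Sigma> (bx g) (T r \<ltimes> wh1 l' r' (bx h)))" by (simp only: swap_cell_wh_left)
  also have "\<dots> = T l \<ltimes>\<^sub>2 \<Sigma> (bx g) (T r \<ltimes> wh1 l' r' (bx h))"
    unfolding wh2_def using cells_Cell[OF tenL2_in[OF T_in iso_cells_cells[OF inter_in[OF bx_in tenL1_in[OF T_in lay_in]]]]] by (simp add: unitR2)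
  also have "\<dots> = \<Sigma> (T l \<ltimes> bx g) (T r \<ltimes> wh1 l' r' (bx h))"
    by (rule inter_assocL[symmetric]) (auto intro: T_in bx_Arr hom_Arr[OF tenL1_in[OF T_in lay_in]])
  also have "\<dots> = \<Sigma> (wh1 l r (bx g)) (wh1 l' r' (bx h))"
    unfolding wh1_def[of l r] by (rule inter_assocM[symmetric]) (auto intro: T_in hom_Arr[OF lay_in] hom_Arr[OF tenL1_in[OF T_in bx_in]])
  finally show ?thesis .
qed

text \<open>The sides of \<open>braid_inter\<close> involve different interchangers:
  \<open>\<Sigma> f g\<close> closes the one, the inverse of \<open>\<Sigma> g f\<close> opens the
  other. These are the coherence cells \<open>w1\<close> and \<open>w2\<close>, which join the ends
  of the two linked paths.\<close>

lemma tile_inter: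
  assumes "btgt g \<noteq> []" "btgt h \<noteq> []" "bsrc g \<noteq> []" "bsrc h \<noteq> []"
  shows "teq (l @ bsrc g @ r @ l' @ bsrc h @ r') (l' @ btgt h @ r' @ l @ btgt g @ r)
    (fst (tile_inter l g r l' h r')) (snd (tile_inter l g r l' h r'))"
proof -
  let ?a = "l @ bsrc g @ r" and ?a' = "l @ btgt g @ r" and ?b = "l' @ bsrc h @ r'" and ?b' = "l' @ btgt h @ r'"
  let ?xs = "l @ bsrc g @ r @ l' @ bsrc h @ r'" and ?ys = "l' @ btgt h @ r' @ l @ btgt g @ r"
  let ?d = "[([], Cr ?a ?b, [])] @ swap_tgt l' h (r' @ l) g r @ []" and ?d' = "[([], Cr ?a ?b, [])] @ swap_src l' h (r' @ l) g r @ []"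
  let ?e = "[] @ swap_src l g (r @ l') h r' @ [([], Cr ?a' ?b', [])]" and ?e' = "[] @ swap_tgt l g (r @ l') h r' @ [([], Cr ?a' ?b', [])]"
  obtain s1 s2 t1 t2 where st: "tile_inter l g r l' h r' = ([s1, s2], [t1, t2])" by (simp add: tile_inter_def Let_def)
  have u: "linked ?xs ?ys ?d [s1, s2] ?e" and v: "linked ?xs ?ys ?d' [t1, t2] ?e'"
    using st assms unfolding tile_inter_def Let_def by (auto simp: linkeds swap_src_def swap_tgt_def)
  have d': "chain ?xs ?d' ?ys" and e: "chain ?xs ?e ?ys" using assms by (simp_all add: swap_src_def)
  note w1 = ich_swap[OF e] and w2 = ich_swap_inv[OF d']
  note pu = pc_post[OF linked_pc'[OF u] w1]
  note pv = pc_pre[OF w2 linked_pc'[OF v]]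
  have dv: "dcell ?xs ?ys ?d' (seval t1) (stgt t1)" "dcell ?xs ?ys (stgt t1) (seval t2) ?e'"
    using v scell_dcell[of ?xs ?ys t1] scell_dcell[of ?xs ?ys t2] seval_scell[of ?xs ?ys t1] seval_scell[of ?xs ?ys t2] by auto
  have "ctx ?xs [] l r' (l @ (btgt g @ (r @ l') @ btgt h) @ r') [([], Cr ?a' ?b', [])] (swap_cell g (r @ l') h) \<bullet> peval [s1, s2]
     = peval [t1, t2] \<bullet> ctx ?xs [([], Cr ?a ?b, [])] l' r (l' @ (btgt h @ (r' @ l) @ btgt g) @ r) [] (inv2 V (swap_cell h (r' @ l) g))"
  proof -
    have "peval [t1, t2] \<bullet> ctx ?xs [([], Cr ?a ?b, [])] l' r (l' @ (btgt h @ (r' @ l) @ btgt g) @ r) [] (inv2 V (swap_cell h (r' @ l) g))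
      = seval t2 \<bullet> seval t1 \<bullet> ctx ?xs [([], Cr ?a ?b, [])] l' r (l' @ (btgt h @ (r' @ l) @ btgt g) @ r) [] (inv2 V (swap_cell h (r' @ l) g))"
      using vassoc[OF ich_dcell[OF w2] dv] by simp
    then show ?thesis
      using st assms braid_inter[OF lay_in[of l r g] lay_in[of l' r' h]] unfolding tile_inter_def Let_def
      by (auto simp: ctx_swap seval_eval wh2_swap_cell_inv swap_cell_both simp del: ev.simps(2) bx.simps)
        (simp add: T_append T_in rcell_True wh1_bx_append_left[of "l @ bsrc g @ r" l' r' h, unfolded append_assoc] wh1_bx_append_left[of "l' @ btgt h @ r'" l r g, unfolded append_assoc]
           wh1_bx_append_right[of l r "l' @ bsrc h @ r'" g, unfolded append_assoc] wh1_bx_append_right[of l' r' "l @ btgt g @ r" h, unfolded append_assoc])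
  qed
  then show ?thesis using teqI[OF pu] pv st by simp
qed

section \<open>Tiles from pseudonaturality of the braiding\<close>

context
  fixes D
  assumes D: "D \<in> Obj V"
begin

lemma braidL_comp: "f \<in> hom V A A' \<Longrightarrow> g \<in> hom V A' A'' \<Longrightarrow> \<beta>L (g \<cdot> f) D = (\<beta>L g D \<lhd> f \<rtimes> D) \<bullet> (D \<ltimes> g \<rhd> \<beta>L f D)"
  using pseudonatural.s1_comp[OF braid_pseudonatL[OF D]] by blast
lemma braidR_comp: "f \<in> hom V A A' \<Longrightarrow> g \<in> hom V A' A'' \<Longrightarrow> \<beta>R D (g \<cdot> f) = (\<beta>R D g \<lhd> D \<ltimes> f) \<bullet> (g \<rtimes> D \<rhd> \<beta>R D f)"
  using pseudonatural.s1_comp[OF braid_pseudonatR[OF D]] by blast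
lemma braidL_nat: "f \<in> hom V A A' \<Longrightarrow> \<phi> \<in> cells V f f' \<Longrightarrow> \<beta>L f' D \<bullet> (D \<ltimes>\<^sub>2 \<phi> \<lhd> \<beta> A D) = (\<beta> A' D \<rhd> \<phi> \<rtimes>\<^sub>2 D) \<bullet> \<beta>L f D"
  using pseudonatural.s1_nat[OF braid_pseudonatL[OF D]] by blast
lemma braidR_nat: "f \<in> hom V A A' \<Longrightarrow> \<phi> \<in> cells V f f' \<Longrightarrow> \<beta>R D f' \<bullet> (\<phi> \<rtimes>\<^sub>2 D \<lhd> \<beta> D A) = (\<beta> D A' \<rhd> D \<ltimes>\<^sub>2 \<phi>) \<bullet> \<beta>R D f"
  using pseudonatural.s1_nat[OF braid_pseudonatR[OF D]] by blast
text \<open>The unit law of a pseudonatural transformation makes the cell at the target an identity,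
  which drops out of the naturality equation.\<close>

lemma braidL_nat_id:
  assumes "\<phi> \<in> cells V f (id1 V A)" "A \<in> Obj V"
  shows "(D \<ltimes>\<^sub>2 \<phi> \<lhd> \<beta> A D) = (\<beta> A D \<rhd> \<phi> \<rtimes>\<^sub>2 D) \<bullet> \<beta>L f D"
proof -
  have f: "f \<in> hom V A A" by (rule cells_hom'[OF assms(1) id1_in[OF assms(2)]])
  note b = braid_in[OF assms(2) D]
  have "D \<ltimes>\<^sub>2 \<phi> \<lhd> \<beta> A D \<in> cells V ((D \<ltimes> f) \<cdot> \<beta> A D) ((D \<ltimes> id1 V A) \<cdot> \<beta> A D)"
    by (rule whiskR_in[OF b tenL1_in[OF D f] tenL2_in[OF D assms(1)]])
  then have "id2 V (\<beta> A D) \<bullet> (D \<ltimes>\<^sub>2 \<phi> \<lhd> \<beta> A D) = D \<ltimes>\<^sub>2 \<phi> \<lhd> \<beta> A D"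
    using vcomp_idL comp1_idL[OF b] tenL1_id[OF D assms(2)] by simp
  then show ?thesis using braidL_nat[OF f assms(1)] pseudonatural.s1_id[OF braid_pseudonatL[OF D] assms(2)] by simp
qed
lemma braidR_nat_id:
  assumes "\<phi> \<in> cells V f (id1 V A)" "A \<in> Obj V"
  shows "(\<phi> \<rtimes>\<^sub>2 D \<lhd> \<beta> D A) = (\<beta> D A \<rhd> D \<ltimes>\<^sub>2 \<phi>) \<bullet> \<beta>R D f"
proof -
  have f: "f \<in> hom V A A" by (rule cells_hom'[OF assms(1) id1_in[OF assms(2)]])
  note b = braid_in[OF D assms(2)]
  have "\<phi> \<rtimes>\<^sub>2 D \<lhd> \<beta> D A \<in> cells V ((f \<rtimes> D) \<cdot> \<beta> D A) ((id1 V A \<rtimes> D) \<cdot> \<beta> D A)"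
    by (rule whiskR_in[OF b tenR1_in[OF D f] tenR2_in[OF D assms(1)]])
  then have "id2 V (\<beta> D A) \<bullet> (\<phi> \<rtimes>\<^sub>2 D \<lhd> \<beta> D A) = \<phi> \<rtimes>\<^sub>2 D \<lhd> \<beta> D A"
    using vcomp_idL comp1_idL[OF b] tenR1_id[OF D assms(2)] by simp
  then show ?thesis using braidR_nat[OF f assms(1)] pseudonatural.s1_id[OF braid_pseudonatR[OF D] assms(2)] by simp
qed

end

text \<open>The composition law of a pseudonatural transformation: the cell at two successive layers
  is the composite of the cells at each of them.\<close>

lemma natL_path:
  assumes c: "chain zs [(l, g, r), (l', h, r')] ws" and b: "b \<noteq> []"
  shows "pc (zs @ b) (b @ ws) [([], Cr zs b, []), (b @ l, g, r), (b @ l', h, r')]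
     [Step [] [] (NatL l g r b) True [] [(b @ l', h, r')], Step [(l, g, r @ b)] [] (NatL l' h r' b) True [] []]
     [(l, g, r @ b), (l', h, r' @ b), ([], Cr ws b, [])] (\<beta>L (ev zs [(l, g, r), (l', h, r')]) (T b))"
    (is "pc _ _ ?d [?s, ?t] ?e _")
proof -
  have z: "zs = l @ bsrc g @ r" "ws = l' @ btgt h @ r'" "l' @ bsrc h @ r' = l @ btgt g @ r" "btgt g \<noteq> []" "btgt h \<noteq> []"
    using c by auto
  have l: "linked (zs @ b) (b @ ws) ?d [?s, ?t] ?e"
    using b z by (simp add: linkeds)
  have "wh1 l' r' (bx h) \<in> hom V (T (l @ btgt g @ r)) (T (l' @ btgt h @ r'))" using lay_in[of l' r' h] z(3) by simp
  from braidL_comp[OF T_in[of b] lay_in[of l r g] this] have "peval [?s, ?t] = \<beta>L (ev zs [(l, g, r), (l', h, r')]) (T b)"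
    using b z(4,5) by (simp add: seval_eval lay_append del: ev.simps(2) bx.simps rc.simps) (simp add: rcell_True)
  then show ?thesis using linked_pc'[OF l] by (simp only:)
qed

text \<open>Naturality of \<open>\<beta>L\<close> at the cell of \<open>\<rho>\<close>, with the
  pseudonaturality cells at source and target expanded by \<open>natL_path\<close>. The form with
  two layers on either side is that of an associator.\<close>

lemma tile_natL:
  assumes "rok \<rho>" "rsrc \<rho> = [(l, g, r), (l', h, r')]" "rtgt \<rho> = [(m, j, s), (m', k, s')]" "b \<noteq> []" "rcod \<rho> \<noteq> []"
  shows "teq (rdom \<rho> @ b) (b @ rcod \<rho>)
    [Step [] [] (NatL l g r b) True [] [(b @ l', h, r')], Step [(l, g, r @ b)] [] (NatL l' h r' b) True [] [],
     Step [] [] \<rho> True b [([], Cr (rcod \<rho>) b, [])]]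
    [Step [([], Cr (rdom \<rho>) b, [])] b \<rho> True [] [], Step [] [] (NatL m j s b) True [] [(b @ m', k, s')],
     Step [(m, j, s @ b)] [] (NatL m' k s' b) True [] []]"
proof -
  have c: "chain (rdom \<rho>) [(l, g, r), (l', h, r')] (rcod \<rho>)" "chain (rdom \<rho>) [(m, j, s), (m', k, s')] (rcod \<rho>)"
    using assms(1-3) by (auto simp: rok_def)
  let ?R = "Step [] [] \<rho> True b [([], Cr (rcod \<rho>) b, [])]" and ?R' = "Step [([], Cr (rdom \<rho>) b, [])] b \<rho> True [] []"
  have k: "sok (rdom \<rho> @ b) (b @ rcod \<rho>) ?R" "sok (rdom \<rho> @ b) (b @ rcod \<rho>) ?R'" using assms by auto
  have R: "pc (rdom \<rho> @ b) (b @ rcod \<rho>) [(l, g, r @ b), (l', h, r' @ b), ([], Cr (rcod \<rho>) b, [])] [?R] [(m, j, s @ b), (m', k, s' @ b), ([], Cr (rcod \<rho>) b, [])] (seval ?R)"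
    using pc_step[OF k(1)] assms(2,3) seval_scell[OF k(1)] by (simp add: psrc_def ptgt_def del: pc.simps scell.simps seval.simps)
  have R': "pc (rdom \<rho> @ b) (b @ rcod \<rho>) [([], Cr (rdom \<rho>) b, []), (b @ l, g, r), (b @ l', h, r')] [?R'] [([], Cr (rdom \<rho>) b, []), (b @ m, j, s), (b @ m', k, s')] (seval ?R')"
    using pc_step[OF k(2)] assms(2,3) seval_scell[OF k(2)] by (simp add: psrc_def ptgt_def del: pc.simps scell.simps seval.simps)
  note u = pc_append[THEN iffD2, OF exI, OF exI, OF exI, OF conjI, OF natL_path[OF c(1) assms(4)] conjI, OF R refl]
  note v = pc_append[THEN iffD2, OF exI, OF exI, OF exI, OF conjI, OF R' conjI, OF natL_path[OF c(2) assms(4)] refl]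
  have "rc \<rho> \<in> cells V (ev (rdom \<rho>) [(l, g, r), (l', h, r')]) (ev (rdom \<rho>) [(m, j, s), (m', k, s')])"
    using iso_cells_cells[OF rc_in[OF assms(1)]] assms(2,3) by simp
  from braidL_nat[OF T_in[of b] ev_in[OF c(1)] this] show ?thesis
    using teqI[OF u] v assms(1) by (simp add: seval_eval del: pc.simps ev.simps(2) bx.simps rc.simps) (simp add: rcell_True del: pc.simps rc.simps)
qed

lemma tile_natL_id:
  assumes "rok \<rho>" "rsrc \<rho> = [(l, g, r), (l', h, r')]" "rtgt \<rho> = []" "b \<noteq> []" "rcod \<rho> \<noteq> []"
  shows "teq (rdom \<rho> @ b) (b @ rcod \<rho>)
    [Step [] [] (NatL l g r b) True [] [(b @ l', h, r')], Step [(l, g, r @ b)] [] (NatL l' h r' b) True [] [],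
     Step [] [] \<rho> True b [([], Cr (rcod \<rho>) b, [])]]
    [Step [([], Cr (rdom \<rho>) b, [])] b \<rho> True [] []]"
proof -
  have c: "chain (rdom \<rho>) [(l, g, r), (l', h, r')] (rcod \<rho>)" "rcod \<rho> = rdom \<rho>"
    using assms(1-3) by (auto simp: rok_def)
  let ?R = "Step [] [] \<rho> True b [([], Cr (rcod \<rho>) b, [])]" and ?R' = "Step [([], Cr (rdom \<rho>) b, [])] b \<rho> True [] []"
  have k: "sok (rdom \<rho> @ b) (b @ rcod \<rho>) ?R" "sok (rdom \<rho> @ b) (b @ rcod \<rho>) ?R'" using assms by auto
  have R: "pc (rdom \<rho> @ b) (b @ rcod \<rho>) [(l, g, r @ b), (l', h, r' @ b), ([], Cr (rcod \<rho>) b, [])] [?R] [([], Cr (rcod \<rho>) b, [])] (seval ?R)"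
    using pc_step[OF k(1)] assms(2,3) seval_scell[OF k(1)] by (simp add: psrc_def ptgt_def del: pc.simps scell.simps seval.simps)
  have R': "pc (rdom \<rho> @ b) (b @ rcod \<rho>) [([], Cr (rdom \<rho>) b, []), (b @ l, g, r), (b @ l', h, r')] [?R'] [([], Cr (rcod \<rho>) b, [])] (seval ?R')"
    using pc_step[OF k(2)] assms(2,3) seval_scell[OF k(2)] c(2) by (simp add: psrc_def ptgt_def del: pc.simps scell.simps seval.simps)
  note u = pc_append[THEN iffD2, OF exI, OF exI, OF exI, OF conjI, OF natL_path[OF c(1) assms(4)] conjI, OF R refl]
  have "rc \<rho> \<in> cells V (ev (rdom \<rho>) [(l, g, r), (l', h, r')]) (id1 V (T (rdom \<rho>)))"
    using iso_cells_cells[OF rc_in[OF assms(1)]] assms(2,3) by simp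
  from braidL_nat_id[OF T_in[of b] this T_in] show ?thesis
    using teqI[OF u] R' assms(1) c(2) by (simp add: seval_eval del: pc.simps ev.simps(2) bx.simps rc.simps) (simp add: rcell_True del: pc.simps rc.simps)
qed

lemma natR_path:
  assumes c: "chain zs [(l, g, r), (l', h, r')] ws" and b: "b \<noteq> []"
  shows "pc (b @ zs) (ws @ b) [([], Cr b zs, []), (l, g, r @ b), (l', h, r' @ b)]
     [Step [] [] (NatR b l g r) True [] [(l', h, r' @ b)], Step [(b @ l, g, r)] [] (NatR b l' h r') True [] []]
     [(b @ l, g, r), (b @ l', h, r'), ([], Cr b ws, [])] (\<beta>R (T b) (ev zs [(l, g, r), (l', h, r')]))"
    (is "pc _ _ ?d [?s, ?t] ?e _")
proof -
  have z: "zs = l @ bsrc g @ r" "ws = l' @ btgt h @ r'" "l' @ bsrc h @ r' = l @ btgt g @ r" "btgt g \<noteq> []" "btgt h \<noteq> []"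
    using c by auto
  have l: "linked (b @ zs) (ws @ b) ?d [?s, ?t] ?e"
    using b z by (simp add: linkeds)
  have "wh1 l' r' (bx h) \<in> hom V (T (l @ btgt g @ r)) (T (l' @ btgt h @ r'))" using lay_in[of l' r' h] z(3) by simp
  from braidR_comp[OF T_in[of b] lay_in[of l r g] this] have "peval [?s, ?t] = \<beta>R (T b) (ev zs [(l, g, r), (l', h, r')])"
    using b z(4,5) by (simp add: seval_eval lay_append del: ev.simps(2) bx.simps rc.simps) (simp add: rcell_True)
  then show ?thesis using linked_pc'[OF l] by (simp only:)
qed

lemma tile_natR:
  assumes "rok \<rho>" "rsrc \<rho> = [(l, g, r), (l', h, r')]" "rtgt \<rho> = [(m, j, s), (m', k, s')]" "b \<noteq> []" "rcod \<rho> \<noteq> []"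
  shows "teq (b @ rdom \<rho>) (rcod \<rho> @ b)
    [Step [] [] (NatR b l g r) True [] [(l', h, r' @ b)], Step [(b @ l, g, r)] [] (NatR b l' h r') True [] [],
     Step [] b \<rho> True [] [([], Cr b (rcod \<rho>), [])]]
    [Step [([], Cr b (rdom \<rho>), [])] [] \<rho> True b [], Step [] [] (NatR b m j s) True [] [(m', k, s' @ b)],
     Step [(b @ m, j, s)] [] (NatR b m' k s') True [] []]"
proof -
  have c: "chain (rdom \<rho>) [(l, g, r), (l', h, r')] (rcod \<rho>)" "chain (rdom \<rho>) [(m, j, s), (m', k, s')] (rcod \<rho>)"
    using assms(1-3) by (auto simp: rok_def)
  let ?R = "Step [] b \<rho> True [] [([], Cr b (rcod \<rho>), [])]" and ?R' = "Step [([], Cr b (rdom \<rho>), [])] [] \<rho> True b []"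
  have k: "sok (b @ rdom \<rho>) (rcod \<rho> @ b) ?R" "sok (b @ rdom \<rho>) (rcod \<rho> @ b) ?R'" using assms by auto
  have R: "pc (b @ rdom \<rho>) (rcod \<rho> @ b) [(b @ l, g, r), (b @ l', h, r'), ([], Cr b (rcod \<rho>), [])] [?R] [(b @ m, j, s), (b @ m', k, s'), ([], Cr b (rcod \<rho>), [])] (seval ?R)"
    using pc_step[OF k(1)] assms(2,3) seval_scell[OF k(1)] by (simp add: psrc_def ptgt_def del: pc.simps scell.simps seval.simps)
  have R': "pc (b @ rdom \<rho>) (rcod \<rho> @ b) [([], Cr b (rdom \<rho>), []), (l, g, r @ b), (l', h, r' @ b)] [?R'] [([], Cr b (rdom \<rho>), []), (m, j, s @ b), (m', k, s' @ b)] (seval ?R')"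
    using pc_step[OF k(2)] assms(2,3) seval_scell[OF k(2)] by (simp add: psrc_def ptgt_def del: pc.simps scell.simps seval.simps)
  note u = pc_append[THEN iffD2, OF exI, OF exI, OF exI, OF conjI, OF natR_path[OF c(1) assms(4)] conjI, OF R refl]
  note v = pc_append[THEN iffD2, OF exI, OF exI, OF exI, OF conjI, OF R' conjI, OF natR_path[OF c(2) assms(4)] refl]
  have "rc \<rho> \<in> cells V (ev (rdom \<rho>) [(l, g, r), (l', h, r')]) (ev (rdom \<rho>) [(m, j, s), (m', k, s')])"
    using iso_cells_cells[OF rc_in[OF assms(1)]] assms(2,3) by simp
  from braidR_nat[OF T_in[of b] ev_in[OF c(1)] this] show ?thesis
    using teqI[OF u] v assms(1) by (simp add: seval_eval del: pc.simps ev.simps(2) bx.simps rc.simps) (simp add: rcell_True del: pc.simps rc.simps)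
qed

lemma tile_natR_id:
  assumes "rok \<rho>" "rsrc \<rho> = [(l, g, r), (l', h, r')]" "rtgt \<rho> = []" "b \<noteq> []" "rcod \<rho> \<noteq> []"
  shows "teq (b @ rdom \<rho>) (rcod \<rho> @ b)
    [Step [] [] (NatR b l g r) True [] [(l', h, r' @ b)], Step [(b @ l, g, r)] [] (NatR b l' h r') True [] [],
     Step [] b \<rho> True [] [([], Cr b (rcod \<rho>), [])]]
    [Step [([], Cr b (rdom \<rho>), [])] [] \<rho> True b []]"
proof -
  have c: "chain (rdom \<rho>) [(l, g, r), (l', h, r')] (rcod \<rho>)" "rcod \<rho> = rdom \<rho>"
    using assms(1-3) by (auto simp: rok_def)
  let ?R = "Step [] b \<rho> True [] [([], Cr b (rcod \<rho>), [])]" and ?R' = "Step [([], Cr b (rdom \<rho>), [])] [] \<rho> True b []"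
  have k: "sok (b @ rdom \<rho>) (rcod \<rho> @ b) ?R" "sok (b @ rdom \<rho>) (rcod \<rho> @ b) ?R'" using assms by auto
  have R: "pc (b @ rdom \<rho>) (rcod \<rho> @ b) [(b @ l, g, r), (b @ l', h, r'), ([], Cr b (rcod \<rho>), [])] [?R] [([], Cr b (rcod \<rho>), [])] (seval ?R)"
    using pc_step[OF k(1)] assms(2,3) seval_scell[OF k(1)] by (simp add: psrc_def ptgt_def del: pc.simps scell.simps seval.simps)
  have R': "pc (b @ rdom \<rho>) (rcod \<rho> @ b) [([], Cr b (rdom \<rho>), []), (l, g, r @ b), (l', h, r' @ b)] [?R'] [([], Cr b (rcod \<rho>), [])] (seval ?R')"
    using pc_step[OF k(2)] assms(2,3) seval_scell[OF k(2)] c(2) by (simp add: psrc_def ptgt_def del: pc.simps scell.simps seval.simps)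
  note u = pc_append[THEN iffD2, OF exI, OF exI, OF exI, OF conjI, OF natR_path[OF c(1) assms(4)] conjI, OF R refl]
  have "rc \<rho> \<in> cells V (ev (rdom \<rho>) [(l, g, r), (l', h, r')]) (id1 V (T (rdom \<rho>)))"
    using iso_cells_cells[OF rc_in[OF assms(1)]] assms(2,3) by simp
  from braidR_nat_id[OF T_in[of b] this T_in] show ?thesis
    using teqI[OF u] R' assms(1) c(2) by (simp add: seval_eval del: pc.simps ev.simps(2) bx.simps rc.simps) (simp add: rcell_True del: pc.simps rc.simps)
qed

lemma tile_NL_assoc:
  assumes "b \<noteq> []"
  shows "teq ([SC k l, SC j k, SC i j] @ b) (b @ [SC i l]) (fst (tile_NL_assoc i j k l b)) (snd (tile_NL_assoc i j k l b))"
  using tile_natL[of "AssC i j k l" _ _ _ _ _ _ _ _ _ _ _ _ b] assms by (simp add: tile_NL_assoc_def rok_simps)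

lemma tile_NR_assoc:
  assumes "a \<noteq> []"
  shows "teq (a @ [SB k l, SB j k, SB i j]) (SB i l # a) (fst (tile_NR_assoc i j k l a)) (snd (tile_NR_assoc i j k l a))"
  using tile_natR[of "AssB i j k l" _ _ _ _ _ _ _ _ _ _ _ _ a] assms by (simp add: tile_NR_assoc_def rok_simps)

lemma tile_NL_right:
  assumes "b \<noteq> []"
  shows "teq (SC i j # b) (b @ [SC i j]) (fst (tile_NL_right i j b)) (snd (tile_NL_right i j b))"
  using tile_natL_id[of "RightC i j" _ _ _ _ _ _ b] assms by (simp add: tile_NL_right_def rok_simps)

lemma tile_NR_left:
  assumes "a \<noteq> []"
  shows "teq (a @ [SB i j]) (SB i j # a) (fst (tile_NR_left i j a)) (snd (tile_NR_left i j a))"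
  using tile_natR_id[of "LeftB i j" _ _ _ _ _ _ a] assms by (simp add: tile_NR_left_def rok_simps)

section \<open>Tiles from the axioms of the two enriched bicategories\<close>

lemma tile_ACB:
  "teq [SB l m, SB k l, SB j k, SB i j] [SB i m] (fst (tile_ACB i j k l m)) (snd (tile_ACB i j k l m))"
proof -
  let ?xs = "[SB l m, SB k l, SB j k, SB i j]"
  let ?d = "[([], MB k l m, [SB j k, SB i j]), ([], MB j k m, [SB i j]), ([], MB i j m, [])]"
    and ?e = "[([SB l m, SB k l], MB i j k, []), ([SB l m], MB i k l, []), ([], MB i l m, [])]"
  obtain s1 s2 s3 t1 t2 where st: "tile_ACB i j k l m = ([s1, s2, s3], [t1, t2])" by (simp add: tile_ACB_def)
  \<comment> \<open>The \<Sigma>^-1 of (AC), placed in the gap between the two steps of the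
    right-hand side.\<close>
  let ?w = "ctx ?xs [] [] [] ([] @ (btgt (MB k l m) @ [] @ btgt (MB i j k)) @ []) [([], MB i k m, [])] (inv2 V (swap_cell (MB k l m) [] (MB i j k)))"
  have u: "linked ?xs [SB i m] ?d [s1, s2, s3] [([SB l m, SB k l], MB i j k, []), ([SB l m], MB i k l, []), ([], MB i l m, [])]"
    using st unfolding tile_ACB_def by (auto simp: linkeds)
  have t: "sok ?xs [SB i m] t1" "sok ?xs [SB i m] t2" "ssrc t1 = ?d" "stgt t2 = ?e"
    "stgt t1 = [] @ swap_tgt [] (MB k l m) [] (MB i j k) [] @ [([], MB i k m, [])]"
    "ssrc t2 = [] @ swap_src [] (MB k l m) [] (MB i j k) [] @ [([], MB i k m, [])]"
    using st unfolding tile_ACB_def by (auto simp: linkeds swap_src_def swap_tgt_def)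
  have w: "ich ?xs [SB i m] (stgt t1) ?w (ssrc t2)"
    unfolding t(5,6) by (rule ich_swap_inv) (simp add: swap_src_def)
  have "peval [s1, s2, s3] = seval t2 \<bullet> ?w \<bullet> seval t1"
    unfolding peval_3[OF u] using st B.AC[OF p_in[of i] p_in[of j] p_in[of k] p_in[of l] p_in[of m]] unfolding tile_ACB_def
    by (auto simp: ctx_swap seval_eval wh2_swap_cell_inv swap_cell_left simp del: ev.simps(2) bx.simps)
      (simp add: rcell_True unitR0_homs wh1_def)
  then show ?thesis
    using teqI[OF linked_pc'[OF u]] pc_mid'[OF t(1,2) w] st t(3,4) by simp
qed

lemma tile_ICB:
  "teq [SB j k, SB i j] [SB i k] (fst (tile_ICB i j k)) (snd (tile_ICB i j k))"
  unfolding tile_ICB_def fst_conv snd_conv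
proof (rule teq_linked[where d = "[([SB j k], UB j, [SB i j]), ([], MB j j k, [SB i j]), ([], MB i j k, [])]"
      and e = "[([], MB i j k, [])]"], goal_cases)
  case 3
  show ?case using B.IC[OF p_in[of i] p_in[of j] p_in[of k]]
    by (simp add: seval_eval del: ev.simps(2) bx.simps) (simp add: rcell_True unitR0_homs wh1_def)
qed (simp_all add: linkeds)

lemma tile_ACC:
  "teq [SC l m, SC k l, SC j k, SC i j] [SC i m] (fst (tile_ACC i j k l m)) (snd (tile_ACC i j k l m))"
proof -
  let ?xs = "[SC l m, SC k l, SC j k, SC i j]"
  let ?d = "[([], MC k l m, [SC j k, SC i j]), ([], MC j k m, [SC i j]), ([], MC i j m, [])]"
    and ?e = "[([SC l m, SC k l], MC i j k, []), ([SC l m], MC i k l, []), ([], MC i l m, [])]"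
  obtain s1 s2 s3 t1 t2 where st: "tile_ACC i j k l m = ([s1, s2, s3], [t1, t2])" by (simp add: tile_ACC_def)
  let ?w = "ctx ?xs [] [] [] ([] @ (btgt (MC k l m) @ [] @ btgt (MC i j k)) @ []) [([], MC i k m, [])] (inv2 V (swap_cell (MC k l m) [] (MC i j k)))"
  have u: "linked ?xs [SC i m] ?d [s1, s2, s3] [([SC l m, SC k l], MC i j k, []), ([SC l m], MC i k l, []), ([], MC i l m, [])]"
    using st unfolding tile_ACC_def by (auto simp: linkeds)
  have t: "sok ?xs [SC i m] t1" "sok ?xs [SC i m] t2" "ssrc t1 = ?d" "stgt t2 = ?e"
    "stgt t1 = [] @ swap_tgt [] (MC k l m) [] (MC i j k) [] @ [([], MC i k m, [])]"
    "ssrc t2 = [] @ swap_src [] (MC k l m) [] (MC i j k) [] @ [([], MC i k m, [])]"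
    using st unfolding tile_ACC_def by (auto simp: linkeds swap_src_def swap_tgt_def)
  have w: "ich ?xs [SC i m] (stgt t1) ?w (ssrc t2)"
    unfolding t(5,6) by (rule ich_swap_inv) (simp add: swap_src_def)
  have "peval [s1, s2, s3] = seval t2 \<bullet> ?w \<bullet> seval t1"
    unfolding peval_3[OF u] using st C.AC[OF q_in[of i] q_in[of j] q_in[of k] q_in[of l] q_in[of m]] unfolding tile_ACC_def
    by (auto simp: ctx_swap seval_eval wh2_swap_cell_inv swap_cell_left simp del: ev.simps(2) bx.simps)
      (simp add: rcell_True unitR0_homs wh1_def)
  then show ?thesis
    using teqI[OF linked_pc'[OF u]] pc_mid'[OF t(1,2) w] st t(3,4) by simp
qed

lemma tile_ICC:
  "teq [SC j k, SC i j] [SC i k] (fst (tile_ICC i j k)) (snd (tile_ICC i j k))"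
  unfolding tile_ICC_def fst_conv snd_conv
proof (rule teq_linked[where d = "[([SC j k], UC j, [SC i j]), ([], MC j j k, [SC i j]), ([], MC i j k, [])]"
      and e = "[([], MC i j k, [])]"], goal_cases)
  case 3
  show ?case using C.IC[OF q_in[of i] q_in[of j] q_in[of k]]
    by (simp add: seval_eval del: ev.simps(2) bx.simps) (simp add: rcell_True unitR0_homs wh1_def)
qed (simp_all add: linkeds)

end

section \<open>The structural cells of the tensor product\<close>

context diagram_rules begin

lemma pc_above:
  assumes "pc zs ws d p e \<phi>" "chain (l @ ws @ r) Y ys"
  shows "pc (l @ zs @ r) ys (wdiag l r d @ Y) (wpath [] l r Y p) (wdiag l r e @ Y) (ev (l @ ws @ r) Y \<rhd> wh2 l r \<phi>)"
  using pc_ctx[OF assms(1) _ assms(2), of "l @ zs @ r" "[]"] ctx_Nil[OF pc_dcell[OF assms(1)] refl refl assms(2)] by simp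

lemma pc_over:
  assumes "pc zs ws d p e \<phi>" "chain ws Y ys"
  shows "pc zs ys (d @ Y) (wpath [] [] [] Y p) (e @ Y) (ev ws Y \<rhd> \<phi>)"
  using pc_above[OF assms(1), of "[]" "[]" Y ys] assms(2) wh2_Nil[OF cells_Cell[OF dcell_cells[OF pc_dcell[OF assms(1)]]]]
  by (simp add: wdiag_Nil)

lemma pc_below:
  assumes "pc zs ws d p e \<phi>" "chain xs X zs"
  shows "pc xs ws (X @ d) (wpath X [] [] [] p) (X @ e) (\<phi> \<lhd> ev xs X)"
  using pc_ctx[OF assms(1), of xs X "[]" "[]" "[]" ws] assms(2) ctx_Nil2[OF pc_dcell[OF assms(1)] refl, of xs X "[]" "[]"]
    wh2_Nil[OF cells_Cell[OF dcell_cells[OF pc_dcell[OF assms(1)]]]] by (simp add: wdiag_Nil)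

lemma pc_between:
  assumes "pc zs ws d p e \<phi>" "chain xs X zs" "chain ws Y ys"
  shows "pc xs ys (X @ d @ Y) (wpath X [] [] Y p) (X @ e @ Y) (ev ws Y \<rhd> \<phi> \<lhd> ev xs X)"
  using pc_ctx[OF assms(1), of xs X "[]" "[]" Y ys] assms wh2_Nil[OF cells_Cell[OF dcell_cells[OF pc_dcell[OF assms(1)]]]]
  by (simp add: wdiag_Nil ctx_def)

lemma pc_comp: "pc xs ys d p e \<phi> \<Longrightarrow> pc xs ys e q f \<psi> \<Longrightarrow> pc xs ys d (p @ q) f (\<psi> \<bullet> \<phi>)"
  unfolding pc_append by blast

lemma pc_seval: "sok xs ys \<sigma> \<Longrightarrow> pc xs ys (ssrc \<sigma>) [\<sigma>] (stgt \<sigma>) (seval \<sigma>)"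
  using pc_step seval_scell by metis

lemma pc_pre_seval:
  "sok xs ys \<sigma> \<Longrightarrow> ich xs ys d \<omega> (ssrc \<sigma>) \<Longrightarrow> pc xs ys d [\<sigma>] (stgt \<sigma>) (seval \<sigma> \<bullet> \<omega>)"
  using pc_pre pc_seval by blast

end

context diagram_semantics begin

text \<open>Extends \<open>slide_left\<close> to a whole diagram on the left, by induction with
  \<open>inter_compL\<close>. It is needed for the interchanger of two multiplications of B
  \<otimes> C in (AC), each of which is a composite.\<close>

lemma slide_block:
  assumes P: "chain zs P ws" and Q: "chain zs' Q ws'"
  shows "slide (zs @ zs') (ws @ ws') (wdiag zs [] Q @ wdiag [] ws' P) (\<Sigma> (ev zs P) (ev zs' Q)) (wdiag [] zs' P @ wdiag ws [] Q)"
  using P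
proof (induction zs P ws rule: chain.induct)
  case (1 xs ys)
  have "ev (xs @ zs') (wdiag xs [] Q) = T xs \<ltimes> ev zs' Q"
    using ev_wdiag[OF Q, of xs "[]"] hom_Arr[OF tenL1_in[OF T_in ev_in[OF Q]]] by (simp add: wh1_def unitR1)
  moreover have "\<Sigma> (id1 V (T xs)) (ev zs' Q) = id2 V (T xs \<ltimes> ev zs' Q)"
    by (rule inter_idL[OF T_in hom_Arr[OF ev_in[OF Q]]])
  ultimately show ?case using slide_refl[of "xs @ zs'" "wdiag xs [] Q" "xs @ ws'"] chain_wdiag[OF Q, of xs "[]"] 1 by simp
next
  case (2 zs l g r P ws)
  then have c: "zs = l @ bsrc g @ r" "btgt g \<noteq> []" "chain (l @ btgt g @ r) P ws" by auto
  note IH = 2(1)[OF c(3)]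
  let ?f = "wh1 l r (bx g)" and ?f' = "ev (l @ btgt g @ r) P" and ?q = "ev zs' Q"
  have f: "?f \<in> hom V (T zs) (T (l @ btgt g @ r))" unfolding c(1) by (rule wh1_in[OF bx_in])
  note f' = ev_in[OF c(3)] and q = ev_in[OF Q]
  have comp: "\<Sigma> (ev zs ((l, g, r) # P)) ?q = (\<Sigma> ?f' ?q \<lhd> (?f \<rtimes> T zs')) \<bullet> ((?f' \<rtimes> T ws') \<rhd> \<Sigma> ?f ?q)"
    using inter_compL[OF f f' q] by simp
  have rq: "T r \<ltimes> ?q \<in> hom V (T (r @ zs')) (T (r @ ws'))" unfolding T_append by (rule tenL1_in[OF T_in q])
  note x0 = inter_in[OF bx_in[of g] rq, THEN iso_cells_cells]
  have fq: "wh2 l [] (\<Sigma> (bx g) (T r \<ltimes> ?q)) = \<Sigma> ?f ?q"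
    unfolding wh2_def wh1_def using cells_Cell[OF tenL2_in[OF T_in x0]] hom_Arr[OF rq] hom_Arr[OF q] hom_Arr[OF tenL1_in[OF T_in bx_in]]
    by (simp add: unitR2 inter_assocL T_in hom_Arr[OF bx_in] inter_assocM)
  have s1: "slide (zs @ zs') (ws @ ws') ([] @ wdiag l [] (wdiag (bsrc g @ r) [] Q @ [([], g, r @ ws')]) @ wdiag [] ws' P)
      (ctx (zs @ zs') [] l [] (l @ (btgt g @ r @ ws') @ []) (wdiag [] ws' P) (\<Sigma> (bx g) (T r \<ltimes> ?q)))
      ([] @ wdiag l [] (([], g, r @ zs') # wdiag (btgt g @ r) [] Q) @ wdiag [] ws' P)"
    by (rule slide_ctx[OF slide_left[OF Q c(2), of r]]) (use c chain_wdiag[OF c(3), of "[]" ws'] in auto)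
  have s2: "slide (zs @ zs') (ws @ ws') ([(l, g, r @ zs')] @ wdiag [] [] (wdiag (l @ btgt g @ r) [] Q @ wdiag [] ws' P) @ [])
      (ctx (zs @ zs') [(l, g, r @ zs')] [] [] ([] @ (ws @ ws') @ []) [] (\<Sigma> ?f' ?q))
      ([(l, g, r @ zs')] @ wdiag [] [] (wdiag [] zs' P @ wdiag ws [] Q) @ [])"
    by (rule slide_ctx[OF IH]) (use c in auto)
  have e1: "ctx (zs @ zs') [] l [] (l @ (btgt g @ r @ ws') @ []) (wdiag [] ws' P) (\<Sigma> (bx g) (T r \<ltimes> ?q)) = (?f' \<rtimes> T ws') \<rhd> \<Sigma> ?f ?q"
  proof -
    note x = inter_in[OF f q, THEN iso_cells_cells]
    have "ev (l @ (btgt g @ r @ ws') @ []) (wdiag [] ws' P) = ?f' \<rtimes> T ws'"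
      using ev_wdiag[OF c(3), of "[]" ws'] by (simp add: wh1_def unitL1 hom_Arr[OF f'])
    moreover note whiskR_id1[OF comp1_in[OF comp1_in[OF tenL1_in[OF T_in q] tenR1_in[OF T_in f]] tenR1_in[OF T_in f']]
       whiskL_in[OF comp1_in[OF tenL1_in[OF T_in q] tenR1_in[OF T_in f]] tenR1_in[OF T_in f'] x]]
    ultimately show ?thesis unfolding ctx_def fq by (simp add: T_append)
  qed
  have e2: "ctx (zs @ zs') [(l, g, r @ zs')] [] [] ([] @ (ws @ ws') @ []) [] (\<Sigma> ?f' ?q) = \<Sigma> ?f' ?q \<lhd> (?f \<rtimes> T zs')"
  proof -
    note x = inter_in[OF f' q, THEN iso_cells_cells]
    have "ev (zs @ zs') [(l, g, r @ zs')] = ?f \<rtimes> T zs'"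
      unfolding ev_single wh1_def T_append by (simp add: assocRR1 T_in hom_Arr[OF tenL1_in[OF T_in bx_in]])
    moreover have "(?f' \<rtimes> T ws') \<cdot> (T (l @ btgt g @ r) \<ltimes> ?q) \<in> hom V (T (l @ btgt g @ r) \<otimes> T zs') (T (ws @ ws'))"
      unfolding T_append[of ws] by (rule comp1_in[OF tenL1_in[OF T_in q] tenR1_in[OF T_in f']])
    ultimately show ?thesis unfolding ctx_def wh2_Nil[OF cells_Cell[OF x]] using whiskL_id1[OF _ x] by simp
  qed
  show ?case unfolding comp
  proof (rule slide_trans)
    show "slide (zs @ zs') (ws @ ws') (wdiag zs [] Q @ wdiag [] ws' ((l, g, r) # P)) ((?f' \<rtimes> T ws') \<rhd> \<Sigma> ?f ?q)
       ((l, g, r @ zs') # wdiag (l @ btgt g @ r) [] Q @ wdiag [] ws' P)"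
      using s1[unfolded e1] c(1) by (simp add: wdiag_wdiag del: map_map)
    show "slide (zs @ zs') (ws @ ws') ((l, g, r @ zs') # wdiag (l @ btgt g @ r) [] Q @ wdiag [] ws' P) (\<Sigma> ?f' ?q \<lhd> (?f \<rtimes> T zs'))
       (wdiag [] zs' ((l, g, r) # P) @ wdiag ws [] Q)"
      using s2[unfolded e2 wdiag_Nil] by simp
  qed
qed

end

context tensor_data begin

lemma tensor_hom_T: "tensor_hom V B C (p i, q i) (p j, q j) = T (SBC i j)"
  by (simp add: tensor_hom_def unitR0_homs)

lemma ten1_T:
  assumes "f \<in> hom V (T xs) (T ys)" "g \<in> hom V (T zs) (T ws)"
  shows "f \<boxtimes> g = (f \<rtimes> T ws) \<cdot> (T xs \<ltimes> g)"
  using assms by (simp add: ten1_def hom_def)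

lemma mul_diag_chain: "chain (SBC j k @ SBC i j) (mul_diag i j k) (SBC i k)"
  by (simp add: mul_diag_def)

lemma unit_diag_chain: "chain [] (unit_diag i) (SBC i i)"
  by (simp add: unit_diag_def)

lemma tensor_mul_ev: "tensor_mul V B C (p i, q i) (p j, q j) (p k, q k) = ev (SBC j k @ SBC i j) (mul_diag i j k)"
proof -
  have "eMul B (p i) (p j) (p k) \<boxtimes> eMul C (q i) (q j) (q k) = (eMul B (p i) (p j) (p k) \<rtimes> eHom C (q i) (q k)) \<cdot> ((eHom B (p j) (p k) \<otimes> eHom B (p i) (p j)) \<ltimes> eMul C (q i) (q j) (q k))"
    using ten1_T[OF bx_in[of "MB i j k"] bx_in[of "MC i j k"]] by (simp add: unitR0_homs)
  then show ?thesis
    unfolding tensor_mul_def mul_diag_def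
    by (simp add: ev_eval del: ev.simps(2) bx.simps) (simp add: unitR0_homs wh1_def)
qed

lemma tensor_unit_ev: "tensor_unit V B C (p i, q i) = ev [] (unit_diag i)"
proof -
  have "eUnit B (p i) \<boxtimes> eUnit C (q i) = (eUnit B (p i) \<rtimes> eHom C (q i) (q i)) \<cdot> (\<one> \<ltimes> eUnit C (q i))"
    using ten1_T[OF bx_in[of "UB i"] bx_in[of "UC i"]] by (simp add: unitR0_homs)
  then show ?thesis unfolding tensor_unit_def unit_diag_def
    by (simp add: ev_eval del: ev.simps(2) bx.simps) (simp add: unitR0_homs wh1_def unitL1[OF bx_Arr[of "UC i"], simplified])
qed

lemmas unit1_bx = unitL1[OF bx_Arr] unitR1[OF bx_Arr]
lemmas unit1 = unit1_bx[of "MB i j k" for i j k, simplified] unit1_bx[of "MC i j k" for i j k, simplified]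
  unit1_bx[of "UB i" for i, simplified] unit1_bx[of "UC i" for i, simplified]

lemma mul_ev: "eMul B (p i) (p j) (p k) \<boxtimes> eMul C (q i') (q j') (q k') =
  (eMul B (p i) (p j) (p k) \<rtimes> eHom C (q i') (q k')) \<cdot> ((eHom B (p j) (p k) \<otimes> eHom B (p i) (p j)) \<ltimes> eMul C (q i') (q j') (q k'))"
  using ten1_T[OF bx_in[of "MB i j k"] bx_in[of "MC i' j' k'"]] by (simp add: unitR0_homs)

lemma mul_ev2: "(eMul B (p i) (p j) (p k) \<rtimes> eHom B (p n) (p i)) \<boxtimes> (eMul C (q i') (q j') (q k') \<rtimes> eHom C (q n') (q i')) =
  (eMul B (p i) (p j) (p k) \<rtimes> (eHom B (p n) (p i) \<otimes> eHom C (q i') (q k') \<otimes> eHom C (q n') (q i')))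
   \<cdot> ((eHom B (p j) (p k) \<otimes> eHom B (p i) (p j) \<otimes> eHom B (p n) (p i)) \<ltimes> eMul C (q i') (q j') (q k') \<rtimes> eHom C (q n') (q i'))"
  using ten1_T[OF lay_in[of "[]" "[SB n i]" "MB i j k"] lay_in[of "[]" "[SC n' i']" "MC i' j' k'"]] assocRR1[OF T_in[of "[SB n i]"] T_in[of "[SC i' k',SC n' i']"] bx_Arr[of "MB i j k"]]
    assocLR1[OF T_in[of "[SB j k, SB i j, SB n i]"] T_in[of "[SC n' i']"] bx_Arr[of "MC i' j' k'"]]
  by (simp add: wh1_bx del: bx.simps) (simp add: unitR0_homs)

lemma swap_cell_Nil: "swap_cell f [] g = \<Sigma> (bx f) (bx g)"
  by (simp add: swap_cell_def unitL1 bx_Arr)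

text \<open>Of the two whiskered forms of the horizontal composite, this one applies
  \<open>\<phi>\<close> first, in accordance with the order of \<open>AssB\<close> and
  \<open>AssC\<close> in \<open>assoc_path\<close>.\<close>

lemma ten2_dcell:
  assumes "dcell zs ws P \<phi> P'" "dcell zs' ws' Q \<psi> Q'"
  shows "\<phi> \<boxtimes>\<^sub>2 \<psi> = (ev (zs @ ws') (wdiag [] ws' P') \<rhd> T zs \<ltimes>\<^sub>2 \<psi>) \<bullet> (\<phi> \<rtimes>\<^sub>2 T ws' \<lhd> ev (zs @ zs') (wdiag zs [] Q))"
proof -
  have h: "ev zs P \<in> hom V (T zs) (T ws)" "ev zs P' \<in> hom V (T zs) (T ws)" "ev zs' Q \<in> hom V (T zs') (T ws')"
    "chain zs P' ws" "chain zs' Q ws'"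
    using assms ev_in by (auto simp: dcell_def)
  note c = dcell_cells[OF assms(1)] dcell_cells[OF assms(2)]
  have "\<phi> \<boxtimes>\<^sub>2 \<psi> = (\<phi> \<rtimes>\<^sub>2 T ws') \<star> (T zs \<ltimes>\<^sub>2 \<psi>)"
    using h c by (simp add: ten2_def cells_def hom_def)
  then show ?thesis
    using hcomp_whisk(2)[OF tenL1_in[OF T_in h(3)] tenR1_in[OF T_in h(1)] tenL2_in[OF T_in c(2)] tenR2_in[OF T_in c(1)]]
      ev_wdiag[OF h(4), of "[]" ws'] ev_wdiag[OF h(5), of zs "[]"] hom_Arr[OF h(2)] hom_Arr[OF tenL1_in[OF T_in h(3)]]
    by (simp add: wh1_def unitL1 unitR1)
qed

text \<open>The other whiskered form, with \<open>\<psi>\<close> first, as in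
  \<open>left_path\<close> and \<open>right_path\<close>. Since the target of \<open>\<psi>\<close>
  is an identity, the remaining factor needs no whiskering.\<close>

lemma ten2_dcell_Nil:
  assumes "dcell zs ws P \<phi> P'" "dcell zs' zs' Q \<psi> []"
  shows "\<phi> \<boxtimes>\<^sub>2 \<psi> = \<phi> \<rtimes>\<^sub>2 T zs' \<bullet> (ev (zs @ zs') (wdiag [] zs' P) \<rhd> T zs \<ltimes>\<^sub>2 \<psi>)"
proof -
  have h: "ev zs P \<in> hom V (T zs) (T ws)" "ev zs' Q \<in> hom V (T zs') (T zs')" "chain zs P ws"
    using assms ev_in by (auto simp: dcell_def)
  note c = dcell_cells[OF assms(1)] dcell_cells[OF assms(2)]
  have "\<phi> \<boxtimes>\<^sub>2 \<psi> = (\<phi> \<rtimes>\<^sub>2 T zs') \<star> (T zs \<ltimes>\<^sub>2 \<psi>)"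
    using h c by (simp add: ten2_def cells_def hom_def)
  then show ?thesis
    using hcomp_whisk(1)[OF tenL1_in[OF T_in h(2)] tenR1_in[OF T_in h(1)] tenL2_in[OF T_in c(2)] tenR2_in[OF T_in c(1)]]
      ev_wdiag[OF h(3), of "[]" zs'] hom_Arr[OF h(1)] whiskR_id1[OF tenR1_in[OF T_in h(1)] tenR2_in[OF T_in c(1)]]
    by (simp add: wh1_def unitL1 tenL1_id T_in)
qed

lemma pc_comp_eq: "pc xs ys d u e \<phi> \<Longrightarrow> pc xs ys e' v f \<psi> \<Longrightarrow> e = e' \<Longrightarrow> pc xs ys d (u @ v) f (\<psi> \<bullet> \<phi>)"
  using pc_comp by blast

text \<open>The link between the definition and the calculus: the interchangers written out in the
  associator are recognised as the coherence cells of gaps, so that its constituents compose to the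
  value of \<open>assoc_path\<close>.\<close>

lemma tensor_assoc_pc:
  "pc (SBC k l @ SBC j k @ SBC i j) (SBC i l) (wdiag [] (SBC i j) (mul_diag j k l) @ mul_diag i j l) (assoc_path i j k l)
    (wdiag (SBC k l) [] (mul_diag i j k) @ mul_diag i k l) (tensor_assoc V B C (p i, q i) (p j, q j) (p k, q k) (p l, q l))"
proof -
  let ?xs = "SBC k l @ SBC j k @ SBC i j"
  let ?x12 = "([SB k l], Cr [SC k l] [SB j k], [SC j k, SB i j, SC i j])"
  let ?x23 = "([SB k l, SC k l, SB j k], Cr [SC j k] [SB i j], [SC i j])"
  let ?x123 = "([SB k l], Cr [SC k l] [SB j k, SB i j], [SC j k, SC i j])"
  let ?m = "([], MB j k l, [SB i j, SC j l, SC i j])" and ?n = "([SB k l, SB j k, SB i j], MC j k l, [SC i j])"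
  let ?x = "([SB k l, SB j k], Cr [SC k l] [SB i j], [SC j k, SC i j])"
  let ?Y = "[([SB j l, SB i j], MC i j l, []), ([], MB i j l, [SC i l])]"

  let ?\<sigma>1 = "Step [] [SB k l, SB j k] (NatL [] (MC j k l) [] [SB i j]) False [SC i j] [?m]"
  let ?xs1 = "[SB k l, SB j k, SC k l, SC j k, SB i j, SC i j]" and ?ys1 = "[SB j l, SB i j, SC j l, SC i j]"
  let ?X1 = "[([SB k l, SB j k], MC j k l, [SB i j, SC i j])]"
  \<comment> \<open>The additional interchanger of \<open>step1\<close>: it exchanges the
    multiplication of B with the braiding, so that the pseudonaturality cell becomes
    applicable.\<close>
  have i1: "ich ?xs1 ?ys1 (?X1 @ swap_tgt [] (MB j k l) [] (Cr [SC j l] [SB i j]) [SC i j] @ [])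
    (ctx ?xs1 ?X1 [] [SC i j] ([] @ (btgt (MB j k l) @ [] @ btgt (Cr [SC j l] [SB i j])) @ [SC i j]) [] (inv2 V (swap_cell (MB j k l) [] (Cr [SC j l] [SB i j]))))
    (ssrc ?\<sigma>1)"
    using ich_swap_inv[of ?xs1 ?X1 "[]" "MB j k l" "[]" "Cr [SC j l] [SB i j]" "[SC i j]" "[]" ?ys1]
    by (simp add: swap_src_def swap_tgt_def linkeds)
  have s1: "sok ?xs1 ?ys1 ?\<sigma>1" by (simp add: linkeds)
  note p1 = pc_between[OF pc_pre_seval[OF s1 i1], of ?xs "[?x12]" ?Y "SBC i l"]

  have s2: "sok ?xs (SBC i l) (Step [?x12] [SB k l, SB j k] (HexS [SC k l] [SC j k] [SB i j]) True [SC i j] (?n # ?m # ?Y))"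
    by (simp add: linkeds)
  note p2 = pc_seval[OF s2]

  \<comment> \<open>\<open>step3\<close> is an interchange and nothing else, hence the value of an
    empty path.\<close>
  have i3: "ich ?xs (SBC i l) ([] @ swap_tgt [SB k l] (Cr [SC k l] [SB j k]) [] (Cr [SC j k] [SB i j]) [SC i j]
       @ ?x # ?n # ?m # ?Y)
    (ctx ?xs [] [SB k l] [SC i j] ([SB k l] @ (btgt (Cr [SC k l] [SB j k]) @ [] @ btgt (Cr [SC j k] [SB i j])) @ [SC i j])
       (?x # ?n # ?m # ?Y) (inv2 V (swap_cell (Cr [SC k l] [SB j k]) [] (Cr [SC j k] [SB i j]))))
    ([] @ swap_src [SB k l] (Cr [SC k l] [SB j k]) [] (Cr [SC j k] [SB i j]) [SC i j]
       @ ?x # ?n # ?m # ?Y)"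
    by (rule ich_swap_inv) (simp add: swap_src_def)
  have "ctx ?xs [] [SB k l] [SC i j] ([SB k l] @ (btgt (Cr [SC k l] [SB j k]) @ [] @ btgt (Cr [SC j k] [SB i j])) @ [SC i j])
       (?x # ?n # ?m # ?Y) (inv2 V (swap_cell (Cr [SC k l] [SB j k]) [] (Cr [SC j k] [SB i j])))
    = ev [SB k l, SB j k, SC k l, SB i j, SC j k, SC i j] (?x # ?n # ?m # ?Y) \<rhd> wh2 [SB k l] [SC i j] (inv2 V (\<Sigma> (bx (Cr [SC k l] [SB j k])) (bx (Cr [SC j k] [SB i j]))))"
    by (subst ctx_Nil[OF dcell_inv[OF swap_dcell]]) (simp_all add: swap_cell_Nil)
  note p3 = i3[unfolded this, folded pc.simps(1)]

  have s4: "sok ?xs (SBC i l) (Step [?x23] [SB k l] (HexR [SC k l] [SB j k] [SB i j]) False [SC j k, SC i j] (?n # ?m # ?Y))"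
    by (simp add: linkeds)
  note p4 = pc_seval[OF s4]

  let ?xs5 = "[SB k l, SB j k, SB i j, SC k l, SC j k, SC i j]"
  let ?\<sigma>5 = "Step [?n, ([SB k l, SB j k, SB i j], MC i j l, [])] [] (AssB i j k l) True [SC i l] []"
  let ?\<tau>5 = "Step [] [SB k l, SB j k, SB i j] (AssC i j k l) True [] [([SB k l], MB i j k, [SC i l]), ([], MB i k l, [SC i l])]"
  let ?X5 = "[([SB k l, SB j k, SB i j, SC k l], MC i j k, [])]"
  have l5: "linked ?xs5 (SBC i l) (ssrc ?\<sigma>5) [?\<sigma>5, ?\<tau>5] (?X5 @ swap_src [SB k l] (MB i j k) [] (MC i k l) [] @ [([], MB i k l, [SC i l])])"
    by (simp add: linkeds swap_src_def)
  \<comment> \<open>In \<open>step5\<close> the two associators stand between two interchangers,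
    treated by \<open>i5\<close> and \<open>j5\<close>.\<close>
  have i5: "ich ?xs5 (SBC i l) ([?n] @ swap_tgt [] (MB j k l) [SB i j] (MC i j l) [] @ [([], MB i j l, [SC i l])])
     (ctx ?xs5 [?n] [] [] ([] @ (btgt (MB j k l) @ [SB i j] @ btgt (MC i j l)) @ []) [([], MB i j l, [SC i l])] (inv2 V (swap_cell (MB j k l) [SB i j] (MC i j l))))
     (ssrc ?\<sigma>5)"
    using ich_swap_inv[of ?xs5 "[?n]" "[]" "MB j k l" "[SB i j]" "MC i j l" "[]" "[([], MB i j l, [SC i l])]" "SBC i l"]
    by (simp add: swap_src_def swap_tgt_def linkeds)
  have j5: "ich ?xs5 (SBC i l) (?X5 @ swap_src [SB k l] (MB i j k) [] (MC i k l) [] @ [([], MB i k l, [SC i l])])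
     (ctx ?xs5 ?X5 [SB k l] [] ([SB k l] @ (btgt (MB i j k) @ [] @ btgt (MC i k l)) @ []) [([], MB i k l, [SC i l])] (swap_cell (MB i j k) [] (MC i k l)))
     (?X5 @ swap_tgt [SB k l] (MB i j k) [] (MC i k l) [] @ [([], MB i k l, [SC i l])])"
    by (rule ich_swap) (simp add: swap_src_def)
  note pc_post[OF pc_pre[OF i5 linked_pc'[OF l5]] j5, unfolded ctx_def]
  note p5 = pc_below[OF this, of ?xs "[?x23, ?x123]"]

  let ?\<sigma>6 = "Step [([SB k l, SC k l, SB j k, SB i j], MC i j k, [])] [SB k l] (NatR [SC k l] [] (MB i j k) []) True [SC i k] []"
  let ?xs6 = "[SB k l, SC k l, SB j k, SB i j, SC j k, SC i j]" and ?ys6 = "[SB k l, SB i k, SC k l, SC i k]"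
  have i6: "ich ?xs6 ?ys6 ([] @ swap_tgt [SB k l] (Cr [SC k l] [SB j k, SB i j]) [] (MC i j k) [] @ [([SB k l], MB i j k, [SC k l, SC i k])])
    (ctx ?xs6 [] [SB k l] [] ([SB k l] @ (btgt (Cr [SC k l] [SB j k, SB i j]) @ [] @ btgt (MC i j k)) @ []) [([SB k l], MB i j k, [SC k l, SC i k])]
       (inv2 V (swap_cell (Cr [SC k l] [SB j k, SB i j]) [] (MC i j k))))
    (ssrc ?\<sigma>6)"
    using ich_swap_inv[of ?xs6 "[]" "[SB k l]" "Cr [SC k l] [SB j k, SB i j]" "[]" "MC i j k" "[]" "[([SB k l], MB i j k, [SC k l, SC i k])]" ?ys6]
    by (simp add: swap_src_def swap_tgt_def linkeds)
  have s6: "sok ?xs6 ?ys6 ?\<sigma>6" by (simp add: linkeds)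
  note p6 = pc_between[OF pc_pre_seval[OF s6 i6], of ?xs "[?x23]" "[([SB k l, SB i k], MC i k l, []), ([], MB i k l, [SC i l])]" "SBC i l"]

  note pc_comp_eq[OF pc_comp_eq[OF pc_comp_eq[OF pc_comp_eq[OF pc_comp_eq[OF p1 p2] p3] p4] p5] p6]
  \<comment> \<open>\<open>ev\<close> composes layer by layer, while the definition keeps the outer
    multiplication as one factor; splitting off the last layers reconciles the two.\<close>
  moreover have "ev [SB k l, SB j k, SB i j, SC k l, SC j k, SC i j] ([?n, ?m] @ ?Y)
      = ev [SB j l, SB i j, SC j l, SC i j] ?Y \<cdot> ev [SB k l, SB j k, SB i j, SC k l, SC j k, SC i j] [?n, ?m]"
    "ev [SB k l, SB j k, SC k l, SB i j, SC j k, SC i j] ([?x, ?n, ?m] @ ?Y)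
      = ev [SB j l, SB i j, SC j l, SC i j] ?Y \<cdot> ev [SB k l, SB j k, SC k l, SB i j, SC j k, SC i j] [?x, ?n, ?m]"
    by (rule ev_append; simp)+
  moreover note ten2_dcell[OF rcell_dcell[OF rok_simps(1)[of i j k l], of True] rcell_dcell[OF rok_simps(2)[of i j k l], of True]]
  ultimately show ?thesis
    by (simp add: swap_tgt_def swap_src_def linkeds mul_diag_def assoc_path_def ctx_swap seval_eval wh2_swap_cell_inv swap_cell_left swap_cell_right del: ev.simps(2) bx.simps pc.simps)
      (simp add: tensor_assoc_def Let_def wh1_def wh2_def rcell_False rcell_True unitR0_homs mul_ev mul_ev2 unit1 del: pc.simps)
qed

text \<open>The step has an identity as its cell, and its source and target diagrams denote the same
  1-cell, so appending it leaves the value unchanged.\<close>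

lemma pc_triv:
  assumes "pc xs ys d u e \<phi>" "sok xs ys (Step X l \<rho> True r Y)" "e = X @ wdiag l r (rsrc \<rho>) @ Y" "\<rho> \<in> {TrivL as, TrivR as}"
  shows "pc xs ys d (u @ [Step X l \<rho> True r Y]) (X @ wdiag l r (rtgt \<rho>) @ Y) \<phi>"
proof -
  let ?\<sigma> = "Step X l \<rho> True r Y"
  have c: "chain xs X (l @ as @ r)" "chain (l @ as @ r) Y ys" using assms(2,4) by auto
  have t: "stgt ?\<sigma> = X @ wdiag l r [] @ Y" "ssrc ?\<sigma> = e" using assms(3,4) by (auto simp: ptgt_def psrc_def)
  have s: "scell xs ?\<sigma> = id2 V (ev xs (stgt ?\<sigma>))"
    using assms(4) ctx_id[OF c chain.simps(1)[THEN iffD2, OF refl]] unfolding t by (auto simp: rcell_True)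
  note d = scell_dcell[OF assms(2), unfolded s]
  have "ev xs (ssrc ?\<sigma>) = ev xs (stgt ?\<sigma>)"
    using cells_dom[OF dcell_cells[OF d]] cells_dom[OF id2_in[of "ev xs (stgt ?\<sigma>)"]] ev_in[of xs "stgt ?\<sigma>" ys] d hom_Arr
    unfolding dcell_def by metis
  then have "scell xs ?\<sigma> \<bullet> \<phi> = \<phi>"
    unfolding s using vcomp_idL dcell_cells[OF pc_dcell[OF assms(1)]] t(2) by simp
  then show ?thesis using pc_comp_eq[OF assms(1) pc_step[OF assms(2)] t(2)[symmetric]] by (simp add: ptgt_def del: pc.simps scell.simps)
qed

lemma tensor_left_pc:
  "pc (SBC i j) (SBC i j) (wdiag [] (SBC i j) (unit_diag j) @ mul_diag i j j) (left_path i j) [] (tensor_left V B C (p i, q i) (p j, q j))"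
proof -
  let ?v = "([], UC j, [SB i j, SC i j])" and ?v' = "([SB i j], UC j, [SC i j])"
  let ?Y = "[([SB j j, SB i j], MC i j j, []), ([], MB i j j, [SC i j])]"
  have i1: "ich (SBC i j) (SBC i j) ([?v] @ swap_tgt [] (UB j) [] (Cr [SC j j] [SB i j]) [SC i j] @ ?Y)
     (ctx (SBC i j) [?v] [] [SC i j] ([] @ (btgt (UB j) @ [] @ btgt (Cr [SC j j] [SB i j])) @ [SC i j]) ?Y (inv2 V (swap_cell (UB j) [] (Cr [SC j j] [SB i j]))))
     ([?v] @ swap_src [] (UB j) [] (Cr [SC j j] [SB i j]) [SC i j] @ ?Y)"
    by (rule ich_swap_inv) (simp add: swap_src_def)
  note p1 = i1[unfolded ctx_def, folded pc.simps(1)]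
  have s2: "sok (SBC i j) (SBC i j) (Step [] [] (NatL [] (UC j) [] [SB i j]) False [SC i j] (([], UB j, [SB i j, SC j j, SC i j]) # ?Y))"
    by (simp add: linkeds)
  have s2': "sok (SBC i j) (SBC i j) (Step [] [] (TrivL [SB i j]) True [SC i j] (?v' # ([], UB j, [SB i j, SC j j, SC i j]) # ?Y))"
    by (simp add: linkeds)
  have i3: "ich (SBC i j) (SBC i j) ([?v'] @ swap_tgt [] (UB j) [SB i j] (MC i j j) [] @ [([], MB i j j, [SC i j])])
     (ctx (SBC i j) [?v'] [] [] ([] @ (btgt (UB j) @ [SB i j] @ btgt (MC i j j)) @ []) [([], MB i j j, [SC i j])] (inv2 V (swap_cell (UB j) [SB i j] (MC i j j))))
     ([?v'] @ swap_src [] (UB j) [SB i j] (MC i j j) [] @ [([], MB i j j, [SC i j])])"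
    by (rule ich_swap_inv) (simp add: swap_src_def)
  note p3 = i3[unfolded ctx_def, folded pc.simps(1)]
  have l4: "linked (SBC i j) (SBC i j) ([?v'] @ swap_src [] (UB j) [SB i j] (MC i j j) [] @ [([], MB i j j, [SC i j])])
     [Step [] [SB i j] (LeftC i j) True [] [([], UB j, [SB i j, SC i j]), ([], MB i j j, [SC i j])], Step [] [] (LeftB i j) True [SC i j] []] []"
    by (simp add: linkeds swap_src_def)
  note pc_comp_eq[OF pc_comp_eq[OF pc_triv[OF pc_comp_eq[OF p1 pc_seval[OF s2]] s2' _ insertI1] p3] linked_pc'[OF l4]]
  moreover note ten2_dcell_Nil[OF rcell_dcell[OF rok_simps(3)[of i j], of True] rcell_dcell[OF rok_simps(4)[of i j], of True, unfolded ptgt_def rtgt.simps rdom.simps rcod.simps if_True]]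
  moreover have "ev [SB i j, SC j j, SC i j] ([([], UB j, [SB i j, SC j j, SC i j])] @ ?Y)
    = ev [SB j j, SB i j, SC j j, SC i j] ?Y \<cdot> ev [SB i j, SC j j, SC i j] [([], UB j, [SB i j, SC j j, SC i j])]"
    by (rule ev_append; simp)
  ultimately show ?thesis
    by (simp add: swap_tgt_def swap_src_def linkeds unit_diag_def mul_diag_def left_path_def ctx_swap seval_eval wh2_swap_cell_inv swap_cell_left swap_cell_right del: ev.simps(2) bx.simps pc.simps)
      (simp add: tensor_left_def Let_def wh1_def wh2_def rcell_False rcell_True unitR0_homs mul_ev mul_ev2 unit1 del: pc.simps)
qed

lemma tensor_right_pc:
  "pc (SBC i j) (SBC i j) (wdiag (SBC i j) [] (unit_diag i) @ mul_diag i i j) (right_path i j) [] (tensor_right V B C (p i, q i) (p j, q j))"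
proof -
  let ?v = "([SB i j, SC i j], UC i, [])" and ?v' = "([SB i j], UB i, [SC i j, SC i i])"
  let ?Y = "[([SB i j, SB i i], MC i i j, []), ([], MB i i j, [SC i j])]"
  have s1: "sok (SBC i j) (SBC i j) (Step [?v] [SB i j] (NatR [SC i j] [] (UB i) []) False [SC i i] ?Y)"
    by (simp add: linkeds)
  have s1': "sok (SBC i j) (SBC i j) (Step [?v] [SB i j] (TrivR [SC i j]) True [SC i i] (?v' # ?Y))"
    by (simp add: linkeds)
  have i3: "ich (SBC i j) (SBC i j) ([?v] @ swap_tgt [SB i j] (UB i) [] (MC i i j) [] @ [([], MB i i j, [SC i j])])
     (ctx (SBC i j) [?v] [SB i j] [] ([SB i j] @ (btgt (UB i) @ [] @ btgt (MC i i j)) @ []) [([], MB i i j, [SC i j])] (inv2 V (swap_cell (UB i) [] (MC i i j))))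
     ([?v] @ swap_src [SB i j] (UB i) [] (MC i i j) [] @ [([], MB i i j, [SC i j])])"
    by (rule ich_swap_inv) (simp add: swap_src_def)
  note p3 = i3[unfolded ctx_def, folded pc.simps(1)]
  have l4: "linked (SBC i j) (SBC i j) ([?v] @ swap_src [SB i j] (UB i) [] (MC i i j) [] @ [([], MB i i j, [SC i j])])
     [Step [] [SB i j] (RightC i j) True [] [([SB i j], UB i, [SC i j]), ([], MB i i j, [SC i j])], Step [] [] (RightB i j) True [SC i j] []] []"
    by (simp add: linkeds swap_src_def)
  note pc_comp_eq[OF pc_comp_eq[OF pc_triv[OF pc_seval[OF s1] s1' _ insertI2[OF insertI1]] p3] linked_pc'[OF l4]]
  moreover note ten2_dcell_Nil[OF rcell_dcell[OF rok_simps(5)[of i j], of True] rcell_dcell[OF rok_simps(6)[of i j], of True, unfolded ptgt_def rtgt.simps rdom.simps rcod.simps if_True]]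
  ultimately show ?thesis
    by (simp add: swap_tgt_def swap_src_def linkeds unit_diag_def mul_diag_def right_path_def ctx_swap seval_eval wh2_swap_cell_inv swap_cell_left swap_cell_right del: ev.simps(2) bx.simps pc.simps)
      (simp add: tensor_right_def Let_def wh1_def wh2_def rcell_False rcell_True unitR0_homs mul_ev mul_ev2 unit1 del: pc.simps)
qed

end

section \<open>The axioms of the tensor product\<close>

context diagram_rules begin

text \<open>Hides the boundary, so that equations with different boundaries can be handled uniformly
  in one list.\<close>

definition good :: "step list \<times> step list \<Rightarrow> bool" where
  "good t \<longleftrightarrow> (\<exists>xs ys. teq xs ys (fst t) (snd t))"

lemma goodI: "teq xs ys (fst t) (snd t) \<Longrightarrow> good t"
  unfolding good_def by blast

lemma good_rotate: "good t \<Longrightarrow> good (rotate_tile n m t)" and good_swap: "good t \<Longrightarrow> good (prod.swap t)"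
  unfolding good_def using teq_rotate teq_swap by blast+

lemma run_good:
  assumes "run ts ms u = Some v" "pc xs ys d u e \<phi>" "\<forall>t\<in>set ts. good t"
  shows "pc xs ys d v e \<phi>"
  using run_pc[OF assms(1,2)] assms(3) unfolding good_def by force

text \<open>\<open>pvalid\<close> provides a cell for one side, and \<open>run\<close> shows that
  the other side has the same cell.\<close>

lemma good_run:
  assumes "pvalid xs ys d (fst t) e" "run ts ms (fst t) = Some (snd t)" "\<forall>t\<in>set ts. good t"
  shows "good t"
  using pvalid_pc[OF assms(1)] run_good[OF assms(2) _ assms(3)] teqI goodI by blast

text \<open>Both cells are values of the common path \<open>w\<close> between the same ends, so
  \<open>pc_unique\<close> applies.\<close>

lemma pc_eqI:
  assumes "\<exists>w. run ts ms u = Some w \<and> run ts' ms' v = Some w" "\<forall>t\<in>set ts. good t" "\<forall>t\<in>set ts'. good t"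
    "pc xs ys d u e \<phi>" "pc xs ys d v e \<psi>"
  shows "\<phi> = \<psi>"
  using assms run_good pc_unique by metis

lemma ich_blocks:
  assumes "chain zs P ws" "chain zs' Q ws'"
  shows "ich (zs @ zs') (ws @ ws') (wdiag [] zs' P @ wdiag ws [] Q) (inv2 V (\<Sigma> (ev zs P) (ev zs' Q))) (wdiag zs [] Q @ wdiag [] ws' P)"
  by (rule ich_sym[OF slide_ich[OF slide_block[OF assms]]])

end

context tensor_data begin

lemma good_distC_assoc: "good distC_assoc"
  by (rule good_run[OF distC_assoc_valid distC_assoc_run])
    (simp add: good_rotate good_swap goodI[OF tile_S1] goodI[OF tile_SS] goodI[OF tile_NL_assoc] goodI[OF tile_S2])

lemma good_distB_assoc: "good distB_assoc"
  by (rule good_run[OF distB_assoc_valid distB_assoc_run])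
    (simp add: good_rotate good_swap goodI[OF tile_R2] goodI[OF tile_RR] goodI[OF tile_NR_assoc] goodI[OF tile_R3])

lemma good_distCB: "good distCB"
  by (rule good_run[OF distCB_valid distCB_run])
    (simp add: good_rotate good_swap goodI[OF tile_inter] goodI[OF tile_S3] goodI[OF tile_R1] goodI[OF tile_RS])

lemma good_distB_unit: "good distB_unit"
  by (rule good_run[OF distB_unit_valid distB_unit_run])
    (simp add: good_rotate good_swap goodI[OF tile_NR_left] goodI[OF tile_R2] goodI[OF tile_R_unit])

lemma good_distC_unit: "good distC_unit"
  by (rule good_run[OF distC_unit_valid distC_unit_run])
    (simp add: good_rotate good_swap goodI[OF tile_S2] goodI[OF tile_S_unit] goodI[OF tile_NL_right])

abbreviation pq :: "nat \<Rightarrow> 'b \<times> 'c" where "pq i \<equiv> (p i, q i)"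

abbreviation tH where "tH i j \<equiv> tensor_hom V B C (pq i) (pq j)"
abbreviation tM where "tM i j k \<equiv> tensor_mul V B C (pq i) (pq j) (pq k)"
abbreviation tU where "tU i \<equiv> tensor_unit V B C (pq i)"
abbreviation tA where "tA i j k l \<equiv> tensor_assoc V B C (pq i) (pq j) (pq k) (pq l)"
abbreviation tL where "tL i j \<equiv> tensor_left V B C (pq i) (pq j)"
abbreviation tR where "tR i j \<equiv> tensor_right V B C (pq i) (pq j)"

lemma assoc_Cell: "tA i j k l \<in> Cell V"
  using cells_Cell[OF dcell_cells[OF pc_dcell[OF tensor_assoc_pc]]] .

lemma wh2_sides:
  assumes "\<phi> \<in> Cell V"
  shows "wh2 [] r \<phi> = \<phi> \<rtimes>\<^sub>2 T r" "wh2 l [] \<phi> = T l \<ltimes>\<^sub>2 \<phi>"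
  using assms cells_Cell[OF tenL2_in[OF T_in, of \<phi>]] by (auto simp: wh2_def unitL2 unitR2 cells_def)

lemma ev_mul_wdiag:
  "ev (l @ (SBC j k @ SBC i j) @ r) (wdiag l r (mul_diag i j k)) = T l \<ltimes> tM i j k \<rtimes> T r"
  "ev ((SBC j k @ SBC i j) @ r) (wdiag [] r (mul_diag i j k)) = tM i j k \<rtimes> T r"
  "ev (l @ SBC j k @ SBC i j) (wdiag l [] (mul_diag i j k)) = T l \<ltimes> tM i j k"
  using ev_wdiag[OF mul_diag_chain, of l j k i r] ev_wdiag[OF mul_diag_chain, of "[]" j k i r] ev_wdiag[OF mul_diag_chain, of l j k i "[]"]
    hom_Arr[OF ev_in[OF mul_diag_chain, of j k i]] hom_Arr[OF tenL1_in[OF T_in[of l] ev_in[OF mul_diag_chain, of j k i]]]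
  unfolding tensor_mul_ev by (simp_all only: wh1_def append_Nil append_Nil2 tens.simps unitL1 unitR1)

lemma pc_assoc_above:
  assumes "chain (l @ SBC i j @ r) Y ys"
  shows "pc (l @ (SBC m j @ SBC k m @ SBC i k) @ r) ys
     (wdiag l (SBC i k @ r) (mul_diag k m j) @ wdiag l r (mul_diag i k j) @ Y) (wpath [] l r Y (assoc_path i k m j))
     (wdiag (l @ SBC m j) r (mul_diag i k m) @ wdiag l r (mul_diag i m j) @ Y)
     (ev (l @ SBC i j @ r) Y \<rhd> wh2 l r (tA i k m j))"
  using pc_above[OF tensor_assoc_pc assms] by (simp only: map_append wdiag_wdiag append_Nil append_Nil2 append_assoc)

lemma pc_assoc_below:
  assumes "chain xs X (SBC m j @ SBC k m @ SBC i k)"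
  shows "pc xs (SBC i j)
     (X @ wdiag [] (SBC i k) (mul_diag k m j) @ mul_diag i k j) (wpath X [] [] [] (assoc_path i k m j))
     (X @ wdiag (SBC m j) [] (mul_diag i k m) @ mul_diag i m j)
     (tA i k m j \<lhd> ev xs X)"
  using pc_below[OF tensor_assoc_pc assms] .

text \<open>Every factor is identified with the value of a whiskered associator path or of an empty
  path. The ends of neighbouring factors coincide, and \<open>ac_run\<close> then compares the two
  composite paths.\<close>

lemma tensor_AC:
  "(tM 0 3 4 \<rhd> tH 3 4 \<ltimes>\<^sub>2 tA 0 1 2 3)
      \<bullet> (tA 0 1 3 4 \<lhd> tH 3 4 \<ltimes> tM 1 2 3 \<rtimes> tH 0 1)
      \<bullet> (tM 0 1 4 \<rhd> tA 1 2 3 4 \<rtimes>\<^sub>2 tH 0 1)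
    = (tA 0 2 3 4 \<lhd> (tH 3 4 \<otimes> tH 2 3) \<ltimes> tM 0 1 2)
      \<bullet> (tM 0 2 4 \<rhd> inv2 V (\<Sigma> (tM 2 3 4) (tM 0 1 2)))
      \<bullet> (tA 0 1 2 4 \<lhd> tM 2 3 4 \<rtimes> (tH 1 2 \<otimes> tH 0 1))"
    (is "?c \<bullet> ?b \<bullet> ?a = ?f \<bullet> ?e \<bullet> ?d")
proof (rule pc_eqI[OF ac_run])
  let ?xs = "SBC 3 4 @ SBC 2 3 @ SBC 1 2 @ SBC 0 1" and ?ys = "SBC 0 4"
  let ?D = "wdiag [] (SBC 1 2 @ SBC 0 1) (mul_diag 2 3 4) @ wdiag [] (SBC 0 1) (mul_diag 1 2 4) @ mul_diag 0 1 4"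
  let ?E = "wdiag (SBC 3 4 @ SBC 2 3) [] (mul_diag 0 1 2) @ wdiag (SBC 3 4) [] (mul_diag 0 2 3) @ mul_diag 0 3 4"
  note ev = ev_mul_wdiag tensor_mul_ev[symmetric] and T = tensor_hom_T[symmetric] T_append
  have a: "pc ?xs ?ys ?D (wpath [] [] (SBC 0 1) (mul_diag 0 1 4) (assoc_path 1 2 3 4))
      (wdiag (SBC 3 4) (SBC 0 1) (mul_diag 1 2 3) @ wdiag [] (SBC 0 1) (mul_diag 1 3 4) @ mul_diag 0 1 4) ?a"
    using pc_assoc_above[of "[]" 1 4 "SBC 0 1" "mul_diag 0 1 4" ?ys 3 2] mul_diag_chain
    by (simp only: append_Nil append_assoc wh2_sides[OF assoc_Cell] ev T)
  have b: "pc ?xs ?ys (wdiag (SBC 3 4) (SBC 0 1) (mul_diag 1 2 3) @ wdiag [] (SBC 0 1) (mul_diag 1 3 4) @ mul_diag 0 1 4)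
      (wpath (wdiag (SBC 3 4) (SBC 0 1) (mul_diag 1 2 3)) [] [] [] (assoc_path 0 1 3 4))
      (wdiag (SBC 3 4) (SBC 0 1) (mul_diag 1 2 3) @ wdiag (SBC 3 4) [] (mul_diag 0 1 3) @ mul_diag 0 3 4) ?b"
    using pc_assoc_below[of ?xs "wdiag (SBC 3 4) (SBC 0 1) (mul_diag 1 2 3)" 3 4 1 0] chain_wdiag[OF mul_diag_chain, of "SBC 3 4" 2 3 1 "SBC 0 1"]
    by (simp only: append_assoc ev(1)[of "SBC 3 4" 2 3 1 "SBC 0 1", unfolded append_assoc] T)
  have c: "pc ?xs ?ys (wdiag (SBC 3 4) (SBC 0 1) (mul_diag 1 2 3) @ wdiag (SBC 3 4) [] (mul_diag 0 1 3) @ mul_diag 0 3 4)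
      (wpath [] (SBC 3 4) [] (mul_diag 0 3 4) (assoc_path 0 1 2 3)) ?E ?c"
    using pc_assoc_above[of "SBC 3 4" 0 3 "[]" "mul_diag 0 3 4" ?ys 2 1] mul_diag_chain
    by (simp only: append_Nil2 append_assoc wh2_sides[OF assoc_Cell] ev T)
  show "pc ?xs ?ys ?D ac_lhs ?E (?c \<bullet> ?b \<bullet> ?a)"
    unfolding ac_lhs_def using pc_comp[OF pc_comp[OF a b] c] by simp
  have d: "pc ?xs ?ys ?D (wpath (wdiag [] (SBC 1 2 @ SBC 0 1) (mul_diag 2 3 4)) [] [] [] (assoc_path 0 1 2 4))
      (wdiag [] (SBC 1 2 @ SBC 0 1) (mul_diag 2 3 4) @ wdiag (SBC 2 4) [] (mul_diag 0 1 2) @ mul_diag 0 2 4) ?d"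
    using pc_assoc_below[of ?xs "wdiag [] (SBC 1 2 @ SBC 0 1) (mul_diag 2 3 4)" 2 4 1 0] chain_wdiag[OF mul_diag_chain, of "[]" 3 4 2 "SBC 1 2 @ SBC 0 1"]
    by (simp only: append_Nil append_assoc ev(2)[of 3 4 2 "SBC 1 2 @ SBC 0 1", unfolded append_assoc] T)
  \<comment> \<open>The interchanger of the two multiplications exchanges blocks of three layers
    each; by \<open>ich_blocks\<close> it is a coherence cell and belongs to the empty path.\<close>
  have e: "pc ?xs ?ys (wdiag [] (SBC 1 2 @ SBC 0 1) (mul_diag 2 3 4) @ wdiag (SBC 2 4) [] (mul_diag 0 1 2) @ mul_diag 0 2 4) []
      (wdiag (SBC 3 4 @ SBC 2 3) [] (mul_diag 0 1 2) @ wdiag [] (SBC 0 2) (mul_diag 2 3 4) @ mul_diag 0 2 4) ?e"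
    using pc_over[OF ich_blocks[OF mul_diag_chain[of 3 4 2] mul_diag_chain[of 1 2 0], folded pc.simps(1)] mul_diag_chain[of 2 4 0]]
    by (simp only: append_assoc ev list.map(1))
  have f: "pc ?xs ?ys (wdiag (SBC 3 4 @ SBC 2 3) [] (mul_diag 0 1 2) @ wdiag [] (SBC 0 2) (mul_diag 2 3 4) @ mul_diag 0 2 4)
      (wpath (wdiag (SBC 3 4 @ SBC 2 3) [] (mul_diag 0 1 2)) [] [] [] (assoc_path 0 2 3 4)) ?E ?f"
    using pc_assoc_below[of ?xs "wdiag (SBC 3 4 @ SBC 2 3) [] (mul_diag 0 1 2)" 3 4 2 0] chain_wdiag[OF mul_diag_chain, of "SBC 3 4 @ SBC 2 3" 1 2 0 "[]"]
    by (simp only: append_Nil2 append_assoc ev(3)[of "SBC 3 4 @ SBC 2 3" 1 2 0, unfolded append_assoc] T)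
  show "pc ?xs ?ys ?D ac_rhs ?E (?f \<bullet> ?e \<bullet> ?d)"
    unfolding ac_rhs_def using pc_comp[OF pc_comp[OF d e] f] by simp
qed (simp_all add: good_distC_assoc good_distB_assoc good_distCB goodI[OF tile_ACB] goodI[OF tile_ACC])

lemma left_Cell: "tL i j \<in> Cell V" and right_Cell: "tR i j \<in> Cell V"
  using cells_Cell[OF dcell_cells[OF pc_dcell[OF tensor_left_pc]]] cells_Cell[OF dcell_cells[OF pc_dcell[OF tensor_right_pc]]] .

text \<open>The unitors end in the empty diagram, so both sides run from the same diagram to the
  bare multiplication, and \<open>ic_run\<close> compares them.\<close>

lemma tensor_IC:
  "(tM 0 1 2 \<rhd> tH 1 2 \<ltimes>\<^sub>2 tL 0 1)
      \<bullet> (tA 0 1 1 2 \<lhd> tH 1 2 \<ltimes> tU 1 \<rtimes> tH 0 1)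
    = tM 0 1 2 \<rhd> tR 1 2 \<rtimes>\<^sub>2 tH 0 1"
    (is "?b \<bullet> ?a = ?c")
proof (rule pc_eqI[OF ic_run])
  let ?xs = "SBC 1 2 @ SBC 0 1" and ?ys = "SBC 0 2"
  let ?D = "wdiag (SBC 1 2) (SBC 0 1) (unit_diag 1) @ wdiag [] (SBC 0 1) (mul_diag 1 1 2) @ mul_diag 0 1 2"
  note ev = tensor_mul_ev[symmetric] tensor_unit_ev[symmetric] and T = tensor_hom_T[symmetric] T_append
  have u: "chain ?xs (wdiag (SBC 1 2) (SBC 0 1) (unit_diag 1)) (SBC 1 2 @ SBC 1 1 @ SBC 0 1)"
    "ev ?xs (wdiag (SBC 1 2) (SBC 0 1) (unit_diag 1)) = tH 1 2 \<ltimes> tU 1 \<rtimes> tH 0 1"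
    using chain_wdiag[OF unit_diag_chain, of "SBC 1 2" "SBC 0 1" 1] ev_wdiag[OF unit_diag_chain, of "SBC 1 2" "SBC 0 1" 1]
    by (simp_all only: append_Nil wh1_def ev T)
  have a: "pc ?xs ?ys ?D (wpath (wdiag (SBC 1 2) (SBC 0 1) (unit_diag 1)) [] [] [] (assoc_path 0 1 1 2))
      (wdiag (SBC 1 2) (SBC 0 1) (unit_diag 1) @ wdiag (SBC 1 2) [] (mul_diag 0 1 1) @ mul_diag 0 1 2) ?a"
    using pc_assoc_below[OF u(1)] by (simp only: u(2))
  have b: "pc ?xs ?ys (wdiag (SBC 1 2) (SBC 0 1) (unit_diag 1) @ wdiag (SBC 1 2) [] (mul_diag 0 1 1) @ mul_diag 0 1 2)
      (wpath [] (SBC 1 2) [] (mul_diag 0 1 2) (left_path 0 1)) (mul_diag 0 1 2) ?b"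
    using pc_above[OF tensor_left_pc, of "SBC 1 2" 0 1 "[]" "mul_diag 0 1 2" ?ys] mul_diag_chain[of 1 2 0]
    by (simp only: map_append wdiag_wdiag append_Nil append_Nil2 append_assoc list.map(1) wh2_sides[OF left_Cell] ev T)
  show "pc ?xs ?ys ?D ic_lhs (mul_diag 0 1 2) (?b \<bullet> ?a)"
    unfolding ic_lhs_def using pc_comp[OF a b] .
  show "pc ?xs ?ys ?D ic_rhs (mul_diag 0 1 2) ?c"
    unfolding ic_rhs_def
    using pc_above[OF tensor_right_pc, of "[]" 1 2 "SBC 0 1" "mul_diag 0 1 2" ?ys] mul_diag_chain[of 1 2 0]
    by (simp only: map_append wdiag_wdiag append_Nil append_Nil2 append_assoc list.map(1) wh2_sides[OF right_Cell] ev T)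
qed (simp_all add: good_distC_unit good_distB_unit goodI[OF tile_ICB] goodI[OF tile_ICC])

lemma tensor_hom_in: "tH i j \<in> Obj V"
  unfolding tensor_hom_T by (rule T_in)

lemma tensor_mul_in: "tM i j k
    \<in> hom V (tH j k \<otimes> tH i j) (tH i k)"
  unfolding tensor_hom_T tensor_mul_ev T_append[symmetric] by (rule ev_in[OF mul_diag_chain])

lemma tensor_unit_in: "tU i \<in> hom V \<one> (tH i i)"
  using ev_in[OF unit_diag_chain] by (simp only: tensor_hom_T tensor_unit_ev tens.simps)

lemma tensor_assoc_in: "tA i j k l \<in> iso_cells V
    (tM i j l \<cdot> (tM j k l \<rtimes> tH i j))
    (tM i k l \<cdot> (tH k l \<ltimes> tM i j k))"
proof -
  have "ev (SBC k l @ SBC j k @ SBC i j) (wdiag [] (SBC i j) (mul_diag j k l) @ mul_diag i j l)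
      = tM i j l \<cdot> (tM j k l \<rtimes> tH i j)"
    using ev_append[OF chain_wdiag[OF mul_diag_chain, of "[]" k l j "SBC i j", unfolded append_assoc append_Nil] mul_diag_chain[of j l i]]
    by (simp only: ev_mul_wdiag(2)[of k l j "SBC i j", unfolded append_assoc] tensor_mul_ev[symmetric] tensor_hom_T)
  moreover have "ev (SBC k l @ SBC j k @ SBC i j) (wdiag (SBC k l) [] (mul_diag i j k) @ mul_diag i k l)
      = tM i k l \<cdot> (tH k l \<ltimes> tM i j k)"
    using ev_append[OF chain_wdiag[OF mul_diag_chain, of "SBC k l" j k i "[]", unfolded append_Nil2] mul_diag_chain[of k l i]]
    by (simp only: ev_mul_wdiag(3) tensor_mul_ev[symmetric] tensor_hom_T)
  ultimately show ?thesis using pc_dcell[OF tensor_assoc_pc[of k l j i]] unfolding dcell_def by simp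
qed

lemma tensor_left_in: "tL i j \<in> iso_cells V
    (tM i j j \<cdot> (tU j \<rtimes> tH i j)) (id1 V (tH i j))"
proof -
  have u: "tU j \<in> Arr V" by (rule hom_Arr[OF tensor_unit_in])
  have "ev (SBC i j) (wdiag [] (SBC i j) (unit_diag j) @ mul_diag i j j)
      = tM i j j \<cdot> (tU j \<rtimes> tH i j)"
    using ev_append[OF chain_wdiag[OF unit_diag_chain, of "[]" "SBC i j" j, unfolded append_Nil] mul_diag_chain[of j j i]]
      ev_wdiag[OF unit_diag_chain, of "[]" "SBC i j" j, unfolded append_Nil]
    by (simp only: tensor_mul_ev[symmetric] tensor_unit_ev[symmetric] wh1_def tensor_hom_T tens.simps(1) unitL1[OF u])
  then show ?thesis using pc_dcell[OF tensor_left_pc[of i j]] unfolding dcell_def by (simp add: tensor_hom_T)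
qed

lemma tensor_right_in: "tR i j \<in> iso_cells V
    (tM i i j \<cdot> (tH i j \<ltimes> tU i)) (id1 V (tH i j))"
proof -
  have u: "T (SBC i j) \<ltimes> tU i \<in> Arr V" by (rule hom_Arr[OF tenL1_in[OF T_in tensor_unit_in]])
  have "ev (SBC i j) (wdiag (SBC i j) [] (unit_diag i) @ mul_diag i i j)
      = tM i i j \<cdot> (tH i j \<ltimes> tU i)"
    using ev_append[OF chain_wdiag[OF unit_diag_chain, of "SBC i j" "[]" i, unfolded append_Nil append_Nil2] mul_diag_chain[of i j i]]
      ev_wdiag[OF unit_diag_chain, of "SBC i j" "[]" i, unfolded append_Nil append_Nil2]
    by (simp only: tensor_mul_ev[symmetric] tensor_unit_ev[symmetric] wh1_def tensor_hom_T tens.simps(1) unitR1[OF u])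
  then show ?thesis using pc_dcell[OF tensor_right_pc[of i j]] unfolding dcell_def by (simp add: tensor_hom_T)
qed

end

theorem theorem4p20:
  fixes V :: "('o, 'f, 't) braided"
    and B :: "('b, 'o, 'f, 't) enr_bicat"
    and C :: "('c, 'o, 'f, 't) enr_bicat"
  assumes "semistrict_braided V"
    and "enriched_bicategory V B"
    and "enriched_bicategory V C"
  shows "enriched_bicategory V (tensor_bicat V B C)"
proof -
  interpret semistrict_braided V by fact
  interpret B: enriched_bicategory V B by fact
  interpret C: enriched_bicategory V C by fact
  \<comment> \<open>\<open>tensor_data\<close> wants an object for every natural number: five
    objects are listed and the last is repeated from index 4 on. For conditions on fewer objects,
    the remaining places are filled with objects already present.\<close>
  define P :: "('b \<times> 'c) \<Rightarrow> ('b \<times> 'c) \<Rightarrow> ('b \<times> 'c) \<Rightarrow> ('b \<times> 'c) \<Rightarrow> ('b \<times> 'c) \<Rightarrow> nat \<Rightarrow> 'b \<times> 'c"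
    where "P a b c d e = (\<lambda>n. [a, b, c, d, e] ! min n 4)" for a b c d e
  have P: "P a b c d e 0 = a" "P a b c d e 1 = b" "P a b c d e 2 = c" "P a b c d e 3 = d" "P a b c d e 4 = e" for a b c d e
    unfolding P_def by (simp_all add: eval_nat_numeral)
  have data: "tensor_data V B C (\<lambda>n. fst (P a b c d e n)) (\<lambda>n. snd (P a b c d e n))"
    if "a \<in> eObj B \<times> eObj C" "b \<in> eObj B \<times> eObj C" "c \<in> eObj B \<times> eObj C" "d \<in> eObj B \<times> eObj C" "e \<in> eObj B \<times> eObj C"
    for a b c d e
  proof (unfold_locales)
    fix i
    have "P a b c d e i \<in> set [a, b, c, d, e]" unfolding P_def by (rule nth_mem) simp
    then have "P a b c d e i \<in> eObj B \<times> eObj C" using that by auto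
    then show "fst (P a b c d e i) \<in> eObj B" "snd (P a b c d e i) \<in> eObj C" by auto
  qed
  show ?thesis
    unfolding tensor_bicat_def
  proof (unfold_locales, goal_cases)
    case (1 c d) then show ?case using tensor_data.tensor_hom_in[OF data, of c d c c c 0 1] P by simp
  next
    case (2 c d e) then show ?case using tensor_data.tensor_mul_in[OF data, of c d e c c 0 1 2] P by simp
  next
    case (3 c) then show ?case using tensor_data.tensor_unit_in[OF data, of c c c c c 0] P by simp
  next
    case (4 a b c d) then show ?case using tensor_data.tensor_assoc_in[OF data, of a b c d a 0 1 2 3] P by simp
  next
    case (5 c d) then show ?case using tensor_data.tensor_left_in[OF data, of c d c c c 0 1] P by simp
  next
    case (6 c d) then show ?case using tensor_data.tensor_right_in[OF data, of c d c c c 0 1] P by simp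
  next
    case (7 a b c) then show ?case using tensor_data.tensor_IC[OF data, of a b c a a] P by simp
  next
    case (8 a b c d e) then show ?case using tensor_data.tensor_AC[OF data, of a b c d e] P by simp
  qed
qed

end
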